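(* Let $\alpha>0$ and let $(Z_i)_{i\in\mathbb{Z}}$ be a strictly stationary sequence of real random variables with $\mathrm{P}(|Z_1|>x)=x^{-\alpha}L(x)$ for $x>0$, where $L$ is slowly varying at infinity, and $$\lim_{x\to\infty}\frac{\mathrm{P}(Z_1>x)}{\mathrm{P}(|Z_1|>x)}=p,\qquad \lim_{x\to\infty}\frac{\mathrm{P}(Z_1<-x)}{\mathrm{P}(|Z_1|>x)}=q,$$ where $p\in[0,1]$ and $p+q=1$. Let $(a_n)_{n\in\mathbb{N}}$ be positive reals with $a_n\to\infty$ and $n\,\mathrm{P}(|Z_1|>a_n)\to1$ as $n\to\infty$. Assume $(Z_i)$ satisfies the local dependence condition $D'$ (see context). Let $(\sigma_i)_{i\in\mathbb{Z}}$ be positive reals such that $0<\beta_1\le\sigma_i\le\beta_2<\infty$ for all $i\in\mathbb{Z}$, for some constants $\beta_1,\beta_2$, and $\frac1n\sum_{i=1}^n\sigma_i^\alpha\to\sigma^\alpha>0$ as $n\to\infty$. Put $Y_i=\sigma_iZ_i$ and assume the mixing condition $\mathcal{A}'$ (see context) holds. Let $(c_j)_{j\ge0}$ be real numbers with $\sum_{j=0}^\infty|c_j|^\delta<\infty$ for some $\delta$ with $\delta<\alpha$ and $0<\delta\le1$, and set $c_+=\max\{c_j\vee0:j\ge0\}$, $c_-=\max\{-c_j\vee0:j\ge0\}$. Assume $pc_++qc_->0$. Let $$X_n=\sum_{j=0}^\infty c_j\sigma_{n-j}Z_{n-j},\quad n\in\mathbb{N},\qquad W_n(t)=\bigvee_{k=1}^{\lfloor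 nt\rfloor}\frac{X_k}{a_n},\quad t\in[0,1],$$ with the convention $W_n(t)=X_1/a_n$ for $t\in[0,1/n)$. Then $W_n\xrightarrow{d}W$ as $n\to\infty$ in $D([0,1],\mathbb{R})$ endowed with the Skorokhod $M_1$ topology, where $W$ is an extremal process with exponent measure $$\nu^*(\mathrm{d}x)=\sigma^\alpha(pc_+^\alpha+qc_-^\alpha)\,\alpha x^{-\alpha-1}1_{(0,\infty)}(x)\,\mathrm{d}x.$$
   Context: $a\vee b=\max\{a,b\}$. $D([0,1],\mathbb{R})$ is the space of real-valued c\`adl\`ag functions on $[0,1]$. $M_1$ topology: for $x\in D([0,1],\mathbb{R})$ the completed graph is $\Gamma_x=\{(t,z)\in[0,1]\times\mathbb{R}: z=\lambda x(t-)+(1-\lambda)x(t)\text{ for some }\lambda\in[0,1]\}$, where $x(t-)$ is the left limit at $t$. It is ordered by $(t_1,z_1)\le(t_2,z_2)$ if $t_1<t_2$, or $t_1=t_2$ and $|x(t_1-)-z_1|\le|x(t_2-)-z_2|$. A parametric representation of $\Gamma_x$ is a continuous nondecreasing (for this order) function $(r,u)$ mapping $[0,1]$ onto $\Gamma_x$; $\Pi(x)$ is the set of these. The $M_1$ topology is induced by the metric $d_{M_1}(x_1,x_2)=\inf\{\|r_1-r_2\|_{[0,1]}\vee\|u_1-u_2\|_{[0,1]}:(r_i,u_i)\in\Pi(x_i),\,i=1,2\}$, with $\|\cdot\|_{[0,1]}$ the supremum norm. Extremal process: for a measure $\nu''$ on $(0,\infty)$ with $\nu''(\delta,\infty)<\infty$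 for every $\delta>0$, the (nonnegative) extremal process with exponent measure $\nu''$ is the process distributed as $t\mapsto\bigvee_{t_i\le t}x_i$ ($\bigvee\emptyset=0$), where $\sum_i\delta_{(t_i,x_i)}$ is a Poisson process on $[0,1]\times(0,\infty)$ with intensity $\mathrm{Leb}\times\nu''$; in particular $\mathrm{P}(W(t)\le x)=e^{-t\nu''(x,\infty)}$ for $t>0$, $x>0$. Condition $D'$: for all $x>0$, $$\lim_{k\to\infty}\limsup_{n\to\infty}\,n\sum_{i=2}^{\lfloor n/k\rfloor}\mathrm{P}\Bigl(\frac{|Z_1|}{a_n}>x,\ \frac{|Z_i|}{a_n}>x\Bigr)=0.$$ $\mathbb{E}=[-\infty,\infty]\setminus\{0\}$ with the metric $\rho(x,y)=\max\{|1/|x|-1/|y||,\,|\mathrm{sign}\,x-\mathrm{sign}\,y|\}$ (with $1/\infty=0$), so that relatively compact sets are those contained in $\mathbb{E}\setminus[-u,u]$ for some $u>0$; $C_K^+([0,1]\times\mathbb{E})$ is the set of nonnegative continuous real functions with compact support, with $f(t,0):=0$. Condition $\mathcal{A}'$: there is a sequence of positive integers $(r_n)$ with $r_n\to\infty$, $r_n/n\to0$ such that, with $k_n=\lfloor n/r_n\rfloor$, for all $f\in C_K^+([0,1]\times\mathbb{E})$, as $n\to\infty$, $$\mathrm{E}\Bigl[\exp\Bigl\{-\sum_{i=1}^nf\Bigl(\frac in,\frac{Y_i}{a_n}\Bigr)\Bigr\}\Bigr]-\prod_{k=1}^{k_n}\mathrm{E}\Bigl[\exp\Bigl\{-\sum_{i=1}^{r_n}f\Bigl(\frac{kr_n}{n},\frac{Y_{i+(k-1)r_n}}{a_n}\Bigr)\Bigr\}\Bigr]\to0.$$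 A function $L$ is slowly varying if $\lim_{x\to\infty}L(tx)/L(x)=1$ for all $t>0$. Under the stated summability of $(c_j)$ the series defining $X_n$ converges almost surely. *)

theory Defs
  imports "HOL-Probability.Probability"
begin

section \<open>Topology and Borel sets induced by a metric; convergence in distribution\<close>

text \<open>
  This is what \<^const>\<open>Metric_space.mtopology\<close> unfolds to. It is restated here because the
  characteristic facts of the latter are only available once the metric axioms have been proved.
\<close>

definition induced_topology :: "'a set \<Rightarrow> ('a \<Rightarrow> 'a \<Rightarrow> real) \<Rightarrow> 'a topology" where
  "induced_topology S d =
     topology (\<lambda>U. U \<subseteq> S \<and> (\<forall>x\<in>U. \<exists>e>0. \<forall>y\<in>S. d x y < e \<longrightarrow> y \<in> U))"

lemma openin_induced_topology:
  "openin (induced_topology S d) U \<longleftrightarrow>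
     U \<subseteq> S \<and> (\<forall>x\<in>U. \<exists>e>0. \<forall>y\<in>S. d x y < e \<longrightarrow> y \<in> U)"
proof -
  have "istopology (\<lambda>U. U \<subseteq> S \<and> (\<forall>x\<in>U. \<exists>e>0. \<forall>y\<in>S. d x y < e \<longrightarrow> y \<in> U))"
    unfolding istopology_def
  proof (intro conjI allI impI ballI)
    fix U V x
    assume U: "U \<subseteq> S \<and> (\<forall>x\<in>U. \<exists>e>0. \<forall>y\<in>S. d x y < e \<longrightarrow> y \<in> U)"
      and V: "V \<subseteq> S \<and> (\<forall>x\<in>V. \<exists>e>0. \<forall>y\<in>S. d x y < e \<longrightarrow> y \<in> V)"
      and x: "x \<in> U \<inter> V"
    obtain e1 where "e1 > 0" "\<forall>y\<in>S. d x y < e1 \<longrightarrow> y \<in> U" using U x by blast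
    moreover obtain e2 where "e2 > 0" "\<forall>y\<in>S. d x y < e2 \<longrightarrow> y \<in> V" using V x by blast
    ultimately show "\<exists>e>0. \<forall>y\<in>S. d x y < e \<longrightarrow> y \<in> U \<inter> V"
      by (intro exI[of _ "min e1 e2"]) auto
  next
    fix \<K> x
    assume K: "\<forall>K\<in>\<K>. K \<subseteq> S \<and> (\<forall>x\<in>K. \<exists>e>0. \<forall>y\<in>S. d x y < e \<longrightarrow> y \<in> K)"
      and "x \<in> \<Union>\<K>"
    then obtain V where V: "V \<in> \<K>" "x \<in> V" by blast
    then obtain e where "e > 0" "\<forall>y\<in>S. d x y < e \<longrightarrow> y \<in> V" using K by blast
    then show "\<exists>e>0. \<forall>y\<in>S. d x y < e \<longrightarrow> y \<in> \<Union>\<K>" using V by blast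
  qed blast+
  then show ?thesis
    by (simp add: induced_topology_def topology_inverse')
qed

lemma topspace_induced_topology: "topspace (induced_topology S d) = S"
proof
  show "topspace (induced_topology S d) \<subseteq> S"
    using openin_topspace openin_induced_topology by metis
  have "openin (induced_topology S d) S"
    unfolding openin_induced_topology using zero_less_one by blast
  then show "S \<subseteq> topspace (induced_topology S d)" by (rule openin_subset)
qed

lemma induced_topology_eq_mtopology:
  assumes "Metric_space S d"
  shows "induced_topology S d = Metric_space.mtopology S d"
  unfolding topology_eq openin_induced_topology Metric_space.openin_mtopology[OF assms]
    Metric_space.mball_def[OF assms] by blast

definition borel_of :: "'a topology \<Rightarrow> 'a measure" where
  "borel_of T = sigma (topspace T) {U. openin T U}"

definition converges_in_distribution ::
    "'x topology \<Rightarrow> 'a measure \<Rightarrow> (nat \<Rightarrow> 'a \<Rightarrow> 'x) \<Rightarrow> 'b measure \<Rightarrow> ('b \<Rightarrow> 'x) \<Rightarrow> bool" where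
  "converges_in_distribution T M X N Y \<longleftrightarrow>
     (\<forall>n. X n \<in> measurable M (borel_of T)) \<and> Y \<in> measurable N (borel_of T) \<and>
     (\<forall>F. continuous_map T euclideanreal F \<and> bounded (F ` topspace T) \<longrightarrow>
        (\<lambda>n. \<integral>\<omega>. F (X n \<omega>) \<partial>M) \<longlonglongrightarrow> (\<integral>\<omega>. F (Y \<omega>) \<partial>N))"


section \<open>The space \<open>D([0,1],\<real>)\<close> with the Skorokhod M1 topology\<close>

text \<open>
  Paths are extensional functions (constantly \<^const>\<open>undefined\<close> off \<open>[0,1]\<close>), so that
  equality of paths is equality on \<open>[0,1]\<close>.
\<close>

definition cadlag_space :: "(real \<Rightarrow> real) set" where
  "cadlag_space = {x \<in> extensional {0..1}.
     (\<forall>t\<in>{0..<1}. (x \<longlongrightarrow> x t) (at_right t)) \<and>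
     (\<forall>t\<in>{0<..1}. \<exists>l. (x \<longlongrightarrow> l) (at_left t))}"

text \<open>The usual convention \<open>x(0-) = x(0)\<close> is used.\<close>

definition left_lim :: "(real \<Rightarrow> real) \<Rightarrow> real \<Rightarrow> real" where
  "left_lim x t = (if t = 0 then x 0 else Lim (at_left t) x)"

definition completed_graph :: "(real \<Rightarrow> real) \<Rightarrow> (real \<times> real) set" where
  "completed_graph x = {(t, z). t \<in> {0..1} \<and>
     (\<exists>l\<in>{0..1}. z = l * left_lim x t + (1 - l) * x t)}"

definition graph_le :: "(real \<Rightarrow> real) \<Rightarrow> real \<times> real \<Rightarrow> real \<times> real \<Rightarrow> bool" where
  "graph_le x v w \<longleftrightarrow> fst v < fst w \<or>
     (fst v = fst w \<and> \<bar>left_lim x (fst v) - snd v\<bar> \<le> \<bar>left_lim x (fst w) - snd w\<bar>)"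

definition param_reps :: "(real \<Rightarrow> real) \<Rightarrow> ((real \<Rightarrow> real) \<times> (real \<Rightarrow> real)) set" where
  "param_reps x = {(r, u). continuous_on {0..1} r \<and> continuous_on {0..1} u \<and>
     (\<lambda>s. (r s, u s)) ` {0..1} = completed_graph x \<and>
     (\<forall>s\<in>{0..1}. \<forall>s'\<in>{0..1}. s \<le> s' \<longrightarrow> graph_le x (r s, u s) (r s', u s'))}"

definition sup_norm01 :: "(real \<Rightarrow> real) \<Rightarrow> real" where
  "sup_norm01 f = (SUP s\<in>{0..1}. \<bar>f s\<bar>)"

definition dist_M1 :: "(real \<Rightarrow> real) \<Rightarrow> (real \<Rightarrow> real) \<Rightarrow> real" where
  "dist_M1 x1 x2 = Inf {max (sup_norm01 (\<lambda>s. r1 s - r2 s)) (sup_norm01 (\<lambda>s. u1 s - u2 s)) |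
     r1 u1 r2 u2. (r1, u1) \<in> param_reps x1 \<and> (r2, u2) \<in> param_reps x2}"

definition M1_topology :: "(real \<Rightarrow> real) topology" where
  "M1_topology = induced_topology cadlag_space dist_M1"


section \<open>Poisson processes and extremal processes\<close>

text \<open>
  A point process \<open>\<Sum>\<^sub>i \<delta>\<^bsub>z\<^sub>i\<^esub>\<close> with at most countably many points is given by an enumeration
  \<open>nat \<Rightarrow> 'p option\<close> of its points, where \<^const>\<open>None\<close> marks unused indices. The value of the
  point process on \<open>A\<close> is its number of points in \<open>A\<close>, counted with multiplicity.
\<close>

definition point_count :: "(nat \<Rightarrow> 'p option) \<Rightarrow> 'p set \<Rightarrow> ennreal" where
  "point_count z A = (\<Sum>i. case z i of None \<Rightarrow> 0 | Some v \<Rightarrow> indicator A v)"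

definition poisson_process :: "'b measure \<Rightarrow> ('b \<Rightarrow> nat \<Rightarrow> 'p option) \<Rightarrow> 'p measure \<Rightarrow> bool" where
  "poisson_process Q P \<mu> \<longleftrightarrow>
     prob_space Q \<and>
     (\<forall>\<omega>\<in>space Q. \<forall>i v. P \<omega> i = Some v \<longrightarrow> v \<in> space \<mu>) \<and>
     (\<forall>A\<in>sets \<mu>. (\<lambda>\<omega>. point_count (P \<omega>) A) \<in> borel_measurable Q) \<and>
     (\<forall>A\<in>sets \<mu>. emeasure \<mu> A < \<infinity> \<longrightarrow>
        (\<forall>k::nat. measure Q {\<omega> \<in> space Q. point_count (P \<omega>) A = of_nat k} =
           measure \<mu> A ^ k / fact k * exp (- measure \<mu> A))) \<and>
     (\<forall>A\<in>sets \<mu>. emeasure \<mu> A = \<infinity> \<longrightarrow> (AE \<omega> in Q. point_count (P \<omega>) A = \<infinity>)) \<and>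
     (\<forall>(m::nat) A. (\<forall>i<m. A i \<in> sets \<mu>) \<and> disjoint_family_on A {..<m} \<longrightarrow>
        prob_space.indep_vars Q (\<lambda>_. borel) (\<lambda>i \<omega>. point_count (P \<omega>) (A i)) {..<m})"

text \<open>The path \<open>t \<mapsto> \<Or>\<^bsub>t\<^sub>i \<le> t\<^esub> x\<^sub>i\<close>; as all \<open>x\<^sub>i\<close> are positive, adding \<open>0\<close> only sets \<open>\<Or>\<emptyset> = 0\<close>.\<close>

definition running_sup :: "(nat \<Rightarrow> (real \<times> real) option) \<Rightarrow> real \<Rightarrow> real" where
  "running_sup z = (\<lambda>t\<in>{0..1}. Sup (insert 0 {x. \<exists>i s. z i = Some (s, x) \<and> s \<le> t}))"

text \<open>
  A random element \<open>W\<close> of \<open>D([0,1],\<real>)\<close> is an extremal process if it has the law (on the product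
  space, i.e. the same finite-dimensional distributions) of the running supremum of some Poisson
  process. That Poisson process may be taken to be the identity on a space of enumerations, since
  any other one can be replaced by its image there.
\<close>

definition extremal_process :: "'b measure \<Rightarrow> ('b \<Rightarrow> real \<Rightarrow> real) \<Rightarrow> real measure \<Rightarrow> bool" where
  "extremal_process N W \<nu> \<longleftrightarrow>
     prob_space N \<and>
     sets \<nu> = sets (restrict_space borel {0<..}) \<and>
     (\<forall>\<delta>>0. emeasure \<nu> {\<delta><..} < \<infinity>) \<and>
     W \<in> measurable N (borel_of M1_topology) \<and>
     W \<in> measurable N (PiM {0..1} (\<lambda>_. borel)) \<and>
     (\<exists>Q :: (nat \<Rightarrow> (real \<times> real) option) measure.
        poisson_process Q (\<lambda>z. z) (restrict_space lborel {0..1} \<Otimes>\<^sub>M \<nu>) \<and>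
        running_sup \<in> measurable Q (PiM {0..1} (\<lambda>_. borel)) \<and>
        distr N (PiM {0..1} (\<lambda>_. borel)) W = distr Q (PiM {0..1} (\<lambda>_. borel)) running_sup)"


section \<open>Conditions on the noise\<close>

definition slowly_varying :: "(real \<Rightarrow> real) \<Rightarrow> bool" where
  "slowly_varying L \<longleftrightarrow> (\<forall>t>0. ((\<lambda>x. L (t * x) / L x) \<longlongrightarrow> 1) at_top)"

definition strictly_stationary :: "'a measure \<Rightarrow> (int \<Rightarrow> 'a \<Rightarrow> real) \<Rightarrow> bool" where
  "strictly_stationary M Z \<longleftrightarrow>
     (\<forall>i. Z i \<in> borel_measurable M) \<and>
     (\<forall>h. \<forall>J. finite J \<longrightarrow>
        distr M (PiM J (\<lambda>_. borel)) (\<lambda>\<omega>. \<lambda>i\<in>J. Z (i + h) \<omega>) =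
        distr M (PiM J (\<lambda>_. borel)) (\<lambda>\<omega>. \<lambda>i\<in>J. Z i \<omega>))"

definition condition_D' :: "'a measure \<Rightarrow> (int \<Rightarrow> 'a \<Rightarrow> real) \<Rightarrow> (nat \<Rightarrow> real) \<Rightarrow> bool" where
  "condition_D' M Z a \<longleftrightarrow> (\<forall>x>0.
     ((\<lambda>k::nat. limsup (\<lambda>n::nat. ereal (real n * (\<Sum>i=2..n div k.
         measure M {\<omega> \<in> space M. \<bar>Z 1 \<omega>\<bar> / a n > x \<and> \<bar>Z (int i) \<omega>\<bar> / a n > x}))))
       \<longlongrightarrow> 0) sequentially)"

definition punctured_ereal :: "ereal set" where
  "punctured_ereal = UNIV - {0}"

definition rho :: "ereal \<Rightarrow> ereal \<Rightarrow> real" where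
  "rho x y = max \<bar>real_of_ereal (1 / \<bar>x\<bar>) - real_of_ereal (1 / \<bar>y\<bar>)\<bar>
                 \<bar>real_of_ereal (sgn x) - real_of_ereal (sgn y)\<bar>"

lemma Metric_space_rho: "Metric_space punctured_ereal rho"
proof
  fix x y z :: ereal
  show "0 \<le> rho x y" "rho x y = rho y x" by (auto simp: rho_def max_def abs_minus_commute)
  show "rho x z \<le> rho x y + rho y z"
    unfolding rho_def by linarith
  assume "x \<in> punctured_ereal" "y \<in> punctured_ereal"
  then show "rho x y = 0 \<longleftrightarrow> x = y"
    by (cases x; cases y)
      (auto simp: rho_def punctured_ereal_def max_def sgn_if one_ereal_def zero_ereal_def
         split: if_splits)
qed

definition time_space_topology :: "(real \<times> ereal) topology" where
  "time_space_topology =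
     prod_topology (top_of_set {0..1}) (induced_topology punctured_ereal rho)"

definition CK_plus :: "(real \<times> ereal \<Rightarrow> real) set" where
  "CK_plus = {f.
     continuous_map time_space_topology euclideanreal f \<and>
     (\<forall>v\<in>topspace time_space_topology. 0 \<le> f v) \<and>
     compactin time_space_topology
       (time_space_topology closure_of {v \<in> topspace time_space_topology. f v \<noteq> 0}) \<and>
     (\<forall>t\<in>{0..1}. f (t, 0) = 0)}"

definition condition_A' :: "'a measure \<Rightarrow> (int \<Rightarrow> 'a \<Rightarrow> real) \<Rightarrow> (nat \<Rightarrow> real) \<Rightarrow> bool" where
  "condition_A' M Y a \<longleftrightarrow> (\<exists>r :: nat \<Rightarrow> nat.
     (\<forall>n. r n > 0) \<and> filterlim r at_top sequentially \<and>
     (\<lambda>n. real (r n) / real n) \<longlonglongrightarrow> 0 \<and>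
     (\<forall>f\<in>CK_plus.
       (\<lambda>n. (\<integral>\<omega>. exp (- (\<Sum>i=1..n. f (real i / real n, ereal (Y (int i) \<omega> / a n)))) \<partial>M) -
            (\<Prod>k=1..n div r n.
               \<integral>\<omega>. exp (- (\<Sum>i=1..r n. f (real (k * r n) / real n,
                       ereal (Y (int (i + (k - 1) * r n)) \<omega> / a n)))) \<partial>M))
         \<longlonglongrightarrow> 0))"


section \<open>The moving average and its partial maxima process\<close>

text \<open>As \<open>c\<^sub>j \<rightarrow> 0\<close>, the suprema below are attained.\<close>

definition c_plus :: "(nat \<Rightarrow> real) \<Rightarrow> real" where
  "c_plus c = (SUP j. max (c j) 0)"

definition c_minus :: "(nat \<Rightarrow> real) \<Rightarrow> real" where
  "c_minus c = (SUP j. max (- c j) 0)"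

definition moving_average ::
    "(nat \<Rightarrow> real) \<Rightarrow> (int \<Rightarrow> real) \<Rightarrow> (int \<Rightarrow> 'a \<Rightarrow> real) \<Rightarrow> nat \<Rightarrow> 'a \<Rightarrow> real" where
  "moving_average c \<sigma> Z n \<omega> = (\<Sum>j. c j * \<sigma> (int n - int j) * Z (int n - int j) \<omega>)"

definition maxima_process :: "(nat \<Rightarrow> 'a \<Rightarrow> real) \<Rightarrow> (nat \<Rightarrow> real) \<Rightarrow> nat \<Rightarrow> 'a \<Rightarrow> real \<Rightarrow> real" where
  "maxima_process X a n \<omega> = (\<lambda>t\<in>{0..1}.
     if real n * t < 1 then X 1 \<omega> / a n
     else Max ((\<lambda>k. X k \<omega> / a n) ` {1..nat \<lfloor>real n * t\<rfloor>}))"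

end

(*
For a nondecreasing path x the completed graph is parametrised canonically by the value of r + u, so
M1-closeness is uniform closeness of the inverses of t + x(t). Discretising time and values on a grid
of mesh 1/m therefore moves x by at most a constant times 1/m, uniformly in x, and convergence in
distribution follows from convergence of P(W_n(j/m) <= i/m for all (j, i) in S).

Such an event says that all X_k stay below a step barrier. For a continuous barrier 1/g, condition A'
splits {1, ..., n} into asymptotically independent blocks, and by D' a block contains at most one
large value, so the probability that no Y_k crosses the barrier tends to exp of minus the limit of
the sum of the crossing probabilities. The same two facts show that a large X_k is, up to a
negligible error, c_j Y_(k-j) for a single j. The remainder of the series is controlled without any
independence: |sum c_j Z_j|^delta <= sum |c_j|^delta |Z_j|^delta, and |Z|^delta has tail index
alpha/delta > 1, so that truncated first moments suffice.

Running suprema of the Poisson process give the same limit through void probabilities.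
*)

theory Submission
  imports Defs "HOL-Real_Asymp.Real_Asymp"
begin

section \<open>Canonical parametrisation of monotone paths\<close>

text \<open>A functional \<open>F\<close> continuous for M1 need not be uniformly continuous, so
  closeness of a path and its discretisation does not control \<open>F\<close> uniformly. Hence
  \<open>F\<close> is replaced from below by Lipschitz minorants whose constant grows like the
  square root of \<open>m\<close>: slowly enough for a grid error of order \<open>1 / m\<close>,
  fast enough to recover \<open>F\<close> pointwise. The resulting one-sided bound, applied to
  \<open>F\<close> and \<open>- F\<close>, gives the limit. Barriers are stored through reciprocals
  \<open>g\<close>, so that the absence of a barrier is the value 0, a crossing is
  \<open>1 < g t * \<bar>y\<bar>\<close>, and a power law gives the region beyond it the mass
  \<open>g t powr \<alpha>\<close>. The signs of the noise need separate levels, because large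
  positive values act through \<open>c_plus\<close> and large negative ones through
  \<open>c_minus\<close>. Condition A' concerns continuous test functions only, and it freezes time
  inside a block. Each of these costs a small shift of the barrier; all shifts are removed at the
  end, since the limit depends continuously on the barrier.\<close>

definition mono_paths :: "(real \<Rightarrow> real) set" where
  "mono_paths = {x \<in> cadlag_space. mono_on {0..1} x}"

text \<open>The generalised inverse of \<open>t + x t\<close>, which is strictly increasing for a
  nondecreasing path. Inserting 1 keeps the set nonempty for \<open>s\<close> beyond
  \<open>1 + x 1\<close>.\<close>

definition graph_time :: "(real \<Rightarrow> real) \<Rightarrow> real \<Rightarrow> real" where
  "graph_time x s = Inf (insert 1 {t \<in> {0..1}. s \<le> t + x t})"

lemma mono_paths_le: "x \<in> mono_paths \<Longrightarrow> 0 \<le> t \<Longrightarrow> t \<le> t' \<Longrightarrow> t' \<le> 1 \<Longrightarrow> x t \<le> x t'"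
  by (auto simp: mono_paths_def mono_on_def)

lemma graph_time_bdd: "bdd_below (insert 1 {t \<in> {0..1}. s \<le> t + x t :: bool})" for x :: "real \<Rightarrow> real"
  by (rule bdd_belowI[of _ 0]) auto

lemma graph_time_ge0: "0 \<le> graph_time x s"
  unfolding graph_time_def by (rule cInf_greatest) auto

lemma graph_time_le1: "graph_time x s \<le> 1"
  unfolding graph_time_def by (rule cInf_lower[OF _ graph_time_bdd]) auto

lemma graph_time_le: "0 \<le> t \<Longrightarrow> t \<le> 1 \<Longrightarrow> s \<le> t + x t \<Longrightarrow> graph_time x s \<le> t"
  unfolding graph_time_def by (rule cInf_lower[OF _ graph_time_bdd]) auto

lemma graph_time_greatest:
  "t \<le> 1 \<Longrightarrow> (\<And>t'. 0 \<le> t' \<Longrightarrow> t' \<le> 1 \<Longrightarrow> s \<le> t' + x t' \<Longrightarrow> t \<le> t') \<Longrightarrow> t \<le> graph_time x s"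
  unfolding graph_time_def by (rule cInf_greatest) auto

lemma graph_time_not_le: "0 \<le> t \<Longrightarrow> t < graph_time x s \<Longrightarrow> t + x t < s"
  using graph_time_le[of t s x] graph_time_le1[of x s] by fastforce

text \<open>Right-continuity would pass a strict inequality at the infimum to a right neighbourhood,
  which then contains no competitor. At value 1 the infimum may come from the inserted 1 alone,
  hence the hypothesis.\<close>

lemma graph_time_attained:
  assumes x: "x \<in> mono_paths" and lt: "graph_time x s < 1"
  shows "s \<le> graph_time x s + x (graph_time x s)"
proof (rule ccontr)
  let ?t = "graph_time x s"
  assume "\<not> ?thesis"
  then have less: "?t + x ?t < s" by simp
  have "(x \<longlongrightarrow> x ?t) (at_right ?t)"
    using x lt graph_time_ge0[of x s] by (auto simp: mono_paths_def cadlag_space_def)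
  then have "((\<lambda>t. t + x t) \<longlongrightarrow> ?t + x ?t) (at_right ?t)"
    by (intro tendsto_intros)
  then have "eventually (\<lambda>t. t + x t < s) (at_right ?t)"
    using less order_tendstoD(2) by blast
  then obtain b where b: "b > ?t" "\<And>t. ?t < t \<Longrightarrow> t < b \<Longrightarrow> t + x t < s"
    unfolding eventually_at_right_field by auto
  have "min b 1 > ?t" using b lt by simp
  then obtain t where t: "t \<in> insert 1 {t \<in> {0..1}. s \<le> t + x t}" "t < min b 1"
    unfolding graph_time_def using cInf_lessD[of "insert 1 {t \<in> {0..1}. s \<le> t + x t}" "min b 1"] by blast
  then have t': "0 \<le> t" "t \<le> 1" "s \<le> t + x t" by auto
  then have "?t \<le> t" by (intro graph_time_le)
  then show False using b(2)[of t] t t' less by (cases "t = ?t") auto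
qed

lemma graph_time_mono: "s \<le> s' \<Longrightarrow> graph_time x s \<le> graph_time x s'"
  by (rule graph_time_greatest[OF graph_time_le1]) (auto intro: graph_time_le)

text \<open>The common source of Lipschitz continuity and of the comparison of two paths:
  \<open>y = x\<close> and \<open>d = 0\<close> give the former, while \<open>d = e\<close> makes
  the shifts of the argument cancel for the latter.\<close>

lemma graph_time_shift:
  assumes x: "x \<in> mono_paths" and "0 \<le> e"
    and le: "\<And>t. 0 \<le> t \<Longrightarrow> t + e < 1 \<Longrightarrow> x t \<le> y (t + e) + d"
  shows "graph_time y (s + e - d) \<le> graph_time x s + e"
proof (cases "graph_time x s + e < 1")
  case True
  then have "s \<le> graph_time x s + x (graph_time x s)"
    using graph_time_attained[OF x] assms(2) by simp
  moreover have "x (graph_time x s) \<le> y (graph_time x s + e) + d"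
    using True graph_time_ge0 le by blast
  ultimately show ?thesis
    using True graph_time_ge0[of x s] assms(2) by (intro graph_time_le) auto
next
  case False
  then show ?thesis using graph_time_le1[of y "s + e - d"] by linarith
qed

lemma graph_time_lipschitz:
  assumes x: "x \<in> mono_paths"
  shows "\<bar>graph_time x s - graph_time x s'\<bar> \<le> \<bar>s - s'\<bar>"
proof -
  have *: "graph_time x s' \<le> graph_time x s + (s' - s) \<and> graph_time x s \<le> graph_time x s'" if "s \<le> s'" for s s'
    using graph_time_shift[OF x, of "s' - s" x 0 s] mono_paths_le[OF x] that graph_time_mono[OF that, of x]
    by auto
  show ?thesis
    using *[of s s'] *[of s' s] by linarith
qed

lemma graph_time_continuous:
  assumes "x \<in> mono_paths" shows "continuous_on A (graph_time x)"
  unfolding continuous_on_iff dist_real_def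
  using graph_time_lipschitz[OF assms] by (meson le_less_trans)

section \<open>Left limits and completed graphs of nondecreasing paths\<close>

lemma left_lim_tendsto:
  assumes "x \<in> cadlag_space" "0 < t" "t \<le> 1"
  shows "(x \<longlongrightarrow> left_lim x t) (at_left t)"
proof -
  obtain l where l: "(x \<longlongrightarrow> l) (at_left t)"
    using assms unfolding cadlag_space_def by fastforce
  then have "Lim (at_left t) x = l"
    by (intro tendsto_Lim) (auto simp: trivial_limit_at_left_real)
  then show ?thesis using l assms by (simp add: left_lim_def)
qed

lemma left_lim_ge:
  assumes x: "x \<in> mono_paths" and t: "0 \<le> t'" "t' < t" "t \<le> 1"
  shows "x t' \<le> left_lim x t"
proof (rule tendsto_lowerbound)
  show "(x \<longlongrightarrow> left_lim x t) (at_left t)"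
    using x t by (intro left_lim_tendsto) (auto simp: mono_paths_def)
  show "\<forall>\<^sub>F i in at_left t. x t' \<le> x i"
    using eventually_at_left_real[OF t(2)]
  proof eventually_elim
    case (elim i) then show ?case using mono_paths_le[OF x, of t' i] t by auto
  qed
qed auto

lemma left_lim_le:
  assumes x: "x \<in> mono_paths" and t: "0 \<le> t" "t \<le> 1"
    and le: "\<And>t'. 0 \<le> t' \<Longrightarrow> t' < t \<Longrightarrow> x t' \<le> z" "t = 0 \<Longrightarrow> x 0 \<le> z"
  shows "left_lim x t \<le> z"
proof (cases "t = 0")
  case True then show ?thesis using le by (simp add: left_lim_def)
next
  case False
  show ?thesis
  proof (rule tendsto_upperbound)
    show "(x \<longlongrightarrow> left_lim x t) (at_left t)"
      using x t False by (intro left_lim_tendsto) (auto simp: mono_paths_def)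
    show "\<forall>\<^sub>F i in at_left t. x i \<le> z"
      using eventually_at_left_real[of 0 t] False t
      by (auto elim!: eventually_mono intro!: le)
  qed auto
qed

lemma left_lim_le_self: "x \<in> mono_paths \<Longrightarrow> 0 \<le> t \<Longrightarrow> t \<le> 1 \<Longrightarrow> left_lim x t \<le> x t"
  by (rule left_lim_le) (auto intro: mono_paths_le)

lemma mono_completed_graph:
  assumes x: "x \<in> mono_paths"
  shows "completed_graph x = {(t, z). 0 \<le> t \<and> t \<le> 1 \<and> left_lim x t \<le> z \<and> z \<le> x t}"
proof -
  have "(\<exists>l\<in>{0..1}. z = l * left_lim x t + (1 - l) * x t) \<longleftrightarrow> left_lim x t \<le> z \<and> z \<le> x t"
    if t: "0 \<le> t" "t \<le> 1" for t z
  proof -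
    have le: "left_lim x t \<le> x t" using left_lim_le_self[OF x t] .
    have "(\<exists>l\<in>{0..1}. z = l * left_lim x t + (1 - l) * x t) \<longleftrightarrow> z \<in> closed_segment (x t) (left_lim x t)"
      by (auto simp: closed_segment_def algebra_simps)
    then show ?thesis using le by (auto simp: closed_segment_eq_real_ivl)
  qed
  then show ?thesis by (auto simp: completed_graph_def)
qed

text \<open>Together with \<open>graph_time_unique\<close>: each line \<open>t + z = s\<close> with
  \<open>s\<close> between \<open>x 0\<close> and \<open>1 + x 1\<close> meets the completed graph
  exactly once, at time \<open>graph_time x s\<close>.\<close>

lemma graph_time_in_graph:
  assumes x: "x \<in> mono_paths" and s: "x 0 \<le> s" "s \<le> 1 + x 1"
  shows "left_lim x (graph_time x s) \<le> s - graph_time x s"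
    and "s - graph_time x s \<le> x (graph_time x s)"
proof -
  let ?t = "graph_time x s"
  have t: "0 \<le> ?t" "?t \<le> 1" using graph_time_ge0 graph_time_le1 by auto
  show "s - ?t \<le> x ?t"
    using graph_time_attained[OF x, of s] s t by (cases "?t < 1") auto
  show "left_lim x ?t \<le> s - ?t"
  proof (rule left_lim_le[OF x t])
    fix t' assume t': "0 \<le> t'" "t' < ?t"
    show "x t' \<le> s - ?t"
    proof (rule ccontr)
      assume "\<not> ?thesis"
      then have "s < ?t + x t'" by simp
      \<comment> \<open>A later time is inserted before the infimum: \<open>x\<close> is no smaller
        there, so \<open>t'' + x t''\<close> already exceeds \<open>s\<close>.\<close>
      then obtain t'' where t'': "t' < t''" "t'' < ?t" "s < t'' + x t'"
      proof -
        assume *: "\<And>t''. t' < t'' \<Longrightarrow> t'' < ?t \<Longrightarrow> s < t'' + x t' \<Longrightarrow> thesis"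
        obtain u where "max t' (s - x t') < u" "u < ?t"
          using dense[of "max t' (s - x t')" ?t] t' \<open>s < ?t + x t'\<close> by auto
        then show thesis using *[of u] by auto
      qed
      moreover have "x t' \<le> x t''" using t' t'' t by (intro mono_paths_le[OF x]) auto
      ultimately show False using graph_time_not_le[of t'' x s] t' by auto
    qed
  next
    assume "?t = 0" then show "x 0 \<le> s - ?t" using s by simp
  qed
qed

lemma graph_time_unique:
  assumes x: "x \<in> mono_paths" and t: "0 \<le> t" "t \<le> 1" and z: "left_lim x t \<le> z" "z \<le> x t"
  shows "graph_time x (t + z) = t"
proof (rule antisym)
  show "graph_time x (t + z) \<le> t" using t z by (intro graph_time_le) auto
  show "t \<le> graph_time x (t + z)"
  proof (rule graph_time_greatest[OF t(2)], rule ccontr)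
    fix t' assume t': "0 \<le> t'" "t' \<le> 1" "t + z \<le> t' + x t'" "\<not> t \<le> t'"
    then show False using left_lim_ge[OF x, of t' t] t z by auto
  qed
qed

text \<open>Both coordinates are continuous because \<open>graph_time\<close> is 1-Lipschitz. Since
  \<open>z \<ge> left_lim x t\<close> on a vertical segment, the graph order is the order of
  \<open>t + z\<close>, so an affine clock running through the range of \<open>t + z\<close>
  respects it.\<close>

lemma mono_param_rep:
  assumes x: "x \<in> mono_paths"
  defines "l \<equiv> \<lambda>\<tau>. x 0 + \<tau> * (1 + x 1 - x 0)"
  shows "((\<lambda>\<tau>. graph_time x (l \<tau>)), (\<lambda>\<tau>. l \<tau> - graph_time x (l \<tau>))) \<in> param_reps x"
proof -
  have x01: "x 0 \<le> x 1" using mono_paths_le[OF x, of 0 1] by simp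
  have cl: "continuous_on A l" for A unfolding l_def by (intro continuous_intros)
  have cg: "continuous_on A (\<lambda>\<tau>. graph_time x (l \<tau>))" for A
    using continuous_on_compose2[OF graph_time_continuous[OF x, of UNIV] cl] by auto
  have lm: "l \<tau> \<le> l \<tau>'" if "\<tau> \<le> \<tau>'" for \<tau> \<tau>'
    using that x01 by (simp add: l_def mult_right_mono)
  have l01: "l 0 = x 0" "l 1 = 1 + x 1" by (auto simp: l_def)
  have lb: "x 0 \<le> l \<tau>" "l \<tau> \<le> 1 + x 1" if "\<tau> \<in> {0..1}" for \<tau>
    using lm[of 0 \<tau>] lm[of \<tau> 1] l01 that by auto
  have im: "(\<lambda>\<tau>. (graph_time x (l \<tau>), l \<tau> - graph_time x (l \<tau>))) ` {0..1} = completed_graph x"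
  proof (intro equalityI subsetI)
    fix v assume "v \<in> (\<lambda>\<tau>. (graph_time x (l \<tau>), l \<tau> - graph_time x (l \<tau>))) ` {0..1}"
    then obtain \<tau> where "\<tau> \<in> {0..1}" "v = (graph_time x (l \<tau>), l \<tau> - graph_time x (l \<tau>))" by auto
    then show "v \<in> completed_graph x"
      using graph_time_in_graph[OF x lb] graph_time_ge0 graph_time_le1
      by (auto simp: mono_completed_graph[OF x])
  next
    fix v assume "v \<in> completed_graph x"
    then obtain t z where v: "v = (t, z)" and t: "0 \<le> t" "t \<le> 1" and z: "left_lim x t \<le> z" "z \<le> x t"
      by (auto simp: mono_completed_graph[OF x])
    have "x 0 \<le> left_lim x t"
      using left_lim_ge[OF x, of 0 t] t by (cases "t = 0") (auto simp: left_lim_def)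
    then have lower: "x 0 \<le> t + z" using t z by simp
    have "x t \<le> x 1" using t mono_paths_le[OF x] by simp
    then have upper: "t + z \<le> 1 + x 1" using t z by simp
    \<comment> \<open>The inverse of the clock \<open>l\<close>, whose slope
      \<open>1 + x 1 - x 0\<close> is at least 1.\<close>
    define \<tau> where "\<tau> = (t + z - x 0) / (1 + x 1 - x 0)"
    have "\<tau> \<in> {0..1}"
      using lower upper x01 by (auto simp: \<tau>_def field_simps)
    moreover have "l \<tau> = t + z"
      using x01 by (simp add: \<tau>_def l_def)
    ultimately
    show "v \<in> (\<lambda>\<tau>. (graph_time x (l \<tau>), l \<tau> - graph_time x (l \<tau>))) ` {0..1}"
      using graph_time_unique[OF x t z] v by (intro image_eqI[of _ _ \<tau>]) auto
  qed
  have ord: "graph_le x (graph_time x (l \<tau>), l \<tau> - graph_time x (l \<tau>))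
      (graph_time x (l \<tau>'), l \<tau>' - graph_time x (l \<tau>'))"
    if "\<tau> \<in> {0..1}" "\<tau>' \<in> {0..1}" "\<tau> \<le> \<tau>'" for \<tau> \<tau>'
    using graph_time_in_graph[OF x lb[OF that(1)]] lm[OF that(3)]
      graph_time_mono[OF lm[OF that(3)], of x]
    by (auto simp: graph_le_def)
  show ?thesis
    unfolding param_reps_def using cl cg im ord by (auto intro!: continuous_intros)
qed

section \<open>A distance on monotone paths that dominates the M1 distance\<close>

definition mono_dist :: "(real \<Rightarrow> real) \<Rightarrow> (real \<Rightarrow> real) \<Rightarrow> real" where
  "mono_dist x y = \<bar>x 0 - y 0\<bar> + \<bar>x 1 - y 1\<bar> + (SUP s. \<bar>graph_time x s - graph_time y s\<bar>)"

lemma graph_time_diff_bdd: "bdd_above (range (\<lambda>s. \<bar>graph_time x s - graph_time y s\<bar>))"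
proof (rule bdd_aboveI2)
  show "\<bar>graph_time x s - graph_time y s\<bar> \<le> 1" for s
    using graph_time_ge0[of x s] graph_time_le1[of x s] graph_time_ge0[of y s] graph_time_le1[of y s]
    by linarith
qed

lemma graph_time_diff_le_SUP:
  "\<bar>graph_time x s - graph_time y s\<bar> \<le> (SUP s. \<bar>graph_time x s - graph_time y s\<bar>)"
  by (rule cSUP_upper[OF _ graph_time_diff_bdd]) simp

lemma mono_dist_nonneg: "0 \<le> mono_dist x y"
  using graph_time_diff_le_SUP[of x 0 y] unfolding mono_dist_def by linarith

lemma mono_dist_commute: "mono_dist x y = mono_dist y x"
  by (simp add: mono_dist_def abs_minus_commute)

lemma mono_dist_triangle: "mono_dist x z \<le> mono_dist x y + mono_dist y z"
proof -
  have "(SUP s. \<bar>graph_time x s - graph_time z s\<bar>) \<le>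
    (SUP s. \<bar>graph_time x s - graph_time y s\<bar>) + (SUP s. \<bar>graph_time y s - graph_time z s\<bar>)"
  proof (rule cSUP_least)
    show "\<bar>graph_time x s - graph_time z s\<bar> \<le> (SUP s. \<bar>graph_time x s - graph_time y s\<bar>)
      + (SUP s. \<bar>graph_time y s - graph_time z s\<bar>)" for s
      using graph_time_diff_le_SUP[of x s y] graph_time_diff_le_SUP[of y s z] by linarith
  qed simp
  then show ?thesis unfolding mono_dist_def by linarith
qed

text \<open>Both inverses are compared through \<open>graph_time_shift\<close> with time shift and
  value shift equal to \<open>e\<close>. The factor 3 counts the two end values and the
  supremum.\<close>

lemma mono_dist_le:
  assumes x: "x \<in> mono_paths" and y: "y \<in> mono_paths" and "0 \<le> e"
    and "\<bar>x 0 - y 0\<bar> \<le> e" "\<bar>x 1 - y 1\<bar> \<le> e"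
    and "\<And>t. 0 \<le> t \<Longrightarrow> t + e < 1 \<Longrightarrow> x t \<le> y (t + e) + e"
    and "\<And>t. 0 \<le> t \<Longrightarrow> t + e < 1 \<Longrightarrow> y t \<le> x (t + e) + e"
  shows "mono_dist x y \<le> 3 * e"
proof -
  have "(SUP s. \<bar>graph_time x s - graph_time y s\<bar>) \<le> e"
  proof (rule cSUP_least)
    show "\<bar>graph_time x s - graph_time y s\<bar> \<le> e" for s
      using graph_time_shift[OF x assms(3), of y e s] graph_time_shift[OF y assms(3), of x e s] assms(6,7)
      by fastforce
  qed simp
  then show ?thesis using assms(4,5) unfolding mono_dist_def by linarith
qed

lemma sup_norm01_le: "(\<And>s. s \<in> {0..1} \<Longrightarrow> \<bar>f s\<bar> \<le> e) \<Longrightarrow> sup_norm01 f \<le> e"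
  unfolding sup_norm01_def by (rule cSUP_least) auto

lemma sup_norm01_nonneg:
  assumes "continuous_on {0..1} f" shows "0 \<le> sup_norm01 f"
proof -
  have "compact ((\<lambda>s. \<bar>f s\<bar>) ` {0..1})"
    using assms by (intro compact_continuous_image continuous_intros) auto
  then have "bdd_above ((\<lambda>s. \<bar>f s\<bar>) ` {0..1})"
    by (intro bounded_imp_bdd_above compact_imp_bounded)
  then have "\<bar>f 0\<bar> \<le> sup_norm01 f"
    unfolding sup_norm01_def by (intro cSUP_upper) auto
  then show ?thesis by linarith
qed

text \<open>The infimum needs a lower bound: the suprema run over compact images of continuous
  functions, hence are nonnegative.\<close>

lemma dist_M1_le:
  assumes "(r1, u1) \<in> param_reps x1" "(r2, u2) \<in> param_reps x2"
    and "\<And>s. s \<in> {0..1} \<Longrightarrow> \<bar>r1 s - r2 s\<bar> \<le> e" "\<And>s. s \<in> {0..1} \<Longrightarrow> \<bar>u1 s - u2 s\<bar> \<le> e"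
  shows "dist_M1 x1 x2 \<le> e"
proof -
  let ?A = "{max (sup_norm01 (\<lambda>s. r1 s - r2 s)) (sup_norm01 (\<lambda>s. u1 s - u2 s)) |
     r1 u1 r2 u2. (r1, u1) \<in> param_reps x1 \<and> (r2, u2) \<in> param_reps x2}"
  have "bdd_below ?A"
  proof (rule bdd_belowI[of _ 0])
    fix z assume "z \<in> ?A"
    then obtain r1 u1 r2 u2 where z: "z = max (sup_norm01 (\<lambda>s. r1 s - r2 s)) (sup_norm01 (\<lambda>s. u1 s - u2 s))"
      and "(r1, u1) \<in> param_reps x1" "(r2, u2) \<in> param_reps x2" by auto
    then have "0 \<le> sup_norm01 (\<lambda>s. r1 s - r2 s)"
      by (intro sup_norm01_nonneg) (auto simp: param_reps_def intro!: continuous_intros)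
    then show "0 \<le> z" using z by simp
  qed
  then have "dist_M1 x1 x2 \<le> max (sup_norm01 (\<lambda>s. r1 s - r2 s)) (sup_norm01 (\<lambda>s. u1 s - u2 s))"
    unfolding dist_M1_def using assms(1,2) by (intro cInf_lower) auto
  also have "\<dots> \<le> e" using assms(3,4) by (auto intro!: sup_norm01_le)
  finally show ?thesis .
qed

text \<open>In the canonical representations the second coordinate is the clock minus the first.
  Clocks and first coordinates each differ by at most \<open>mono_dist x y\<close>, which explains
  the factor 2. The end values enter \<open>mono_dist\<close> because the clocks depend on
  them.\<close>

lemma dist_M1_le_mono_dist:
  assumes x: "x \<in> mono_paths" and y: "y \<in> mono_paths"
  shows "dist_M1 x y \<le> 2 * mono_dist x y"
proof (rule dist_M1_le[OF mono_param_rep[OF x] mono_param_rep[OF y]])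
  fix \<tau> :: real assume \<tau>: "\<tau> \<in> {0..1}"
  define lx ly where "lx = x 0 + \<tau> * (1 + x 1 - x 0)" and "ly = y 0 + \<tau> * (1 + y 1 - y 0)"
  define S where "S = (SUP s. \<bar>graph_time x s - graph_time y s\<bar>)"
  have "\<bar>lx - ly\<bar> = \<bar>(1 - \<tau>) * (x 0 - y 0) + \<tau> * (x 1 - y 1)\<bar>"
    by (simp add: lx_def ly_def algebra_simps)
  also have "\<dots> \<le> \<bar>(1 - \<tau>) * (x 0 - y 0)\<bar> + \<bar>\<tau> * (x 1 - y 1)\<bar>" by linarith
  also have "\<dots> \<le> \<bar>x 0 - y 0\<bar> + \<bar>x 1 - y 1\<bar>"
    using \<tau> by (intro add_mono) (auto simp: abs_mult mult_left_le_one_le)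
  finally have l: "\<bar>lx - ly\<bar> \<le> \<bar>x 0 - y 0\<bar> + \<bar>x 1 - y 1\<bar>" .
  have S: "\<bar>graph_time x ly - graph_time y ly\<bar> \<le> S"
    unfolding S_def by (rule graph_time_diff_le_SUP)
  have r: "\<bar>graph_time x lx - graph_time y ly\<bar> \<le> \<bar>lx - ly\<bar> + S"
    using graph_time_lipschitz[OF x, of lx ly] S by linarith
  have d: "mono_dist x y = \<bar>x 0 - y 0\<bar> + \<bar>x 1 - y 1\<bar> + S" by (simp add: mono_dist_def S_def)
  have S0: "0 \<le> S" using S by linarith
  have dn: "\<bar>lx - ly\<bar> + S \<le> mono_dist x y" using l d by linarith
  then have dr: "\<bar>graph_time x lx - graph_time y ly\<bar> \<le> mono_dist x y" using r by linarith
  show "\<bar>graph_time x (x 0 + \<tau> * (1 + x 1 - x 0)) - graph_time y (y 0 + \<tau> * (1 + y 1 - y 0))\<bar> \<le> 2 * mono_dist x y"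
    using dn dr S0 unfolding lx_def[symmetric] ly_def[symmetric] by linarith
  show "\<bar>(x 0 + \<tau> * (1 + x 1 - x 0) - graph_time x (x 0 + \<tau> * (1 + x 1 - x 0))) -
      (y 0 + \<tau> * (1 + y 1 - y 0) - graph_time y (y 0 + \<tau> * (1 + y 1 - y 0)))\<bar> \<le> 2 * mono_dist x y"
    using dn dr S0 unfolding lx_def[symmetric] ly_def[symmetric] by linarith
qed

text \<open>The shape shared by the grid discretisation and the maxima process. At
  \<open>t = 1\<close> the index is \<open>n\<close>; for \<open>n = 0\<close> the path is
  constant.\<close>

definition step_path :: "nat \<Rightarrow> (nat \<Rightarrow> real) \<Rightarrow> real \<Rightarrow> real" where
  "step_path n v = (\<lambda>t\<in>{0..1}. v (nat \<lfloor>real n * t\<rfloor>))"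

lemma eventually_at_left_gt: "b < t \<Longrightarrow> eventually (\<lambda>u. b < u) (at_left (t :: real))"
  using eventually_mono[OF eventually_at_left_real, of b t "\<lambda>u. b < u"] by simp

lemma eventually_at_left_lt: "eventually (\<lambda>u. u < t) (at_left (t :: real))"
  by (simp add: eventually_at_filter)

lemma step_path_mono_paths:
  assumes v: "\<And>i j. i \<le> j \<Longrightarrow> j \<le> n \<Longrightarrow> v i \<le> v j"
  shows "step_path n v \<in> mono_paths"
proof -
  have const: "(step_path n v \<longlongrightarrow> c) F"
    if "eventually (\<lambda>t. t \<in> {0..1} \<and> v (nat \<lfloor>real n * t\<rfloor>) = c) F" for c F
    using that by (intro tendsto_eventually) (rule eventually_mono, assumption, simp add: step_path_def)
  have right: "(step_path n v \<longlongrightarrow> step_path n v t) (at_right t)" if t: "0 \<le> t" "t < 1" for t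
  proof (rule const)
    have ev: "eventually (\<lambda>u. u < (\<lfloor>real n * t\<rfloor> + 1) / real n) (at_right t)" if "n > 0"
    proof -
      have "t * real n < \<lfloor>real n * t\<rfloor> + 1" by (subst mult.commute) (rule floor_correct[THEN conjunct2])
      then have "t < (\<lfloor>real n * t\<rfloor> + 1) / real n" using that by (simp only: pos_less_divide_eq of_nat_0_less_iff)
      then show ?thesis by (rule eventually_at_right_real[THEN eventually_mono]) simp
    qed
    have "eventually (\<lambda>u. \<lfloor>real n * u\<rfloor> = \<lfloor>real n * t\<rfloor>) (at_right t)"
    proof (cases "n = 0")
      case False
      then have "eventually (\<lambda>u. u < (\<lfloor>real n * t\<rfloor> + 1) / real n) (at_right t)" using ev by simp
      moreover have "eventually (\<lambda>u. t < u) (at_right t)" by (rule eventually_at_right_less)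
      ultimately show ?thesis
      proof eventually_elim
        case (elim u)
        have "real n * t \<le> real n * u" using elim by (intro mult_left_mono) auto
        then have "\<lfloor>real n * t\<rfloor> \<le> real n * u" by (rule order_trans[OF of_int_floor_le])
        moreover have "u * real n < \<lfloor>real n * t\<rfloor> + 1"
          using elim(1) False by (subst (asm) pos_less_divide_eq) auto
        then have "real n * u < \<lfloor>real n * t\<rfloor> + 1" by (subst mult.commute)
        ultimately show ?case by (intro floor_unique) auto
      qed
    qed simp
    moreover have "eventually (\<lambda>u. u < 1) (at_right t)" using t(2) by (rule eventually_at_right_real[THEN eventually_mono]) simp
    moreover have "eventually (\<lambda>u. t < u) (at_right t)" by (rule eventually_at_right_less)
    ultimately show "eventually (\<lambda>u. u \<in> {0..1} \<and> v (nat \<lfloor>real n * u\<rfloor>) = step_path n v t) (at_right t)"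
    proof eventually_elim
      case (elim u)
      then show ?case using t by (simp add: step_path_def)
    qed
  qed
  have left: "\<exists>l. (step_path n v \<longlongrightarrow> l) (at_left t)" if t: "0 < t" "t \<le> 1" for t
  proof (intro exI const)
    \<comment> \<open>For \<open>n > 0\<close> the left limit has index
      \<open>\<lceil>real n * t\<rceil> - 1\<close>, which differs from the floor exactly when
      \<open>real n * t\<close> is an integer.\<close>
    have "eventually (\<lambda>u. \<lfloor>real n * u\<rfloor> = (if n = 0 then 0 else \<lceil>real n * t\<rceil> - 1)) (at_left t)"
    proof (cases "n = 0")
      case False
      have "real_of_int \<lceil>real n * t\<rceil> - 1 < t * real n"
        using ceiling_correct[of "real n * t"] by (subst mult.commute) simp
      then have "(real_of_int \<lceil>real n * t\<rceil> - 1) / real n < t"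
        using False by (subst pos_divide_less_eq) auto
      then have "eventually (\<lambda>u. (real_of_int \<lceil>real n * t\<rceil> - 1) / real n < u) (at_left t)"
        by (rule eventually_at_left_gt)
      moreover have "eventually (\<lambda>u. u < t) (at_left t)" by (rule eventually_at_left_lt)
      ultimately show ?thesis
      proof eventually_elim
        case (elim u)
        have "real n * u < real n * t" using elim(2) False by (intro mult_strict_left_mono) auto
        then have "real n * u < \<lceil>real n * t\<rceil>" using le_of_int_ceiling[of "real n * t"] by (rule less_le_trans)
        moreover have "real_of_int \<lceil>real n * t\<rceil> - 1 < u * real n"
          using elim(1) False by (subst (asm) pos_divide_less_eq) auto
        then have "real_of_int \<lceil>real n * t\<rceil> - 1 < real n * u" by (subst mult.commute)
        ultimately have "\<lfloor>real n * u\<rfloor> = \<lceil>real n * t\<rceil> - 1"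
          by (intro floor_unique) auto
        then show ?case using False by simp
      qed
    qed simp
    moreover have "eventually (\<lambda>u. 0 < u) (at_left t)" using t(1) by (rule eventually_at_left_gt)
    moreover have "eventually (\<lambda>u. u < t) (at_left t)" by (rule eventually_at_left_lt)
    ultimately show "eventually (\<lambda>u. u \<in> {0..1} \<and> v (nat \<lfloor>real n * u\<rfloor>) =
        v (nat (if n = 0 then 0 else \<lceil>real n * t\<rceil> - 1))) (at_left t)"
    proof eventually_elim
      case (elim u)
      then show ?case using t by simp
    qed
  qed
  have "mono_on {0..1} (step_path n v)"
  proof (rule mono_onI)
    fix t t' :: real assume t: "t \<in> {0..1}" "t' \<in> {0..1}" "t \<le> t'"
    have "real n * t' \<le> real n * 1" using t by (intro mult_left_mono) auto
    then have "nat \<lfloor>real n * t'\<rfloor> \<le> n" by linarith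
    moreover have "nat \<lfloor>real n * t\<rfloor> \<le> nat \<lfloor>real n * t'\<rfloor>"
      using t by (intro nat_mono floor_mono mult_left_mono) auto
    ultimately show "step_path n v t \<le> step_path n v t'" using t v by (simp add: step_path_def)
  qed
  then show ?thesis
    using left right by (auto simp: mono_paths_def cadlag_space_def step_path_def)
qed

section \<open>Reduction of weak convergence to grid events\<close>

lemma pattern_measurable:
  fixes \<Phi> :: "'i set \<Rightarrow> real"
  assumes "finite J" "\<And>i. i \<in> J \<Longrightarrow> Measurable.pred M (B i)"
  shows "(\<lambda>\<omega>. \<Phi> {i \<in> J. B i \<omega>}) \<in> borel_measurable M"
  using assms
proof (induction J arbitrary: \<Phi> rule: finite_induct)
  case (insert j J)
  have "{i \<in> insert j J. B i \<omega>} = (if B j \<omega> then insert j {i \<in> J. B i \<omega>} else {i \<in> J. B i \<omega>})" for \<omega>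
    by auto
  then have "(\<lambda>\<omega>. \<Phi> {i \<in> insert j J. B i \<omega>}) =
      (\<lambda>\<omega>. if B j \<omega> then \<Phi> (insert j {i \<in> J. B i \<omega>}) else \<Phi> {i \<in> J. B i \<omega>})"
    by auto
  moreover have "(\<lambda>\<omega>. (\<lambda>T. \<Phi> (insert j T)) {i \<in> J. B i \<omega>}) \<in> borel_measurable M"
    by (rule insert.IH) (use insert.prems in auto)
  moreover have "(\<lambda>\<omega>. \<Phi> {i \<in> J. B i \<omega>}) \<in> borel_measurable M"
    by (rule insert.IH) (use insert.prems in auto)
  moreover have "Measurable.pred M (B j)" using insert.prems by simp
  ultimately show ?case by simp
qed simp

lemma pattern_bounded:
  fixes \<Phi> :: "'i set \<Rightarrow> real"
  assumes "finite J" shows "\<bar>\<Phi> {i \<in> J. B i}\<bar> \<le> (\<Sum>T\<in>Pow J. \<bar>\<Phi> T\<bar>)"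
  using assms by (intro member_le_sum) auto

lemma pattern_integrable:
  fixes \<Phi> :: "'i set \<Rightarrow> real"
  assumes "prob_space M" "finite J" "finite S" "\<And>i. i \<in> J \<union> S \<Longrightarrow> Measurable.pred M (B i)"
  shows "integrable M (\<lambda>\<omega>. if \<forall>i\<in>S. B i \<omega> then \<Phi> {i \<in> J. B i \<omega>} else 0)"
proof -
  interpret prob_space M by fact
  have [measurable]: "(\<lambda>\<omega>. \<Phi> {i \<in> J. B i \<omega>}) \<in> borel_measurable M"
    using assms by (intro pattern_measurable) auto
  have "Measurable.pred M (\<lambda>\<omega>. \<forall>i\<in>S. B i \<omega>)"
    using assms by (intro pred_intros_finite) auto
  then have "(\<lambda>\<omega>. if \<forall>i\<in>S. B i \<omega> then \<Phi> {i \<in> J. B i \<omega>} else 0) \<in> borel_measurable M"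
    by measurable
  then show ?thesis
  proof (rule integrable_const_bound[rotated])
    show "AE \<omega> in M. norm (if \<forall>i\<in>S. B i \<omega> then \<Phi> {i \<in> J. B i \<omega>} else 0) \<le> (\<Sum>T\<in>Pow J. \<bar>\<Phi> T\<bar>)"
      using pattern_bounded[OF assms(2), of \<Phi>] by (auto intro!: sum_nonneg)
  qed
qed

text \<open>Inclusion--exclusion, one index at a time: \<open>S\<close> collects the indices already prescribed.\<close>

lemma pattern_integral_insert:
  fixes \<Phi> :: "'i set \<Rightarrow> real"
  assumes "prob_space M" "finite J" "finite S" "\<And>i. i \<in> insert j J \<union> S \<Longrightarrow> Measurable.pred M (B i)"
  shows "(\<integral>\<omega>. (if \<forall>i\<in>S. B i \<omega> then \<Phi> {i \<in> insert j J. B i \<omega>} else 0) \<partial>M) =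
    (\<integral>\<omega>. (if \<forall>i\<in>insert j S. B i \<omega> then \<Phi> (insert j {i \<in> J. B i \<omega>}) else 0) \<partial>M) +
    (\<integral>\<omega>. (if \<forall>i\<in>S. B i \<omega> then \<Phi> {i \<in> J. B i \<omega>} else 0) \<partial>M) -
    (\<integral>\<omega>. (if \<forall>i\<in>insert j S. B i \<omega> then \<Phi> {i \<in> J. B i \<omega>} else 0) \<partial>M)"
proof -
  have i1: "integrable M (\<lambda>\<omega>. if \<forall>i\<in>insert j S. B i \<omega> then \<Phi> (insert j {i \<in> J. B i \<omega>}) else 0)"
    by (rule pattern_integrable[where \<Phi> = "\<lambda>T. \<Phi> (insert j T)"]) (use assms in auto)
  have i2: "integrable M (\<lambda>\<omega>. if \<forall>i\<in>S. B i \<omega> then \<Phi> {i \<in> J. B i \<omega>} else 0)"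
    by (rule pattern_integrable) (use assms in auto)
  have i3: "integrable M (\<lambda>\<omega>. if \<forall>i\<in>insert j S. B i \<omega> then \<Phi> {i \<in> J. B i \<omega>} else 0)"
    by (rule pattern_integrable) (use assms in auto)
  have eq: "(if \<forall>i\<in>S. B i \<omega> then \<Phi> {i \<in> insert j J. B i \<omega>} else 0) =
    (if \<forall>i\<in>insert j S. B i \<omega> then \<Phi> (insert j {i \<in> J. B i \<omega>}) else 0) +
    (if \<forall>i\<in>S. B i \<omega> then \<Phi> {i \<in> J. B i \<omega>} else 0) -
    (if \<forall>i\<in>insert j S. B i \<omega> then \<Phi> {i \<in> J. B i \<omega>} else 0)" for \<omega>
  proof -
    have "{i \<in> insert j J. B i \<omega>} = (if B j \<omega> then insert j {i \<in> J. B i \<omega>} else {i \<in> J. B i \<omega>})"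
      by auto
    then show ?thesis by auto
  qed
  show ?thesis
    unfolding eq Bochner_Integration.integral_diff[OF Bochner_Integration.integrable_add[OF i1 i2] i3]
      Bochner_Integration.integral_add[OF i1 i2] ..
qed

lemma pattern_integral_empty:
  fixes c :: real
  assumes "finite S" "\<And>i. i \<in> S \<Longrightarrow> Measurable.pred K (P i)"
  shows "(\<integral>\<omega>. (if \<forall>i\<in>S. P i \<omega> then c else 0) \<partial>K) = measure K {\<omega> \<in> space K. \<forall>i\<in>S. P i \<omega>} * c"
proof -
  have [measurable]: "Measurable.pred K (\<lambda>\<omega>. \<forall>i\<in>S. P i \<omega>)"
    using assms by (intro pred_intros_finite) auto
  have "(\<integral>\<omega>. (if \<forall>i\<in>S. P i \<omega> then c else 0) \<partial>K) =
      (\<integral>\<omega>. c * indicator {\<omega> \<in> space K. \<forall>i\<in>S. P i \<omega>} \<omega> \<partial>K)"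
    by (intro Bochner_Integration.integral_cong) auto
  also have "\<dots> = measure K {\<omega> \<in> space K. \<forall>i\<in>S. P i \<omega>} * c"
    by (simp add: mult.commute)
  finally show ?thesis .
qed

text \<open>Joint probabilities of all subfamilies determine the law of the random set of events
  that occur. The induction removes one index at a time from \<open>J\<close>, possibly adding it to
  the prescribed set \<open>S\<close>, so both \<open>S\<close> and \<open>\<Phi>\<close> have to be
  general.\<close>

lemma pattern_integral_convergence:
  fixes \<Phi> :: "'i set \<Rightarrow> real"
  assumes M: "prob_space M" and N: "prob_space N" and I: "finite I"
    and B: "\<And>n i. i \<in> I \<Longrightarrow> Measurable.pred M (B n i)" and B': "\<And>i. i \<in> I \<Longrightarrow> Measurable.pred N (B' i)"
    and conv: "\<And>S. S \<subseteq> I \<Longrightarrow> (\<lambda>n. measure M {\<omega> \<in> space M. \<forall>i\<in>S. B n i \<omega>})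
      \<longlonglongrightarrow> measure N {\<omega> \<in> space N. \<forall>i\<in>S. B' i \<omega>}"
  shows "(\<lambda>n. \<integral>\<omega>. \<Phi> {i \<in> I. B n i \<omega>} \<partial>M) \<longlonglongrightarrow> (\<integral>\<omega>. \<Phi> {i \<in> I. B' i \<omega>} \<partial>N)"
proof -
  have "(\<lambda>n. \<integral>\<omega>. (if \<forall>i\<in>S. B n i \<omega> then \<Phi> {i \<in> J. B n i \<omega>} else 0) \<partial>M)
      \<longlonglongrightarrow> (\<integral>\<omega>. (if \<forall>i\<in>S. B' i \<omega> then \<Phi> {i \<in> J. B' i \<omega>} else 0) \<partial>N)"
    if "finite J" "J \<subseteq> I" "S \<subseteq> I" for J S and \<Phi> :: "'i set \<Rightarrow> real"
    using that
  proof (induction J arbitrary: S \<Phi> rule: finite_induct)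
    case empty
    have fS: "finite S" using empty.prems I finite_subset by blast
    have "(\<lambda>n. measure M {\<omega> \<in> space M. \<forall>i\<in>S. B n i \<omega>} * \<Phi> {})
      \<longlonglongrightarrow> measure N {\<omega> \<in> space N. \<forall>i\<in>S. B' i \<omega>} * \<Phi> {}"
      using empty.prems by (intro tendsto_intros conv)
    moreover have "(\<integral>\<omega>. (if \<forall>i\<in>S. B n i \<omega> then \<Phi> {} else 0) \<partial>M) =
        measure M {\<omega> \<in> space M. \<forall>i\<in>S. B n i \<omega>} * \<Phi> {}" for n
      using B empty.prems by (intro pattern_integral_empty fS) auto
    moreover have "(\<integral>\<omega>. (if \<forall>i\<in>S. B' i \<omega> then \<Phi> {} else 0) \<partial>N) =
        measure N {\<omega> \<in> space N. \<forall>i\<in>S. B' i \<omega>} * \<Phi> {}"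
      using B' empty.prems by (intro pattern_integral_empty fS) auto
    moreover have "{i \<in> ({} :: 'i set). P i} = {}" for P by simp
    ultimately show ?case by presburger
  next
    case (insert j J)
    have fS: "finite S" using insert.prems I finite_subset by blast
    have "(\<lambda>n. (\<integral>\<omega>. (if \<forall>i\<in>insert j S. B n i \<omega> then \<Phi> (insert j {i \<in> J. B n i \<omega>}) else 0) \<partial>M) +
        (\<integral>\<omega>. (if \<forall>i\<in>S. B n i \<omega> then \<Phi> {i \<in> J. B n i \<omega>} else 0) \<partial>M) -
        (\<integral>\<omega>. (if \<forall>i\<in>insert j S. B n i \<omega> then \<Phi> {i \<in> J. B n i \<omega>} else 0) \<partial>M))
      \<longlonglongrightarrow> (\<integral>\<omega>. (if \<forall>i\<in>insert j S. B' i \<omega> then \<Phi> (insert j {i \<in> J. B' i \<omega>}) else 0) \<partial>N) +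
        (\<integral>\<omega>. (if \<forall>i\<in>S. B' i \<omega> then \<Phi> {i \<in> J. B' i \<omega>} else 0) \<partial>N) -
        (\<integral>\<omega>. (if \<forall>i\<in>insert j S. B' i \<omega> then \<Phi> {i \<in> J. B' i \<omega>} else 0) \<partial>N)"
      using insert.prems insert.IH[of "insert j S" "\<lambda>T. \<Phi> (insert j T)"] insert.IH[of "insert j S" \<Phi>]
        insert.IH[of S \<Phi>] by (intro tendsto_intros) auto
    moreover have "(\<integral>\<omega>. (if \<forall>i\<in>S. B n i \<omega> then \<Phi> {i \<in> insert j J. B n i \<omega>} else 0) \<partial>M) =
      (\<integral>\<omega>. (if \<forall>i\<in>insert j S. B n i \<omega> then \<Phi> (insert j {i \<in> J. B n i \<omega>}) else 0) \<partial>M) +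
      (\<integral>\<omega>. (if \<forall>i\<in>S. B n i \<omega> then \<Phi> {i \<in> J. B n i \<omega>} else 0) \<partial>M) -
      (\<integral>\<omega>. (if \<forall>i\<in>insert j S. B n i \<omega> then \<Phi> {i \<in> J. B n i \<omega>} else 0) \<partial>M)" for n
      by (rule pattern_integral_insert[OF M insert.hyps(1) fS]) (use insert.prems B in auto)
    moreover have "(\<integral>\<omega>. (if \<forall>i\<in>S. B' i \<omega> then \<Phi> {i \<in> insert j J. B' i \<omega>} else 0) \<partial>N) =
      (\<integral>\<omega>. (if \<forall>i\<in>insert j S. B' i \<omega> then \<Phi> (insert j {i \<in> J. B' i \<omega>}) else 0) \<partial>N) +
      (\<integral>\<omega>. (if \<forall>i\<in>S. B' i \<omega> then \<Phi> {i \<in> J. B' i \<omega>} else 0) \<partial>N) -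
      (\<integral>\<omega>. (if \<forall>i\<in>insert j S. B' i \<omega> then \<Phi> {i \<in> J. B' i \<omega>} else 0) \<partial>N)"
      by (rule pattern_integral_insert[OF N insert.hyps(1) fS]) (use insert.prems B' in auto)
    ultimately show ?case by presburger
  qed
  from this[of I "{}" \<Phi>] I show ?thesis by simp
qed

text \<open>Levels run up to \<open>m\<^sup>2 / m = m\<close>, so mesh and range of the grid improve
  together. They start at \<open>1 / m\<close>, so negative values are rounded to 0.\<close>

definition grid_pattern :: "nat \<Rightarrow> (real \<Rightarrow> real) \<Rightarrow> (nat \<times> nat) set" where
  "grid_pattern m x = {v \<in> {..m} \<times> {1..m\<^sup>2}. x (real (fst v) / real m) \<le> real (snd v) / real m}"

text \<open>Rebuilds a path from the events alone, so that every functional of the discretised path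
  is a function of a finite pattern. The complement is counted because it consists of the levels
  strictly below the path.\<close>

definition grid_path :: "nat \<Rightarrow> (nat \<times> nat) set \<Rightarrow> real \<Rightarrow> real" where
  "grid_path m T = step_path m (\<lambda>j. real (card {i \<in> {1..m\<^sup>2}. (j, i) \<notin> T}) / real m)"

definition grid_round :: "nat \<Rightarrow> real \<Rightarrow> real" where
  "grid_round m v = real (card {i \<in> {1..m\<^sup>2}. real i / real m < v}) / real m"

text \<open>The count is \<open>nat \<lceil>real m * v\<rceil> - 1\<close> with truncated
  subtraction, so slightly negative values round to 0. The tolerance \<open>- (1 / real m)\<close>
  serves the maxima process, whose initial value \<open>X 1 / a n\<close> may be negative.\<close>

lemma grid_round_error:
  assumes m: "m > 0" and v: "- (1 / real m) \<le> v" "v \<le> real m"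
  shows "\<bar>grid_round m v - v\<bar> \<le> 1 / real m"
proof -
  have "{i \<in> {1..m\<^sup>2}. real i / real m < v} = {1..<nat \<lceil>real m * v\<rceil>}"
  proof -
    have "i \<le> m\<^sup>2" if "real i < real m * v" for i
    proof -
      have "real i < real m * real m" using that v m by (smt (verit) mult_left_mono of_nat_0_le_iff)
      then show ?thesis by (metis less_imp_le_nat of_nat_less_iff of_nat_mult power2_eq_square)
    qed
    moreover have "real i / real m < v \<longleftrightarrow> i < nat \<lceil>real m * v\<rceil>" for i
    proof -
      have "real i / real m < v \<longleftrightarrow> real i < real m * v" using m by (simp add: pos_divide_less_eq mult.commute)
      also have "\<dots> \<longleftrightarrow> int i < \<lceil>real m * v\<rceil>" by (metis less_ceiling_iff of_int_of_nat_eq)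
      also have "\<dots> \<longleftrightarrow> i < nat \<lceil>real m * v\<rceil>" by linarith
      finally show ?thesis .
    qed
    ultimately show ?thesis
      using m by (auto simp: pos_divide_less_eq mult.commute)
  qed
  then have r: "grid_round m v = real (nat \<lceil>real m * v\<rceil> - 1) / real m"
    by (simp add: grid_round_def)
  have "- 1 \<le> real m * v" using v m by (simp add: field_simps)
  then have "\<bar>real (nat \<lceil>real m * v\<rceil> - 1) - real m * v\<bar> \<le> 1" by linarith
  moreover have "grid_round m v - v = (real (nat \<lceil>real m * v\<rceil> - 1) - real m * v) / real m"
    using m by (simp add: r field_simps)
  ultimately show ?thesis using m by (simp add: divide_right_mono)
qed

lemma grid_path_eval:
  assumes "m > 0" "0 \<le> t" "t \<le> 1"
  shows "grid_path m (grid_pattern m x) t = grid_round m (x (real (nat \<lfloor>real m * t\<rfloor>) / real m))"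
proof -
  have "real m * t \<le> real m" using assms by (simp add: mult_left_le)
  then have "nat \<lfloor>real m * t\<rfloor> \<le> m" by linarith
  then have "{i \<in> {1..m\<^sup>2}. (nat \<lfloor>real m * t\<rfloor>, i) \<notin> grid_pattern m x} =
    {i \<in> {1..m\<^sup>2}. real i / real m < x (real (nat \<lfloor>real m * t\<rfloor>) / real m)}"
    by (auto simp: grid_pattern_def)
  then show ?thesis using assms by (simp add: grid_path_def step_path_def grid_round_def)
qed

lemma grid_path_mono_paths:
  assumes x: "x \<in> mono_paths" and m: "m > 0"
  shows "grid_path m (grid_pattern m x) \<in> mono_paths"
  unfolding grid_path_def
proof (rule step_path_mono_paths)
  fix i j assume ij: "i \<le> j" "j \<le> m"
  then have "x (real i / real m) \<le> x (real j / real m)"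
    using m by (intro mono_paths_le[OF x]) (auto simp: divide_right_mono)
  then have "{k \<in> {1..m\<^sup>2}. (i, k) \<notin> grid_pattern m x} \<subseteq> {k \<in> {1..m\<^sup>2}. (j, k) \<notin> grid_pattern m x}"
    using ij by (auto simp: grid_pattern_def)
  then show "real (card {k \<in> {1..m\<^sup>2}. (i, k) \<notin> grid_pattern m x}) / real m
      \<le> real (card {k \<in> {1..m\<^sup>2}. (j, k) \<notin> grid_pattern m x}) / real m"
    by (intro divide_right_mono of_nat_mono card_mono) auto
qed

text \<open>Looking back to the last grid time makes the grid path lag by at most
  \<open>1 / m\<close>; a shift of that length in time, plus the rounding error, restores both
  inequalities.\<close>

lemma mono_dist_grid_path:
  assumes x: "x \<in> mono_paths" and m: "m > 0" and "- (1 / real m) \<le> x 0" "x 1 \<le> real m"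
  shows "mono_dist x (grid_path m (grid_pattern m x)) \<le> 3 / real m"
proof -
  let ?g = "grid_path m (grid_pattern m x)"
  have err: "\<bar>grid_round m (x t) - x t\<bar> \<le> 1 / real m" if "0 \<le> t" "t \<le> 1" for t
    using mono_paths_le[OF x, of 0 t] mono_paths_le[OF x, of t 1] that assms
    by (intro grid_round_error) auto
  have fl: "0 \<le> real (nat \<lfloor>real m * t\<rfloor>) / real m" "real (nat \<lfloor>real m * t\<rfloor>) / real m \<le> t" if "0 \<le> t" for t
    using that m by (auto simp: pos_divide_le_eq mult.commute)
  have "mono_dist x ?g \<le> 3 * (1 / real m)"
  proof (rule mono_dist_le[OF x grid_path_mono_paths[OF x m]])
    show "\<bar>x 0 - ?g 0\<bar> \<le> 1 / real m" using err[of 0] grid_path_eval[OF m, of 0 x] by simp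
    show "\<bar>x 1 - ?g 1\<bar> \<le> 1 / real m" using err[of 1] grid_path_eval[OF m, of 1 x] m by simp
  next
    fix t assume t: "0 \<le> t" "t + 1 / real m < 1"
    let ?u = "real (nat \<lfloor>real m * (t + 1 / real m)\<rfloor>) / real m"
    \<comment> \<open>After a shift by one mesh the last grid time is not earlier than
      \<open>t\<close>.\<close>
    have "real m * (t + 1 / real m) = real m * t + 1" using m by (simp add: field_simps)
    then have "real m * t \<le> real (nat \<lfloor>real m * (t + 1 / real m)\<rfloor>)" using t by linarith
    then have tu: "t \<le> ?u" using m by (simp add: pos_le_divide_eq mult.commute)
    have "?u \<le> t + 1 / real m" using t by (intro fl) auto
    then have u1: "?u \<le> 1" using t by linarith
    have "x t \<le> x ?u" using t tu u1 by (intro mono_paths_le[OF x])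
    also have "\<dots> \<le> grid_round m (x ?u) + 1 / real m" using err[of ?u] tu t u1 by linarith
    also have "grid_round m (x ?u) = ?g (t + 1 / real m)"
      using t m by (subst grid_path_eval[OF m]) auto
    finally show "x t \<le> ?g (t + 1 / real m) + 1 / real m" .
  next
    fix t assume t: "0 \<le> t" "t + 1 / real m < 1"
    let ?u = "real (nat \<lfloor>real m * t\<rfloor>) / real m"
    have t1: "t \<le> t + 1 / real m" by simp
    have "?g t = grid_round m (x ?u)" using t t1 by (intro grid_path_eval[OF m]) linarith+
    also have "\<dots> \<le> x ?u + 1 / real m" using err[of ?u] fl[of t] t t1 by linarith
    also have "x ?u \<le> x (t + 1 / real m)" using fl[of t] t t1 by (intro mono_paths_le[OF x]) linarith+
    finally show "?g t \<le> x (t + 1 / real m) + 1 / real m" by simp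
  qed simp
  then show ?thesis by simp
qed

text \<open>The Pasch-Hausdorff envelope of \<open>F\<close> for \<open>mono_dist\<close>: on
  monotone paths the largest minorant that is Lipschitz with constant \<open>k\<close>.\<close>

definition lipschitz_minorant :: "((real \<Rightarrow> real) \<Rightarrow> real) \<Rightarrow> real \<Rightarrow> (real \<Rightarrow> real) \<Rightarrow> real" where
  "lipschitz_minorant F k x = (INF y\<in>mono_paths. F y + k * mono_dist x y)"

context
  fixes F :: "(real \<Rightarrow> real) \<Rightarrow> real" and C k :: real
  assumes bound: "\<And>y. y \<in> mono_paths \<Longrightarrow> \<bar>F y\<bar> \<le> C" and k: "0 \<le> k"
begin

lemma lipschitz_minorant_bdd: "bdd_below ((\<lambda>y. F y + k * mono_dist x y) ` mono_paths)"
proof (rule bdd_belowI2[of _ "- C"])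
  fix y assume "y \<in> mono_paths"
  then show "- C \<le> F y + k * mono_dist x y"
    using bound[of y] mult_nonneg_nonneg[OF k mono_dist_nonneg[of x y]] by linarith
qed

lemma lipschitz_minorant_lower: "y \<in> mono_paths \<Longrightarrow> lipschitz_minorant F k x \<le> F y + k * mono_dist x y"
  unfolding lipschitz_minorant_def by (rule cINF_lower[OF lipschitz_minorant_bdd])

lemma lipschitz_minorant_le: "x \<in> mono_paths \<Longrightarrow> lipschitz_minorant F k x \<le> F x"
  using lipschitz_minorant_lower[of x x] by (simp add: mono_dist_def)

lemma lipschitz_minorant_greatest:
  "x \<in> mono_paths \<Longrightarrow> (\<And>y. y \<in> mono_paths \<Longrightarrow> z \<le> F y + k * mono_dist x y) \<Longrightarrow> z \<le> lipschitz_minorant F k x"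
  unfolding lipschitz_minorant_def by (rule cINF_greatest) auto

lemma lipschitz_minorant_lipschitz:
  assumes "x \<in> mono_paths"
  shows "lipschitz_minorant F k y \<le> lipschitz_minorant F k x + k * mono_dist x y"
proof -
  have "lipschitz_minorant F k y - k * mono_dist x y \<le> lipschitz_minorant F k x"
  proof (rule lipschitz_minorant_greatest[OF assms])
    fix z assume z: "z \<in> mono_paths"
    have "k * mono_dist y z \<le> k * (mono_dist x y + mono_dist x z)"
      using mono_dist_triangle[of y z x] k by (intro mult_left_mono) (auto simp: mono_dist_commute)
    then show "lipschitz_minorant F k y - k * mono_dist x y \<le> F z + k * mono_dist x z"
      using lipschitz_minorant_lower[OF z, of y] by (simp add: algebra_simps)
  qed
  then show ?thesis by simp
qed

end

text \<open>Continuity transfers from M1 to \<open>mono_dist\<close>, since the latter controls the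
  M1 distance up to the factor 2.\<close>

lemma M1_continuous_on_mono_paths:
  assumes F: "continuous_map M1_topology euclideanreal F" and x: "x \<in> mono_paths" and e: "0 < e"
  shows "\<exists>d>0. \<forall>y\<in>mono_paths. mono_dist x y < d \<longrightarrow> \<bar>F y - F x\<bar> < e"
proof -
  have xc: "x \<in> cadlag_space" using x by (simp add: mono_paths_def)
  have "openin M1_topology {y \<in> topspace M1_topology. F y \<in> ball (F x) e}"
    using F by (rule openin_continuous_map_preimage) simp
  then obtain d where d: "d > 0" "\<And>y. y \<in> cadlag_space \<Longrightarrow> dist_M1 x y < d \<Longrightarrow> F y \<in> ball (F x) e"
    using xc e unfolding M1_topology_def openin_induced_topology topspace_induced_topology by force
  have "\<bar>F y - F x\<bar> < e" if y: "y \<in> mono_paths" "mono_dist x y < d / 2" for y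
  proof -
    have "dist_M1 x y < d" using dist_M1_le_mono_dist[OF x y(1)] y(2) by simp
    then show ?thesis using d(2)[of y] y by (auto simp: mono_paths_def dist_real_def)
  qed
  then show ?thesis using d(1) by (intro exI[of _ "d / 2"]) auto
qed

text \<open>With constant \<open>sqrt m\<close> the grid error costs at most
  \<open>3 / sqrt m\<close>, while the penalty for leaving a fixed ball around \<open>x\<close>
  eventually exceeds \<open>2 * C\<close>, the largest possible gain. Inside the ball continuity of
  \<open>F\<close> at \<open>x\<close> decides.\<close>

lemma lipschitz_minorant_grid_tendsto:
  assumes F: "continuous_map M1_topology euclideanreal F"
    and bound: "\<And>y. y \<in> mono_paths \<Longrightarrow> \<bar>F y\<bar> \<le> C"
    and x: "x \<in> mono_paths" "0 \<le> x 0"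
  shows "(\<lambda>m. lipschitz_minorant F (sqrt (real m)) (grid_path m (grid_pattern m x))) \<longlonglongrightarrow> F x"
proof (rule LIMSEQ_I)
  fix e :: real assume e: "0 < e"
  obtain d where d: "d > 0" "\<And>y. y \<in> mono_paths \<Longrightarrow> mono_dist x y < d \<Longrightarrow> \<bar>F y - F x\<bar> < e / 2"
    using M1_continuous_on_mono_paths[OF F x(1), of "e / 2"] e by auto
  have "eventually (\<lambda>m. real m \<ge> max 1 (x 1)) sequentially"
    using eventually_ge_at_top[of "nat \<lceil>max 1 (x 1)\<rceil>"] by eventually_elim linarith
  moreover have "eventually (\<lambda>m. 3 / real m < d) sequentially"
    using d(1) by real_asymp
  moreover have "eventually (\<lambda>m. 3 / sqrt (real m) < e / 2) sequentially"
    using e by real_asymp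
  moreover have "eventually (\<lambda>m. 2 * C \<le> sqrt (real m) * d) sequentially"
    using d(1) by real_asymp
  ultimately have "eventually (\<lambda>m. norm (lipschitz_minorant F (sqrt (real m))
      (grid_path m (grid_pattern m x)) - F x) < e) sequentially"
  proof eventually_elim
    case (elim m)
    let ?g = "grid_path m (grid_pattern m x)" and ?k = "sqrt (real m)"
    have m: "m > 0" using elim(1) by (auto intro: Nat.gr0I)
    have g: "?g \<in> mono_paths" using x(1) m by (rule grid_path_mono_paths)
    have k: "0 \<le> ?k" by simp
    have dist: "mono_dist x ?g \<le> 3 / real m"
      using elim(1) m x by (intro mono_dist_grid_path) (auto intro: order_trans[of _ 0])
    have "lipschitz_minorant F ?k ?g \<le> F ?g" by (rule lipschitz_minorant_le[OF bound k g])
    also have "\<bar>F ?g - F x\<bar> < e / 2" using dist elim(2) by (intro d(2)[OF g]) linarith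
    then have "F ?g < F x + e" using e by linarith
    finally have upper: "lipschitz_minorant F ?k ?g < F x + e" .
    have "F x - e / 2 \<le> lipschitz_minorant F ?k x"
    proof (rule lipschitz_minorant_greatest[OF bound k x(1)])
      fix y assume y: "y \<in> mono_paths"
      show "F x - e / 2 \<le> F y + ?k * mono_dist x y"
      proof (cases "mono_dist x y < d")
        case True
        have "0 \<le> ?k * mono_dist x y" using k mono_dist_nonneg by (rule mult_nonneg_nonneg)
        then show ?thesis using d(2)[OF y True] by linarith
      next
        case False
        then have "2 * C \<le> ?k * mono_dist x y"
          using elim(4) mult_left_mono[of d "mono_dist x y" ?k] k by linarith
        then show ?thesis using bound[OF y] bound[OF x(1)] e by linarith
      qed
    qed
    also have "\<dots> \<le> lipschitz_minorant F ?k ?g + ?k * mono_dist ?g x"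
      by (rule lipschitz_minorant_lipschitz[OF bound k g])
    also have "?k * mono_dist ?g x \<le> ?k * (3 / real m)"
      using dist k by (intro mult_left_mono) (auto simp: mono_dist_commute)
    also have "?k * (3 / real m) = 3 / ?k"
      using m by (simp add: field_simps flip: power2_eq_square)
    finally have "F x - e < lipschitz_minorant F ?k ?g" using elim(3) by simp
    then show ?case using upper by auto
  qed
  then show "\<exists>no. \<forall>n\<ge>no. norm (lipschitz_minorant F (sqrt (real n))
      (grid_path n (grid_pattern n x)) - F x) < e"
    by (simp add: eventually_sequentially)
qed

section \<open>Weak convergence in M1 from grid events\<close>

lemma space_borel_of: "space (borel_of T) = topspace T"
  unfolding borel_of_def by (rule space_measure_of) (auto dest: openin_subset)

lemma continuous_map_measurable_borel_of:
  assumes "continuous_map T euclideanreal F"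
  shows "F \<in> borel_measurable (borel_of T)"
proof (rule borel_measurableI)
  fix S :: "real set" assume "open S"
  then have "openin T {x \<in> topspace T. F x \<in> S}"
    using assms by (intro openin_continuous_map_preimage) auto
  moreover have "F -` S \<inter> space (borel_of T) = {x \<in> topspace T. F x \<in> S}"
    by (auto simp: space_borel_of)
  moreover have "{U. openin T U} \<subseteq> Pow (topspace T)" using openin_subset by auto
  ultimately show "F -` S \<inter> space (borel_of T) \<in> sets (borel_of T)"
    by (simp add: borel_of_def)
qed

lemma topspace_M1: "topspace M1_topology = cadlag_space"
  by (simp add: M1_topology_def topspace_induced_topology)

text \<open>Grid levels are at least \<open>1 / m\<close>, so grid events cannot see a negative
  start of \<open>V\<close>; \<open>V_start\<close> rules it out asymptotically. Monotonicity of
  \<open>W\<close> is asked almost surely, since it will be derived from the law of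
  \<open>W\<close>.\<close>

locale mono_fidi_convergence =
  M: prob_space M + N: prob_space N for M :: "'a measure" and N :: "'b measure" +
  fixes V :: "nat \<Rightarrow> 'a \<Rightarrow> real \<Rightarrow> real" and W :: "'b \<Rightarrow> real \<Rightarrow> real"
  assumes V_measurable: "\<And>n. V n \<in> measurable M (borel_of M1_topology)"
    and W_measurable: "W \<in> measurable N (borel_of M1_topology)"
    and V_coord: "\<And>n t. t \<in> {0..1} \<Longrightarrow> (\<lambda>\<omega>. V n \<omega> t) \<in> borel_measurable M"
    and W_coord: "\<And>t. t \<in> {0..1} \<Longrightarrow> (\<lambda>\<omega>. W \<omega> t) \<in> borel_measurable N"
    and V_mono: "\<And>n \<omega>. \<omega> \<in> space M \<Longrightarrow> V n \<omega> \<in> mono_paths"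
    and W_mono: "AE \<omega> in N. W \<omega> \<in> mono_paths \<and> 0 \<le> W \<omega> 0"
    and V_start: "\<And>e. e > 0 \<Longrightarrow> (\<lambda>n. measure M {\<omega> \<in> space M. V n \<omega> 0 < - e}) \<longlonglongrightarrow> 0"
    and fidi: "\<And>m S. m > 0 \<Longrightarrow> S \<subseteq> {..m} \<times> {1..m\<^sup>2} \<Longrightarrow>
      (\<lambda>n. measure M {\<omega> \<in> space M. \<forall>v\<in>S. V n \<omega> (real (fst v) / real m) \<le> real (snd v) / real m})
      \<longlonglongrightarrow> measure N {\<omega> \<in> space N. \<forall>v\<in>S. W \<omega> (real (fst v) / real m) \<le> real (snd v) / real m}"
begin

lemma grid_time: "m > 0 \<Longrightarrow> v \<in> {..m} \<times> A \<Longrightarrow> real (fst v) / real m \<in> {0..1}"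
  by auto

text \<open>The grid size \<open>m\<close> is chosen from \<open>W\<close> alone; then
  \<open>n\<close> tends to infinity with \<open>m\<close> fixed, and only finitely many events
  matter. Unless \<open>V\<close> leaves the range of the grid, the discretised minorant exceeds
  \<open>F\<close> by at most \<open>3 / sqrt m\<close>.\<close>

lemma integral_liminf:
  assumes F: "continuous_map M1_topology euclideanreal F"
    and bound: "\<And>y. y \<in> cadlag_space \<Longrightarrow> \<bar>F y\<bar> \<le> C" and \<epsilon>: "\<epsilon> > 0"
  shows "eventually (\<lambda>n. (\<integral>\<omega>. F (W \<omega>) \<partial>N) - \<epsilon> < (\<integral>\<omega>. F (V n \<omega>) \<partial>M)) sequentially"
proof -
  have bound': "\<bar>F y\<bar> \<le> C" if "y \<in> mono_paths" for y using that bound by (simp add: mono_paths_def)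
  obtain \<omega>0 where "\<omega>0 \<in> space M" using M.not_empty by blast
  then have C0: "0 \<le> C" using bound'[OF V_mono, of \<omega>0] by (meson abs_ge_zero order_trans)
  \<comment> \<open>The minorant is cut at \<open>- C\<close>, which keeps its absolute value below
    \<open>C\<close> on grid patterns of monotone paths.\<close>
  define \<Phi> where "\<Phi> m = (\<lambda>T. max (- C) (lipschitz_minorant F (sqrt (real m)) (grid_path m T)))" for m
  have W1: "(\<lambda>m. measure N {\<omega> \<in> space N. W \<omega> 1 > real m}) \<longlonglongrightarrow> 0"
  proof -
    have [measurable]: "(\<lambda>\<omega>. W \<omega> 1) \<in> borel_measurable N" by (rule W_coord) simp
    have "(\<lambda>m. measure N {\<omega> \<in> space N. W \<omega> 1 > real m}) \<longlonglongrightarrow> measure N (\<Inter>m. {\<omega> \<in> space N. W \<omega> 1 > real m})"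
    proof (rule N.finite_Lim_measure_decseq)
      show "range (\<lambda>m. {\<omega> \<in> space N. real m < W \<omega> 1}) \<subseteq> sets N" by auto
      show "decseq (\<lambda>m. {\<omega> \<in> space N. real m < W \<omega> 1})"
        by (rule decseq_SucI) auto
    qed
    moreover have False if "\<forall>m. real m < W \<omega> 1" for \<omega>
      using reals_Archimedean2[of "W \<omega> 1"] that less_asym by blast
    then have "(\<Inter>m. {\<omega> \<in> space N. W \<omega> 1 > real m}) = {}" by auto
    ultimately show ?thesis by simp
  qed
  have \<Phi>_bound: "\<bar>\<Phi> m (grid_pattern m x)\<bar> \<le> C" if "m > 0" "x \<in> mono_paths" for m x
    using lipschitz_minorant_le[where F = F and k = "sqrt (real m)" and x = "grid_path m (grid_pattern m x)", OF bound']
      bound'[OF grid_path_mono_paths[OF that(2,1)]] grid_path_mono_paths[OF that(2,1)] C0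
    by (auto simp: \<Phi>_def)
  have \<Phi>_measurable: "(\<lambda>\<omega>. \<Phi> m (grid_pattern m (X \<omega>))) \<in> borel_measurable K"
    if "m > 0" "\<And>t. t \<in> {0..1} \<Longrightarrow> (\<lambda>\<omega>. X \<omega> t) \<in> borel_measurable K" for m K and X :: "'x \<Rightarrow> real \<Rightarrow> real"
    unfolding grid_pattern_def
  proof (rule pattern_measurable)
    fix v assume "v \<in> {..m} \<times> {1..m\<^sup>2}"
    then have "(\<lambda>\<omega>. X \<omega> (real (fst v) / real m)) \<in> borel_measurable K"
      using that grid_time by blast
    then show "Measurable.pred K (\<lambda>\<omega>. X \<omega> (real (fst v) / real m) \<le> real (snd v) / real m)"
      by measurable
  qed simp
  have F_W: "(\<lambda>\<omega>. F (W \<omega>)) \<in> borel_measurable N"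
    using measurable_compose[OF W_measurable continuous_map_measurable_borel_of[OF F]] .
  have F_V: "(\<lambda>\<omega>. F (V n \<omega>)) \<in> borel_measurable M" for n
    using measurable_compose[OF V_measurable continuous_map_measurable_borel_of[OF F]] .
  \<comment> \<open>\<open>Suc m\<close> avoids the degenerate grid with
    \<open>m = 0\<close>.\<close>
  have W_lim: "(\<lambda>m. \<integral>\<omega>. \<Phi> (Suc m) (grid_pattern (Suc m) (W \<omega>)) \<partial>N) \<longlonglongrightarrow> (\<integral>\<omega>. F (W \<omega>) \<partial>N)"
  proof (rule integral_dominated_convergence[where w = "\<lambda>_. C"])
    show "AE \<omega> in N. (\<lambda>m. \<Phi> (Suc m) (grid_pattern (Suc m) (W \<omega>))) \<longlonglongrightarrow> F (W \<omega>)"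
      using W_mono
    proof eventually_elim
      case (elim \<omega>)
      have "(\<lambda>m. \<Phi> m (grid_pattern m (W \<omega>))) \<longlonglongrightarrow> max (- C) (F (W \<omega>))"
        unfolding \<Phi>_def using elim
        by (intro tendsto_max tendsto_const lipschitz_minorant_grid_tendsto[OF F bound']) auto
      moreover have "max (- C) (F (W \<omega>)) = F (W \<omega>)" using bound'[of "W \<omega>"] elim by auto
      ultimately have "(\<lambda>m. \<Phi> m (grid_pattern m (W \<omega>))) \<longlonglongrightarrow> F (W \<omega>)" by (simp only:)
      then show ?case by (rule LIMSEQ_Suc)
    qed
    show "AE \<omega> in N. norm (\<Phi> (Suc m) (grid_pattern (Suc m) (W \<omega>))) \<le> C" for m
      using W_mono by eventually_elim (use \<Phi>_bound in auto)
  qed (auto intro: F_W \<Phi>_measurable W_coord)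
  have "(\<lambda>m. (\<integral>\<omega>. \<Phi> (Suc m) (grid_pattern (Suc m) (W \<omega>)) \<partial>N) - 3 / sqrt (real (Suc m))
      - 2 * C * measure N {\<omega> \<in> space N. W \<omega> 1 > real (Suc m)}) \<longlonglongrightarrow> (\<integral>\<omega>. F (W \<omega>) \<partial>N) - 0 - 2 * C * 0"
    using W_lim LIMSEQ_Suc[OF W1]
    by (intro tendsto_diff tendsto_mult tendsto_const) (auto, real_asymp)
  then have "eventually (\<lambda>m. (\<integral>\<omega>. F (W \<omega>) \<partial>N) - \<epsilon> <
      (\<integral>\<omega>. \<Phi> (Suc m) (grid_pattern (Suc m) (W \<omega>)) \<partial>N) - 3 / sqrt (real (Suc m))
      - 2 * C * measure N {\<omega> \<in> space N. W \<omega> 1 > real (Suc m)}) sequentially"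
    using \<epsilon> by (intro order_tendstoD(1)) auto
  then obtain m' where "(\<integral>\<omega>. F (W \<omega>) \<partial>N) - \<epsilon> <
      (\<integral>\<omega>. \<Phi> (Suc m') (grid_pattern (Suc m') (W \<omega>)) \<partial>N) - 3 / sqrt (real (Suc m'))
      - 2 * C * measure N {\<omega> \<in> space N. W \<omega> 1 > real (Suc m')}"
    by (auto simp: eventually_sequentially)
  moreover define m where "m = Suc m'"
  ultimately have m: "m > 0" and lim: "(\<integral>\<omega>. F (W \<omega>) \<partial>N) - \<epsilon> <
      (\<integral>\<omega>. \<Phi> m (grid_pattern m (W \<omega>)) \<partial>N) - 3 / sqrt (real m)
      - 2 * C * measure N {\<omega> \<in> space N. W \<omega> 1 > real m}"
    by simp_all
  have \<Phi>_lim: "(\<lambda>n. \<integral>\<omega>. \<Phi> m (grid_pattern m (V n \<omega>)) \<partial>M) \<longlonglongrightarrow> (\<integral>\<omega>. \<Phi> m (grid_pattern m (W \<omega>)) \<partial>N)"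
    unfolding grid_pattern_def
  proof (rule pattern_integral_convergence)
    fix v n assume "v \<in> {..m} \<times> {1..m\<^sup>2}"
    then have t: "real (fst v) / real m \<in> {0..1}" using m grid_time by blast
    show "Measurable.pred M (\<lambda>\<omega>. V n \<omega> (real (fst v) / real m) \<le> real (snd v) / real m)"
      using V_coord[OF t] by measurable
    show "Measurable.pred N (\<lambda>\<omega>. W \<omega> (real (fst v) / real m) \<le> real (snd v) / real m)"
      using W_coord[OF t] by measurable
  qed (use fidi[OF m] in \<open>auto intro: M.prob_space_axioms N.prob_space_axioms\<close>)
  have top_compl: "measure K {\<omega> \<in> space K. X \<omega> > real m} = 1 - measure K {\<omega> \<in> space K. X \<omega> \<le> real m}"
    if "X \<in> borel_measurable K" "prob_space K" for K and X :: "'x \<Rightarrow> real"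
  proof -
    have "{\<omega> \<in> space K. X \<omega> > real m} = space K - {\<omega> \<in> space K. X \<omega> \<le> real m}" by auto
    then show ?thesis using that by (simp add: prob_space.prob_compl)
  qed
  \<comment> \<open>The complement is the single grid event at time \<open>m / m = 1\<close> and
    level \<open>m\<^sup>2 / m = m\<close>.\<close>
  have V1_lim: "(\<lambda>n. measure M {\<omega> \<in> space M. V n \<omega> 1 > real m}) \<longlonglongrightarrow> measure N {\<omega> \<in> space N. W \<omega> 1 > real m}"
  proof -
    have "(\<lambda>n. measure M {\<omega> \<in> space M. V n \<omega> 1 \<le> real m}) \<longlonglongrightarrow> measure N {\<omega> \<in> space N. W \<omega> 1 \<le> real m}"
      using fidi[OF m, of "{(m, m\<^sup>2)}"] m by (simp add: power2_eq_square)
    then show ?thesis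
      using V_coord[of 1] W_coord[of 1] M.prob_space_axioms N.prob_space_axioms
      by (simp add: top_compl tendsto_diff)
  qed
  \<comment> \<open>The two ways to leave the range in which rounding is accurate; there the
    integrands differ by at most \<open>2 * C\<close>.\<close>
  let ?bad = "\<lambda>n. measure M {\<omega> \<in> space M. V n \<omega> 0 < - (1 / real m)} + measure M {\<omega> \<in> space M. V n \<omega> 1 > real m}"
  have lower: "(\<integral>\<omega>. \<Phi> m (grid_pattern m (V n \<omega>)) \<partial>M) - 3 / sqrt (real m) - 2 * C * ?bad n
      \<le> (\<integral>\<omega>. F (V n \<omega>) \<partial>M)" for n
  proof -
    have [measurable]: "(\<lambda>\<omega>. V n \<omega> 0) \<in> borel_measurable M" "(\<lambda>\<omega>. V n \<omega> 1) \<in> borel_measurable M"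
      using V_coord by auto
    let ?A = "{\<omega> \<in> space M. V n \<omega> 0 < - (1 / real m)}" and ?B = "{\<omega> \<in> space M. V n \<omega> 1 > real m}"
    have iF: "integrable M (\<lambda>\<omega>. F (V n \<omega>))"
      by (rule M.integrable_const_bound[of _ C]) (use F_V bound' V_mono in auto)
    have i\<Phi>: "integrable M (\<lambda>\<omega>. \<Phi> m (grid_pattern m (V n \<omega>)))"
      by (rule M.integrable_const_bound[of _ C])
        (use \<Phi>_bound[OF m] V_mono \<Phi>_measurable[OF m V_coord] in auto)
    have iA: "integrable M (indicator ?A :: 'a \<Rightarrow> real)" "integrable M (indicator ?B :: 'a \<Rightarrow> real)"
      by (auto simp: M.emeasure_eq_measure)
    have "(\<integral>\<omega>. \<Phi> m (grid_pattern m (V n \<omega>)) - 3 / sqrt (real m) - 2 * C * (indicator ?A \<omega> + indicator ?B \<omega>) \<partial>M)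
      \<le> (\<integral>\<omega>. F (V n \<omega>) \<partial>M)"
    proof (rule integral_mono)
      fix \<omega> assume \<omega>: "\<omega> \<in> space M"
      note x = V_mono[OF \<omega>, of n]
      have s3: "0 \<le> 3 / sqrt (real m)" by simp
      show "\<Phi> m (grid_pattern m (V n \<omega>)) - 3 / sqrt (real m) - 2 * C * (indicator ?A \<omega> + indicator ?B \<omega>) \<le> F (V n \<omega>)"
      proof (cases "\<omega> \<in> ?A \<or> \<omega> \<in> ?B")
        case True
        then have "(1 :: real) \<le> indicator ?A \<omega> + indicator ?B \<omega>" by (auto simp: indicator_def)
        then have "2 * C * 1 \<le> 2 * C * (indicator ?A \<omega> + indicator ?B \<omega>)"
          using C0 by (intro mult_left_mono) auto
        then show ?thesis using \<Phi>_bound[OF m x] bound'[OF x] s3 by linarith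
      next
        case False
        let ?g = "grid_path m (grid_pattern m (V n \<omega>))"
        have g: "?g \<in> mono_paths" by (rule grid_path_mono_paths[OF x m])
        have "mono_dist (V n \<omega>) ?g \<le> 3 / real m"
          using False \<omega> by (intro mono_dist_grid_path[OF x m]) auto
        then have "sqrt (real m) * mono_dist (V n \<omega>) ?g \<le> sqrt (real m) * (3 / real m)"
          by (intro mult_left_mono) auto
        also have "\<dots> = 3 / sqrt (real m)" using m by (simp add: field_simps flip: power2_eq_square)
        finally have d: "sqrt (real m) * mono_dist (V n \<omega>) ?g \<le> 3 / sqrt (real m)" .
        have "lipschitz_minorant F (sqrt (real m)) ?g \<le>
            lipschitz_minorant F (sqrt (real m)) (V n \<omega>) + sqrt (real m) * mono_dist (V n \<omega>) ?g"
          by (rule lipschitz_minorant_lipschitz[OF bound' _ x]) simp_all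
        also have "lipschitz_minorant F (sqrt (real m)) (V n \<omega>) \<le> F (V n \<omega>)"
          by (rule lipschitz_minorant_le[OF bound' _ x]) simp_all
        finally have "lipschitz_minorant F (sqrt (real m)) ?g \<le> F (V n \<omega>) + 3 / sqrt (real m)"
          using d by simp
        moreover have "- C \<le> F (V n \<omega>) + 3 / sqrt (real m)" using bound'[OF x] s3 by linarith
        ultimately have "\<Phi> m (grid_pattern m (V n \<omega>)) \<le> F (V n \<omega>) + 3 / sqrt (real m)"
          by (simp add: \<Phi>_def)
        moreover have "indicator ?A \<omega> = (0::real)" "indicator ?B \<omega> = (0::real)" using False by auto
        ultimately show ?thesis by (metis add.right_neutral diff_le_eq mult_zero_right diff_zero)
      qed
    qed (use i\<Phi> iF iA in auto)
    also have "(\<integral>\<omega>. \<Phi> m (grid_pattern m (V n \<omega>)) - 3 / sqrt (real m) - 2 * C * (indicator ?A \<omega> + indicator ?B \<omega>) \<partial>M) =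
      (\<integral>\<omega>. \<Phi> m (grid_pattern m (V n \<omega>)) \<partial>M) - 3 / sqrt (real m) - 2 * C * ?bad n"
      using i\<Phi> iA by (simp add: M.prob_space)
    finally show ?thesis .
  qed
  have "(\<lambda>n. (\<integral>\<omega>. \<Phi> m (grid_pattern m (V n \<omega>)) \<partial>M) - 3 / sqrt (real m) - 2 * C * ?bad n)
    \<longlonglongrightarrow> (\<integral>\<omega>. \<Phi> m (grid_pattern m (W \<omega>)) \<partial>N) - 3 / sqrt (real m)
      - 2 * C * (0 + measure N {\<omega> \<in> space N. W \<omega> 1 > real m})"
    using m by (intro tendsto_intros \<Phi>_lim V1_lim V_start) auto
  then have "eventually (\<lambda>n. (\<integral>\<omega>. F (W \<omega>) \<partial>N) - \<epsilon> <
      (\<integral>\<omega>. \<Phi> m (grid_pattern m (V n \<omega>)) \<partial>M) - 3 / sqrt (real m) - 2 * C * ?bad n) sequentially"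
    using lim by (intro order_tendstoD(1)) auto
  then show ?thesis
    using lower by (auto elim!: eventually_mono intro: less_le_trans)
qed

theorem converges_in_M1: "converges_in_distribution M1_topology M V N W"
  unfolding converges_in_distribution_def
proof (intro conjI allI impI)
  fix F assume "continuous_map M1_topology euclideanreal F \<and> bounded (F ` topspace M1_topology)"
  then have F: "continuous_map M1_topology euclideanreal F" and "bounded (F ` cadlag_space)"
    by (auto simp: topspace_M1)
  then obtain C where C: "\<And>y. y \<in> cadlag_space \<Longrightarrow> \<bar>F y\<bar> \<le> C"
    by (auto simp: bounded_iff)
  show "(\<lambda>n. \<integral>\<omega>. F (V n \<omega>) \<partial>M) \<longlonglongrightarrow> (\<integral>\<omega>. F (W \<omega>) \<partial>N)"
  proof (rule order_tendstoI)
    fix l assume "l < (\<integral>\<omega>. F (W \<omega>) \<partial>N)"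
    then show "eventually (\<lambda>n. l < (\<integral>\<omega>. F (V n \<omega>) \<partial>M)) sequentially"
      using integral_liminf[OF F C, of "(\<integral>\<omega>. F (W \<omega>) \<partial>N) - l"] by simp
  next
    fix u assume "(\<integral>\<omega>. F (W \<omega>) \<partial>N) < u"
    moreover have "continuous_map M1_topology euclideanreal (\<lambda>y. - F y)"
      using F by (rule continuous_map_minus)
    ultimately show "eventually (\<lambda>n. (\<integral>\<omega>. F (V n \<omega>) \<partial>M) < u) sequentially"
      using integral_liminf[of "\<lambda>y. - F y" C "u - (\<integral>\<omega>. F (W \<omega>) \<partial>N)"] C by simp
  qed
qed (use V_measurable W_measurable in auto)

end

text \<open>The generators are M1-open sets, so measurability reduces to openness in the finitely
  many values that determine the path: nearby monotone value vectors give M1-close paths.\<close>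

lemma step_path_measurable:
  fixes X :: "nat \<Rightarrow> 'a \<Rightarrow> real"
  assumes X: "\<And>k. X k \<in> borel_measurable M" and mono: "\<And>\<omega> i j. i \<le> j \<Longrightarrow> X i \<omega> \<le> X j \<omega>"
  shows "(\<lambda>\<omega>. step_path n (\<lambda>k. X k \<omega>)) \<in> measurable M (borel_of M1_topology)"
  unfolding borel_of_def
proof (rule measurable_measure_of)
  show "{U. openin M1_topology U} \<subseteq> Pow (topspace M1_topology)" using openin_subset by auto
  have paths: "step_path n (\<lambda>k. X k \<omega>) \<in> mono_paths" for \<omega>
    using mono by (intro step_path_mono_paths) auto
  then show "(\<lambda>\<omega>. step_path n (\<lambda>k. X k \<omega>)) \<in> space M \<rightarrow> topspace M1_topology"
    by (auto simp: topspace_M1 mono_paths_def)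
  fix U assume "U \<in> {U. openin M1_topology U}"
  then have U: "\<And>x. x \<in> U \<Longrightarrow> \<exists>e>0. \<forall>y\<in>cadlag_space. dist_M1 x y < e \<longrightarrow> y \<in> U"
    unfolding M1_topology_def by (auto simp: openin_induced_topology)
  \<comment> \<open>A union of open boxes whose monotone members give paths in \<open>U\<close>.
    Monotonicity is built in because closeness of paths is controlled for monotone vectors only, and
    the values of \<open>X\<close> form such a vector.\<close>
  define G where "G = {v :: nat \<Rightarrow> real. \<exists>w e. e > 0 \<and> (\<forall>k\<le>n. \<bar>v k - w k\<bar> < e) \<and>
      (\<forall>v'. mono v' \<longrightarrow> (\<forall>k\<le>n. \<bar>v' k - w k\<bar> < e) \<longrightarrow> step_path n v' \<in> U)}"
  have "open G"
  proof -
    have "G = (\<Union>(w, e)\<in>{(w, e). e > 0 \<and> (\<forall>v'. mono v' \<longrightarrow> (\<forall>k\<le>n. \<bar>v' k - w k\<bar> < e) \<longrightarrow> step_path n v' \<in> U)}.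
        (\<Inter>k\<in>{..n}. {v. \<bar>v k - w k\<bar> < e}))"
      by (auto simp: G_def)
    moreover have "open {v :: nat \<Rightarrow> real. \<bar>v k - w k\<bar> < e}" for w k e
      by (intro open_Collect_less continuous_intros continuous_on_product_coordinates)
    ultimately show ?thesis by (auto intro!: open_UN open_INT)
  qed
  moreover have "(\<lambda>\<omega> k. X k \<omega>) \<in> borel_measurable M"
    using X by (rule measurable_coordinatewise_then_product)
  ultimately have "(\<lambda>\<omega> k. X k \<omega>) -` G \<inter> space M \<in> sets M"
    by (auto intro: measurable_sets borel_open)
  moreover have "step_path n (\<lambda>k. X k \<omega>) \<in> U \<longleftrightarrow> (\<lambda>k. X k \<omega>) \<in> G" for \<omega>
  proof
    assume "(\<lambda>k. X k \<omega>) \<in> G"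
    then show "step_path n (\<lambda>k. X k \<omega>) \<in> U"
      using mono by (auto simp: G_def mono_def)
  next
    assume "step_path n (\<lambda>k. X k \<omega>) \<in> U"
    from U[OF this] obtain e where e: "e > 0"
      "\<And>y. y \<in> cadlag_space \<Longrightarrow> dist_M1 (step_path n (\<lambda>k. X k \<omega>)) y < e \<Longrightarrow> y \<in> U" by auto
    \<comment> \<open>With tolerance \<open>e / 12\<close> the M1 distance is at most
      \<open>2 * (3 * (e / 12)) = e / 2 < e\<close>.\<close>
    have "step_path n v \<in> U" if v: "mono v" "\<forall>k\<le>n. \<bar>v k - X k \<omega>\<bar> < e / 12" for v
    proof (rule e(2))
      have vp: "step_path n v \<in> mono_paths" using v(1) by (intro step_path_mono_paths) (auto simp: mono_def)
      then show "step_path n v \<in> cadlag_space" by (simp add: mono_paths_def)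
      have close: "\<bar>step_path n v t - step_path n (\<lambda>k. X k \<omega>) t\<bar> \<le> e / 12" if t: "0 \<le> t" "t \<le> 1" for t
      proof -
        have "real n * t \<le> real n" using t by (simp add: mult_left_le)
        then have "nat \<lfloor>real n * t\<rfloor> \<le> n" by linarith
        then show ?thesis using v(2) t by (simp add: step_path_def less_imp_le)
      qed
      have "mono_dist (step_path n (\<lambda>k. X k \<omega>)) (step_path n v) \<le> 3 * (e / 12)"
      proof (rule mono_dist_le[OF paths vp])
        fix t assume t: "0 \<le> t" "t + e / 12 < 1"
        then have t': "t \<le> t + e / 12" "t \<le> 1" "t + e / 12 \<le> 1" using e(1) by auto
        show "step_path n (\<lambda>k. X k \<omega>) t \<le> step_path n v (t + e / 12) + e / 12"
          using close[OF t(1) t'(2)] mono_paths_le[OF vp t(1) t'(1,3)] by linarith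
        show "step_path n v t \<le> step_path n (\<lambda>k. X k \<omega>) (t + e / 12) + e / 12"
          using close[OF t(1) t'(2)] mono_paths_le[OF paths[of \<omega>] t(1) t'(1,3)] by linarith
      qed (use e(1) close[of 0] close[of 1] in \<open>auto simp: abs_minus_commute\<close>)
      then show "dist_M1 (step_path n (\<lambda>k. X k \<omega>)) (step_path n v) < e"
        using dist_M1_le_mono_dist[OF paths[of \<omega>] vp] e(1) by linarith
    qed
    then show "(\<lambda>k. X k \<omega>) \<in> G"
      using e(1) unfolding G_def by (intro CollectI exI[of _ "\<lambda>k. X k \<omega>"] exI[of _ "e / 12"]) auto
  qed
  ultimately show "(\<lambda>\<omega>. step_path n (\<lambda>k. X k \<omega>)) -` U \<inter> space M \<in> sets M"
    by (simp add: vimage_def)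
qed

section \<open>Regularly varying tails\<close>

text \<open>Polya's argument: monotonicity traps \<open>f n\<close> between neighbouring points of a
  finite partition, on each cell of which the limit varies by less than
  \<open>e / 2\<close>.\<close>

lemma mono_pointwise_imp_uniform:
  fixes f :: "nat \<Rightarrow> real \<Rightarrow> real"
  assumes T: "0 < T" and mono: "\<And>n x y. 0 \<le> x \<Longrightarrow> x \<le> y \<Longrightarrow> y \<le> T \<Longrightarrow> f n x \<le> f n y"
    and conv: "\<And>x. 0 \<le> x \<Longrightarrow> x \<le> T \<Longrightarrow> (\<lambda>n. f n x) \<longlonglongrightarrow> g x" and cont: "continuous_on {0..T} g"
    and e: "0 < e"
  shows "eventually (\<lambda>n. \<forall>x\<in>{0..T}. \<bar>f n x - g x\<bar> < e) sequentially"
proof -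
  have "uniformly_continuous_on {0..T} g" using cont by (rule compact_uniformly_continuous) simp
  then obtain d where d: "d > 0" "\<And>x y. x \<in> {0..T} \<Longrightarrow> y \<in> {0..T} \<Longrightarrow> \<bar>x - y\<bar> < d \<Longrightarrow> \<bar>g x - g y\<bar> < e / 2"
    unfolding uniformly_continuous_on_def dist_real_def using e by (meson half_gt_zero)
  obtain K :: nat where K: "T / d < real K" using reals_Archimedean2 by blast
  have K0: "K > 0" using K T d(1) by (auto intro!: Nat.gr0I simp: field_simps)
  define x where "x k = real k * (T / real K)" for k
  have x01: "x k \<in> {0..T}" if "k \<le> K" for k using that T K0 by (auto simp: x_def field_simps)
  have xd: "x (Suc k) - x k < d" for k
    using K K0 d(1) T by (simp add: x_def field_simps)
  have "eventually (\<lambda>n. \<forall>k\<in>{..K}. \<bar>f n (x k) - g (x k)\<bar> < e / 2) sequentially"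
  proof (rule eventually_ball_finite)
    show "\<forall>k\<in>{..K}. \<forall>\<^sub>F n in sequentially. \<bar>f n (x k) - g (x k)\<bar> < e / 2"
    proof
      fix k assume "k \<in> {..K}"
      then have "(\<lambda>n. f n (x k)) \<longlonglongrightarrow> g (x k)" using x01[of k] by (intro conv) auto
      then show "\<forall>\<^sub>F n in sequentially. \<bar>f n (x k) - g (x k)\<bar> < e / 2"
        using tendstoD[of _ _ _ "e / 2"] e by (fastforce simp: dist_real_def)
    qed
  qed simp
  then show ?thesis
  proof eventually_elim
    case (elim n)
    show ?case
    proof
      fix y assume y: "y \<in> {0..T}"
      show "\<bar>f n y - g y\<bar> < e"
      proof (cases "y = T")
        case True
        have "x K = T" using K0 by (simp add: x_def)
        then show ?thesis using True elim[rule_format, of K] e by simp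
      next
        case False
        define k where "k = nat \<lfloor>y / (T / real K)\<rfloor>"
        have yk: "y / (T / real K) \<ge> 0" using y T K0 by simp
        have "real k \<le> y / (T / real K)" "y / (T / real K) < real k + 1" using yk unfolding k_def by linarith+
        then have k: "x k \<le> y" "y < x (Suc k)" using T K0 by (auto simp: x_def field_simps)
        have "y < T" using False y by simp
        then have "x k < T" using k by simp
        then have kK: "k < K" using T K0 by (auto simp: x_def field_simps)
        have m: "f n (x k) \<le> f n y" "f n y \<le> f n (x (Suc k))"
          using k x01[of k] x01[of "Suc k"] kK y by (auto intro!: mono)
        have "\<bar>f n (x k) - g (x k)\<bar> < e / 2" "\<bar>f n (x (Suc k)) - g (x (Suc k))\<bar> < e / 2"
          using elim kK by auto
        moreover have "\<bar>g (x k) - g y\<bar> < e / 2" "\<bar>g (x (Suc k)) - g y\<bar> < e / 2"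
          using k xd[of k] x01[of k] x01[of "Suc k"] kK y by (intro d(2); linarith | simp)+
        ultimately show ?thesis using m by linarith
      qed
    qed
  qed
qed

text \<open>Subadditivity of the power: every \<open>x j\<close> is at most \<open>y\<close>, so
  \<open>x j = x j powr \<delta> * x j powr (1 - \<delta>)\<close> is at most
  \<open>x j powr \<delta> * y powr (1 - \<delta>)\<close>. Extended reals in the hypothesis let
  summability be a conclusion.\<close>

lemma sum_le_of_powr_sum_le:
  fixes x :: "nat \<Rightarrow> real"
  assumes x: "\<And>j. 0 \<le> x j" and y: "0 < y" and \<delta>: "0 < \<delta>" "\<delta> \<le> 1"
    and le: "(\<Sum>j. ennreal (x j powr \<delta>)) \<le> ennreal (y powr \<delta>)"
  shows "summable x" and "suminf x \<le> y"
proof -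
  have sm: "summable (\<lambda>j. x j powr \<delta>)"
    using le by (intro summable_suminf_not_top) (auto simp: top_unique)
  have "(\<Sum>j. ennreal (x j powr \<delta>)) = ennreal (\<Sum>j. x j powr \<delta>)"
    using sm by (intro suminf_ennreal2) auto
  then have le': "(\<Sum>j. x j powr \<delta>) \<le> y powr \<delta>" using le by (simp add: ennreal_le_iff)
  have xy: "x j \<le> y" for j
  proof -
    have "x j powr \<delta> \<le> (\<Sum>j. x j powr \<delta>)"
      using sum_le_suminf[OF sm, of "{j}"] by simp
    then have "x j powr \<delta> \<le> y powr \<delta>" using le' by simp
    then show ?thesis using \<delta> x y by (meson not_le powr_less_mono2 less_imp_le)
  qed
  have bound: "x j \<le> x j powr \<delta> * y powr (1 - \<delta>)" for j
  proof (cases "x j = 0")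
    case False
    then have "x j = x j powr \<delta> * x j powr (1 - \<delta>)" using x[of j] by (simp flip: powr_add)
    also have "\<dots> \<le> x j powr \<delta> * y powr (1 - \<delta>)"
      using xy x \<delta> by (intro mult_left_mono powr_mono2) auto
    finally show ?thesis .
  qed simp
  have sm2: "summable (\<lambda>j. x j powr \<delta> * y powr (1 - \<delta>))" using sm by (rule summable_mult2)
  show s: "summable x" using x bound by (intro summable_comparison_test'[OF sm2, of 0]) auto
  have "suminf x \<le> (\<Sum>j. x j powr \<delta> * y powr (1 - \<delta>))" using bound s sm2 by (rule suminf_le)
  also have "\<dots> = (\<Sum>j. x j powr \<delta>) * y powr (1 - \<delta>)" using suminf_mult2[OF sm] by simp
  also have "\<dots> \<le> y powr \<delta> * y powr (1 - \<delta>)" using le' by (intro mult_right_mono) auto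
  also have "\<dots> = y" using y by (simp flip: powr_add)
  finally show "suminf x \<le> y" .
qed

section \<open>Tail asymptotics of the stationary noise\<close>

locale heavy_tailed_noise = prob_space M for M :: "'a measure" +
  fixes Z :: "int \<Rightarrow> 'a \<Rightarrow> real" and \<alpha> p q :: real and L :: "real \<Rightarrow> real" and a :: "nat \<Rightarrow> real"
  assumes alpha: "\<alpha> > 0"
    and stationary: "strictly_stationary M Z"
    and slow: "slowly_varying L"
    and tail: "\<And>x. x > 0 \<Longrightarrow> measure M {\<omega> \<in> space M. \<bar>Z 1 \<omega>\<bar> > x} = x powr (- \<alpha>) * L x"
    and right_tail: "((\<lambda>x. measure M {\<omega> \<in> space M. Z 1 \<omega> > x} /
               measure M {\<omega> \<in> space M. \<bar>Z 1 \<omega>\<bar> > x}) \<longlongrightarrow> p) at_top"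
    and left_tail: "((\<lambda>x. measure M {\<omega> \<in> space M. Z 1 \<omega> < - x} /
               measure M {\<omega> \<in> space M. \<bar>Z 1 \<omega>\<bar> > x}) \<longlongrightarrow> q) at_top"
    and a_pos: "\<And>n. n \<ge> 1 \<Longrightarrow> a n > 0"
    and a_top: "filterlim a at_top sequentially"
    and a_norm: "(\<lambda>n. real n * measure M {\<omega> \<in> space M. \<bar>Z 1 \<omega>\<bar> > a n}) \<longlonglongrightarrow> 1"
    and D': "condition_D' M Z a"
begin

definition tailp :: "real \<Rightarrow> real" where
  "tailp x = measure M {\<omega> \<in> space M. \<bar>Z 1 \<omega>\<bar> > x}"

lemma Z_measurable [measurable]: "Z i \<in> borel_measurable M"
  using stationary by (simp add: strictly_stationary_def)

lemma stationary_prob: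
  assumes "finite J" and P: "Measurable.pred (PiM J (\<lambda>_. borel)) P"
  shows "measure M {\<omega> \<in> space M. P (\<lambda>i\<in>J. Z (i + h) \<omega>)} = measure M {\<omega> \<in> space M. P (\<lambda>i\<in>J. Z i \<omega>)}"
proof -
  let ?P = "PiM J (\<lambda>_. borel :: real measure)"
  have m: "(\<lambda>\<omega>. \<lambda>i\<in>J. Z (i + h) \<omega>) \<in> measurable M ?P" "(\<lambda>\<omega>. \<lambda>i\<in>J. Z i \<omega>) \<in> measurable M ?P"
    by (auto intro!: measurable_restrict)
  have "distr M ?P (\<lambda>\<omega>. \<lambda>i\<in>J. Z (i + h) \<omega>) = distr M ?P (\<lambda>\<omega>. \<lambda>i\<in>J. Z i \<omega>)"
    using stationary assms(1) by (simp add: strictly_stationary_def)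
  then have "measure (distr M ?P (\<lambda>\<omega>. \<lambda>i\<in>J. Z (i + h) \<omega>)) {f \<in> space ?P. P f} =
      measure (distr M ?P (\<lambda>\<omega>. \<lambda>i\<in>J. Z i \<omega>)) {f \<in> space ?P. P f}" by simp
  moreover have "{f \<in> space ?P. P f} \<in> sets ?P" using P by measurable
  moreover have "(\<lambda>\<omega>. \<lambda>i\<in>J. Z (i + h) \<omega>) -` {f \<in> space ?P. P f} \<inter> space M = {\<omega> \<in> space M. P (\<lambda>i\<in>J. Z (i + h) \<omega>)}"
    "(\<lambda>\<omega>. \<lambda>i\<in>J. Z i \<omega>) -` {f \<in> space ?P. P f} \<inter> space M = {\<omega> \<in> space M. P (\<lambda>i\<in>J. Z i \<omega>)}"
    by (auto simp: space_PiM)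
  ultimately show ?thesis using m by (simp add: measure_distr)
qed

lemma stationary_one:
  assumes [measurable]: "Measurable.pred borel P"
  shows "measure M {\<omega> \<in> space M. P (Z i \<omega>)} = measure M {\<omega> \<in> space M. P (Z 1 \<omega>)}"
  using stationary_prob[of "{1}" "\<lambda>f. P (f 1)" "i - 1"] by simp

lemma stationary_two:
  "measure M {\<omega> \<in> space M. \<bar>Z i \<omega>\<bar> > x \<and> \<bar>Z (i + d) \<omega>\<bar> > x} =
   measure M {\<omega> \<in> space M. \<bar>Z 1 \<omega>\<bar> > x \<and> \<bar>Z (1 + d) \<omega>\<bar> > x}"
  using stationary_prob[of "{1, 1 + d}" "\<lambda>f. \<bar>f 1\<bar> > x \<and> \<bar>f (1 + d)\<bar> > x" "i - 1"]
  by (simp add: add.commute)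

lemma tailp_Z: "measure M {\<omega> \<in> space M. \<bar>Z i \<omega>\<bar> > x} = tailp x"
  unfolding tailp_def by (rule stationary_one) measurable

lemma tailp_nonneg: "0 \<le> tailp x" by (simp add: tailp_def)

text \<open>Slow variation with factor 1 already forces \<open>L x \<noteq> 0\<close> eventually,
  because the convention \<open>0 / 0 = 0\<close> would contradict the limit 1.\<close>

lemma eventually_tailp_pos: "eventually (\<lambda>x. tailp x > 0) at_top"
proof -
  have "((\<lambda>x. L (1 * x) / L x) \<longlongrightarrow> 1) at_top"
    using slow zero_less_one unfolding slowly_varying_def by blast
  then have "eventually (\<lambda>x. L (1 * x) / L x > 1 / 2) at_top" by (rule order_tendstoD) simp
  then show ?thesis using eventually_gt_at_top[of 0]
  proof eventually_elim
    case (elim x)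
    then have "L x \<noteq> 0" by auto
    then have "tailp x \<noteq> 0" using tail[of x] elim(2) by (simp add: tailp_def)
    then show ?case using tailp_nonneg[of x] by simp
  qed
qed

lemma tailp_ratio:
  assumes t: "t > 0" shows "((\<lambda>x. tailp (t * x) / tailp x) \<longlongrightarrow> t powr (- \<alpha>)) at_top"
proof -
  have A: "((\<lambda>x. t powr (- \<alpha>) * (L (t * x) / L x)) \<longlongrightarrow> t powr (- \<alpha>) * 1) at_top"
    using slow t by (intro tendsto_intros) (auto simp: slowly_varying_def)
  have B: "eventually (\<lambda>x. t powr (- \<alpha>) * (L (t * x) / L x) = tailp (t * x) / tailp x) at_top"
    using eventually_gt_at_top[of 0]
  proof eventually_elim
    case (elim x)
    then show ?case using tail[of x] tail[of "t * x"] t by (simp add: tailp_def powr_mult)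
  qed
  show ?thesis using Lim_transform_eventually[OF A B] by simp
qed

lemma scaled_a_top: "t > 0 \<Longrightarrow> filterlim (\<lambda>n. t * a n) at_top sequentially"
  using a_top by (rule filterlim_tendsto_pos_mult_at_top[OF tendsto_const, rotated])

lemma n_tailp:
  assumes t: "t > 0" shows "(\<lambda>n. real n * tailp (t * a n)) \<longlonglongrightarrow> t powr (- \<alpha>)"
proof -
  have A: "(\<lambda>n. (real n * tailp (a n)) * (tailp (t * a n) / tailp (a n))) \<longlonglongrightarrow> 1 * t powr (- \<alpha>)"
    using a_norm filterlim_compose[OF tailp_ratio[OF t] a_top]
    by (intro tendsto_mult) (auto simp: tailp_def)
  have B: "eventually (\<lambda>n. (real n * tailp (a n)) * (tailp (t * a n) / tailp (a n)) = real n * tailp (t * a n)) sequentially"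
    using eventually_compose_filterlim[OF eventually_tailp_pos a_top] by eventually_elim simp
  show ?thesis using Lim_transform_eventually[OF A B] by simp
qed

lemma n_prob_lim:
  assumes lim: "((\<lambda>x. R x / tailp x) \<longlongrightarrow> w) at_top" and t: "t > 0"
  shows "(\<lambda>n. real n * R (t * a n)) \<longlonglongrightarrow> w * t powr (- \<alpha>)"
proof -
  have A: "(\<lambda>n. (R (t * a n) / tailp (t * a n)) * (real n * tailp (t * a n))) \<longlonglongrightarrow> w * t powr (- \<alpha>)"
    using filterlim_compose[OF lim scaled_a_top[OF t]] n_tailp[OF t] by (rule tendsto_mult)
  have B: "eventually (\<lambda>n. (R (t * a n) / tailp (t * a n)) * (real n * tailp (t * a n)) = real n * R (t * a n)) sequentially"
    using eventually_compose_filterlim[OF eventually_tailp_pos scaled_a_top[OF t]] by eventually_elim simp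
  show ?thesis using Lim_transform_eventually[OF A B] by simp
qed

text \<open>Writing the threshold as a multiplier \<open>\<tau>\<close> of the variable includes
  \<open>\<tau> = 0\<close>, the case without a barrier.\<close>

lemma n_scaled_lim:
  assumes lim: "((\<lambda>x. measure M {\<omega> \<in> space M. X \<omega> > x} / tailp x) \<longlongrightarrow> w) at_top" and \<tau>: "\<tau> \<ge> 0"
  shows "(\<lambda>n. real n * measure M {\<omega> \<in> space M. \<tau> * X \<omega> > a n}) \<longlonglongrightarrow> w * \<tau> powr \<alpha>"
proof (cases "\<tau> = 0")
  case True
  have "eventually (\<lambda>n. real n * measure M {\<omega> \<in> space M. \<tau> * X \<omega> > a n} = 0) sequentially"
    using eventually_ge_at_top[of 1]
  proof eventually_elim
    case (elim n) then show ?case using a_pos[of n] True by simp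
  qed
  then show ?thesis using True by (simp add: tendsto_eventually)
next
  case False
  then have \<tau>: "\<tau> > 0" using assms by simp
  have "(\<lambda>n. real n * measure M {\<omega> \<in> space M. X \<omega> > (1 / \<tau>) * a n}) \<longlonglongrightarrow> w * (1 / \<tau>) powr (- \<alpha>)"
    using \<tau> by (intro n_prob_lim[OF lim]) simp
  moreover have "(1 / \<tau>) powr (- \<alpha>) = \<tau> powr \<alpha>"
    using \<tau> by (simp add: powr_divide powr_minus_divide)
  moreover have "{\<omega> \<in> space M. X \<omega> > (1 / \<tau>) * a n} = {\<omega> \<in> space M. \<tau> * X \<omega> > a n}" for n
    using \<tau> by (auto simp: field_simps)
  ultimately show ?thesis by simp
qed

text \<open>Uniformity is needed because the multipliers \<open>\<sigma> i * g (i / n)\<close>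
  change with \<open>i\<close> and \<open>n\<close>. A positive threshold forces
  \<open>X > 0\<close> on the event, so its probability is monotone in \<open>\<tau>\<close> and
  pointwise convergence suffices.\<close>

lemma n_scaled_uniform:
  assumes lim: "((\<lambda>x. measure M {\<omega> \<in> space M. X \<omega> > x} / tailp x) \<longlongrightarrow> w) at_top"
    and [measurable]: "X \<in> borel_measurable M" and T: "0 < T" and e: "e > 0"
  shows "eventually (\<lambda>n. \<forall>\<tau>\<in>{0..T}. \<bar>real n * measure M {\<omega> \<in> space M. \<tau> * X \<omega> > a n} - w * \<tau> powr \<alpha>\<bar> < e) sequentially"
proof (rule mono_pointwise_imp_uniform[OF T _ _ _ e])
  fix n :: nat and x y :: real assume xy: "0 \<le> x" "x \<le> y"
  show "real n * measure M {\<omega> \<in> space M. x * X \<omega> > a n} \<le> real n * measure M {\<omega> \<in> space M. y * X \<omega> > a n}"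
  proof (cases "n = 0")
    case False
    then have an: "a n > 0" using a_pos[of n] by simp
    show ?thesis
    proof (intro mult_left_mono finite_measure_mono)
      show "{\<omega> \<in> space M. a n < x * X \<omega>} \<subseteq> {\<omega> \<in> space M. a n < y * X \<omega>}"
      proof clarify
        fix \<omega> assume "a n < x * X \<omega>"
        then have "X \<omega> > 0" using an xy by (smt (verit) zero_less_mult_pos mult_nonneg_nonpos)
        then have "x * X \<omega> \<le> y * X \<omega>" using xy by simp
        then show "a n < y * X \<omega>" using \<open>a n < x * X \<omega>\<close> by simp
      qed
    qed auto
  qed simp
next
  show "continuous_on {0..T} (\<lambda>\<tau>. w * \<tau> powr \<alpha>)"
    using alpha by (intro continuous_intros continuous_on_powr') auto
qed (use n_scaled_lim[OF lim] in auto)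

text \<open>A Potter bound along powers of 2: the ratio for doubling tends to
  \<open>2 powr (- \<alpha>)\<close>, which is below \<open>2 powr (- \<beta>)\<close>, and the
  estimate is iterated.\<close>

lemma tailp_doubling:
  assumes "0 < \<beta>" "\<beta> < \<alpha>"
  obtains u0 where "u0 > 0" "\<And>u k. u \<ge> u0 \<Longrightarrow> tailp (2 ^ k * u) \<le> (2 powr (- \<beta>)) ^ k * tailp u"
proof -
  have "2 powr (- \<alpha>) < 2 powr (- \<beta>)" using assms by simp
  then have "eventually (\<lambda>x. tailp (2 * x) / tailp x < 2 powr (- \<beta>)) at_top"
    using tailp_ratio[of 2] by (intro order_tendstoD(2)) auto
  then have "eventually (\<lambda>x. tailp (2 * x) \<le> 2 powr (- \<beta>) * tailp x) at_top"
    using eventually_tailp_pos by eventually_elim (simp add: pos_divide_less_eq)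
  then obtain u1 where u1: "\<And>x. x \<ge> u1 \<Longrightarrow> tailp (2 * x) \<le> 2 powr (- \<beta>) * tailp x"
    by (auto simp: eventually_at_top_linorder)
  show thesis
  proof (rule that[of "max u1 1"])
    fix u k assume u: "u \<ge> max u1 1"
    show "tailp (2 ^ k * u) \<le> (2 powr (- \<beta>)) ^ k * tailp u"
    proof (induction k)
      case (Suc k)
      have "u1 \<le> 1 * u" using u by simp
      also have "1 * u \<le> 2 ^ k * u" using u by (intro mult_right_mono) auto
      finally have "u1 \<le> 2 ^ k * u" .
      then have "tailp (2 * (2 ^ k * u)) \<le> 2 powr (- \<beta>) * tailp (2 ^ k * u)" by (rule u1)
      also have "\<dots> \<le> 2 powr (- \<beta>) * ((2 powr (- \<beta>)) ^ k * tailp u)" by (intro mult_left_mono Suc) simp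
      finally show ?case by (simp add: mult.assoc)
    qed simp
  qed simp
qed

text \<open>If \<open>\<bar>z\<bar>\<close> lies above \<open>2 ^ j * u\<close> and is at most
  \<open>2 ^ Suc j * u\<close>, the summand with index \<open>j\<close> alone is large enough. For
  \<open>\<bar>z\<bar> \<le> u\<close> the left side is 0, because \<open>ennreal\<close> cuts off
  negative numbers.\<close>

lemma dyadic_bound:
  fixes z u \<delta> :: real
  assumes u: "u > 0" and \<delta>: "\<delta> > 0"
  shows "ennreal (\<bar>z\<bar> powr \<delta> - u powr \<delta>) \<le> (\<Sum>k. ennreal ((2 ^ Suc k * u) powr \<delta>) * indicator {x. \<bar>x\<bar> > 2 ^ k * u} z)"
proof (cases "\<bar>z\<bar> \<le> u")
  case True
  then have "\<bar>z\<bar> powr \<delta> \<le> u powr \<delta>" using \<delta> by (intro powr_mono2) auto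
  then show ?thesis by (simp add: ennreal_neg)
next
  case False
  obtain n where "\<bar>z\<bar> / u < 2 ^ n" using real_arch_pow[of 2 "\<bar>z\<bar> / u"] by auto
  then have n: "\<bar>z\<bar> \<le> 2 ^ n * u" using u by (simp add: field_simps)
  define k where "k = (LEAST k. \<bar>z\<bar> \<le> 2 ^ k * u)"
  have k: "\<bar>z\<bar> \<le> 2 ^ k * u" unfolding k_def using n by (rule LeastI)
  have "k \<noteq> 0" using k False by (cases k) auto
  then obtain j where j: "k = Suc j" by (cases k) auto
  have zj: "\<bar>z\<bar> > 2 ^ j * u" using not_less_Least[of j "\<lambda>k. \<bar>z\<bar> \<le> 2 ^ k * u"] j unfolding k_def[symmetric] by auto
  have "ennreal (\<bar>z\<bar> powr \<delta> - u powr \<delta>) \<le> ennreal ((2 ^ Suc j * u) powr \<delta>)"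
  proof (rule ennreal_leI)
    have "\<bar>z\<bar> powr \<delta> \<le> (2 ^ Suc j * u) powr \<delta>" using k j \<delta> by (intro powr_mono2) auto
    then show "\<bar>z\<bar> powr \<delta> - u powr \<delta> \<le> (2 ^ Suc j * u) powr \<delta>" using powr_ge_zero[of u \<delta>] by linarith
  qed
  also have "\<dots> = (\<Sum>k\<in>{j}. ennreal ((2 ^ Suc k * u) powr \<delta>) * indicator {x. \<bar>x\<bar> > 2 ^ k * u} z)"
    using zj by simp
  also have "\<dots> \<le> (\<Sum>k. ennreal ((2 ^ Suc k * u) powr \<delta>) * indicator {x. \<bar>x\<bar> > 2 ^ k * u} z)"
    by (rule sum_le_suminf) auto
  finally show ?thesis .
qed

text \<open>A substitute for Karamata's theorem: halving the tail along dyadic levels is all that is used.\<close>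

lemma truncated_moment:
  assumes \<delta>: "0 < \<delta>" "\<delta> < \<alpha>"
  obtains C u0 where "C > 0" "u0 > 0"
    "\<And>u i. u \<ge> u0 \<Longrightarrow> (\<integral>\<^sup>+\<omega>. ennreal (\<bar>Z i \<omega>\<bar> powr \<delta> - u powr \<delta>) \<partial>M) \<le> ennreal (C * u powr \<delta> * tailp u)"
proof -
  \<comment> \<open>Halfway between \<open>\<delta>\<close> and \<open>\<alpha>\<close>: the level
    weights grow like powers of \<open>2 powr \<delta>\<close> and the tails decay like powers of
    \<open>2 powr (- \<beta>)\<close>, so the dyadic series is geometric with ratio below 1.\<close>
  define \<beta> where "\<beta> = (\<alpha> + \<delta>) / 2"
  have \<beta>: "0 < \<beta>" "\<beta> < \<alpha>" "\<delta> < \<beta>" using \<delta> by (auto simp: \<beta>_def)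
  obtain u0 where u0: "u0 > 0" "\<And>u k. u \<ge> u0 \<Longrightarrow> tailp (2 ^ k * u) \<le> (2 powr (- \<beta>)) ^ k * tailp u"
    using tailp_doubling[OF \<beta>(1,2)] by blast
  define r where "r = 2 powr (\<delta> - \<beta>)"
  have r: "0 < r" "r < 1" using \<beta>(3) by (auto simp: r_def powr_less_one)
  define C where "C = 2 powr \<delta> * (1 / (1 - r))"
  show thesis
  proof (rule that[of C u0])
    show "C > 0" using r by (simp add: C_def)
    show "u0 > 0" by fact
    fix u :: real and i :: int assume u: "u \<ge> u0"
    then have up: "u > 0" using u0(1) by simp
    have pw: "(2 ^ Suc k * u) powr \<delta> = 2 powr \<delta> * (2 powr \<delta>) ^ k * u powr \<delta>" for k
    proof -
      have "(2 ^ k :: real) powr \<delta> = (2 powr \<delta>) ^ k"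
        using powr_realpow[of 2 k] powr_realpow[of "2 powr \<delta>" k] powr_powr_swap[of 2 "real k" \<delta>] by simp
      then show ?thesis using up by (simp add: powr_mult)
    qed
    have sums: "(\<lambda>k. 2 powr \<delta> * u powr \<delta> * tailp u * r ^ k) sums (C * u powr \<delta> * tailp u)"
      using sums_mult[OF geometric_sums[of r], of "2 powr \<delta> * u powr \<delta> * tailp u"] r
      by (simp add: C_def mult_ac)
    have "(\<integral>\<^sup>+\<omega>. ennreal (\<bar>Z i \<omega>\<bar> powr \<delta> - u powr \<delta>) \<partial>M) \<le>
      (\<integral>\<^sup>+\<omega>. (\<Sum>k. ennreal ((2 ^ Suc k * u) powr \<delta>) * indicator {x. \<bar>x\<bar> > 2 ^ k * u} (Z i \<omega>)) \<partial>M)"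
      using dyadic_bound[OF up \<delta>(1)] by (intro nn_integral_mono) auto
    also have "\<dots> = (\<Sum>k. \<integral>\<^sup>+\<omega>. ennreal ((2 ^ Suc k * u) powr \<delta>) * indicator {x. \<bar>x\<bar> > 2 ^ k * u} (Z i \<omega>) \<partial>M)"
      by (intro nn_integral_suminf) measurable
    also have "\<dots> = (\<Sum>k. ennreal ((2 ^ Suc k * u) powr \<delta> * tailp (2 ^ k * u)))"
    proof (rule suminf_cong)
      fix k
      have "(\<integral>\<^sup>+\<omega>. ennreal ((2 ^ Suc k * u) powr \<delta>) * indicator {x. \<bar>x\<bar> > 2 ^ k * u} (Z i \<omega>) \<partial>M)
        = ennreal ((2 ^ Suc k * u) powr \<delta>) * (\<integral>\<^sup>+\<omega>. indicator {\<omega> \<in> space M. \<bar>Z i \<omega>\<bar> > 2 ^ k * u} \<omega> \<partial>M)"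
        by (subst nn_integral_cmult[symmetric]) (auto intro!: nn_integral_cong simp: indicator_def)
      also have "\<dots> = ennreal ((2 ^ Suc k * u) powr \<delta>) * ennreal (tailp (2 ^ k * u))"
        by (simp add: emeasure_eq_measure tailp_Z)
      finally show "(\<integral>\<^sup>+\<omega>. ennreal ((2 ^ Suc k * u) powr \<delta>) * indicator {x. \<bar>x\<bar> > 2 ^ k * u} (Z i \<omega>) \<partial>M)
        = ennreal ((2 ^ Suc k * u) powr \<delta> * tailp (2 ^ k * u))"
        by (simp add: ennreal_mult tailp_nonneg)
    qed
    also have "\<dots> \<le> (\<Sum>k. ennreal (2 powr \<delta> * u powr \<delta> * tailp u * r ^ k))"
    proof (intro suminf_le ennreal_leI)
      fix k
      have "(2 ^ Suc k * u) powr \<delta> * tailp (2 ^ k * u) \<le> (2 powr \<delta> * (2 powr \<delta>) ^ k * u powr \<delta>) * ((2 powr (- \<beta>)) ^ k * tailp u)"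
        unfolding pw by (intro mult_left_mono u0(2) u) auto
      also have "\<dots> = 2 powr \<delta> * u powr \<delta> * tailp u * ((2 powr \<delta>) * (2 powr (- \<beta>))) ^ k"
        by (simp add: power_mult_distrib mult_ac)
      also have "(2 powr \<delta>) * (2 powr (- \<beta>)) = r" by (simp add: r_def flip: powr_add)
      finally show "(2 ^ Suc k * u) powr \<delta> * tailp (2 ^ k * u) \<le> 2 powr \<delta> * u powr \<delta> * tailp u * r ^ k" .
    qed auto
    also have "\<dots> = ennreal (\<Sum>k. 2 powr \<delta> * u powr \<delta> * tailp u * r ^ k)"
      using sums r tailp_nonneg by (intro suminf_ennreal2) (auto simp: sums_iff)
    also have "(\<Sum>k. 2 powr \<delta> * u powr \<delta> * tailp u * r ^ k) = C * u powr \<delta> * tailp u"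
      using sums by (simp add: sums_iff)
    finally show "(\<integral>\<^sup>+\<omega>. ennreal (\<bar>Z i \<omega>\<bar> powr \<delta> - u powr \<delta>) \<partial>M) \<le> ennreal (C * u powr \<delta> * tailp u)" .
  qed
qed

text \<open>Only the marginal law enters: subtracting the same level from each \<open>|Z|\<^sup>\<delta>\<close> leaves a sum whose mean is small.\<close>

lemma weighted_sum_tail:
  assumes \<delta>: "0 < \<delta>" "\<delta> < \<alpha>"
  obtains C u0 where "C > 0" "u0 > 0"
    "\<And>d D u \<kappa>. (\<And>j. 0 \<le> d j) \<Longrightarrow> summable d \<Longrightarrow> suminf d \<le> D \<Longrightarrow> 0 < D \<Longrightarrow> u0 \<le> u \<Longrightarrow>
      measure M {\<omega> \<in> space M. (\<Sum>j. ennreal (d j * \<bar>Z (\<kappa> j) \<omega>\<bar> powr \<delta>)) > ennreal (2 * D * u powr \<delta>)}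
      \<le> C * tailp u"
proof -
  obtain C u0 where C: "C > 0" "u0 > 0"
    "\<And>u i. u \<ge> u0 \<Longrightarrow> (\<integral>\<^sup>+\<omega>. ennreal (\<bar>Z i \<omega>\<bar> powr \<delta> - u powr \<delta>) \<partial>M) \<le> ennreal (C * u powr \<delta> * tailp u)"
    using truncated_moment[OF \<delta>] by blast
  show thesis
  proof (rule that[OF C(1,2)])
    fix d :: "nat \<Rightarrow> real" and D u and \<kappa> :: "nat \<Rightarrow> int"
    assume d: "\<And>j. 0 \<le> d j" "summable d" and D: "suminf d \<le> D" "0 < D" and u: "u0 \<le> u"
    define w where "w = u powr \<delta>"
    have w: "w > 0" using u C(2) by (simp add: w_def)
    \<comment> \<open>Negative differences become 0 under \<open>ennreal\<close>, so
      \<open>R\<close> sums the excesses over the level \<open>w\<close>.\<close>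
    define R where "R \<omega> = (\<Sum>j. ennreal (d j) * ennreal (\<bar>Z (\<kappa> j) \<omega>\<bar> powr \<delta> - w))" for \<omega>
    have [measurable]: "R \<in> borel_measurable M" unfolding R_def by measurable
    \<comment> \<open>The level itself accounts for at most \<open>D * w\<close>; exceeding
      \<open>2 * D * w\<close> therefore forces \<open>R > D * w\<close>, and Markov's inequality
      applies.\<close>
    have sub: "{\<omega> \<in> space M. (\<Sum>j. ennreal (d j * \<bar>Z (\<kappa> j) \<omega>\<bar> powr \<delta>)) > ennreal (2 * D * w)}
      \<subseteq> {\<omega> \<in> space M. 1 \<le> ennreal (1 / (D * w)) * R \<omega>}"
    proof clarify
      fix \<omega> assume gt: "(\<Sum>j. ennreal (d j * \<bar>Z (\<kappa> j) \<omega>\<bar> powr \<delta>)) > ennreal (2 * D * w)"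
      have "(\<Sum>j. ennreal (d j * \<bar>Z (\<kappa> j) \<omega>\<bar> powr \<delta>)) \<le>
        (\<Sum>j. ennreal (d j * w) + ennreal (d j) * ennreal (\<bar>Z (\<kappa> j) \<omega>\<bar> powr \<delta> - w))"
      proof (intro suminf_le)
        fix j
        have "ennreal (\<bar>Z (\<kappa> j) \<omega>\<bar> powr \<delta>) \<le> ennreal w + ennreal (\<bar>Z (\<kappa> j) \<omega>\<bar> powr \<delta> - w)"
        proof (cases "\<bar>Z (\<kappa> j) \<omega>\<bar> powr \<delta> \<le> w")
          case True then show ?thesis by (auto simp: ennreal_neg intro: ennreal_leI)
        next
          case False
          then have "ennreal w + ennreal (\<bar>Z (\<kappa> j) \<omega>\<bar> powr \<delta> - w) = ennreal (w + (\<bar>Z (\<kappa> j) \<omega>\<bar> powr \<delta> - w))"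
            using w by (subst ennreal_plus) auto
          then show ?thesis by simp
        qed
        then have "ennreal (d j) * ennreal (\<bar>Z (\<kappa> j) \<omega>\<bar> powr \<delta>) \<le>
            ennreal (d j) * (ennreal w + ennreal (\<bar>Z (\<kappa> j) \<omega>\<bar> powr \<delta> - w))"
          by (intro mult_left_mono) auto
        then show "ennreal (d j * \<bar>Z (\<kappa> j) \<omega>\<bar> powr \<delta>) \<le>
            ennreal (d j * w) + ennreal (d j) * ennreal (\<bar>Z (\<kappa> j) \<omega>\<bar> powr \<delta> - w)"
          using d w by (simp add: ennreal_mult distrib_left)
      qed auto
      also have "\<dots> = (\<Sum>j. ennreal (d j * w)) + R \<omega>"
        unfolding R_def by (rule suminf_add[symmetric]) auto
      also have "(\<Sum>j. ennreal (d j * w)) = ennreal (suminf d * w)"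
        using d w suminf_mult2[OF d(2), of w] by (subst suminf_ennreal2) (auto intro: summable_mult2)
      also have "\<dots> \<le> ennreal (D * w)" using D w by (intro ennreal_leI mult_right_mono) auto
      finally have "ennreal (2 * D * w) < ennreal (D * w) + R \<omega>" using gt by (auto intro: less_le_trans add_right_mono)
      moreover have "ennreal (2 * D * w) = ennreal (D * w) + ennreal (D * w)"
        using D w by (subst ennreal_plus[symmetric]) (auto simp: mult_ac)
      ultimately have "ennreal (D * w) < R \<omega>" by (simp add: ennreal_add_left_cancel_less)
      then have "ennreal (D * w) \<le> R \<omega>" by (rule less_imp_le)
      then have "ennreal (1 / (D * w)) * ennreal (D * w) \<le> ennreal (1 / (D * w)) * R \<omega>"
        by (rule mult_left_mono) simp
      moreover have "ennreal (1 / (D * w)) * ennreal (D * w) = 1"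
        using D w by (subst ennreal_mult[symmetric]) auto
      ultimately show "1 \<le> ennreal (1 / (D * w)) * R \<omega>" by (simp only:)
    qed
    have "ennreal (measure M {\<omega> \<in> space M. (\<Sum>j. ennreal (d j * \<bar>Z (\<kappa> j) \<omega>\<bar> powr \<delta>)) > ennreal (2 * D * w)})
      \<le> emeasure M {\<omega> \<in> space M. 1 \<le> ennreal (1 / (D * w)) * R \<omega>}"
      unfolding emeasure_eq_measure[symmetric] using sub by (intro emeasure_mono) auto
    also have "\<dots> \<le> ennreal (1 / (D * w)) * (\<integral>\<^sup>+\<omega>. R \<omega> \<partial>M)"
    proof -
      have "emeasure M {\<omega> \<in> space M. 1 \<le> ennreal (1 / (D * w)) * R \<omega>} \<le>
          ennreal (1 / (D * w)) * (\<integral>\<^sup>+\<omega>. R \<omega> * indicator (space M) \<omega> \<partial>M)"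
        by (rule nn_integral_Markov_inequality) auto
      also have "(\<integral>\<^sup>+\<omega>. R \<omega> * indicator (space M) \<omega> \<partial>M) = (\<integral>\<^sup>+\<omega>. R \<omega> \<partial>M)"
        by (intro nn_integral_cong) auto
      finally show ?thesis .
    qed
    also have "(\<integral>\<^sup>+\<omega>. R \<omega> \<partial>M) = (\<Sum>j. ennreal (d j) * (\<integral>\<^sup>+\<omega>. ennreal (\<bar>Z (\<kappa> j) \<omega>\<bar> powr \<delta> - w) \<partial>M))"
      unfolding R_def by (subst nn_integral_suminf) (auto simp: nn_integral_cmult)
    also have "\<dots> \<le> (\<Sum>j. ennreal (d j * (C * w * tailp u)))"
    proof (intro suminf_le)
      fix j
      have "ennreal (d j) * (\<integral>\<^sup>+\<omega>. ennreal (\<bar>Z (\<kappa> j) \<omega>\<bar> powr \<delta> - w) \<partial>M) \<le> ennreal (d j) * ennreal (C * w * tailp u)"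
        unfolding w_def by (intro mult_left_mono C(3) u) auto
      then show "ennreal (d j) * (\<integral>\<^sup>+\<omega>. ennreal (\<bar>Z (\<kappa> j) \<omega>\<bar> powr \<delta> - w) \<partial>M) \<le> ennreal (d j * (C * w * tailp u))"
        using d C(1) w tailp_nonneg by (simp add: ennreal_mult)
    qed auto
    also have "\<dots> = ennreal (suminf d * (C * w * tailp u))"
      using d C(1) w tailp_nonneg suminf_mult2[OF d(2), of "C * w * tailp u"]
      by (subst suminf_ennreal2) (auto intro: summable_mult2)
    also have "\<dots> \<le> ennreal (D * (C * w * tailp u))"
      using D C(1) w tailp_nonneg by (intro ennreal_leI mult_right_mono) auto
    also have "ennreal (1 / (D * w)) * ennreal (D * (C * w * tailp u)) = ennreal (C * tailp u)"
      using D w C(1) tailp_nonneg by (subst ennreal_mult[symmetric]) auto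
    finally show "measure M {\<omega> \<in> space M. (\<Sum>j. ennreal (d j * \<bar>Z (\<kappa> j) \<omega>\<bar> powr \<delta>)) > ennreal (2 * D * u powr \<delta>)}
      \<le> C * tailp u"
      using C(1) tailp_nonneg by (simp add: ennreal_le_iff w_def mult_left_mono)
  qed
qed

end

section \<open>Limits of exceedance sums\<close>

text \<open>On each cell the mean value theorem, applied to an antiderivative, replaces the integral
  by one value of \<open>g\<close>, which is within \<open>e\<close> of the value at the right
  end.\<close>

lemma integral_step_error:
  fixes g :: "real \<Rightarrow> real"
  assumes g: "continuous_on {0..1} g" and m: "m > 0"
    and e: "\<And>x y. x \<in> {0..1} \<Longrightarrow> y \<in> {0..1} \<Longrightarrow> \<bar>x - y\<bar> \<le> 1 / real m \<Longrightarrow> \<bar>g x - g y\<bar> \<le> e"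
  shows "\<bar>(LINT t:{0..1}|lborel. g t) - (\<Sum>j=1..m. g (real j / real m)) / real m\<bar> \<le> e"
proof -
  obtain G where G: "\<And>x. x \<in> {0..1} \<Longrightarrow> (G has_vector_derivative g x) (at x within {0..1})"
    using antiderivative_continuous[OF g] by blast
  have I: "(LINT t:{0..1}|lborel. g t) = G 1 - G 0"
    unfolding set_lebesgue_integral_def by (rule integral_FTC_atLeastAtMost) (use G g in auto)
  have "\<bar>G (real k / real m) - G 0 - (\<Sum>j=1..k. g (real j / real m)) / real m\<bar> \<le> e * real k / real m"
    if "k \<le> m" for k
    using that
  proof (induction k)
    case (Suc k)
    let ?a = "real k / real m" and ?b = "real (Suc k) / real m"
    have ab: "0 \<le> ?a" "?a < ?b" "?b \<le> 1" "?b - ?a = 1 / real m"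
      using m Suc.prems by (auto simp: field_simps)
    obtain z where z: "?a < z" "z < ?b" "G ?b - G ?a = (?b - ?a) * g z"
    proof (rule mvt[OF ab(2), where f = G and f' = "\<lambda>x h. h * g x"])
      show "continuous_on {?a..?b} G"
        using ab by (intro continuous_on_subset[OF continuous_on_vector_derivative[OF G]]) auto
      fix x assume x: "?a < x" "x < ?b"
      then have x01: "0 \<le> x" "x \<le> 1" using ab by linarith+
      then have "(G has_vector_derivative g x) (at x within {0..1})" by (intro G) auto
      moreover have "at x within {0..1} = at x" using x ab by (intro at_within_Icc_at) linarith+
      ultimately show "(G has_derivative (\<lambda>h. h * g x)) (at x)"
        by (simp add: has_vector_derivative_def)
    qed blast
    have z3: "G ?b - G ?a = g z / real m" unfolding z(3) ab(4) by simp
    have z01: "0 \<le> z" "z \<le> 1" using z(1,2) ab by linarith+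
    moreover have "\<bar>z - ?b\<bar> \<le> 1 / real m" using z(1,2) ab(4) by linarith
    moreover have "0 \<le> ?b" using ab by linarith
    ultimately have "\<bar>g z - g ?b\<bar> \<le> e" using ab(3) by (intro e) auto
    then have "\<bar>g z / real m - g ?b / real m\<bar> \<le> e / real m"
      using m by (simp add: diff_divide_distrib[symmetric] divide_right_mono)
    moreover have "(\<Sum>j=1..Suc k. g (real j / real m)) / real m = (\<Sum>j=1..k. g (real j / real m)) / real m + g ?b / real m"
      by (simp add: add_divide_distrib)
    moreover have "e * real (Suc k) / real m = e * real k / real m + e / real m"
      using m by (simp add: field_simps)
    ultimately show ?case using Suc z3 by linarith
  qed simp
  from this[of m] m show ?thesis by (simp add: I)
qed

text \<open>Nonnegative weights with Cesaro mean \<open>\<mu>\<close> spread their mass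
  asymptotically like \<open>\<mu>\<close> times Lebesgue measure over \<open>m\<close> equal time
  blocks, and \<open>g\<close> is nearly constant on a block.\<close>

lemma cesaro_weighted_integral:
  fixes w :: "nat \<Rightarrow> real" and g :: "real \<Rightarrow> real"
  assumes w: "\<And>i. 0 \<le> w i" and lim: "(\<lambda>n. (\<Sum>i=1..n. w i) / real n) \<longlonglongrightarrow> \<mu>"
    and g: "continuous_on {0..1} g"
  shows "(\<lambda>n. (\<Sum>i=1..n. w i * g (real i / real n)) / real n) \<longlonglongrightarrow> \<mu> * (LINT t:{0..1}|lborel. g t)"
proof (rule LIMSEQ_I)
  fix \<epsilon> :: real assume \<epsilon>: "0 < \<epsilon>"
  define S where "S n = (\<Sum>i=1..n. w i)" for n
  have \<mu>: "0 \<le> \<mu>" using lim by (rule LIMSEQ_le_const) (auto intro!: exI[of _ 0] divide_nonneg_nonneg sum_nonneg w)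
  \<comment> \<open>Chosen for the final balance: \<open>e * (\<mu> + 1)\<close> from the weights
    and \<open>\<mu> * e\<close> from the Riemann sum add up to
    \<open>\<epsilon> / 2\<close>.\<close>
  define e where "e = \<epsilon> / (2 * (2 * \<mu> + 1))"
  have e: "0 < e" "e * (2 * \<mu> + 1) = \<epsilon> / 2" using \<epsilon> \<mu> by (auto simp: e_def field_simps)
  have "uniformly_continuous_on {0..1} g" using g by (rule compact_uniformly_continuous) simp
  then obtain d where d: "d > 0" "\<And>x y. x \<in> {0..1} \<Longrightarrow> y \<in> {0..1} \<Longrightarrow> \<bar>x - y\<bar> < d \<Longrightarrow> \<bar>g x - g y\<bar> < e"
    unfolding uniformly_continuous_on_def dist_real_def using e(1) by meson
  obtain m :: nat where m: "m > 0" "1 / real m < d"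
    using reals_Archimedean[OF d(1)] by (auto simp: inverse_eq_divide intro: that[of "Suc _"])
  have gm: "\<bar>g x - g y\<bar> \<le> e" if "x \<in> {0..1}" "y \<in> {0..1}" "\<bar>x - y\<bar> \<le> 1 / real m" for x y
    using d(2)[OF that(1,2)] that(3) m(2) by linarith
  have I: "\<bar>(LINT t:{0..1}|lborel. g t) - (\<Sum>j=1..m. g (real j / real m)) / real m\<bar> \<le> e"
    by (rule integral_step_error[OF g m(1) gm])
  \<comment> \<open>The weights up to the block boundary \<open>n * j div m\<close> carry
    asymptotically the share \<open>j / m\<close> of the total.\<close>
  have Sj: "(\<lambda>n. S (n * j div m) / real n) \<longlonglongrightarrow> \<mu> * (real j / real m)" for j
  proof (cases "j = 0")
    case True then show ?thesis by (simp add: S_def)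
  next
    case False
    have fl: "filterlim (\<lambda>n. n * j div m) at_top sequentially"
      unfolding filterlim_at_top
    proof
      fix Z
      show "eventually (\<lambda>n. Z \<le> n * j div m) sequentially"
        using eventually_ge_at_top[of "Z * m"]
      proof eventually_elim
        case (elim n)
        have "Z * m \<le> n * j" using elim False by (metis One_nat_def Suc_leI le_trans mult.right_neutral mult_le_mono2 not_gr_zero)
        then show ?case using m(1) by (simp add: less_eq_div_iff_mult_less_eq)
      qed
    qed
    have A: "(\<lambda>n. S (n * j div m) / real (n * j div m)) \<longlonglongrightarrow> \<mu>"
      using filterlim_compose[OF lim fl] by (simp add: S_def)
    have B: "(\<lambda>n. real (n * j div m) / real n) \<longlonglongrightarrow> real j / real m"
    proof (rule tendsto_sandwich)
      show "(\<lambda>n. real j / real m - 1 / real n) \<longlonglongrightarrow> real j / real m" by real_asymp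
      show "(\<lambda>n. real j / real m) \<longlonglongrightarrow> real j / real m" by simp
      show "eventually (\<lambda>n. real (n * j div m) / real n \<le> real j / real m) sequentially"
        using eventually_gt_at_top[of 0]
      proof eventually_elim
        case (elim n)
        have "real (n * j div m) \<le> real (n * j) / real m" by (rule of_nat_div_le_of_nat)
        then show ?case using elim by (simp add: pos_divide_le_eq mult.commute)
      qed
      show "eventually (\<lambda>n. real j / real m - 1 / real n \<le> real (n * j div m) / real n) sequentially"
        using eventually_gt_at_top[of 0]
      proof eventually_elim
        case (elim n)
        have "real (n * j) / real m - 1 \<le> real (n * j div m)"
        proof -
          have "real (n * j) < real (m + n * j div m * m)"
            using dividend_less_div_times[OF m(1), of "n * j"] by (simp only: of_nat_less_iff)
          then show ?thesis using m(1) by (simp add: field_simps)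
        qed
        then have "(real (n * j) / real m - 1) / real n \<le> real (n * j div m) / real n"
          by (rule divide_right_mono) simp
        moreover have "(real (n * j) / real m - 1) / real n = real j / real m - 1 / real n"
          using elim by (simp add: field_simps)
        ultimately show ?case by simp
      qed
    qed
    have eq: "S k / real k * (real k / real n) = S k / real n" for k n
      by (cases "k = 0") (auto simp: S_def)
    show ?thesis using tendsto_mult[OF A B] unfolding eq .
  qed
  have "(\<lambda>n. (\<Sum>j=1..m. g (real j / real m) * (S (n * j div m) / real n - S (n * (j - 1) div m) / real n)))
      \<longlonglongrightarrow> (\<Sum>j=1..m. g (real j / real m) * (\<mu> * (real j / real m) - \<mu> * (real (j - 1) / real m)))"
    by (intro tendsto_intros Sj)
  also have "(\<Sum>j=1..m. g (real j / real m) * (\<mu> * (real j / real m) - \<mu> * (real (j - 1) / real m))) =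
      (\<Sum>j=1..m. g (real j / real m) * (\<mu> / real m))"
    by (intro sum.cong) (auto simp: of_nat_diff field_simps)
  also have "\<dots> = \<mu> * ((\<Sum>j=1..m. g (real j / real m)) / real m)"
    by (simp add: sum_distrib_right[symmetric] sum_divide_distrib[symmetric])
  finally have step: "(\<lambda>n. (\<Sum>j=1..m. g (real j / real m) * (S (n * j div m) / real n - S (n * (j - 1) div m) / real n)))
      \<longlonglongrightarrow> \<mu> * ((\<Sum>j=1..m. g (real j / real m)) / real m)" .
  have block: "\<bar>(\<Sum>i=1..n * k div m. w i * g (real i / real n)) -
      (\<Sum>j=1..k. g (real j / real m) * (S (n * j div m) - S (n * (j - 1) div m)))\<bar> \<le> e * S (n * k div m)"
    if "k \<le> m" "n > 0" for k n
    using that(1)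
  proof (induction k)
    case (Suc k)
    let ?a = "n * k div m" and ?b = "n * Suc k div m"
    have ab: "?a \<le> ?b" by (intro div_le_mono) simp
    have split: "(\<Sum>i=1..?b. f i) = (\<Sum>i=1..?a. f i) + (\<Sum>i\<in>{?a<..?b}. f i)" for f :: "nat \<Rightarrow> real"
      using ab sum.ub_add_nat[of 1 ?a f "?b - ?a"] by (simp add: atLeastSucAtMost_greaterThanAtMost)
    have "\<bar>(\<Sum>i\<in>{?a<..?b}. w i * g (real i / real n)) - g (real (Suc k) / real m) * (\<Sum>i\<in>{?a<..?b}. w i)\<bar>
        = \<bar>\<Sum>i\<in>{?a<..?b}. w i * (g (real i / real n) - g (real (Suc k) / real m))\<bar>"
      by (simp add: sum_distrib_left right_diff_distrib sum_subtractf mult.commute)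
    also have "\<dots> \<le> (\<Sum>i\<in>{?a<..?b}. w i * e)"
    proof (rule order_trans[OF sum_abs sum_mono])
      fix i assume i: "i \<in> {?a<..?b}"
      then have "n * k < i * m" using m(1) by (simp add: div_less_iff_less_mult)
      moreover have "i * m \<le> n * Suc k" using i m(1) by (simp add: less_eq_div_iff_mult_less_eq)
      ultimately have im: "real n * real k < real i * real m" "real i * real m \<le> real n * real (Suc k)"
        unfolding of_nat_mult[symmetric] of_nat_less_iff of_nat_le_iff by simp_all
      have kn: "i \<le> n"
      proof -
        have "n * Suc k \<le> n * m" using Suc.prems by (intro mult_le_mono2)
        then show ?thesis using \<open>i * m \<le> n * Suc k\<close> m(1) by (meson le_trans mult_le_cancel2 not_gr_zero nat_mult_le_cancel_disj)
      qed
      have up: "real i / real n \<le> real (Suc k) / real m"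
        using im(2) m(1) that(2) by (simp add: divide_le_eq mult.commute) (simp add: field_simps)
      have lo: "real k / real m < real i / real n"
        using im(1) m(1) that(2) by (simp add: field_simps)
      have dist: "\<bar>real i / real n - real (Suc k) / real m\<bar> \<le> 1 / real m"
        using up lo by (simp add: add_divide_distrib abs_if)
      have "\<bar>g (real i / real n) - g (real (Suc k) / real m)\<bar> \<le> e"
        using kn that(2) Suc.prems m(1) by (intro gm dist) (auto simp: field_simps)
      then show "\<bar>w i * (g (real i / real n) - g (real (Suc k) / real m))\<bar> \<le> w i * e"
        using w[of i] by (simp add: abs_mult mult_left_mono)
    qed
    also have "\<dots> = (\<Sum>i\<in>{?a<..?b}. w i) * e" by (rule sum_distrib_right[symmetric])
    also have "\<dots> = e * (\<Sum>i\<in>{?a<..?b}. w i)" by (rule mult.commute)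
    finally have "\<bar>(\<Sum>i\<in>{?a<..?b}. w i * g (real i / real n)) - g (real (Suc k) / real m) * (\<Sum>i\<in>{?a<..?b}. w i)\<bar>
        \<le> e * (\<Sum>i\<in>{?a<..?b}. w i)" .
    moreover have "(\<Sum>i\<in>{?a<..?b}. w i) = S ?b - S ?a" using split[of w] by (simp add: S_def)
    moreover have "e * S ?b = e * S ?a + e * (S ?b - S ?a)" by (simp add: algebra_simps)
    ultimately show ?case using Suc split[of "\<lambda>i. w i * g (real i / real n)"] by simp
  qed (simp add: S_def)
  have "eventually (\<lambda>n. \<bar>(\<Sum>j=1..m. g (real j / real m) * (S (n * j div m) / real n - S (n * (j - 1) div m) / real n))
      - \<mu> * ((\<Sum>j=1..m. g (real j / real m)) / real m)\<bar> < \<epsilon> / 2) sequentially"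
    using tendstoD[OF step, of "\<epsilon> / 2"] \<epsilon> by (simp add: dist_real_def)
  moreover have "eventually (\<lambda>n. S n / real n < \<mu> + 1) sequentially"
    using lim unfolding S_def by (rule order_tendstoD) simp
  ultimately have "eventually (\<lambda>n. norm ((\<Sum>i=1..n. w i * g (real i / real n)) / real n -
      \<mu> * (LINT t:{0..1}|lborel. g t)) < \<epsilon>) sequentially"
    using eventually_gt_at_top[of 0]
  proof eventually_elim
    case (elim n)
    let ?A = "\<Sum>i=1..n. w i * g (real i / real n)"
    let ?B = "\<Sum>j=1..m. g (real j / real m) * (S (n * j div m) - S (n * (j - 1) div m))"
    let ?C = "(\<Sum>j=1..m. g (real j / real m)) / real m" and ?I = "LINT t:{0..1}|lborel. g t"
    have "\<bar>?A - ?B\<bar> \<le> e * S n" using block[of m n] elim(3) m(1) by simp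
    then have "\<bar>?A / real n - ?B / real n\<bar> \<le> e * (S n / real n)"
      using elim(3) by (simp add: diff_divide_distrib[symmetric] divide_right_mono)
    also have "\<dots> \<le> e * (\<mu> + 1)" using e(1) elim(2) by (intro mult_left_mono) auto
    finally have 1: "\<bar>?A / real n - ?B / real n\<bar> \<le> e * (\<mu> + 1)" .
    have 2: "?B / real n = (\<Sum>j=1..m. g (real j / real m) * (S (n * j div m) / real n - S (n * (j - 1) div m) / real n))"
      by (simp add: sum_divide_distrib diff_divide_distrib right_diff_distrib)
    have "\<bar>\<mu> * ?C - \<mu> * ?I\<bar> = \<mu> * \<bar>?I - ?C\<bar>"
      by (simp only: right_diff_distrib[symmetric] abs_mult abs_of_nonneg[OF \<mu>] abs_minus_commute)
    also have "\<dots> \<le> \<mu> * e" using I \<mu> by (rule mult_left_mono)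
    finally have 3: "\<bar>\<mu> * ?C - \<mu> * ?I\<bar> \<le> \<mu> * e" .
    have "e * (\<mu> + 1) + \<mu> * e = \<epsilon> / 2" using e(2) by (simp add: algebra_simps)
    moreover have "\<bar>x - w\<bar> \<le> \<bar>x - y\<bar> + \<bar>y - z\<bar> + \<bar>z - w\<bar>" for x y z w :: real by linarith
    from this[of "?A / real n" "\<mu> * ?I" "?B / real n" "\<mu> * ?C"]
    have "\<bar>?A / real n - \<mu> * ?I\<bar> \<le> \<bar>?A / real n - ?B / real n\<bar> + \<bar>?B / real n - \<mu> * ?C\<bar> + \<bar>\<mu> * ?C - \<mu> * ?I\<bar>" .
    ultimately show ?case using 1 3 elim(1) unfolding 2[symmetric] real_norm_def by linarith
  qed
  then show "\<exists>no. \<forall>n\<ge>no. norm ((\<Sum>i=1..n. w i * g (real i / real n)) / real n -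
      \<mu> * (LINT t:{0..1}|lborel. g t)) < \<epsilon>"
    by (simp add: eventually_sequentially)
qed

section \<open>Pairs of large noise values\<close>

context heavy_tailed_noise
begin

text \<open>For each fixed \<open>k\<close> eventually \<open>r n \<le> n div k\<close>, and the
  sums grow with their upper limit; so the double limit in D' becomes a single limit along
  \<open>r\<close>.\<close>

lemma D'_sum:
  fixes r :: "nat \<Rightarrow> nat"
  assumes r: "(\<lambda>n. real (r n) / real n) \<longlonglongrightarrow> 0" and x: "x > 0"
  shows "(\<lambda>n. real n * (\<Sum>i=2..r n. measure M {\<omega> \<in> space M. \<bar>Z 1 \<omega>\<bar> / a n > x \<and> \<bar>Z (int i) \<omega>\<bar> / a n > x})) \<longlonglongrightarrow> 0"
proof -
  define f where "f n k = real n * (\<Sum>i=2..k. measure M {\<omega> \<in> space M. \<bar>Z 1 \<omega>\<bar> / a n > x \<and> \<bar>Z (int i) \<omega>\<bar> / a n > x})" for n k :: nat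
  have f0: "0 \<le> f n k" for n k unfolding f_def by (intro mult_nonneg_nonneg sum_nonneg) auto
  have fm: "f n k \<le> f n k'" if "k \<le> k'" for n k k'
    unfolding f_def using that by (intro mult_left_mono sum_mono2) auto
  have lim: "(\<lambda>k. limsup (\<lambda>n. ereal (f n (n div k)))) \<longlonglongrightarrow> 0"
    using D' x by (simp add: condition_D'_def f_def)
  have "(\<lambda>n. f n (r n)) \<longlonglongrightarrow> 0"
  proof (rule order_tendstoI)
    fix l :: real assume "l < 0"
    then show "eventually (\<lambda>n. l < f n (r n)) sequentially"
      by (intro always_eventually allI) (rule less_le_trans[OF _ f0])
  next
    fix u :: real assume "0 < u"
    then have "eventually (\<lambda>k. limsup (\<lambda>n. ereal (f n (n div k))) < ereal u) sequentially"
      using lim by (intro order_tendstoD) (auto simp: zero_ereal_def)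
    then have "eventually (\<lambda>k. limsup (\<lambda>n. ereal (f n (n div k))) < ereal u \<and> k > 0) sequentially"
      using eventually_gt_at_top[of 0] by (rule eventually_conj)
    then obtain k where k: "limsup (\<lambda>n. ereal (f n (n div k))) < ereal u" "k > 0"
      by (auto simp: eventually_sequentially)
    have "eventually (\<lambda>n. ereal (f n (n div k)) < ereal u) sequentially"
      using k(1) by (rule Limsup_lessD)
    moreover have "eventually (\<lambda>n. real (r n) / real n < 1 / real k) sequentially"
      using r k(2) by (intro order_tendstoD) auto
    ultimately show "eventually (\<lambda>n. f n (r n) < u) sequentially"
      using eventually_gt_at_top[of 0]
    proof eventually_elim
      case (elim n)
      then have "real (r n) * real k < real n" using k(2) by (simp add: field_simps)
      then have "r n * k \<le> n" unfolding of_nat_mult[symmetric] of_nat_less_iff by simp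
      then have "r n \<le> n div k" using k(2) by (simp add: less_eq_div_iff_mult_less_eq)
      then have "f n (r n) \<le> f n (n div k)" by (rule fm)
      then show ?case using elim(1) by simp
    qed
  qed
  then show ?thesis by (simp add: f_def)
qed

definition pairp :: "real \<Rightarrow> nat \<Rightarrow> nat \<Rightarrow> real" where
  "pairp x n d = measure M {\<omega> \<in> space M. \<bar>Z 1 \<omega>\<bar> > x * a n \<and> \<bar>Z (1 + int d) \<omega>\<bar> > x * a n}"

lemma pairp_nonneg: "0 \<le> pairp x n d" by (simp add: pairp_def)

lemma prob_pair:
  "measure M {\<omega> \<in> space M. \<bar>Z i \<omega>\<bar> > x * a n \<and> \<bar>Z (i + int d) \<omega>\<bar> > x * a n} = pairp x n d"
  unfolding pairp_def by (rule stationary_two)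

text \<open>Lag \<open>d\<close> corresponds to the index \<open>d + 1\<close> in D', which is
  therefore used with \<open>r n + 1\<close>.\<close>

lemma pairp_sum:
  fixes r :: "nat \<Rightarrow> nat"
  assumes r: "(\<lambda>n. real (r n) / real n) \<longlonglongrightarrow> 0" and x: "x > 0"
  shows "(\<lambda>n. real n * (\<Sum>d=1..r n. pairp x n d)) \<longlonglongrightarrow> 0"
proof -
  have "(\<lambda>n. real (r n) / real n + 1 / real n) \<longlonglongrightarrow> 0 + 0" by (intro tendsto_add r) real_asymp
  then have r': "(\<lambda>n. real (r n + 1) / real n) \<longlonglongrightarrow> 0" by (simp add: add_divide_distrib add.commute)
  have A: "(\<lambda>n. real n * (\<Sum>i=2..r n + 1. measure M {\<omega> \<in> space M. \<bar>Z 1 \<omega>\<bar> / a n > x \<and> \<bar>Z (int i) \<omega>\<bar> / a n > x})) \<longlonglongrightarrow> 0"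
    by (rule D'_sum[OF r' x])
  have B: "eventually (\<lambda>n. real n * (\<Sum>i=2..r n + 1. measure M {\<omega> \<in> space M. \<bar>Z 1 \<omega>\<bar> / a n > x \<and> \<bar>Z (int i) \<omega>\<bar> / a n > x})
      = real n * (\<Sum>d=1..r n. pairp x n d)) sequentially"
    using eventually_ge_at_top[of 1]
  proof eventually_elim
    case (elim n)
    have "(\<Sum>i=2..r n + 1. measure M {\<omega> \<in> space M. \<bar>Z 1 \<omega>\<bar> / a n > x \<and> \<bar>Z (int i) \<omega>\<bar> / a n > x}) =
      (\<Sum>d=1..r n. measure M {\<omega> \<in> space M. \<bar>Z 1 \<omega>\<bar> / a n > x \<and> \<bar>Z (int (d + 1)) \<omega>\<bar> / a n > x})"
      by (rule sum.reindex_bij_witness[of _ "\<lambda>d. d + 1" "\<lambda>i. i - 1"]) auto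
    then show ?case using a_pos[OF elim] by (simp add: pairp_def pos_less_divide_eq)
  qed
  show ?thesis using Lim_transform_eventually[OF A B] .
qed

end

section \<open>Exceedances of the scaled noise\<close>

locale scaled_heavy_noise = heavy_tailed_noise +
  fixes \<sigma> :: "int \<Rightarrow> real" and \<beta>1 \<beta>2 s :: real
  assumes \<beta>1: "0 < \<beta>1" and \<sigma>_ge: "\<And>i. \<beta>1 \<le> \<sigma> i" and \<sigma>_le: "\<And>i. \<sigma> i \<le> \<beta>2" and s: "s > 0"
    and \<sigma>_mean: "(\<lambda>n. (\<Sum>i=1..n. \<sigma> (int i) powr \<alpha>) / real n) \<longlonglongrightarrow> s powr \<alpha>"
begin

lemma \<sigma>_pos: "0 < \<sigma> i" using \<beta>1 \<sigma>_ge[of i] by linarith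

lemma \<beta>2_pos: "0 < \<beta>2" using \<sigma>_pos[of 1] \<sigma>_le[of 1] by linarith

text \<open>The multipliers stay in a fixed interval, so \<open>n\<close> times each probability is
  uniformly close to \<open>w\<close> times the power of the multiplier. The resulting weighted
  averages are handled by \<open>cesaro_weighted_integral\<close>.\<close>

lemma exceedance_sum:
  assumes lim: "((\<lambda>x. measure M {\<omega> \<in> space M. X \<omega> > x} / tailp x) \<longlongrightarrow> w) at_top"
    and X: "X \<in> borel_measurable M"
    and g: "continuous_on {0..1} g" and g0: "\<And>t. t \<in> {0..1} \<Longrightarrow> 0 \<le> g t"
  shows "(\<lambda>n. \<Sum>i=1..n. measure M {\<omega> \<in> space M. (\<sigma> (int i) * g (real i / real n)) * X \<omega> > a n})
    \<longlonglongrightarrow> s powr \<alpha> * (w * (LINT t:{0..1}|lborel. g t powr \<alpha>))"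
proof -
  have "compact (g ` {0..1})" using g by (intro compact_continuous_image) auto
  then obtain B where B: "\<And>t. t \<in> {0..1} \<Longrightarrow> g t \<le> B"
    using compact_imp_bounded[of "g ` {0..1}"] bounded_imp_bdd_above by (fastforce simp: bdd_above_def)
  have B0: "0 \<le> B" using g0[of 0] B[of 0] by simp
  define T where "T = \<beta>2 * B + 1"
  have T: "0 < T" using \<beta>2_pos B0 by (simp add: T_def add_nonneg_pos)
  have range: "\<sigma> (int i) * g (real i / real n) \<in> {0..T}" if "i \<in> {1..n}" for i n
  proof -
    have t: "real i / real n \<in> {0..1}" using that by auto
    have "\<sigma> (int i) * g (real i / real n) \<le> \<beta>2 * B"
      using \<sigma>_le \<sigma>_pos[of "int i"] g0[OF t] B[OF t] \<beta>2_pos by (intro mult_mono) auto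
    then show ?thesis using \<sigma>_pos[of "int i"] g0[OF t] by (simp add: T_def)
  qed
  have gp: "continuous_on {0..1} (\<lambda>t. g t powr \<alpha>)"
    using g g0 alpha by (intro continuous_on_powr') (auto intro: continuous_intros)
  let ?P = "\<lambda>n. \<Sum>i=1..n. measure M {\<omega> \<in> space M. (\<sigma> (int i) * g (real i / real n)) * X \<omega> > a n}"
  let ?A = "\<lambda>n. w * ((\<Sum>i=1..n. \<sigma> (int i) powr \<alpha> * g (real i / real n) powr \<alpha>) / real n)"
  have A: "?A \<longlonglongrightarrow> w * (s powr \<alpha> * (LINT t:{0..1}|lborel. g t powr \<alpha>))"
    by (intro tendsto_mult tendsto_const cesaro_weighted_integral \<sigma>_mean gp) simp
  have "(\<lambda>n. ?P n - ?A n) \<longlonglongrightarrow> 0"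
  proof (rule LIMSEQ_I)
    fix e :: real assume e: "0 < e"
    have "eventually (\<lambda>n. \<forall>\<tau>\<in>{0..T}. \<bar>real n * measure M {\<omega> \<in> space M. \<tau> * X \<omega> > a n} - w * \<tau> powr \<alpha>\<bar> < e / 2) sequentially"
      using e by (intro n_scaled_uniform[OF lim X T]) simp
    then have "eventually (\<lambda>n. norm (?P n - ?A n - 0) < e) sequentially"
      using eventually_gt_at_top[of 0]
    proof eventually_elim
      case (elim n)
      have "?A n = (\<Sum>i=1..n. w * (\<sigma> (int i) * g (real i / real n)) powr \<alpha> / real n)"
        using \<sigma>_pos g0 by (simp add: sum_distrib_left sum_divide_distrib powr_mult less_imp_le)
      then have "\<bar>?P n - ?A n\<bar> = \<bar>\<Sum>i=1..n. measure M {\<omega> \<in> space M. (\<sigma> (int i) * g (real i / real n)) * X \<omega> > a n}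
          - w * (\<sigma> (int i) * g (real i / real n)) powr \<alpha> / real n\<bar>"
        by (simp add: sum_subtractf)
      also have "\<dots> \<le> (\<Sum>i=1..n. (e / 2) / real n)"
      proof (rule order_trans[OF sum_abs sum_mono])
        fix i assume "i \<in> {1..n}"
        from elim(1)[rule_format, OF range[OF this]]
        have *: "\<bar>real n * measure M {\<omega> \<in> space M. (\<sigma> (int i) * g (real i / real n)) * X \<omega> > a n}
          - w * (\<sigma> (int i) * g (real i / real n)) powr \<alpha>\<bar> / real n \<le> (e / 2) / real n"
          by (intro divide_right_mono) auto
        have **: "\<bar>real n * x - y\<bar> / real n = \<bar>x - y / real n\<bar>" for x y
        proof -
          have "x - y / real n = (real n * x - y) / real n" using elim(2) by (simp add: diff_divide_distrib)
          then show ?thesis by (simp only: abs_divide abs_of_nat)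
        qed
        show "\<bar>measure M {\<omega> \<in> space M. (\<sigma> (int i) * g (real i / real n)) * X \<omega> > a n}
          - w * (\<sigma> (int i) * g (real i / real n)) powr \<alpha> / real n\<bar> \<le> (e / 2) / real n"
          using * unfolding ** .
      qed
      also have "\<dots> = e / 2" using elim(2) by simp
      finally show ?case using e by simp
    qed
    then show "\<exists>no. \<forall>n\<ge>no. norm (?P n - ?A n - 0) < e" by (simp add: eventually_sequentially)
  qed
  from tendsto_add[OF this A] show ?thesis by (simp add: mult_ac)
qed

end

section \<open>Test functions on the punctured extended line\<close>

lemma lipschitz_continuous_map_induced:
  fixes h :: "'a \<Rightarrow> real"
  assumes "\<And>x y. x \<in> S \<Longrightarrow> y \<in> S \<Longrightarrow> \<bar>h x - h y\<bar> \<le> d x y"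
  shows "continuous_map (induced_topology S d) euclideanreal h"
  unfolding continuous_map_def openin_induced_topology topspace_induced_topology
proof (intro conjI allI impI)
  fix U :: "real set" assume "openin euclidean U"
  then have U: "open U" by simp
  show "\<forall>x\<in>{x \<in> S. h x \<in> U}. \<exists>e>0. \<forall>y\<in>S. d x y < e \<longrightarrow> y \<in> {x \<in> S. h x \<in> U}"
  proof
    fix x assume x: "x \<in> {x \<in> S. h x \<in> U}"
    then obtain e where e: "e > 0" "\<And>z. dist z (h x) < e \<Longrightarrow> z \<in> U" using U by (auto simp: open_dist)
    have "h y \<in> U" if "y \<in> S" "d x y < e" for y
      using assms[of x y] x that by (intro e(2)) (auto simp: dist_real_def abs_minus_commute)
    then show "\<exists>e>0. \<forall>y\<in>S. d x y < e \<longrightarrow> y \<in> {x \<in> S. h x \<in> U}" using e(1) by auto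
  qed
qed auto

lemma lipschitz_continuous_map_into_induced:
  fixes k :: "real \<Rightarrow> 'a"
  assumes "\<And>x. x \<in> A \<Longrightarrow> k x \<in> S" "\<And>x y. x \<in> A \<Longrightarrow> y \<in> A \<Longrightarrow> d (k x) (k y) \<le> \<bar>x - y\<bar>"
  shows "continuous_map (top_of_set A) (induced_topology S d) k"
  unfolding continuous_map_def openin_induced_topology topspace_induced_topology
proof (intro conjI allI impI)
  fix U assume U: "U \<subseteq> S \<and> (\<forall>x\<in>U. \<exists>e>0. \<forall>y\<in>S. d x y < e \<longrightarrow> y \<in> U)"
  show "openin (top_of_set A) {x \<in> topspace (top_of_set A). k x \<in> U}"
    unfolding openin_euclidean_subtopology_iff
  proof (intro conjI ballI)
    fix x assume x: "x \<in> {x \<in> topspace (top_of_set A). k x \<in> U}"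
    then obtain e where e: "e > 0" "\<And>y. y \<in> S \<Longrightarrow> d (k x) y < e \<Longrightarrow> y \<in> U" using U by auto
    have "k y \<in> U" if "y \<in> A" "dist y x < e" for y
      using assms(2)[of x y] x that assms(1) by (intro e(2)) (auto simp: dist_real_def abs_minus_commute)
    then show "\<exists>e>0. \<forall>x'\<in>A. dist x' x < e \<longrightarrow> x' \<in> {x \<in> topspace (top_of_set A). k x \<in> U}"
      using e(1) by auto
  qed auto
qed (use assms in auto)

definition inv_modulus :: "ereal \<Rightarrow> real" where
  "inv_modulus y = real_of_ereal (1 / \<bar>y\<bar>)"

definition sign_real :: "ereal \<Rightarrow> real" where
  "sign_real y = real_of_ereal (sgn y)"

text \<open>Inverse moduli in \<open>[0, D]\<close> parametrise each sign class isometrically, with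
  0 corresponding to an infinite point; the set is thus a union of two images of a compact
  interval.\<close>

lemma compactin_inv_modulus:
  "compactin (induced_topology punctured_ereal rho) {y \<in> punctured_ereal. inv_modulus y \<le> D}"
proof -
  define k where "k = (\<lambda>w. if w = 0 then \<infinity> else ereal (1 / w))"
  have rho_k: "rho (k x) (k y) = \<bar>x - y\<bar>" "rho (- k x) (- k y) = \<bar>x - y\<bar>" if "x \<ge> 0" "y \<ge> 0" for x y
    using that by (auto simp: rho_def k_def sgn_if one_ereal_def zero_ereal_def)
  have k: "k x \<in> punctured_ereal" "- k x \<in> punctured_ereal" for x
    by (auto simp: k_def punctured_ereal_def zero_ereal_def)
  have comp: "compactin (induced_topology punctured_ereal rho) (f ` {0..D})"
    if "continuous_map (top_of_set {0..D}) (induced_topology punctured_ereal rho) f" for f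
    by (rule image_compactin[OF _ that]) (simp add: compactin_subtopology)
  have "compactin (induced_topology punctured_ereal rho) (k ` {0..D} \<union> (\<lambda>x. - k x) ` {0..D})"
    using k rho_k by (intro compactin_Un comp lipschitz_continuous_map_into_induced) auto
  moreover have "{y \<in> punctured_ereal. inv_modulus y \<le> D} = k ` {0..D} \<union> (\<lambda>x. - k x) ` {0..D}"
  proof (intro equalityI subsetI)
    fix y assume y: "y \<in> {y \<in> punctured_ereal. inv_modulus y \<le> D}"
    show "y \<in> k ` {0..D} \<union> (\<lambda>x. - k x) ` {0..D}"
    proof (cases y)
      case (real r)
      then have r: "r \<noteq> 0" "1 / \<bar>r\<bar> \<le> D"
        using y by (auto simp: punctured_ereal_def inv_modulus_def one_ereal_def zero_ereal_def)
      then have D: "1 / \<bar>r\<bar> \<in> {0..D}" by simp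
      show ?thesis
      proof (cases "r > 0")
        case True
        then have "y = k (1 / \<bar>r\<bar>)" using real by (simp add: k_def)
        then show ?thesis using D by blast
      next
        case False
        then have "y = - k (1 / \<bar>r\<bar>)" using real r(1) by (simp add: k_def)
        then show ?thesis using D by blast
      qed
    next
      case PInf
      then have "0 \<in> {0..D}" "y = k 0" using y by (auto simp: inv_modulus_def k_def)
      then show ?thesis by blast
    next
      case MInf
      then have "0 \<in> {0..D}" "y = - k 0" using y by (auto simp: inv_modulus_def k_def)
      then show ?thesis by blast
    qed
  next
    fix y assume "y \<in> k ` {0..D} \<union> (\<lambda>x. - k x) ` {0..D}"
    then obtain x where x: "0 \<le> x" "x \<le> D" "y = k x \<or> y = - k x" by auto
    then have "inv_modulus y = x" by (auto simp: inv_modulus_def k_def one_ereal_def)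
    moreover have "y \<in> punctured_ereal" using x(3) k[of x] by auto
    ultimately show "y \<in> {y \<in> punctured_ereal. inv_modulus y \<le> D}" using x(2) by simp
  qed
  ultimately show ?thesis by simp
qed

text \<open>The value is the reciprocal of the height of the barrier: \<open>y\<close> crosses when
  its modulus exceeds \<open>1 / gp t\<close> or \<open>1 / gm t\<close>, depending on its
  sign.\<close>

definition barrier_level :: "(real \<Rightarrow> real) \<Rightarrow> (real \<Rightarrow> real) \<Rightarrow> real \<Rightarrow> real \<Rightarrow> real" where
  "barrier_level gp gm t y = (if 0 < y then gp t else gm t)"

text \<open>The level is an affine function of the sign, and the threshold is compared with \<open>1/|y|\<close>; both
  are Lipschitz for \<^const>\<open>rho\<close>, also at \<open>\<plusminus>\<infinity>\<close>. The case split at \<open>y = 0\<close> is needed because \<open>1 / 0 = \<infinity>\<close>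
  has real part \<open>0\<close>.\<close>

definition barrier_test :: "real \<Rightarrow> real \<Rightarrow> (real \<Rightarrow> real) \<Rightarrow> (real \<Rightarrow> real) \<Rightarrow> real \<times> ereal \<Rightarrow> real" where
  "barrier_test \<Lambda> \<epsilon> gp gm v = (if snd v = 0 then 0 else
     \<Lambda> * max 0 (min 1 ((gp (fst v) * ((1 + sign_real (snd v)) / 2) + gm (fst v) * ((1 - sign_real (snd v)) / 2)
       - inv_modulus (snd v)) / \<epsilon>)))"

text \<open>A common bound \<open>D\<close> of the levels puts the support into
  \<open>{0..1}\<close> times the compact set of points with inverse modulus at most
  \<open>D\<close>. The Hausdorff property makes this product closed, so it contains the closure as
  well.\<close>

lemma barrier_test_CK_plus:
  assumes \<Lambda>: "0 \<le> \<Lambda>" and \<epsilon>: "0 < \<epsilon>" and gp: "continuous_on {0..1} gp" and gm: "continuous_on {0..1} gm"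
  shows "barrier_test \<Lambda> \<epsilon> gp gm \<in> CK_plus"
proof -
  let ?R = "induced_topology punctured_ereal rho" and ?I = "top_of_set {0..1 :: real}"
  let ?T = "time_space_topology"
  have cw: "continuous_map ?R euclideanreal inv_modulus" and cs: "continuous_map ?R euclideanreal sign_real"
    by (auto intro!: lipschitz_continuous_map_induced simp: rho_def inv_modulus_def sign_real_def)
  have snd': "continuous_map ?T ?R snd" and fst': "continuous_map ?T ?I fst"
    unfolding time_space_topology_def by (rule continuous_map_snd continuous_map_fst)+
  have c1: "continuous_map ?T euclideanreal (\<lambda>v. inv_modulus (snd v))"
    "continuous_map ?T euclideanreal (\<lambda>v. sign_real (snd v))"
    using continuous_map_compose[OF snd' cw] continuous_map_compose[OF snd' cs] by (simp_all add: o_def)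
  have c2: "continuous_map ?T euclideanreal (\<lambda>v. gp (fst v))" "continuous_map ?T euclideanreal (\<lambda>v. gm (fst v))"
    using continuous_map_compose[OF fst', of euclideanreal gp] continuous_map_compose[OF fst', of euclideanreal gm] gp gm
    by (simp_all add: o_def)
  have top: "topspace ?T = {0..1} \<times> punctured_ereal"
    by (simp add: time_space_topology_def topspace_induced_topology)
  have cont: "continuous_map ?T euclideanreal (barrier_test \<Lambda> \<epsilon> gp gm)"
  proof (rule continuous_map_eq)
    show "continuous_map ?T euclideanreal (\<lambda>v. \<Lambda> * max 0 (min 1 ((gp (fst v) * ((1 + sign_real (snd v)) / 2)
      + gm (fst v) * ((1 - sign_real (snd v)) / 2) - inv_modulus (snd v)) / \<epsilon>)))"
      using \<epsilon> c1 c2 by (intro continuous_intros) auto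
  qed (auto simp: top punctured_ereal_def barrier_test_def)
  have "compact (gp ` {0..1})" "compact (gm ` {0..1})" using gp gm by (auto intro: compact_continuous_image)
  then have "bdd_above (gp ` {0..1} \<union> gm ` {0..1})"
    by (auto intro!: bounded_imp_bdd_above compact_imp_bounded)
  then obtain D where "\<And>x. x \<in> gp ` {0..1} \<union> gm ` {0..1} \<Longrightarrow> x \<le> D" by (auto simp: bdd_above_def)
  then have D: "gp t \<le> D" "gm t \<le> D" if "t \<in> {0..1}" for t using that by auto
  define K where "K = {0..1 :: real} \<times> {y \<in> punctured_ereal. inv_modulus y \<le> D}"
  have "compactin ?T K"
    unfolding K_def time_space_topology_def compactin_Times
    by (intro disjI2 conjI compactin_inv_modulus) (simp add: compactin_subtopology)
  moreover have "Hausdorff_space ?T"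
    unfolding time_space_topology_def Hausdorff_space_prod_topology
    using Metric_space.Hausdorff_space_mtopology[OF Metric_space_rho]
    by (intro disjI2 conjI) (auto simp: induced_topology_eq_mtopology[OF Metric_space_rho] Hausdorff_space_subtopology)
  ultimately have "closedin ?T K" by (intro compactin_imp_closedin)
  moreover have "{v \<in> topspace ?T. barrier_test \<Lambda> \<epsilon> gp gm v \<noteq> 0} \<subseteq> K"
  proof clarify
    fix t y assume v: "(t, y) \<in> topspace ?T" and ne: "barrier_test \<Lambda> \<epsilon> gp gm (t, y) \<noteq> 0"
    have y: "y \<in> punctured_ereal" and t: "t \<in> {0..1}" using v by (auto simp: top)
    have sg: "sign_real y = 1 \<or> sign_real y = - 1"
      using y by (cases y) (auto simp: sign_real_def sgn_if punctured_ereal_def zero_ereal_def one_ereal_def)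
    have "0 < (gp t * ((1 + sign_real y) / 2) + gm t * ((1 - sign_real y) / 2) - inv_modulus y) / \<epsilon>"
      using ne by (auto simp: barrier_test_def max_def split: if_splits)
    then have "inv_modulus y < gp t * ((1 + sign_real y) / 2) + gm t * ((1 - sign_real y) / 2)"
      using \<epsilon> by (simp add: zero_less_divide_iff)
    also have "\<dots> \<le> D" using sg D[OF t] by auto
    finally show "(t, y) \<in> K" using t y by (simp add: K_def)
  qed
  ultimately have "?T closure_of {v \<in> topspace ?T. barrier_test \<Lambda> \<epsilon> gp gm v \<noteq> 0} \<subseteq> K"
    by (intro closure_of_minimal)
  then have "compactin ?T (?T closure_of {v \<in> topspace ?T. barrier_test \<Lambda> \<epsilon> gp gm v \<noteq> 0})"
    by (rule closed_compactin[OF \<open>compactin ?T K\<close> _ closedin_closure_of])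
  then show ?thesis
    using cont \<Lambda> by (auto simp: CK_plus_def barrier_test_def)
qed

lemma barrier_test_nonneg: "0 \<le> \<Lambda> \<Longrightarrow> 0 \<le> barrier_test \<Lambda> \<epsilon> gp gm v"
  by (simp add: barrier_test_def)

lemma barrier_test_real:
  assumes "y \<noteq> 0"
  shows "barrier_test \<Lambda> \<epsilon> gp gm (t, ereal y) = \<Lambda> * max 0 (min 1 ((barrier_level gp gm t y - 1 / \<bar>y\<bar>) / \<epsilon>))"
proof -
  have "sign_real (ereal y) = (if 0 < y then 1 else - 1)" "inv_modulus (ereal y) = 1 / \<bar>y\<bar>"
    using assms by (auto simp: sign_real_def inv_modulus_def sgn_if zero_ereal_def one_ereal_def)
  then show ?thesis using assms by (simp add: barrier_test_def barrier_level_def zero_ereal_def)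
qed

text \<open>With \<open>barrier_test_saturated\<close> this forms a sandwich: the test function
  vanishes unless the barrier is crossed, and it takes its full height \<open>\<Lambda>\<close> once
  the barrier with reciprocal smaller by \<open>\<epsilon>\<close> is crossed.\<close>

lemma barrier_test_support:
  assumes "barrier_test \<Lambda> \<epsilon> gp gm (t, ereal y) \<noteq> 0" "0 < \<epsilon>"
  shows "1 < barrier_level gp gm t y * \<bar>y\<bar>"
proof -
  have y: "y \<noteq> 0" using assms by (auto simp: barrier_test_def zero_ereal_def)
  then have "0 < (barrier_level gp gm t y - 1 / \<bar>y\<bar>) / \<epsilon>"
    using assms(1) by (auto simp: barrier_test_real max_def split: if_splits)
  then have "1 / \<bar>y\<bar> < barrier_level gp gm t y" using assms(2) by (simp add: zero_less_divide_iff)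
  then show ?thesis using y by (simp add: pos_divide_less_eq)
qed

lemma barrier_test_saturated:
  assumes "1 < (barrier_level gp gm t y - \<epsilon>) * \<bar>y\<bar>" "0 < \<epsilon>"
  shows "barrier_test \<Lambda> \<epsilon> gp gm (t, ereal y) = \<Lambda>"
proof -
  have y: "y \<noteq> 0" using assms by auto
  then have "1 / \<bar>y\<bar> \<le> barrier_level gp gm t y - \<epsilon>"
    using assms(1) by (simp add: pos_divide_le_eq)
  then have "1 \<le> (barrier_level gp gm t y - 1 / \<bar>y\<bar>) / \<epsilon>" using assms(2) by (simp add: pos_le_divide_eq)
  then show ?thesis using y by (simp add: barrier_test_real)
qed

lemma barrier_test_measurable:
  assumes "X \<in> borel_measurable M"
  shows "(\<lambda>\<omega>. barrier_test \<Lambda> \<epsilon> gp gm (t, ereal (X \<omega>))) \<in> borel_measurable M"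
proof -
  have "(\<lambda>\<omega>. barrier_test \<Lambda> \<epsilon> gp gm (t, ereal (X \<omega>))) =
    (\<lambda>\<omega>. if X \<omega> = 0 then 0 else \<Lambda> * max 0 (min 1 (((if 0 < X \<omega> then gp t else gm t) - 1 / \<bar>X \<omega>\<bar>) / \<epsilon>)))"
  proof
    fix \<omega>
    show "barrier_test \<Lambda> \<epsilon> gp gm (t, ereal (X \<omega>)) = (if X \<omega> = 0 then 0
        else \<Lambda> * max 0 (min 1 (((if 0 < X \<omega> then gp t else gm t) - 1 / \<bar>X \<omega>\<bar>) / \<epsilon>)))"
      by (cases "X \<omega> = 0") (simp_all add: barrier_test_real barrier_level_def, simp add: barrier_test_def zero_ereal_def)
  qed
  then show ?thesis using assms by simp
qed

section \<open>Crossings of a moving barrier by the noise\<close>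

lemma prod_one_minus_lower:
  fixes u :: "nat \<Rightarrow> real"
  assumes "\<And>i. 0 \<le> u i" "\<And>i. u i \<le> 1"
  shows "1 - (\<Sum>i=1..r. u i) \<le> (\<Prod>i=1..r. 1 - u i)"
proof (induction r)
  case (Suc r)
  have "0 \<le> u (Suc r) * (\<Sum>i=1..r. u i)" using assms by (intro mult_nonneg_nonneg sum_nonneg)
  then have "1 - (\<Sum>i=1..Suc r. u i) \<le> (1 - (\<Sum>i=1..r. u i)) * (1 - u (Suc r))"
    by (simp add: algebra_simps)
  also have "\<dots> \<le> (\<Prod>i=1..r. 1 - u i) * (1 - u (Suc r))"
    using Suc assms by (intro mult_right_mono) auto
  finally show ?case by simp
qed simp

text \<open>The second Bonferroni inequality, \<open>prod_one_minus_lower\<close> being the first.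
  The pair terms are those that D' makes negligible.\<close>

lemma prod_one_minus_upper:
  fixes u :: "nat \<Rightarrow> real"
  assumes "\<And>i. 0 \<le> u i" "\<And>i. u i \<le> 1"
  shows "(\<Prod>i=1..r. 1 - u i) \<le> 1 - (\<Sum>i=1..r. u i) + (\<Sum>j=1..r. \<Sum>i=1..<j. u i * u j)"
proof (induction r)
  case (Suc r)
  have "u (Suc r) * (1 - (\<Sum>i=1..r. u i)) \<le> u (Suc r) * (\<Prod>i=1..r. 1 - u i)"
    using assms by (intro mult_left_mono prod_one_minus_lower)
  moreover have "(\<Sum>i=1..<Suc r. u i * u (Suc r)) = u (Suc r) * (\<Sum>i=1..r. u i)"
    by (simp add: sum_distrib_left mult.commute atLeastLessThanSuc_atLeastAtMost)
  moreover have "(\<Sum>j=1..Suc r. \<Sum>i=1..<j. u i * u j) = (\<Sum>j=1..r. \<Sum>i=1..<j. u i * u j) + (\<Sum>i=1..<Suc r. u i * u (Suc r))"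
    by simp
  moreover have "(\<Prod>i=1..Suc r. 1 - u i) = (\<Prod>i=1..r. 1 - u i) - u (Suc r) * (\<Prod>i=1..r. 1 - u i)"
    by (simp add: algebra_simps)
  moreover have "(\<Sum>i=1..Suc r. u i) = (\<Sum>i=1..r. u i) + u (Suc r)" by simp
  ultimately show ?case using Suc by (simp only: right_diff_distrib mult_1_right)
qed simp

lemma sum_blocks:
  fixes f :: "nat \<Rightarrow> real"
  shows "(\<Sum>k=1..K. \<Sum>i=1..r. f (i + (k - 1) * r)) = (\<Sum>i=1..K * r. f i)"
proof (induction K)
  case (Suc K)
  have "(\<Sum>i=1..Suc K * r. f i) = (\<Sum>i=1..K * r. f i) + (\<Sum>i=K * r + 1..K * r + r. f i)"
    using sum.ub_add_nat[of 1 "K * r" f r] by (simp add: add.commute)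
  also have "(\<Sum>i=K * r + 1..K * r + r. f i) = (\<Sum>i=1..r. f (i + K * r))"
    using sum.shift_bounds_cl_nat_ivl[of f 1 "K * r" r] by (simp add: add.commute)
  finally show ?case using Suc by simp
qed simp

text \<open>A squeeze with a parameter: \<open>n\<close> goes to infinity first for fixed
  \<open>N\<close>, and the gap closes only as \<open>N\<close> grows.\<close>

lemma tendsto_by_bounds:
  fixes x :: "nat \<Rightarrow> real"
  assumes ub: "\<And>N. eventually (\<lambda>n. x n \<le> ub N n) sequentially" "\<And>N. (\<lambda>n. ub N n) \<longlonglongrightarrow> U N" "U \<longlonglongrightarrow> l"
    and lb: "\<And>N. eventually (\<lambda>n. lb N n \<le> x n) sequentially" "\<And>N. (\<lambda>n. lb N n) \<longlonglongrightarrow> B N" "B \<longlonglongrightarrow> l"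
  shows "x \<longlonglongrightarrow> l"
proof (rule order_tendstoI)
  fix y assume "y < l"
  then obtain N :: nat where "y < B N" using order_tendstoD(1)[OF lb(3)] by (auto simp: eventually_sequentially)
  then have "eventually (\<lambda>n. y < lb N n) sequentially" using order_tendstoD(1)[OF lb(2)] by blast
  then show "eventually (\<lambda>n. y < x n) sequentially" using lb(1)[of N] by eventually_elim simp
next
  fix y assume "l < y"
  then obtain N :: nat where "U N < y" using order_tendstoD(2)[OF ub(3)] by (auto simp: eventually_sequentially)
  then have "eventually (\<lambda>n. ub N n < y) sequentially" using order_tendstoD(2)[OF ub(2)] by blast
  then show "eventually (\<lambda>n. x n < y) sequentially" using ub(1)[of N] by eventually_elim simp
qed

text \<open>Dominated convergence. Measurability is asked after multiplication by the indicator,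
  since barriers are known to be continuous on \<open>{0..1}\<close> only.\<close>

lemma powr_integral_tendsto:
  fixes h :: "nat \<Rightarrow> real \<Rightarrow> real" and \<alpha> :: real
  assumes \<alpha>: "0 < \<alpha>"
    and m: "\<And>N. (\<lambda>t. indicator {0..1} t * h N t) \<in> borel_measurable borel"
    and m0: "(\<lambda>t. indicator {0..1} t * h0 t) \<in> borel_measurable borel"
    and bound: "\<And>N t. t \<in> {0..1} \<Longrightarrow> 0 \<le> h N t \<and> h N t \<le> B"
    and lim: "AE t in lborel. t \<in> {0..1} \<longrightarrow> (\<lambda>N. h N t) \<longlonglongrightarrow> h0 t"
  shows "(\<lambda>N. LINT t:{0..1}|lborel. h N t powr \<alpha>) \<longlonglongrightarrow> (LINT t:{0..1}|lborel. h0 t powr \<alpha>)"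
proof -
  have ind: "indicator {0..1} t *\<^sub>R f t powr \<alpha> = (indicator {0..1} t * f t) powr \<alpha>" for f :: "real \<Rightarrow> real" and t
    by (auto simp: indicator_def)
  show ?thesis
    unfolding set_lebesgue_integral_def
  proof (rule integral_dominated_convergence[where w = "\<lambda>t. indicator {0..1} t *\<^sub>R B powr \<alpha>"])
    show "(\<lambda>t. indicator {0..1} t *\<^sub>R h0 t powr \<alpha>) \<in> borel_measurable lborel"
      unfolding ind using m0 by simp
    show "(\<lambda>t. indicator {0..1} t *\<^sub>R h N t powr \<alpha>) \<in> borel_measurable lborel" for N
      unfolding ind using m[of N] by simp
    show "integrable lborel (\<lambda>t. indicator {0..1 :: real} t *\<^sub>R B powr \<alpha>)" by simp
    show "AE t in lborel. (\<lambda>N. indicator {0..1} t *\<^sub>R h N t powr \<alpha>) \<longlonglongrightarrow> indicator {0..1} t *\<^sub>R h0 t powr \<alpha>"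
      using lim
    proof eventually_elim
      case (elim t)
      show ?case
      proof (cases "t \<in> {0..1}")
        case True
        then have "(\<lambda>N. h N t powr \<alpha>) \<longlonglongrightarrow> h0 t powr \<alpha>"
          using elim \<alpha> bound by (intro tendsto_powr') (auto intro!: always_eventually)
        then show ?thesis using True by simp
      qed simp
    qed
    show "AE t in lborel. norm (indicator {0..1} t *\<^sub>R h N t powr \<alpha>) \<le> indicator {0..1} t *\<^sub>R B powr \<alpha>" for N
      using bound \<alpha> by (auto simp: indicator_def intro!: AE_I2 powr_mono2)
  qed
qed

lemma continuous_indicator_measurable:
  "continuous_on {0..1} g \<Longrightarrow> (\<lambda>t. indicator {0..1} t * g t) \<in> borel_measurable borel" for g :: "real \<Rightarrow> real"
  using borel_measurable_continuous_on_indicator[of "{0..1}" g] by simp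

section \<open>Crossing events and their expected number\<close>

context scaled_heavy_noise
begin

text \<open>The product form makes a level of 0 uncrossable. The time \<open>t\<close> is separate
  from the index \<open>i\<close> because A' evaluates test functions at one common time per
  block.\<close>

definition crossing :: "(real \<Rightarrow> real) \<Rightarrow> (real \<Rightarrow> real) \<Rightarrow> nat \<Rightarrow> real \<Rightarrow> int \<Rightarrow> 'a set" where
  "crossing gp gm n t i = {\<omega> \<in> space M.
     1 < barrier_level gp gm t (\<sigma> i * Z i \<omega> / a n) * \<bar>\<sigma> i * Z i \<omega> / a n\<bar>}"

lemma crossing_sets [measurable]: "crossing gp gm n t i \<in> sets M"
  unfolding crossing_def barrier_level_def by measurable

text \<open>A level that is not positive is never crossed, so only positive parts need to be
  compared.\<close>

lemma crossing_mono:
  assumes "gp t \<le> max 0 (gp' t')" "gm t \<le> max 0 (gm' t')"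
  shows "crossing gp gm n t i \<subseteq> crossing gp' gm' n t' i"
proof -
  have "1 < barrier_level gp' gm' t' y * \<bar>y\<bar>" if "1 < barrier_level gp gm t y * \<bar>y\<bar>" for y
  proof -
    have "0 < barrier_level gp gm t y" using that by (smt (verit) mult_nonpos_nonneg abs_ge_zero)
    then have "barrier_level gp gm t y \<le> barrier_level gp' gm' t' y"
      using assms by (auto simp: barrier_level_def split: if_splits)
    then have "barrier_level gp gm t y * \<bar>y\<bar> \<le> barrier_level gp' gm' t' y * \<bar>y\<bar>" by (intro mult_right_mono) auto
    then show ?thesis using that by linarith
  qed
  then show ?thesis unfolding crossing_def by blast
qed

text \<open>Replaces events about the barrier by exceedances of a fixed multiple of
  \<open>a n\<close>, the form to which D' and the tail asymptotics apply.\<close>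

lemma crossing_large:
  assumes n: "n \<ge> 1" and B: "0 < B" "gp t \<le> B" "gm t \<le> B"
  shows "crossing gp gm n t i \<subseteq> {\<omega> \<in> space M. \<bar>Z i \<omega>\<bar> > 1 / (B * \<beta>2) * a n}"
proof
  fix \<omega> assume \<omega>: "\<omega> \<in> crossing gp gm n t i"
  let ?y = "\<sigma> i * Z i \<omega> / a n"
  have an: "0 < a n" using a_pos[OF n] .
  have "1 < barrier_level gp gm t ?y * \<bar>?y\<bar>" using \<omega> by (simp add: crossing_def)
  also have "\<dots> \<le> B * \<bar>?y\<bar>" using B by (intro mult_right_mono) (auto simp: barrier_level_def)
  also have "\<dots> = B * \<sigma> i * \<bar>Z i \<omega>\<bar> / a n" using an \<sigma>_pos[of i] by (simp add: abs_mult abs_divide)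
  also have "\<dots> \<le> B * \<beta>2 * \<bar>Z i \<omega>\<bar> / a n"
    using an B \<sigma>_le[of i] by (intro divide_right_mono mult_right_mono mult_left_mono) auto
  finally have "1 / (B * \<beta>2) * a n < \<bar>Z i \<omega>\<bar>"
    using an B \<beta>2_pos by (simp add: field_simps)
  then show "\<omega> \<in> {\<omega> \<in> space M. \<bar>Z i \<omega>\<bar> > 1 / (B * \<beta>2) * a n}" using \<omega> by (simp add: crossing_def)
qed

text \<open>Positive and negative crossings exclude each other, since a positive threshold fixes the
  sign of \<open>Z i\<close>.\<close>

lemma crossing_prob:
  assumes n: "n \<ge> 1" and g: "0 \<le> gp t" "0 \<le> gm t"
  shows "measure M (crossing gp gm n t i) =
    measure M {\<omega> \<in> space M. (\<sigma> i * gp t) * Z 1 \<omega> > a n} + measure M {\<omega> \<in> space M. (\<sigma> i * gm t) * (- Z 1 \<omega>) > a n}"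
proof -
  have an: "0 < a n" using a_pos[OF n] .
  let ?A = "{\<omega> \<in> space M. (\<sigma> i * gp t) * Z i \<omega> > a n}" and ?B = "{\<omega> \<in> space M. (\<sigma> i * gm t) * (- Z i \<omega>) > a n}"
  have neg: "\<not> a n < \<sigma> i * g * z" if "0 \<le> g" "z \<le> 0" for g z
    using that \<sigma>_pos[of i] an mult_nonneg_nonpos[of "\<sigma> i * g" z] by auto
  have "crossing gp gm n t i = ?A \<union> ?B"
  proof -
    have "1 < barrier_level gp gm t (\<sigma> i * z / a n) * \<bar>\<sigma> i * z / a n\<bar> \<longleftrightarrow>
        a n < (\<sigma> i * gp t) * z \<or> a n < (\<sigma> i * gm t) * (- z)" for z
    proof (cases "z > 0")
      case True
      then have "0 < \<sigma> i * z / a n" using an \<sigma>_pos[of i] by simp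
      then have "1 < barrier_level gp gm t (\<sigma> i * z / a n) * \<bar>\<sigma> i * z / a n\<bar> \<longleftrightarrow> a n < (\<sigma> i * gp t) * z"
        using an by (simp add: barrier_level_def pos_less_divide_eq mult_ac)
      then show ?thesis using neg[OF g(2), of "- z"] True by auto
    next
      case False
      then have "\<not> 0 < \<sigma> i * z / a n" using an \<sigma>_pos[of i] by (auto simp: not_less divide_nonpos_pos mult_nonneg_nonpos)
      moreover have "\<bar>\<sigma> i * z / a n\<bar> = \<sigma> i * (- z) / a n"
        using False an \<sigma>_pos[of i] by (simp add: abs_mult abs_divide)
      ultimately have "1 < barrier_level gp gm t (\<sigma> i * z / a n) * \<bar>\<sigma> i * z / a n\<bar> \<longleftrightarrow> 1 < gm t * (\<sigma> i * (- z) / a n)"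
        by (simp add: barrier_level_def)
      also have "gm t * (\<sigma> i * (- z) / a n) = ((\<sigma> i * gm t) * (- z)) / a n" by (simp add: mult_ac)
      also have "1 < \<dots> \<longleftrightarrow> a n < (\<sigma> i * gm t) * (- z)" using an by (subst pos_less_divide_eq) auto
      finally show ?thesis using neg[OF g(1), of z] False by auto
    qed
    then show ?thesis by (auto simp: crossing_def)
  qed
  moreover have "?A \<inter> ?B = {}"
  proof (rule ccontr)
    assume "?A \<inter> ?B \<noteq> {}"
    then obtain \<omega> where "a n < (\<sigma> i * gp t) * Z i \<omega>" "a n < (\<sigma> i * gm t) * (- Z i \<omega>)" by auto
    then show False using neg[OF g(1), of "Z i \<omega>"] neg[OF g(2), of "- Z i \<omega>"] by (cases "Z i \<omega> \<le> 0") auto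
  qed
  ultimately have "measure M (crossing gp gm n t i) = measure M ?A + measure M ?B"
    by (simp add: finite_measure_Union)
  also have "measure M ?A = measure M {\<omega> \<in> space M. (\<sigma> i * gp t) * Z 1 \<omega> > a n}"
    by (rule stationary_one) measurable
  also have "measure M ?B = measure M {\<omega> \<in> space M. (\<sigma> i * gm t) * (- Z 1 \<omega>) > a n}"
    by (rule stationary_one) measurable
  finally show ?thesis .
qed

text \<open>The mass beyond the barrier under the limit intensity of the points formed by
  \<open>i / n\<close> and \<open>\<sigma> i * Z i / a n\<close>: at time \<open>t\<close> the tails
  at \<open>1 / gp t\<close> and \<open>1 / gm t\<close> are \<open>p * gp t powr \<alpha>\<close>
  and \<open>q * gm t powr \<alpha>\<close>, times the averaged scale
  \<open>s powr \<alpha>\<close>.\<close>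

definition crossing_rate :: "(real \<Rightarrow> real) \<Rightarrow> (real \<Rightarrow> real) \<Rightarrow> real" where
  "crossing_rate gp gm = s powr \<alpha> * (p * (LINT t:{0..1}|lborel. gp t powr \<alpha>) + q * (LINT t:{0..1}|lborel. gm t powr \<alpha>))"

lemma crossing_sum:
  assumes gp: "continuous_on {0..1} gp" "\<And>t. t \<in> {0..1} \<Longrightarrow> 0 \<le> gp t"
    and gm: "continuous_on {0..1} gm" "\<And>t. t \<in> {0..1} \<Longrightarrow> 0 \<le> gm t"
  shows "(\<lambda>n. \<Sum>i=1..n. measure M (crossing gp gm n (real i / real n) (int i))) \<longlonglongrightarrow> crossing_rate gp gm"
proof -
  have lp: "((\<lambda>x. measure M {\<omega> \<in> space M. Z 1 \<omega> > x} / tailp x) \<longlongrightarrow> p) at_top"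
    using right_tail by (simp add: tailp_def)
  have "{\<omega> \<in> space M. - Z 1 \<omega> > x} = {\<omega> \<in> space M. Z 1 \<omega> < - x}" for x by auto
  then have lq: "((\<lambda>x. measure M {\<omega> \<in> space M. - Z 1 \<omega> > x} / tailp x) \<longlongrightarrow> q) at_top"
    using left_tail by (simp add: tailp_def)
  have A: "(\<lambda>n. (\<Sum>i=1..n. measure M {\<omega> \<in> space M. (\<sigma> (int i) * gp (real i / real n)) * Z 1 \<omega> > a n}) +
      (\<Sum>i=1..n. measure M {\<omega> \<in> space M. (\<sigma> (int i) * gm (real i / real n)) * (- Z 1 \<omega>) > a n}))
    \<longlonglongrightarrow> s powr \<alpha> * (p * (LINT t:{0..1}|lborel. gp t powr \<alpha>)) + s powr \<alpha> * (q * (LINT t:{0..1}|lborel. gm t powr \<alpha>))"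
    by (intro tendsto_add exceedance_sum lp lq gp gm) auto
  have "(\<Sum>i=1..n. measure M (crossing gp gm n (real i / real n) (int i))) =
      (\<Sum>i=1..n. measure M {\<omega> \<in> space M. (\<sigma> (int i) * gp (real i / real n)) * Z 1 \<omega> > a n}) +
      (\<Sum>i=1..n. measure M {\<omega> \<in> space M. (\<sigma> (int i) * gm (real i / real n)) * (- Z 1 \<omega>) > a n})" for n
    unfolding sum.distrib[symmetric] by (intro sum.cong refl crossing_prob gp gm) auto
  then show ?thesis using A by (simp add: crossing_rate_def distrib_left)
qed

end

section \<open>Laplace functionals of a single block\<close>

locale mixing_noise = scaled_heavy_noise +
  assumes A': "condition_A' M (\<lambda>i \<omega>. \<sigma> i * Z i \<omega>) a" and p_nonneg: "0 \<le> p" and q_nonneg: "0 \<le> q"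
begin

definition test_value :: "real \<Rightarrow> real \<Rightarrow> (real \<Rightarrow> real) \<Rightarrow> (real \<Rightarrow> real) \<Rightarrow> nat \<Rightarrow> real \<Rightarrow> int \<Rightarrow> 'a \<Rightarrow> real" where
  "test_value \<Lambda> \<epsilon> gp gm n t i \<omega> = barrier_test \<Lambda> \<epsilon> gp gm (t, ereal (\<sigma> i * Z i \<omega> / a n))"

lemma test_value_measurable [measurable]: "test_value \<Lambda> \<epsilon> gp gm n t i \<in> borel_measurable M"
  unfolding test_value_def by (rule barrier_test_measurable) measurable

text \<open>Turns the Laplace functional of a block into the mean of a product of factors
  \<open>1 - u\<close> with \<open>u\<close> in \<open>[0, 1]\<close>, the form required by the
  Bonferroni inequalities.\<close>

definition test_defect :: "real \<Rightarrow> real \<Rightarrow> (real \<Rightarrow> real) \<Rightarrow> (real \<Rightarrow> real) \<Rightarrow> nat \<Rightarrow> real \<Rightarrow> int \<Rightarrow> 'a \<Rightarrow> real" where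
  "test_defect \<Lambda> \<epsilon> gp gm n t i \<omega> = 1 - exp (- test_value \<Lambda> \<epsilon> gp gm n t i \<omega>)"

lemma test_defect_measurable [measurable]: "test_defect \<Lambda> \<epsilon> gp gm n t i \<in> borel_measurable M"
  unfolding test_defect_def by measurable

context
  fixes \<Lambda> \<epsilon> :: real and gp gm :: "real \<Rightarrow> real"
  assumes \<Lambda>: "0 \<le> \<Lambda>" and \<epsilon>: "0 < \<epsilon>"
begin

lemma test_value_nonneg: "0 \<le> test_value \<Lambda> \<epsilon> gp gm n t i \<omega>"
  unfolding test_value_def using \<Lambda> by (rule barrier_test_nonneg)

lemma test_defect_bounds: "0 \<le> test_defect \<Lambda> \<epsilon> gp gm n t i \<omega>" "test_defect \<Lambda> \<epsilon> gp gm n t i \<omega> \<le> 1"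
  using test_value_nonneg[of n t i \<omega>] by (auto simp: test_defect_def)

lemma test_defect_le:
  assumes "\<omega> \<in> space M"
  shows "test_defect \<Lambda> \<epsilon> gp gm n t i \<omega> \<le> indicator (crossing gp gm n t i) \<omega>"
proof (cases "test_value \<Lambda> \<epsilon> gp gm n t i \<omega> = 0")
  case False
  then have "\<omega> \<in> crossing gp gm n t i"
    using assms barrier_test_support[OF _ \<epsilon>] unfolding test_value_def crossing_def by blast
  then show ?thesis using test_defect_bounds by simp
qed (simp add: test_defect_def)

lemma test_defect_ge:
  assumes "\<omega> \<in> space M"
  shows "(1 - exp (- \<Lambda>)) * indicator (crossing (\<lambda>t. gp t - \<epsilon>) (\<lambda>t. gm t - \<epsilon>) n t i) \<omega> \<le> test_defect \<Lambda> \<epsilon> gp gm n t i \<omega>"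
proof (cases "\<omega> \<in> crossing (\<lambda>t. gp t - \<epsilon>) (\<lambda>t. gm t - \<epsilon>) n t i")
  case True
  have "barrier_level (\<lambda>t. gp t - \<epsilon>) (\<lambda>t. gm t - \<epsilon>) t y = barrier_level gp gm t y - \<epsilon>" for y
    by (simp add: barrier_level_def)
  then have "test_value \<Lambda> \<epsilon> gp gm n t i \<omega> = \<Lambda>"
    using True barrier_test_saturated[OF _ \<epsilon>] by (simp add: crossing_def test_value_def)
  then show ?thesis using True by (simp add: test_defect_def)
qed (use test_defect_bounds in auto)

lemma block_exp: "exp (- (\<Sum>i=1..r. test_value \<Lambda> \<epsilon> gp gm n t (int (i + m)) \<omega>)) = (\<Prod>i=1..r. 1 - test_defect \<Lambda> \<epsilon> gp gm n t (int (i + m)) \<omega>)"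
  by (simp add: test_defect_def exp_sum sum_negf[symmetric])

lemma test_defect_integrable: "integrable M (test_defect \<Lambda> \<epsilon> gp gm n t i)"
  using test_defect_bounds by (intro integrable_const_bound[of _ 1]) auto

lemma block_exp_integrable: "integrable M (\<lambda>\<omega>. exp (- (\<Sum>i=1..r. test_value \<Lambda> \<epsilon> gp gm n t (int (i + m)) \<omega>)))"
  using test_value_nonneg by (intro integrable_const_bound[of _ 1]) (auto intro!: sum_nonneg)

lemma block_lower:
  "1 - (\<Sum>i=1..r. measure M (crossing gp gm n t (int (i + m)))) \<le>
    (\<integral>\<omega>. exp (- (\<Sum>i=1..r. test_value \<Lambda> \<epsilon> gp gm n t (int (i + m)) \<omega>)) \<partial>M)"
proof -
  have "1 - (\<Sum>i=1..r. measure M (crossing gp gm n t (int (i + m)))) =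
    (\<integral>\<omega>. 1 - (\<Sum>i=1..r. indicator (crossing gp gm n t (int (i + m))) \<omega>) \<partial>M)"
    by (simp add: prob_space emeasure_eq_measure)
  also have "\<dots> \<le> (\<integral>\<omega>. exp (- (\<Sum>i=1..r. test_value \<Lambda> \<epsilon> gp gm n t (int (i + m)) \<omega>)) \<partial>M)"
  proof (rule integral_mono)
    show "integrable M (\<lambda>\<omega>. exp (- (\<Sum>i=1..r. test_value \<Lambda> \<epsilon> gp gm n t (int (i + m)) \<omega>)))"
      by (rule block_exp_integrable)
    fix \<omega> assume \<omega>: "\<omega> \<in> space M"
    have "(\<Sum>i=1..r. test_defect \<Lambda> \<epsilon> gp gm n t (int (i + m)) \<omega>) \<le> (\<Sum>i=1..r. indicator (crossing gp gm n t (int (i + m))) \<omega>)"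
      using test_defect_le[OF \<omega>] by (rule sum_mono)
    then show "1 - (\<Sum>i=1..r. indicator (crossing gp gm n t (int (i + m))) \<omega>) \<le>
        exp (- (\<Sum>i=1..r. test_value \<Lambda> \<epsilon> gp gm n t (int (i + m)) \<omega>))"
      unfolding block_exp
      using prod_one_minus_lower[of "\<lambda>i. test_defect \<Lambda> \<epsilon> gp gm n t (int (i + m)) \<omega>" r] test_defect_bounds by fastforce
  qed (simp add: emeasure_eq_measure)
  finally show ?thesis .
qed

text \<open>Second-order Bonferroni inside one block: every index has fewer than \<open>r\<close>
  earlier partners, so the pair terms sum to at most \<open>r\<close> times the sum over the lags.
  The exponential form lets the bounds multiply over the blocks.\<close>

lemma block_upper:
  assumes n: "n \<ge> 1" and B: "0 < B" "gp t \<le> B" "gm t \<le> B"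
  shows "(\<integral>\<omega>. exp (- (\<Sum>i=1..r. test_value \<Lambda> \<epsilon> gp gm n t (int (i + m)) \<omega>)) \<partial>M) \<le>
    exp (- ((1 - exp (- \<Lambda>)) * (\<Sum>i=1..r. measure M (crossing (\<lambda>t. gp t - \<epsilon>) (\<lambda>t. gm t - \<epsilon>) n t (int (i + m)))))
      + real r * (\<Sum>d=1..r. pairp (1 / (B * \<beta>2)) n d))"
proof -
  let ?u = "\<lambda>i. test_defect \<Lambda> \<epsilon> gp gm n t (int (i + m))"
  let ?w = "1 / (B * \<beta>2)"
  let ?C = "\<lambda>i. crossing (\<lambda>t. gp t - \<epsilon>) (\<lambda>t. gm t - \<epsilon>) n t (int (i + m))"
  have iuu: "integrable M (\<lambda>\<omega>. ?u i \<omega> * ?u j \<omega>)" for i j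
    using test_defect_bounds by (intro integrable_const_bound[of _ 1]) (auto simp: abs_mult mult_le_one)
  have pair: "(\<integral>\<omega>. ?u i \<omega> * ?u j \<omega> \<partial>M) \<le> pairp ?w n (j - i)" if "i < j" for i j
  proof -
    let ?P = "{\<omega> \<in> space M. \<bar>Z (int (i + m)) \<omega>\<bar> > ?w * a n \<and> \<bar>Z (int (i + m) + int (j - i)) \<omega>\<bar> > ?w * a n}"
    have ji: "int (i + m) + int (j - i) = int (j + m)" using that by simp
    have "(\<integral>\<omega>. ?u i \<omega> * ?u j \<omega> \<partial>M) \<le> (\<integral>\<omega>. indicator ?P \<omega> \<partial>M)"
    proof (rule integral_mono[OF iuu])
      show "integrable M (indicator ?P :: 'a \<Rightarrow> real)" by (simp add: emeasure_eq_measure)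
      fix \<omega> assume \<omega>: "\<omega> \<in> space M"
      have "?u i \<omega> * ?u j \<omega> \<le> indicator (crossing gp gm n t (int (i + m))) \<omega> * indicator (crossing gp gm n t (int (j + m))) \<omega>"
        using test_defect_bounds test_defect_le[OF \<omega>] by (intro mult_mono) auto
      also have "\<dots> \<le> indicator ?P \<omega>"
        using crossing_large[OF n B(1), of gp t gm] B(2,3) \<omega> unfolding ji by (auto simp: indicator_def)
      finally show "?u i \<omega> * ?u j \<omega> \<le> indicator ?P \<omega>" .
    qed
    also have "(\<integral>\<omega>. indicator ?P \<omega> \<partial>M) = measure M ?P" by (simp add: Int_absorb2 subset_eq)
    also have "\<dots> = pairp ?w n (j - i)" by (rule prob_pair)
    finally show ?thesis .
  qed
  have pairs: "(\<Sum>j=1..r. \<Sum>i=1..<j. \<integral>\<omega>. ?u i \<omega> * ?u j \<omega> \<partial>M) \<le> real r * (\<Sum>d=1..r. pairp ?w n d)"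
  proof -
    have "(\<Sum>i=1..<j. \<integral>\<omega>. ?u i \<omega> * ?u j \<omega> \<partial>M) \<le> (\<Sum>d=1..r. pairp ?w n d)" if j: "j \<in> {1..r}" for j
    proof -
      have "(\<Sum>i=1..<j. \<integral>\<omega>. ?u i \<omega> * ?u j \<omega> \<partial>M) \<le> (\<Sum>i=1..<j. pairp ?w n (j - i))"
        by (intro sum_mono pair) auto
      also have "\<dots> = (\<Sum>d=1..<j. pairp ?w n d)"
        by (rule sum.reindex_bij_witness[of _ "\<lambda>d. j - d" "\<lambda>i. j - i"]) auto
      also have "\<dots> \<le> (\<Sum>d=1..r. pairp ?w n d)" using j by (intro sum_mono2) (auto simp: pairp_nonneg)
      finally show ?thesis .
    qed
    then have "(\<Sum>j=1..r. \<Sum>i=1..<j. \<integral>\<omega>. ?u i \<omega> * ?u j \<omega> \<partial>M) \<le> (\<Sum>j=1..r. (\<Sum>d=1..r. pairp ?w n d))" by (rule sum_mono)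
    then show ?thesis by simp
  qed
  have single: "(1 - exp (- \<Lambda>)) * (\<Sum>i=1..r. measure M (?C i)) \<le> (\<Sum>i=1..r. \<integral>\<omega>. ?u i \<omega> \<partial>M)"
    unfolding sum_distrib_left
  proof (rule sum_mono)
    fix i
    have "(1 - exp (- \<Lambda>)) * measure M (?C i) = (\<integral>\<omega>. (1 - exp (- \<Lambda>)) * indicator (?C i) \<omega> \<partial>M)" by simp
    also have "\<dots> \<le> (\<integral>\<omega>. ?u i \<omega> \<partial>M)"
      by (intro integral_mono test_defect_integrable test_defect_ge) (simp_all add: emeasure_eq_measure)
    finally show "(1 - exp (- \<Lambda>)) * measure M (?C i) \<le> (\<integral>\<omega>. ?u i \<omega> \<partial>M)" .
  qed
  have "(\<integral>\<omega>. exp (- (\<Sum>i=1..r. test_value \<Lambda> \<epsilon> gp gm n t (int (i + m)) \<omega>)) \<partial>M) \<le>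
    (\<integral>\<omega>. 1 - (\<Sum>i=1..r. ?u i \<omega>) + (\<Sum>j=1..r. \<Sum>i=1..<j. ?u i \<omega> * ?u j \<omega>) \<partial>M)"
    unfolding block_exp
  proof (rule integral_mono)
    show "integrable M (\<lambda>\<omega>. \<Prod>i=1..r. 1 - ?u i \<omega>)" using block_exp_integrable unfolding block_exp .
    show "(\<Prod>i=1..r. 1 - ?u i \<omega>) \<le> 1 - (\<Sum>i=1..r. ?u i \<omega>) + (\<Sum>j=1..r. \<Sum>i=1..<j. ?u i \<omega> * ?u j \<omega>)" for \<omega>
      by (rule prod_one_minus_upper) (rule test_defect_bounds)+
  qed (intro Bochner_Integration.integrable_add Bochner_Integration.integrable_diff Bochner_Integration.integrable_sum
      test_defect_integrable iuu integrable_const)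
  also have "\<dots> = 1 - (\<Sum>i=1..r. \<integral>\<omega>. ?u i \<omega> \<partial>M) + (\<Sum>j=1..r. \<Sum>i=1..<j. \<integral>\<omega>. ?u i \<omega> * ?u j \<omega> \<partial>M)"
  proof -
    have i1: "integrable M (\<lambda>\<omega>. 1 - (\<Sum>i=1..r. ?u i \<omega>))"
      by (intro Bochner_Integration.integrable_diff Bochner_Integration.integrable_sum test_defect_integrable integrable_const)
    have i2: "integrable M (\<lambda>\<omega>. \<Sum>j=1..r. \<Sum>i=1..<j. ?u i \<omega> * ?u j \<omega>)"
      by (intro Bochner_Integration.integrable_sum iuu)
    have i3: "integrable M (\<lambda>\<omega>. \<Sum>i=1..r. ?u i \<omega>)"
      by (intro Bochner_Integration.integrable_sum test_defect_integrable)
    have e1: "(\<integral>\<omega>. (\<Sum>i=1..r. ?u i \<omega>) \<partial>M) = (\<Sum>i=1..r. \<integral>\<omega>. ?u i \<omega> \<partial>M)"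
      by (intro Bochner_Integration.integral_sum test_defect_integrable)
    have "(\<integral>\<omega>. (\<Sum>j=1..r. \<Sum>i=1..<j. ?u i \<omega> * ?u j \<omega>) \<partial>M) = (\<Sum>j=1..r. \<integral>\<omega>. (\<Sum>i=1..<j. ?u i \<omega> * ?u j \<omega>) \<partial>M)"
      by (intro Bochner_Integration.integral_sum Bochner_Integration.integrable_sum iuu)
    also have "\<dots> = (\<Sum>j=1..r. \<Sum>i=1..<j. \<integral>\<omega>. ?u i \<omega> * ?u j \<omega> \<partial>M)"
      by (intro sum.cong refl Bochner_Integration.integral_sum iuu)
    finally have e2: "(\<integral>\<omega>. (\<Sum>j=1..r. \<Sum>i=1..<j. ?u i \<omega> * ?u j \<omega>) \<partial>M) = (\<Sum>j=1..r. \<Sum>i=1..<j. \<integral>\<omega>. ?u i \<omega> * ?u j \<omega> \<partial>M)" .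
    show ?thesis
      unfolding Bochner_Integration.integral_add[OF i1 i2] Bochner_Integration.integral_diff[OF integrable_const i3] e1 e2
      by (simp add: prob_space)
  qed
  also have "\<dots> \<le> 1 + (- ((1 - exp (- \<Lambda>)) * (\<Sum>i=1..r. measure M (?C i))) + real r * (\<Sum>d=1..r. pairp ?w n d))"
    using single pairs by linarith
  also have "\<dots> \<le> exp (- ((1 - exp (- \<Lambda>)) * (\<Sum>i=1..r. measure M (?C i))) + real r * (\<Sum>d=1..r. pairp ?w n d))"
    by (rule exp_ge_add_one_self)
  finally show ?thesis .
qed

end

end

lemma continuous_uniform_bound:
  fixes g :: "real \<Rightarrow> real"
  assumes "continuous_on {0..1} g"
  obtains B where "0 < B" "\<And>t. t \<in> {0..1} \<Longrightarrow> \<bar>g t\<bar> \<le> B"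
proof -
  have "bounded (g ` {0..1})"
    using assms by (intro compact_imp_bounded compact_continuous_image) auto
  then obtain B where "B > 0" "\<forall>x\<in>g ` {0..1}. norm x \<le> B" unfolding bounded_pos by blast
  then show thesis by (intro that[of B]) auto
qed

lemma continuous_uniform_modulus:
  fixes g :: "real \<Rightarrow> real"
  assumes "continuous_on {0..1} g" "0 < e"
  obtains d where "0 < d" "\<And>t t'. t \<in> {0..1} \<Longrightarrow> t' \<in> {0..1} \<Longrightarrow> \<bar>t - t'\<bar> < d \<Longrightarrow> \<bar>g t - g t'\<bar> < e"
proof -
  have "uniformly_continuous_on {0..1} g" using assms(1) by (rule compact_uniformly_continuous) simp
  then show thesis using that assms(2) unfolding uniformly_continuous_on_def dist_real_def by meson
qed

section \<open>From blocks to the whole sample\<close>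

context mixing_noise
begin

definition uncrossed :: "(real \<Rightarrow> real) \<Rightarrow> (real \<Rightarrow> real) \<Rightarrow> nat \<Rightarrow> 'a set" where
  "uncrossed gp gm n = {\<omega> \<in> space M. \<forall>i\<in>{1..n}. \<omega> \<notin> crossing gp gm n (real i / real n) (int i)}"

lemma uncrossed_sets [measurable]: "uncrossed gp gm n \<in> sets M"
proof -
  have "uncrossed gp gm n = space M - (\<Union>i\<in>{1..n}. crossing gp gm n (real i / real n) (int i))"
    by (auto simp: uncrossed_def)
  then show ?thesis by simp
qed

definition block_index :: "(nat \<Rightarrow> nat) \<Rightarrow> bool" where
  "block_index r \<longleftrightarrow> (\<forall>n. r n > 0) \<and> (\<lambda>n. real (r n) / real n) \<longlonglongrightarrow> 0"

definition mixing_error :: "(nat \<Rightarrow> nat) \<Rightarrow> real \<Rightarrow> real \<Rightarrow> (real \<Rightarrow> real) \<Rightarrow> (real \<Rightarrow> real) \<Rightarrow> nat \<Rightarrow> real" where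
  "mixing_error r \<Lambda> \<epsilon> gp gm n =
     (\<integral>\<omega>. exp (- (\<Sum>i=1..n. test_value \<Lambda> \<epsilon> gp gm n (real i / real n) (int i) \<omega>)) \<partial>M) -
     (\<Prod>k=1..n div r n. \<integral>\<omega>. exp (- (\<Sum>i=1..r n. test_value \<Lambda> \<epsilon> gp gm n (real (k * r n) / real n)
        (int (i + (k - 1) * r n)) \<omega>)) \<partial>M)"

lemma mixing:
  obtains r where "block_index r"
    "\<And>\<Lambda> \<epsilon> gp gm. 0 \<le> \<Lambda> \<Longrightarrow> 0 < \<epsilon> \<Longrightarrow> continuous_on {0..1} gp \<Longrightarrow> continuous_on {0..1} gm \<Longrightarrow>
      mixing_error r \<Lambda> \<epsilon> gp gm \<longlonglongrightarrow> 0"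
  using A' barrier_test_CK_plus
  unfolding condition_A'_def mixing_error_def test_value_def block_index_def
  by blast

lemma block_time:
  assumes "block_index r" "k \<in> {1..n div r n}" "i \<in> {1..r n}"
  shows "real (k * r n) / real n \<in> {0..1}" "real (i + (k - 1) * r n) / real n \<in> {0..1}"
    and "\<bar>real (k * r n) / real n - real (i + (k - 1) * r n) / real n\<bar> \<le> real (r n) / real n"
proof -
  have r: "r n > 0" using assms(1) by (simp add: block_index_def)
  have "k * r n \<le> n" using assms(2) r by (simp add: less_eq_div_iff_mult_less_eq)
  moreover have kr: "k * r n = r n + (k - 1) * r n" using assms(2) by (cases k) auto
  moreover have "i + (k - 1) * r n \<le> k * r n" unfolding kr using assms(3) by simp
  moreover have "n > 0" using assms(2) by (cases "n = 0") auto
  ultimately show "real (k * r n) / real n \<in> {0..1}" "real (i + (k - 1) * r n) / real n \<in> {0..1}"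
    by (auto simp: pos_divide_le_eq simp flip: of_nat_mult of_nat_add)
  have "\<bar>real (k * r n) - real (i + (k - 1) * r n)\<bar> \<le> real (r n)"
    unfolding kr using assms(3) by simp
  then show "\<bar>real (k * r n) / real n - real (i + (k - 1) * r n) / real n\<bar> \<le> real (r n) / real n"
    by (simp add: diff_divide_distrib[symmetric] divide_right_mono)
qed

lemma crossing_le_tailp:
  assumes "n \<ge> 1" "0 < B" "gp t \<le> B" "gm t \<le> B"
  shows "measure M (crossing gp gm n t i) \<le> tailp (1 / (B * \<beta>2) * a n)"
proof -
  have "measure M (crossing gp gm n t i) \<le> measure M {\<omega> \<in> space M. \<bar>Z i \<omega>\<bar> > 1 / (B * \<beta>2) * a n}"
    using crossing_large[where gp = gp and gm = gm and t = t, OF assms] by (rule finite_measure_mono) simp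
  then show ?thesis by (simp only: tailp_Z)
qed

text \<open>The mean number of exceedances in one block vanishes, because a block is a vanishing
  fraction of the sample.\<close>

lemma block_tailp_tendsto:
  assumes "block_index r" "x > 0"
  shows "(\<lambda>n. real (r n) * tailp (x * a n)) \<longlonglongrightarrow> 0"
proof -
  have "(\<lambda>n. real (r n) / real n * (real n * tailp (x * a n))) \<longlonglongrightarrow> 0 * x powr (- \<alpha>)"
    using assms n_tailp[OF assms(2)] by (intro tendsto_mult) (auto simp: block_index_def)
  then have A: "(\<lambda>n. real (r n) / real n * (real n * tailp (x * a n))) \<longlonglongrightarrow> 0" by simp
  have B: "eventually (\<lambda>n. real (r n) / real n * (real n * tailp (x * a n)) = real (r n) * tailp (x * a n)) sequentially"
    using eventually_gt_at_top[of 0] by eventually_elim simp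
  show ?thesis using Lim_transform_eventually[OF A B] .
qed

text \<open>The reciprocals drop by \<open>2 * \<epsilon>\<close>: once because the test function is
  saturated only beyond the barrier with reciprocal smaller by \<open>\<epsilon>\<close>, once
  because time is frozen inside a block. The factor \<open>1 - exp (- \<Lambda>)\<close> is the
  defect at saturation.\<close>

lemma uncrossed_upper:
  assumes gp: "continuous_on {0..1} gp" and gm: "continuous_on {0..1} gm" and \<Lambda>: "0 \<le> \<Lambda>" and \<epsilon>: "0 < \<epsilon>"
  obtains ub where "eventually (\<lambda>n. measure M (uncrossed gp gm n) \<le> ub n) sequentially"
    "ub \<longlonglongrightarrow> exp (- ((1 - exp (- \<Lambda>)) * crossing_rate (\<lambda>t. max 0 (gp t - 2 * \<epsilon>)) (\<lambda>t. max 0 (gm t - 2 * \<epsilon>))))"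
proof -
  obtain r where r: "block_index r" and mix: "mixing_error r \<Lambda> \<epsilon> gp gm \<longlonglongrightarrow> 0"
    using mixing \<Lambda> \<epsilon> gp gm by metis
  obtain Bp where Bp: "0 < Bp" "\<And>t. t \<in> {0..1} \<Longrightarrow> \<bar>gp t\<bar> \<le> Bp" using continuous_uniform_bound[OF gp] by blast
  obtain Bm where Bm: "0 < Bm" "\<And>t. t \<in> {0..1} \<Longrightarrow> \<bar>gm t\<bar> \<le> Bm" using continuous_uniform_bound[OF gm] by blast
  define B where "B = Bp + Bm"
  have B: "0 < B" "gp t \<le> B" "gm t \<le> B" if "t \<in> {0..1}" for t
    using Bp(2)[OF that] Bm(2)[OF that] Bp(1) Bm(1) by (auto simp: B_def abs_le_iff)
  have B0: "0 < B" using B[of 0] by simp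
  define x where "x = 1 / (B * \<beta>2)"
  have x: "0 < x" using B0 \<beta>2_pos by (simp add: x_def)
  define hp hm where "hp = (\<lambda>t. max 0 (gp t - 2 * \<epsilon>))" and "hm = (\<lambda>t. max 0 (gm t - 2 * \<epsilon>))"
  define h where "h n i = measure M (crossing hp hm n (real i / real n) (int i))" for n i
  define c where "c = 1 - exp (- \<Lambda>)"
  have c: "0 \<le> c" using \<Lambda> by (simp add: c_def)
  have h_sum: "(\<lambda>n. \<Sum>i=1..n. h n i) \<longlonglongrightarrow> crossing_rate hp hm"
    unfolding h_def hp_def hm_def by (intro crossing_sum continuous_intros gp gm) auto
  \<comment> \<open>The term with \<open>tailp\<close> pays for the at most \<open>r n\<close>
    indices after the last complete block.\<close>
  define ub where "ub n = mixing_error r \<Lambda> \<epsilon> gp gm n +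
      exp (- (c * ((\<Sum>i=1..n. h n i) - real (r n) * tailp (x * a n))) + real n * (\<Sum>d=1..r n. pairp x n d))" for n
  have "ub \<longlonglongrightarrow> 0 + exp (- (c * (crossing_rate hp hm - 0)) + 0)"
    unfolding ub_def
    using r x by (intro tendsto_intros mix h_sum block_tailp_tendsto pairp_sum) (auto simp: block_index_def)
  then have lim: "ub \<longlonglongrightarrow> exp (- ((1 - exp (- \<Lambda>)) * crossing_rate hp hm))" by (simp add: c_def)
  obtain dp where dp: "0 < dp" "\<And>t t'. t \<in> {0..1} \<Longrightarrow> t' \<in> {0..1} \<Longrightarrow> \<bar>t - t'\<bar> < dp \<Longrightarrow> \<bar>gp t - gp t'\<bar> < \<epsilon>"
    using continuous_uniform_modulus[OF gp \<epsilon>] by blast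
  obtain dm where dm: "0 < dm" "\<And>t t'. t \<in> {0..1} \<Longrightarrow> t' \<in> {0..1} \<Longrightarrow> \<bar>t - t'\<bar> < dm \<Longrightarrow> \<bar>gm t - gm t'\<bar> < \<epsilon>"
    using continuous_uniform_modulus[OF gm \<epsilon>] by blast
  have "eventually (\<lambda>n. real (r n) / real n < min dp dm) sequentially"
    using r dp(1) dm(1) by (intro order_tendstoD(2)[where y = 0]) (auto simp: block_index_def)
  then have "eventually (\<lambda>n. measure M (uncrossed gp gm n) \<le> ub n) sequentially"
    using eventually_ge_at_top[of 1]
  proof eventually_elim
    case (elim n)
    let ?K = "n div r n"
    have rn: "r n > 0" using r by (simp add: block_index_def)
    let ?E = "\<lambda>k. \<integral>\<omega>. exp (- (\<Sum>i=1..r n. test_value \<Lambda> \<epsilon> gp gm n (real (k * r n) / real n) (int (i + (k - 1) * r n)) \<omega>)) \<partial>M"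
    have "measure M (uncrossed gp gm n) = (\<integral>\<omega>. indicator (uncrossed gp gm n) \<omega> \<partial>M)" by simp
    \<comment> \<open>Without a crossing all test values vanish, so the exponential is 1 on the
      event.\<close>
    also have "\<dots> \<le> (\<integral>\<omega>. exp (- (\<Sum>i=1..n. test_value \<Lambda> \<epsilon> gp gm n (real i / real n) (int i) \<omega>)) \<partial>M)"
    proof (rule integral_mono)
      show "integrable M (\<lambda>\<omega>. exp (- (\<Sum>i=1..n. test_value \<Lambda> \<epsilon> gp gm n (real i / real n) (int i) \<omega>)))"
        using test_value_nonneg[OF \<Lambda> \<epsilon>] by (intro integrable_const_bound[of _ 1]) (auto intro!: sum_nonneg)
      fix \<omega> assume \<omega>: "\<omega> \<in> space M"
      show "indicator (uncrossed gp gm n) \<omega> \<le> exp (- (\<Sum>i=1..n. test_value \<Lambda> \<epsilon> gp gm n (real i / real n) (int i) \<omega>))"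
      proof (cases "\<omega> \<in> uncrossed gp gm n")
        case True
        have "test_value \<Lambda> \<epsilon> gp gm n (real i / real n) (int i) \<omega> = 0" if "i \<in> {1..n}" for i
        proof -
          have "\<omega> \<notin> crossing gp gm n (real i / real n) (int i)" using True that by (auto simp: uncrossed_def)
          then have "test_defect \<Lambda> \<epsilon> gp gm n (real i / real n) (int i) \<omega> = 0"
            using test_defect_le[OF \<Lambda> \<epsilon> \<omega>, of gp gm n "real i / real n" "int i"]
              test_defect_bounds(1)[OF \<Lambda> \<epsilon>, of gp gm n "real i / real n" "int i" \<omega>] by simp
          then show ?thesis by (simp add: test_defect_def)
        qed
        then show ?thesis using True by simp
      qed simp
    qed (simp add: emeasure_eq_measure)
    also have "\<dots> = mixing_error r \<Lambda> \<epsilon> gp gm n + (\<Prod>k=1..?K. ?E k)" by (simp add: mixing_error_def)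
    also have "(\<Prod>k=1..?K. ?E k) \<le> (\<Prod>k=1..?K. exp (- (c * (\<Sum>i=1..r n. h n (i + (k - 1) * r n)))
        + real (r n) * (\<Sum>d=1..r n. pairp x n d)))"
    proof (rule prod_mono, intro conjI)
      fix k assume k: "k \<in> {1..?K}"
      let ?t = "real (k * r n) / real n"
      have t: "?t \<in> {0..1}" using block_time(1)[OF r k, of 1] rn by simp
      have "(\<Sum>i=1..r n. h n (i + (k - 1) * r n)) \<le>
        (\<Sum>i=1..r n. measure M (crossing (\<lambda>t. gp t - \<epsilon>) (\<lambda>t. gm t - \<epsilon>) n ?t (int (i + (k - 1) * r n))))"
        unfolding h_def
      proof (intro sum_mono finite_measure_mono crossing_mono crossing_sets)
        fix i assume i: "i \<in> {1..r n}"
        let ?u = "real (i + (k - 1) * r n) / real n"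
        have u: "?u \<in> {0..1}" "\<bar>?t - ?u\<bar> < dp" "\<bar>?t - ?u\<bar> < dm"
          using block_time(2,3)[OF r k i] elim(1) by auto
        show "hp ?u \<le> max 0 (gp ?t - \<epsilon>)" using dp(2)[OF t u(1,2)] by (auto simp: hp_def max_def abs_less_iff)
        show "hm ?u \<le> max 0 (gm ?t - \<epsilon>)" using dm(2)[OF t u(1,3)] by (auto simp: hm_def max_def abs_less_iff)
      qed
      then have "c * (\<Sum>i=1..r n. h n (i + (k - 1) * r n)) \<le>
        c * (\<Sum>i=1..r n. measure M (crossing (\<lambda>t. gp t - \<epsilon>) (\<lambda>t. gm t - \<epsilon>) n ?t (int (i + (k - 1) * r n))))"
        using c by (rule mult_left_mono)
      moreover note block_upper[where gp = gp and gm = gm and t = ?t and r = "r n" and m = "(k - 1) * r n", OF \<Lambda> \<epsilon> elim(2) B[OF t]]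
      ultimately show "?E k \<le> exp (- (c * (\<Sum>i=1..r n. h n (i + (k - 1) * r n))) + real (r n) * (\<Sum>d=1..r n. pairp x n d))"
        unfolding c_def[symmetric] x_def[symmetric] by (elim order_trans) simp
    qed simp
    also have "\<dots> = exp (- (c * (\<Sum>k=1..?K. \<Sum>i=1..r n. h n (i + (k - 1) * r n))) + real (?K * r n) * (\<Sum>d=1..r n. pairp x n d))"
      unfolding exp_sum[symmetric, OF finite_atLeastAtMost]
      by (simp add: sum_subtractf sum_distrib_left[symmetric] mult.assoc)
    also have "\<dots> \<le> exp (- (c * ((\<Sum>i=1..n. h n i) - real (r n) * tailp (x * a n))) + real n * (\<Sum>d=1..r n. pairp x n d))"
    proof -
      have h_le: "h n i \<le> tailp (x * a n)" if "i \<in> {1..n}" for i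
      proof -
        have t: "real i / real n \<in> {0..1}" using that by auto
        show ?thesis unfolding h_def x_def
          using B[OF t] \<epsilon> by (intro crossing_le_tailp elim(2)) (auto simp: hp_def hm_def)
      qed
      have Kr: "?K * r n \<le> n" by (simp add: mult.commute)
      have "(\<Sum>i=1..n. h n i) = (\<Sum>i=1..?K * r n. h n i) + (\<Sum>i=?K * r n + 1..n. h n i)"
        using sum.ub_add_nat[of 1 "?K * r n" "h n" "n - ?K * r n"] Kr by simp
      also have "(\<Sum>i=?K * r n + 1..n. h n i) \<le> (\<Sum>i=?K * r n + 1..n. tailp (x * a n))"
        by (intro sum_mono h_le) auto
      also have "\<dots> \<le> real (r n) * tailp (x * a n)"
      proof -
        have "n - ?K * r n = n mod r n" by (simp add: minus_div_mult_eq_mod)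
        then have "card {?K * r n + 1..n} \<le> r n" using rn by (simp add: less_imp_le)
        then have "real (card {?K * r n + 1..n}) * tailp (x * a n) \<le> real (r n) * tailp (x * a n)"
          by (intro mult_right_mono tailp_nonneg) (simp only: of_nat_le_iff)
        then show ?thesis by (simp only: sum_constant)
      qed
      finally have "(\<Sum>i=1..n. h n i) - real (r n) * tailp (x * a n) \<le> (\<Sum>k=1..?K. \<Sum>i=1..r n. h n (i + (k - 1) * r n))"
        unfolding sum_blocks by simp
      then have "c * ((\<Sum>i=1..n. h n i) - real (r n) * tailp (x * a n)) \<le> c * (\<Sum>k=1..?K. \<Sum>i=1..r n. h n (i + (k - 1) * r n))"
        using c by (rule mult_left_mono)
      moreover have "real (?K * r n) * (\<Sum>d=1..r n. pairp x n d) \<le> real n * (\<Sum>d=1..r n. pairp x n d)"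
        using Kr by (intro mult_right_mono sum_nonneg pairp_nonneg) (simp only: of_nat_le_iff)
      ultimately show ?thesis unfolding exp_le_cancel_iff by linarith
    qed
    finally show ?case by (simp add: ub_def)
  qed
  then show thesis using lim that unfolding hp_def hm_def by blast
qed

lemma uncrossed_lower:
  assumes gp: "continuous_on {0..1} gp" and gm: "continuous_on {0..1} gm" and \<Lambda>: "0 \<le> \<Lambda>" and \<epsilon>: "0 < \<epsilon>"
    and gp0: "\<And>t. t \<in> {0..1} \<Longrightarrow> 0 \<le> gp t" and gm0: "\<And>t. t \<in> {0..1} \<Longrightarrow> 0 \<le> gm t"
  obtains lb where "eventually (\<lambda>n. lb n \<le> measure M (uncrossed gp gm n)) sequentially"
    "lb \<longlonglongrightarrow> exp (- crossing_rate (\<lambda>t. gp t + 2 * \<epsilon>) (\<lambda>t. gm t + 2 * \<epsilon>)) - exp (- \<Lambda>)"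
proof -
  define fp fm where "fp = (\<lambda>t. gp t + \<epsilon>)" and "fm = (\<lambda>t. gm t + \<epsilon>)"
  have fc: "continuous_on {0..1} fp" "continuous_on {0..1} fm"
    unfolding fp_def fm_def by (intro continuous_intros gp gm)+
  obtain r where r: "block_index r" and mix: "mixing_error r \<Lambda> \<epsilon> fp fm \<longlonglongrightarrow> 0"
    using mixing \<Lambda> \<epsilon> fc by metis
  obtain Bp where Bp: "0 < Bp" "\<And>t. t \<in> {0..1} \<Longrightarrow> \<bar>fp t\<bar> \<le> Bp" using continuous_uniform_bound[OF fc(1)] by blast
  obtain Bm where Bm: "0 < Bm" "\<And>t. t \<in> {0..1} \<Longrightarrow> \<bar>fm t\<bar> \<le> Bm" using continuous_uniform_bound[OF fc(2)] by blast
  define B where "B = Bp + Bm"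
  have B: "0 < B" "fp t \<le> B" "fm t \<le> B" if "t \<in> {0..1}" for t
    using Bp(2)[OF that] Bm(2)[OF that] Bp(1) Bm(1) by (auto simp: B_def abs_le_iff)
  have B0: "0 < B" using B[of 0] by simp
  define x where "x = 1 / (B * \<beta>2)"
  have x: "0 < x" using B0 \<beta>2_pos by (simp add: x_def)
  define hp hm where "hp = (\<lambda>t. gp t + 2 * \<epsilon>)" and "hm = (\<lambda>t. gm t + 2 * \<epsilon>)"
  define h where "h n i = measure M (crossing hp hm n (real i / real n) (int i))" for n i
  have h0: "0 \<le> h n i" for n i by (simp add: h_def)
  have h_sum: "(\<lambda>n. \<Sum>i=1..n. h n i) \<longlonglongrightarrow> crossing_rate hp hm"
    unfolding h_def hp_def hm_def using gp0 gm0 \<epsilon> by (intro crossing_sum continuous_intros gp gm) (auto intro!: add_nonneg_nonneg)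
  define \<rho> where "\<rho> n = real (r n) * tailp (x * a n)" for n
  have \<rho>_lim: "\<rho> \<longlonglongrightarrow> 0" unfolding \<rho>_def by (rule block_tailp_tendsto[OF r x])
  have \<rho>0: "0 \<le> \<rho> n" for n by (simp add: \<rho>_def tailp_nonneg)
  \<comment> \<open>\<open>\<rho> n\<close> bounds the expected number \<open>Q\<close> of crossings
    in a block. Since \<open>1 - Q \<ge> exp (- Q - 2 * Q\<^sup>2)\<close> for
    \<open>Q \<le> 1 / 2\<close>, the quadratic error is absorbed by the factor
    \<open>1 + 2 * \<rho> n\<close>.\<close>
  define lb where "lb n = mixing_error r \<Lambda> \<epsilon> fp fm n + exp (- ((1 + 2 * \<rho> n) * (\<Sum>i=1..n. h n i))) - exp (- \<Lambda>)" for n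
  have "lb \<longlonglongrightarrow> 0 + exp (- ((1 + 2 * 0) * crossing_rate hp hm)) - exp (- \<Lambda>)"
    unfolding lb_def by (intro tendsto_intros mix h_sum \<rho>_lim)
  then have lim: "lb \<longlonglongrightarrow> exp (- crossing_rate hp hm) - exp (- \<Lambda>)" by simp
  obtain dp where dp: "0 < dp" "\<And>t t'. t \<in> {0..1} \<Longrightarrow> t' \<in> {0..1} \<Longrightarrow> \<bar>t - t'\<bar> < dp \<Longrightarrow> \<bar>gp t - gp t'\<bar> < \<epsilon>"
    using continuous_uniform_modulus[OF gp \<epsilon>] by blast
  obtain dm where dm: "0 < dm" "\<And>t t'. t \<in> {0..1} \<Longrightarrow> t' \<in> {0..1} \<Longrightarrow> \<bar>t - t'\<bar> < dm \<Longrightarrow> \<bar>gm t - gm t'\<bar> < \<epsilon>"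
    using continuous_uniform_modulus[OF gm \<epsilon>] by blast
  have "eventually (\<lambda>n. real (r n) / real n < min dp dm) sequentially"
    using r dp(1) dm(1) by (intro order_tendstoD(2)[where y = 0]) (auto simp: block_index_def)
  moreover have "eventually (\<lambda>n. \<rho> n < 1 / 2) sequentially" using \<rho>_lim by (rule order_tendstoD) simp
  ultimately have "eventually (\<lambda>n. lb n \<le> measure M (uncrossed gp gm n)) sequentially"
    using eventually_ge_at_top[of 1]
  proof eventually_elim
    case (elim n)
    let ?K = "n div r n"
    have rn: "r n > 0" using r by (simp add: block_index_def)
    let ?E = "\<lambda>k. \<integral>\<omega>. exp (- (\<Sum>i=1..r n. test_value \<Lambda> \<epsilon> fp fm n (real (k * r n) / real n) (int (i + (k - 1) * r n)) \<omega>)) \<partial>M"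
    have "exp (- ((1 + 2 * \<rho> n) * (\<Sum>i=1..n. h n i))) \<le> exp (- ((1 + 2 * \<rho> n) * (\<Sum>k=1..?K. \<Sum>i=1..r n. h n (i + (k - 1) * r n))))"
    proof -
      have "(\<Sum>k=1..?K. \<Sum>i=1..r n. h n (i + (k - 1) * r n)) \<le> (\<Sum>i=1..n. h n i)"
        unfolding sum_blocks using h0 by (intro sum_mono2) (auto intro: order_trans[OF _ div_times_less_eq_dividend])
      then show ?thesis using \<rho>0[of n] by (simp add: mult_left_mono)
    qed
    also have "\<dots> = (\<Prod>k=1..?K. exp (- ((1 + 2 * \<rho> n) * (\<Sum>i=1..r n. h n (i + (k - 1) * r n)))))"
      by (simp add: exp_sum[symmetric] sum_negf sum_distrib_left)
    also have "\<dots> \<le> (\<Prod>k=1..?K. ?E k)"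
    proof (rule prod_mono, intro conjI)
      fix k assume k: "k \<in> {1..?K}"
      let ?t = "real (k * r n) / real n"
      have t: "?t \<in> {0..1}" using block_time(1)[OF r k, of 1] rn by simp
      define Q where "Q = (\<Sum>i=1..r n. measure M (crossing fp fm n ?t (int (i + (k - 1) * r n))))"
      have Q0: "0 \<le> Q" by (simp add: Q_def sum_nonneg)
      have "Q \<le> (\<Sum>i=1..r n. tailp (x * a n))"
        unfolding Q_def x_def using B[OF t] by (intro sum_mono crossing_le_tailp elim(3)) auto
      then have Q\<rho>: "Q \<le> \<rho> n" by (simp add: \<rho>_def)
      have Qh: "Q \<le> (\<Sum>i=1..r n. h n (i + (k - 1) * r n))"
        unfolding Q_def h_def
      proof (intro sum_mono finite_measure_mono crossing_mono crossing_sets)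
        fix i assume i: "i \<in> {1..r n}"
        let ?u = "real (i + (k - 1) * r n) / real n"
        have u: "?u \<in> {0..1}" "\<bar>?t - ?u\<bar> < dp" "\<bar>?t - ?u\<bar> < dm"
          using block_time(2,3)[OF r k i] elim(1) by auto
        show "fp ?t \<le> max 0 (hp ?u)" using dp(2)[OF t u(1,2)] by (auto simp: hp_def fp_def max_def abs_less_iff)
        show "fm ?t \<le> max 0 (hm ?u)" using dm(2)[OF t u(1,3)] by (auto simp: hm_def fm_def max_def abs_less_iff)
      qed
      have Q12: "Q \<le> 1 / 2" using Q\<rho> elim(2) by simp
      have "exp (- ((1 + 2 * \<rho> n) * (\<Sum>i=1..r n. h n (i + (k - 1) * r n)))) \<le> exp (- ((1 + 2 * Q) * Q))"
        using Qh Q\<rho> Q0 by (simp add: mult_mono)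
      also have "\<dots> = exp (- Q - 2 * Q\<^sup>2)" by (simp add: algebra_simps power2_eq_square)
      also have "\<dots> \<le> exp (ln (1 - Q))"
        using ln_one_minus_pos_lower_bound[OF Q0 Q12] by simp
      also have "\<dots> = 1 - Q" using Q12 by simp
      also have "\<dots> \<le> ?E k" unfolding Q_def by (rule block_lower[OF \<Lambda> \<epsilon>])
      finally show "exp (- ((1 + 2 * \<rho> n) * (\<Sum>i=1..r n. h n (i + (k - 1) * r n)))) \<le> ?E k" .
    qed simp
    also have "\<dots> = (\<integral>\<omega>. exp (- (\<Sum>i=1..n. test_value \<Lambda> \<epsilon> fp fm n (real i / real n) (int i) \<omega>)) \<partial>M) - mixing_error r \<Lambda> \<epsilon> fp fm n"
      by (simp add: mixing_error_def)
    also have "(\<integral>\<omega>. exp (- (\<Sum>i=1..n. test_value \<Lambda> \<epsilon> fp fm n (real i / real n) (int i) \<omega>)) \<partial>M)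
        \<le> (\<integral>\<omega>. indicator (uncrossed gp gm n) \<omega> + exp (- \<Lambda>) \<partial>M)"
    proof (rule integral_mono)
      show "integrable M (\<lambda>\<omega>. exp (- (\<Sum>i=1..n. test_value \<Lambda> \<epsilon> fp fm n (real i / real n) (int i) \<omega>)))"
        using test_value_nonneg[OF \<Lambda> \<epsilon>] by (intro integrable_const_bound[of _ 1]) (auto intro!: sum_nonneg)
      fix \<omega> assume \<omega>: "\<omega> \<in> space M"
      let ?S = "\<Sum>i=1..n. test_value \<Lambda> \<epsilon> fp fm n (real i / real n) (int i) \<omega>"
      have S0: "0 \<le> ?S" by (intro sum_nonneg test_value_nonneg[OF \<Lambda> \<epsilon>])
      show "exp (- ?S) \<le> indicator (uncrossed gp gm n) \<omega> + exp (- \<Lambda>)"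
      proof (cases "\<omega> \<in> uncrossed gp gm n")
        case True
        have "exp (- ?S) \<le> 1" using S0 by (simp only: exp_le_one_iff neg_le_0_iff_le)
        moreover have "0 \<le> exp (- \<Lambda>)" by simp
        moreover have "indicator (uncrossed gp gm n) \<omega> = (1 :: real)" using True by simp
        ultimately show ?thesis by linarith
      next
        case False
        then obtain i where i: "i \<in> {1..n}" "\<omega> \<in> crossing gp gm n (real i / real n) (int i)"
          using \<omega> by (auto simp: uncrossed_def)
        have "barrier_level fp fm t y - \<epsilon> = barrier_level gp gm t y" for t y
          by (simp add: barrier_level_def fp_def fm_def)
        then have "test_value \<Lambda> \<epsilon> fp fm n (real i / real n) (int i) \<omega> = \<Lambda>"
          using i(2) barrier_test_saturated[OF _ \<epsilon>, of fp fm] by (simp add: crossing_def test_value_def)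
        then have "\<Lambda> \<le> ?S"
          using member_le_sum[OF i(1), of "\<lambda>i. test_value \<Lambda> \<epsilon> fp fm n (real i / real n) (int i) \<omega>"]
            test_value_nonneg[OF \<Lambda> \<epsilon>] by simp
        then show ?thesis using False by simp
      qed
    qed (simp add: emeasure_eq_measure)
    also have "(\<integral>\<omega>. indicator (uncrossed gp gm n) \<omega> + exp (- \<Lambda>) \<partial>M) = measure M (uncrossed gp gm n) + exp (- \<Lambda>)"
      by (simp add: emeasure_eq_measure prob_space)
    finally show ?case by (simp add: lb_def)
  qed
  then show thesis using lim that unfolding hp_def hm_def by blast
qed

lemma crossing_rate_tendsto:
  assumes "\<And>N. continuous_on {0..1} (gpN N)" "\<And>N. continuous_on {0..1} (gmN N)"
    "continuous_on {0..1} gp" "continuous_on {0..1} gm"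
    "\<And>N t. t \<in> {0..1} \<Longrightarrow> 0 \<le> gpN N t \<and> gpN N t \<le> B" "\<And>N t. t \<in> {0..1} \<Longrightarrow> 0 \<le> gmN N t \<and> gmN N t \<le> B"
    "\<And>t. t \<in> {0..1} \<Longrightarrow> (\<lambda>N. gpN N t) \<longlonglongrightarrow> gp t" "\<And>t. t \<in> {0..1} \<Longrightarrow> (\<lambda>N. gmN N t) \<longlonglongrightarrow> gm t"
  shows "(\<lambda>N. crossing_rate (gpN N) (gmN N)) \<longlonglongrightarrow> crossing_rate gp gm"
  unfolding crossing_rate_def
  by (intro tendsto_intros powr_integral_tendsto[OF alpha, where B = B] continuous_indicator_measurable AE_I2 impI assms)

text \<open>The height \<open>\<Lambda> = N\<close> and the margin
  \<open>\<epsilon> = 1 / (N + 1)\<close> vary together; both bounds have the same limit because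
  \<open>crossing_rate\<close> is continuous along these barriers.\<close>

theorem uncrossed_tendsto:
  assumes gp: "continuous_on {0..1} gp" and gm: "continuous_on {0..1} gm"
    and gp0: "\<And>t. t \<in> {0..1} \<Longrightarrow> 0 \<le> gp t" and gm0: "\<And>t. t \<in> {0..1} \<Longrightarrow> 0 \<le> gm t"
  shows "(\<lambda>n. measure M (uncrossed gp gm n)) \<longlonglongrightarrow> exp (- crossing_rate gp gm)"
proof -
  define \<epsilon> where "\<epsilon> N = 1 / real (Suc N)" for N
  have \<epsilon>: "0 < \<epsilon> N" "\<epsilon> N \<le> 1" for N by (auto simp: \<epsilon>_def)
  have \<epsilon>_lim: "\<epsilon> \<longlonglongrightarrow> 0" unfolding \<epsilon>_def by real_asymp
  obtain Bp where Bp: "0 < Bp" "\<And>t. t \<in> {0..1} \<Longrightarrow> \<bar>gp t\<bar> \<le> Bp" using continuous_uniform_bound[OF gp] by blast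
  obtain Bm where Bm: "0 < Bm" "\<And>t. t \<in> {0..1} \<Longrightarrow> \<bar>gm t\<bar> \<le> Bm" using continuous_uniform_bound[OF gm] by blast
  have exp_lim: "(\<lambda>N. exp (- real N)) \<longlonglongrightarrow> 0" by real_asymp
  let ?L = "\<lambda>N. crossing_rate (\<lambda>t. max 0 (gp t - 2 * \<epsilon> N)) (\<lambda>t. max 0 (gm t - 2 * \<epsilon> N))"
  let ?U = "\<lambda>N. crossing_rate (\<lambda>t. gp t + 2 * \<epsilon> N) (\<lambda>t. gm t + 2 * \<epsilon> N)"
  have L: "?L \<longlonglongrightarrow> crossing_rate gp gm"
  proof (rule crossing_rate_tendsto[where B = "Bp + Bm"])
    fix t :: real assume t: "t \<in> {0..1}"
    have "(\<lambda>N. max 0 (gp t - 2 * \<epsilon> N)) \<longlonglongrightarrow> max 0 (gp t - 2 * 0)" by (intro tendsto_intros \<epsilon>_lim)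
    then show "(\<lambda>N. max 0 (gp t - 2 * \<epsilon> N)) \<longlonglongrightarrow> gp t" using gp0[OF t] by simp
    have "(\<lambda>N. max 0 (gm t - 2 * \<epsilon> N)) \<longlonglongrightarrow> max 0 (gm t - 2 * 0)" by (intro tendsto_intros \<epsilon>_lim)
    then show "(\<lambda>N. max 0 (gm t - 2 * \<epsilon> N)) \<longlonglongrightarrow> gm t" using gm0[OF t] by simp
    fix N
    show "0 \<le> max 0 (gp t - 2 * \<epsilon> N) \<and> max 0 (gp t - 2 * \<epsilon> N) \<le> Bp + Bm"
      using Bp(2)[OF t] Bp(1) Bm(1) \<epsilon>(1)[of N] by auto
    show "0 \<le> max 0 (gm t - 2 * \<epsilon> N) \<and> max 0 (gm t - 2 * \<epsilon> N) \<le> Bp + Bm"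
      using Bm(2)[OF t] Bp(1) Bm(1) \<epsilon>(1)[of N] by auto
  qed (intro continuous_intros gp gm)+
  have U: "?U \<longlonglongrightarrow> crossing_rate gp gm"
  proof (rule crossing_rate_tendsto[where B = "Bp + Bm + 2"])
    fix t :: real assume t: "t \<in> {0..1}"
    have "(\<lambda>N. gp t + 2 * \<epsilon> N) \<longlonglongrightarrow> gp t + 2 * 0" by (intro tendsto_intros \<epsilon>_lim)
    then show "(\<lambda>N. gp t + 2 * \<epsilon> N) \<longlonglongrightarrow> gp t" by simp
    have "(\<lambda>N. gm t + 2 * \<epsilon> N) \<longlonglongrightarrow> gm t + 2 * 0" by (intro tendsto_intros \<epsilon>_lim)
    then show "(\<lambda>N. gm t + 2 * \<epsilon> N) \<longlonglongrightarrow> gm t" by simp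
    fix N
    show "0 \<le> gp t + 2 * \<epsilon> N \<and> gp t + 2 * \<epsilon> N \<le> Bp + Bm + 2"
      using gp0[OF t] Bp(2)[OF t] Bp(1) Bm(1) \<epsilon>[of N] by auto
    show "0 \<le> gm t + 2 * \<epsilon> N \<and> gm t + 2 * \<epsilon> N \<le> Bp + Bm + 2"
      using gm0[OF t] Bm(2)[OF t] Bp(1) Bm(1) \<epsilon>[of N] by auto
  qed (intro continuous_intros gp gm)+
  \<comment> \<open>The bounds are only known to exist for each \<open>N\<close>; stating this as an
    existence claim lets \<open>choice\<close> turn them into a family.\<close>
  have "\<forall>N. \<exists>ub. eventually (\<lambda>n. measure M (uncrossed gp gm n) \<le> ub n) sequentially \<and>
      ub \<longlonglongrightarrow> exp (- ((1 - exp (- real N)) * ?L N))"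
  proof
    fix N
    show "\<exists>ub. eventually (\<lambda>n. measure M (uncrossed gp gm n) \<le> ub n) sequentially \<and>
      ub \<longlonglongrightarrow> exp (- ((1 - exp (- real N)) * ?L N))"
      by (rule uncrossed_upper[OF gp gm _ \<epsilon>(1), of "real N" N]) auto
  qed
  from choice[OF this] obtain ub where ub: "\<And>N. eventually (\<lambda>n. measure M (uncrossed gp gm n) \<le> ub N n) sequentially"
      "\<And>N. ub N \<longlonglongrightarrow> exp (- ((1 - exp (- real N)) * ?L N))" by blast
  have "\<forall>N. \<exists>lb. eventually (\<lambda>n. lb n \<le> measure M (uncrossed gp gm n)) sequentially \<and>
      lb \<longlonglongrightarrow> exp (- ?U N) - exp (- real N)"
  proof
    fix N
    show "\<exists>lb. eventually (\<lambda>n. lb n \<le> measure M (uncrossed gp gm n)) sequentially \<and>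
      lb \<longlonglongrightarrow> exp (- ?U N) - exp (- real N)"
      by (rule uncrossed_lower[OF gp gm _ \<epsilon>(1), of "real N" N]) (auto intro: gp0 gm0)
  qed
  from choice[OF this] obtain lb where lb: "\<And>N. eventually (\<lambda>n. lb N n \<le> measure M (uncrossed gp gm n)) sequentially"
      "\<And>N. lb N \<longlonglongrightarrow> exp (- ?U N) - exp (- real N)" by blast
  have "(\<lambda>N. exp (- ((1 - exp (- real N)) * ?L N))) \<longlonglongrightarrow> exp (- ((1 - 0) * crossing_rate gp gm))"
    by (intro tendsto_intros exp_lim L)
  moreover have "(\<lambda>N. exp (- ?U N) - exp (- real N)) \<longlonglongrightarrow> exp (- crossing_rate gp gm) - 0"
    by (intro tendsto_intros exp_lim U)
  ultimately show ?thesis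
    by (intro tendsto_by_bounds[OF ub _ lb]) simp_all
qed

end

section \<open>The moving average as a sum with one large term\<close>

locale moving_average_noise = mixing_noise +
  fixes c :: "nat \<Rightarrow> real" and \<delta> :: real
  assumes \<delta>: "0 < \<delta>" "\<delta> \<le> 1" "\<delta> < \<alpha>" and c_summable: "summable (\<lambda>j. \<bar>c j\<bar> powr \<delta>)"
begin

lemma c_tendsto_0: "c \<longlonglongrightarrow> 0"
proof (rule LIMSEQ_I)
  fix e :: real assume e: "0 < e"
  have "(\<lambda>j. \<bar>c j\<bar> powr \<delta>) \<longlonglongrightarrow> 0" using c_summable by (rule summable_LIMSEQ_zero)
  then have "eventually (\<lambda>j. \<bar>c j\<bar> powr \<delta> < e powr \<delta>) sequentially" using e by (intro order_tendstoD) auto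
  then have "eventually (\<lambda>j. norm (c j - 0) < e) sequentially"
  proof eventually_elim
    case (elim j)
    have "\<not> e \<le> \<bar>c j\<bar>"
    proof
      assume "e \<le> \<bar>c j\<bar>"
      then have "e powr \<delta> \<le> \<bar>c j\<bar> powr \<delta>" using \<delta> e by (intro powr_mono2) auto
      then show False using elim by simp
    qed
    then show ?case by simp
  qed
  then show "\<exists>no. \<forall>n\<ge>no. norm (c n - 0) < e" by (simp add: eventually_sequentially)
qed

end

text \<open>A null sequence exceeds half of a positive supremum only finitely often, so the supremum
  is a maximum over finitely many indices.\<close>

lemma sup_pos_part:
  fixes b :: "nat \<Rightarrow> real"
  assumes b: "b \<longlonglongrightarrow> 0"
  shows "b j \<le> (SUP j. max (b j) 0)" "0 \<le> (SUP j. max (b j) 0)"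
    and "0 < (SUP j. max (b j) 0) \<Longrightarrow> \<exists>j. b j = (SUP j. max (b j) 0)"
proof -
  let ?S = "SUP j. max (b j) 0"
  obtain K where K: "\<And>j. norm (b j) \<le> K"
    using convergent_imp_Bseq[of b] b unfolding Bseq_def convergent_def by blast
  have bdd: "bdd_above (range (\<lambda>j. max (b j) 0))"
  proof (rule bdd_aboveI2)
    fix j
    show "max (b j) 0 \<le> K" using K[of j] norm_ge_zero[of "b j"] by (auto simp: abs_le_iff)
  qed
  have up: "max (b j) 0 \<le> ?S" for j by (rule cSUP_upper[OF _ bdd]) simp
  show "b j \<le> ?S" "0 \<le> ?S" using up[of j] by auto
  assume pos: "0 < ?S"
  have "eventually (\<lambda>j. b j < ?S / 2) sequentially" using b pos by (intro order_tendstoD) auto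
  then obtain J where J: "\<And>j. j \<ge> J \<Longrightarrow> b j < ?S / 2" by (auto simp: eventually_sequentially)
  have "\<exists>j. ?S / 2 < max (b j) 0"
    using less_cSUP_iff[OF _ bdd, of "?S / 2"] pos by auto
  then obtain j0 where j0: "?S / 2 < b j0" using pos by (auto simp: max_def split: if_splits)
  then have "j0 < J" using J[of j0] by (cases "j0 < J") auto
  define m where "m = Max (b ` {..<J})"
  have m_ge: "b j \<le> m" if "j < J" for j using that by (auto simp: m_def)
  have "m \<in> b ` {..<J}" unfolding m_def using \<open>j0 < J\<close> by (intro Max_in) auto
  then obtain j1 where j1: "b j1 = m" by auto
  have "?S / 2 < m" using j0 m_ge[OF \<open>j0 < J\<close>] by simp
  have "?S \<le> m"
  proof (rule cSUP_least)
    fix j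
    show "max (b j) 0 \<le> m"
      using m_ge[of j] J[of j] \<open>?S / 2 < m\<close> pos by (cases "j < J") auto
  qed simp
  then show "\<exists>j. b j = ?S" using up[of j1] j1 by (intro exI[of _ j1]) auto
qed

section \<open>Truncating the series and isolating large noise values\<close>

context moving_average_noise
begin

lemma c_le_plus: "c j \<le> c_plus c" and c_plus_nonneg: "0 \<le> c_plus c"
  and c_plus_attained: "0 < c_plus c \<Longrightarrow> \<exists>j. c j = c_plus c"
  unfolding c_plus_def using sup_pos_part[OF c_tendsto_0] by auto

lemma c_le_minus: "- c j \<le> c_minus c" and c_minus_nonneg: "0 \<le> c_minus c"
  and c_minus_attained: "0 < c_minus c \<Longrightarrow> \<exists>j. - c j = c_minus c"
  unfolding c_minus_def using sup_pos_part[of "\<lambda>j. - c j"] tendsto_minus[OF c_tendsto_0] by auto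

abbreviation X :: "nat \<Rightarrow> 'a \<Rightarrow> real" where "X \<equiv> moving_average c \<sigma> Z"

lemma X_measurable [measurable]: "X k \<in> borel_measurable M"
  unfolding moving_average_def by measurable

text \<open>Stated in extended reals, so that divergence of the series counts as heavy and the
  complement yields summability. The scale factors \<open>\<sigma>\<close> are bounded separately by
  \<open>\<beta>2\<close>.\<close>

definition heavy_remainder :: "nat \<Rightarrow> real \<Rightarrow> nat \<Rightarrow> 'a set" where
  "heavy_remainder l y k = {\<omega> \<in> space M. ennreal (y powr \<delta>) <
     (\<Sum>j. ennreal (\<bar>c (j + l)\<bar> powr \<delta> * \<bar>Z (int k - int (j + l)) \<omega>\<bar> powr \<delta>))}"

lemma heavy_remainder_sets [measurable]: "heavy_remainder l y k \<in> sets M"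
  unfolding heavy_remainder_def by measurable

text \<open>The estimate of \<open>weighted_sum_tail\<close> depends on the coefficients only
  through their sum, so a late start \<open>l\<close> allows a high level \<open>t * a n\<close>. It
  is uniform in \<open>k\<close> because only the marginal law enters.\<close>

lemma heavy_remainder_prob:
  assumes \<theta>: "0 < \<theta>" and \<epsilon>: "0 < \<epsilon>"
  obtains l0 where "\<And>l. l \<ge> l0 \<Longrightarrow>
    eventually (\<lambda>n. \<forall>k. real n * measure M (heavy_remainder l (\<theta> * a n) k) \<le> \<epsilon>) sequentially"
proof -
  obtain C u0 where C: "C > 0" "u0 > 0"
    "\<And>d D u \<kappa>. (\<And>j. 0 \<le> d j) \<Longrightarrow> summable d \<Longrightarrow> suminf d \<le> D \<Longrightarrow> 0 < D \<Longrightarrow> u0 \<le> u \<Longrightarrow>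
      measure M {\<omega> \<in> space M. (\<Sum>j. ennreal (d j * \<bar>Z (\<kappa> j) \<omega>\<bar> powr \<delta>)) > ennreal (2 * D * u powr \<delta>)} \<le> C * tailp u"
    using weighted_sum_tail[OF \<delta>(1,3)] by blast
  have "((\<lambda>t. C * t powr (- \<alpha>)) \<longlongrightarrow> 0) at_top" using alpha C(1) by real_asymp
  then have "eventually (\<lambda>t. C * t powr (- \<alpha>) < \<epsilon>) at_top" using \<epsilon> by (rule order_tendstoD)
  then have "eventually (\<lambda>t. C * t powr (- \<alpha>) < \<epsilon> \<and> t > 0) at_top"
    using eventually_gt_at_top[of 0] by (rule eventually_conj)
  then obtain t where t: "C * t powr (- \<alpha>) < \<epsilon>" "t > 0" by (auto simp: eventually_at_top_linorder)
  \<comment> \<open>Makes \<open>2 * D * (t * a n) powr \<delta>\<close> equal to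
    \<open>(\<theta> * a n) powr \<delta>\<close>, the threshold of the remainder.\<close>
  define D where "D = (\<theta> / t) powr \<delta> / 2"
  have D: "0 < D" using \<theta> t by (simp add: D_def)
  have "(\<lambda>l. \<Sum>j. \<bar>c (j + l)\<bar> powr \<delta>) \<longlonglongrightarrow> 0" by (rule suminf_exist_split2[OF c_summable])
  then have "eventually (\<lambda>l. (\<Sum>j. \<bar>c (j + l)\<bar> powr \<delta>) < D) sequentially" using D by (rule order_tendstoD)
  then obtain l0 where l0: "\<And>l. l \<ge> l0 \<Longrightarrow> (\<Sum>j. \<bar>c (j + l)\<bar> powr \<delta>) < D" by (auto simp: eventually_sequentially)
  show thesis
  proof (rule that[of l0])
    fix l assume l: "l \<ge> l0"
    have "(\<lambda>n. C * (real n * tailp (t * a n))) \<longlonglongrightarrow> C * t powr (- \<alpha>)"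
      by (intro tendsto_intros n_tailp t)
    then have "eventually (\<lambda>n. C * (real n * tailp (t * a n)) < \<epsilon>) sequentially"
      using t(1) by (rule order_tendstoD)
    moreover have "eventually (\<lambda>n. u0 \<le> t * a n) sequentially"
      using scaled_a_top[OF t(2)] by (simp add: filterlim_at_top)
    ultimately show "eventually (\<lambda>n. \<forall>k. real n * measure M (heavy_remainder l (\<theta> * a n) k) \<le> \<epsilon>) sequentially"
      using eventually_ge_at_top[of 1]
    proof eventually_elim
      case (elim n)
      have an: "0 < a n" using a_pos[OF elim(3)] .
      have "2 * D * (t * a n) powr \<delta> = (\<theta> * a n) powr \<delta>"
        using \<theta> t(2) an by (simp add: D_def powr_mult[symmetric])
      moreover have "measure M {\<omega> \<in> space M. (\<Sum>j. ennreal (\<bar>c (j + l)\<bar> powr \<delta> * \<bar>Z (int k - int (j + l)) \<omega>\<bar> powr \<delta>))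
          > ennreal (2 * D * (t * a n) powr \<delta>)} \<le> C * tailp (t * a n)" for k
        by (rule C(3)) (use summable_ignore_initial_segment[OF c_summable] l0[OF l] D elim(2) in auto)
      ultimately have "measure M (heavy_remainder l (\<theta> * a n) k) \<le> C * tailp (t * a n)" for k
        unfolding heavy_remainder_def by simp
      then have "real n * measure M (heavy_remainder l (\<theta> * a n) k) \<le> real n * (C * tailp (t * a n))" for k
        by (intro mult_left_mono) auto
      then show ?case using elim(1) by (auto simp: mult_ac intro: order_trans[OF _ less_imp_le])
    qed
  qed
qed

text \<open>\<open>sum_le_of_powr_sum_le\<close> leads from the powers back to the remainder itself,
  including convergence of the series at this \<open>\<omega>\<close>.\<close>

lemma light_remainder:
  assumes \<omega>: "\<omega> \<in> space M" "\<omega> \<notin> heavy_remainder l y k" and y: "0 < y"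
  shows "\<bar>X k \<omega> - (\<Sum>j<l. c j * (\<sigma> (int k - int j) * Z (int k - int j) \<omega>))\<bar> \<le> \<beta>2 * y"
proof -
  let ?f = "\<lambda>j. c j * \<sigma> (int k - int j) * Z (int k - int j) \<omega>"
  let ?x = "\<lambda>j. \<bar>c (j + l)\<bar> * \<bar>Z (int k - int (j + l)) \<omega>\<bar>"
  have le: "(\<Sum>j. ennreal (?x j powr \<delta>)) \<le> ennreal (y powr \<delta>)"
    using \<omega> by (simp add: heavy_remainder_def not_less powr_mult)
  have x: "summable ?x" "suminf ?x \<le> y"
    by (rule sum_le_of_powr_sum_le[OF _ y \<delta>(1,2) le], simp)+
  have fx: "\<bar>?f (j + l)\<bar> \<le> \<beta>2 * ?x j" for j
  proof -
    have "\<bar>?f (j + l)\<bar> = \<sigma> (int k - int (j + l)) * ?x j"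
      using \<sigma>_pos[of "int k - int (j + l)"] by (simp add: abs_mult mult_ac)
    also have "\<dots> \<le> \<beta>2 * ?x j" using \<sigma>_le by (intro mult_right_mono) auto
    finally show ?thesis .
  qed
  have sx: "summable (\<lambda>j. \<beta>2 * ?x j)" using x(1) by (rule summable_mult)
  have sa: "summable (\<lambda>j. \<bar>?f (j + l)\<bar>)"
  proof (rule summable_comparison_test'[OF sx, of 0])
    show "norm \<bar>?f (j + l)\<bar> \<le> \<beta>2 * ?x j" for j using fx[of j] by (simp only: real_norm_def abs_idempotent)
  qed
  then have sf: "summable (\<lambda>j. ?f (j + l))" by (rule summable_rabs_cancel)
  then have "summable ?f" by (rule iffD1[OF summable_iff_shift[of ?f l]])
  then have "X k \<omega> = (\<Sum>j. ?f (j + l)) + (\<Sum>j<l. ?f j)"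
    unfolding moving_average_def by (rule suminf_split_initial_segment)
  then have "\<bar>X k \<omega> - (\<Sum>j<l. c j * (\<sigma> (int k - int j) * Z (int k - int j) \<omega>))\<bar> = \<bar>\<Sum>j. ?f (j + l)\<bar>"
    by (simp add: mult.assoc)
  also have "\<dots> \<le> (\<Sum>j. \<bar>?f (j + l)\<bar>)"
    by (rule summable_rabs[OF sa])
  also have "\<dots> \<le> (\<Sum>j. \<beta>2 * ?x j)"
    by (rule suminf_le[OF fx sa sx])
  also have "\<dots> = \<beta>2 * suminf ?x" using x(1) by (rule suminf_mult)
  also have "\<dots> \<le> \<beta>2 * y" using x(2) \<beta>2_pos by (intro mult_left_mono) auto
  finally show ?thesis .
qed

text \<open>Excluded are two large values at distance at most \<open>l\<close>, large values near
  either end (whose effect would come from before time 1 or reach past \<open>n\<close>), and heavy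
  remainders. What is left has at most one large term in each window.\<close>

definition regular :: "nat \<Rightarrow> real \<Rightarrow> real \<Rightarrow> nat \<Rightarrow> 'a set" where
  "regular l h \<theta> n = space M -
     ((\<Union>i\<in>{- int l..int n}. \<Union>d\<in>{1..l}. {\<omega> \<in> space M. \<bar>Z i \<omega>\<bar> > h * a n \<and> \<bar>Z (i + int d) \<omega>\<bar> > h * a n}) \<union>
     (\<Union>i\<in>{- int l..0} \<union> {int n - int l..int n}. {\<omega> \<in> space M. \<bar>Z i \<omega>\<bar> > h * a n}) \<union>
     (\<Union>k\<in>{1..n}. heavy_remainder (Suc l) (\<theta> * a n) k))"

lemma regular_sets [measurable]: "regular l h \<theta> n \<in> sets M"
  unfolding regular_def by simp

lemma regular_isolated:
  assumes \<omega>: "\<omega> \<in> regular l h \<theta> n" and large: "\<bar>Z i \<omega>\<bar> > h * a n"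
    and i: "i \<in> {- int l..int n}" and i': "i' \<in> {- int l..int n}" "i' \<noteq> i" "\<bar>i' - i\<bar> \<le> int l"
  shows "\<bar>Z i' \<omega>\<bar> \<le> h * a n"
proof (rule ccontr)
  assume "\<not> ?thesis"
  then have large': "\<bar>Z i' \<omega>\<bar> > h * a n" by simp
  have sep: "\<not> (\<bar>Z j \<omega>\<bar> > h * a n \<and> \<bar>Z (j + int d) \<omega>\<bar> > h * a n)" if "j \<in> {- int l..int n}" "d \<in> {1..l}" for j d
    using \<omega> that unfolding regular_def by blast
  show False
  proof (cases "i < i'")
    case True
    then have "nat (i' - i) \<in> {1..l}" "i + int (nat (i' - i)) = i'" using i' by auto
    then show False using sep[OF i, of "nat (i' - i)"] large large' by simp
  next
    case False
    then have "nat (i - i') \<in> {1..l}" "i' + int (nat (i - i')) = i" using i' by auto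
    then show False using sep[OF i'(1), of "nat (i - i')"] large large' by simp
  qed
qed

lemma regular_boundary:
  assumes "\<omega> \<in> regular l h \<theta> n" "i \<in> {- int l..0} \<union> {int n - int l..int n}"
  shows "\<bar>Z i \<omega>\<bar> \<le> h * a n"
proof -
  have "\<not> \<bar>Z i \<omega>\<bar> > h * a n" using assms unfolding regular_def by blast
  then show ?thesis by simp
qed

lemma regular_remainder:
  assumes "\<omega> \<in> regular l h \<theta> n" "k \<in> {1..n}"
  shows "\<omega> \<in> space M" "\<omega> \<notin> heavy_remainder (Suc l) (\<theta> * a n) k"
  using assms unfolding regular_def by blast+

text \<open>The cut \<open>l\<close> is fixed by the remainder, independently of \<open>h\<close>;
  the other two exceptional events vanish for any fixed \<open>l\<close> and \<open>h\<close>. This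
  order matters because \<open>h\<close> is later chosen depending on \<open>l\<close>.\<close>

lemma regular_prob:
  assumes \<theta>: "0 < \<theta>" and \<epsilon>: "0 < \<epsilon>"
  obtains l0 where "\<And>l h. l \<ge> l0 \<Longrightarrow> 0 < h \<Longrightarrow>
    eventually (\<lambda>n. measure M (space M - regular l h \<theta> n) \<le> \<epsilon>) sequentially"
proof -
  obtain l0 where l0: "\<And>l. l \<ge> l0 \<Longrightarrow>
    eventually (\<lambda>n. \<forall>k. real n * measure M (heavy_remainder l (\<theta> * a n) k) \<le> \<epsilon> / 3) sequentially"
    using heavy_remainder_prob[OF \<theta>, of "\<epsilon> / 3"] \<epsilon> by auto
  show thesis
  proof (rule that[of l0])
    fix l :: nat and h :: real assume l: "l \<ge> l0" and h: "0 < h"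
    have "(\<lambda>n. real l / real n) \<longlonglongrightarrow> 0" by real_asymp
    \<comment> \<open>The factor \<open>real l + 2\<close> accounts for the \<open>n + l + 1\<close>
      starting points of a pair, which are at most \<open>(l + 2) * n\<close>.\<close>
    then have p1: "(\<lambda>n. (real l + 2) * (real n * (\<Sum>d=1..l. pairp h n d))) \<longlonglongrightarrow> (real l + 2) * 0"
      using h by (intro tendsto_intros pairp_sum)
    then have ev1: "eventually (\<lambda>n. (real l + 2) * (real n * (\<Sum>d=1..l. pairp h n d)) < \<epsilon> / 3) sequentially"
      using \<epsilon> by (intro order_tendstoD(2)[OF p1]) auto
    have t0: "(\<lambda>n. real n * tailp (h * a n) * ((2 * real l + 2) / real n)) \<longlonglongrightarrow> h powr (- \<alpha>) * 0"
      by (intro tendsto_mult n_tailp h) real_asymp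
    then have ev2: "eventually (\<lambda>n. real n * tailp (h * a n) * ((2 * real l + 2) / real n) < \<epsilon> / 3) sequentially"
      using \<epsilon> by (intro order_tendstoD(2)[OF t0]) auto
    have ev3: "eventually (\<lambda>n. \<forall>k. real n * measure M (heavy_remainder (Suc l) (\<theta> * a n) k) \<le> \<epsilon> / 3) sequentially"
      using l by (intro l0) simp
    show "eventually (\<lambda>n. measure M (space M - regular l h \<theta> n) \<le> \<epsilon>) sequentially"
      using ev1 ev2 ev3 eventually_ge_at_top[of 1]
    proof eventually_elim
      case (elim n)
      let ?P = "\<lambda>i d. {\<omega> \<in> space M. \<bar>Z i \<omega>\<bar> > h * a n \<and> \<bar>Z (i + int d) \<omega>\<bar> > h * a n}"
      let ?A = "\<Union>i\<in>{- int l..int n}. \<Union>d\<in>{1..l}. ?P i d"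
      let ?B = "\<Union>i\<in>{- int l..0} \<union> {int n - int l..int n}. {\<omega> \<in> space M. \<bar>Z i \<omega>\<bar> > h * a n}"
      let ?C = "\<Union>k\<in>{1..n}. heavy_remainder (Suc l) (\<theta> * a n) k"
      have "space M - regular l h \<theta> n \<subseteq> ?A \<union> ?B \<union> ?C"
        unfolding regular_def by blast
      then have "measure M (space M - regular l h \<theta> n) \<le> measure M (?A \<union> ?B \<union> ?C)"
        by (intro finite_measure_mono) auto
      also have "\<dots> \<le> measure M (?A \<union> ?B) + measure M ?C"
        by (intro measure_Un_le) auto
      also have "measure M (?A \<union> ?B) \<le> measure M ?A + measure M ?B"
        by (intro measure_Un_le) auto
      also have "measure M ?A \<le> \<epsilon> / 3"
      proof -
        have "measure M ?A \<le> (\<Sum>i\<in>{- int l..int n}. measure M (\<Union>d\<in>{1..l}. ?P i d))"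
          by (intro measure_UNION_le) auto
        also have "\<dots> \<le> (\<Sum>i\<in>{- int l..int n}. \<Sum>d\<in>{1..l}. measure M (?P i d))"
          by (intro sum_mono measure_UNION_le) auto
        also have "\<dots> = (\<Sum>i\<in>{- int l..int n}. \<Sum>d\<in>{1..l}. pairp h n d)" by (simp only: prob_pair)
        also have "\<dots> = (real n + real l + 1) * (\<Sum>d=1..l. pairp h n d)" by simp
        also have "\<dots> \<le> ((real l + 2) * real n) * (\<Sum>d=1..l. pairp h n d)"
        proof (intro mult_right_mono sum_nonneg pairp_nonneg)
          have "real l + 1 \<le> (real l + 1) * real n" using elim(4) mult_left_mono[of 1 "real n" "real l + 1"] by simp
          then show "real n + real l + 1 \<le> (real l + 2) * real n" by (simp add: algebra_simps)
        qed
        finally show ?thesis using elim(1) by (simp add: mult.assoc)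
      qed
      also have "measure M ?B \<le> \<epsilon> / 3"
      proof -
        have "measure M ?B \<le> (\<Sum>i\<in>{- int l..0} \<union> {int n - int l..int n}. measure M {\<omega> \<in> space M. \<bar>Z i \<omega>\<bar> > h * a n})"
          by (intro measure_UNION_le) auto
        also have "\<dots> = real (card ({- int l..0} \<union> {int n - int l..int n})) * tailp (h * a n)" by (simp add: tailp_Z)
        also have "\<dots> \<le> (2 * real l + 2) * tailp (h * a n)"
        proof (intro mult_right_mono tailp_nonneg)
          have "card ({- int l..0} \<union> {int n - int l..int n}) \<le> card {- int l..0} + card {int n - int l..int n}"
            by (rule card_Un_le)
          also have "\<dots> = 2 * l + 2" by simp
          finally show "real (card ({- int l..0} \<union> {int n - int l..int n})) \<le> 2 * real l + 2" by linarith
        qed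
        also have "\<dots> = real n * tailp (h * a n) * ((2 * real l + 2) / real n)" using elim(4) by simp
        finally show ?thesis using elim(2) by simp
      qed
      also have "measure M ?C \<le> \<epsilon> / 3"
      proof -
        have "measure M ?C \<le> (\<Sum>k\<in>{1..n}. measure M (heavy_remainder (Suc l) (\<theta> * a n) k))"
          by (intro measure_UNION_le) auto
        also have "\<dots> \<le> (\<Sum>k\<in>{1..n}. (\<epsilon> / 3) / real n)"
        proof (rule sum_mono)
          fix k
          show "measure M (heavy_remainder (Suc l) (\<theta> * a n) k) \<le> (\<epsilon> / 3) / real n"
            using elim(3)[rule_format, of k] elim(4) by (simp add: pos_le_divide_eq mult_ac)
        qed
        also have "\<dots> = \<epsilon> / 3" using elim(4) by simp
        finally show ?thesis .
      qed
      finally show ?case by simp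
    qed
  qed
qed

end

section \<open>Pathwise comparison of the moving average with its largest term\<close>

context moving_average_noise
begin

text \<open>One \<open>\<tau>\<close> pays for the remainder of the series and one for the other
  terms of the window, which are small by hypothesis.\<close>

lemma X_single_summand:
  assumes \<omega>: "\<omega> \<in> regular l h \<theta> n" and n: "n \<ge> 1" and k: "k \<in> {1..n}" and h: "0 < h" and \<theta>: "0 < \<theta>" and m: "m \<le> l"
    and small: "\<And>j. j \<le> l \<Longrightarrow> j \<noteq> m \<Longrightarrow> \<bar>Z (int k - int j) \<omega>\<bar> \<le> h * a n"
    and hl: "\<beta>2 * h * (\<Sum>j\<le>l. \<bar>c j\<bar>) \<le> \<tau>" and \<theta>\<tau>: "\<beta>2 * \<theta> \<le> \<tau>"
  shows "\<bar>X k \<omega> - c m * (\<sigma> (int k - int m) * Z (int k - int m) \<omega>)\<bar> \<le> 2 * \<tau> * a n"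
proof -
  have an: "0 < a n" using a_pos[OF n] .
  let ?f = "\<lambda>j. c j * (\<sigma> (int k - int j) * Z (int k - int j) \<omega>)"
  have "\<bar>X k \<omega> - (\<Sum>j<Suc l. ?f j)\<bar> \<le> \<beta>2 * (\<theta> * a n)"
    using regular_remainder[OF \<omega> k] \<theta> an by (intro light_remainder) auto
  also have "\<dots> \<le> \<tau> * a n" using \<theta>\<tau> an by (simp add: mult.assoc[symmetric] mult_right_mono)
  finally have 1: "\<bar>X k \<omega> - (\<Sum>j\<le>l. ?f j)\<bar> \<le> \<tau> * a n" by (simp only: lessThan_Suc_atMost)
  have 2: "(\<Sum>j\<le>l. ?f j) = ?f m + (\<Sum>j\<in>{..l} - {m}. ?f j)"
    using m by (intro sum.remove) auto
  have "\<bar>\<Sum>j\<in>{..l} - {m}. ?f j\<bar> \<le> (\<Sum>j\<in>{..l} - {m}. \<bar>c j\<bar> * (\<beta>2 * (h * a n)))"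
  proof (rule order_trans[OF sum_abs sum_mono])
    fix j assume "j \<in> {..l} - {m}"
    then have "\<bar>Z (int k - int j) \<omega>\<bar> \<le> h * a n" by (intro small) auto
    then have "\<sigma> (int k - int j) * \<bar>Z (int k - int j) \<omega>\<bar> \<le> \<beta>2 * (h * a n)"
      using \<sigma>_le \<sigma>_pos[of "int k - int j"] \<beta>2_pos by (intro mult_mono) auto
    then show "\<bar>?f j\<bar> \<le> \<bar>c j\<bar> * (\<beta>2 * (h * a n))"
      using \<sigma>_pos[of "int k - int j"] by (simp add: abs_mult mult_left_mono)
  qed
  also have "\<dots> \<le> (\<Sum>j\<le>l. \<bar>c j\<bar> * (\<beta>2 * (h * a n)))"
    using h an \<beta>2_pos by (intro sum_mono2) auto
  also have "\<dots> = (\<beta>2 * h * (\<Sum>j\<le>l. \<bar>c j\<bar>)) * a n"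
    by (simp add: sum_distrib_left sum_distrib_right mult_ac)
  also have "\<dots> \<le> \<tau> * a n" using hl an by (intro mult_right_mono) auto
  finally show ?thesis using 1 2 by linarith
qed

text \<open>The signed weight treats both signs at once: for a negative value the two minus signs
  cancel.\<close>

lemma crossing_scaled:
  assumes n: "n \<ge> 1" and g: "0 \<le> g t"
  shows "\<omega> \<in> crossing (\<lambda>t. g t * c_plus c) (\<lambda>t. g t * c_minus c) n t i \<longleftrightarrow>
    \<omega> \<in> space M \<and> a n < g t * (if 0 < Z i \<omega> then c_plus c else - c_minus c) * (\<sigma> i * Z i \<omega>)"
proof -
  have an: "0 < a n" using a_pos[OF n] .
  have pos: "0 < \<sigma> i * Z i \<omega> / a n \<longleftrightarrow> 0 < Z i \<omega>"
    using an \<sigma>_pos[of i] by (simp add: zero_less_divide_iff zero_less_mult_iff)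
  have "\<bar>\<sigma> i * Z i \<omega> / a n\<bar> = (if 0 < Z i \<omega> then \<sigma> i * Z i \<omega> else - (\<sigma> i * Z i \<omega>)) / a n"
    using an \<sigma>_pos[of i] by (auto simp: abs_mult abs_divide)
  then show ?thesis
    using an by (auto simp: crossing_def barrier_level_def pos pos_less_divide_eq)
qed

text \<open>No coefficient does better than \<open>c_plus\<close> on positive noise values or
  \<open>- c_minus\<close> on negative ones.\<close>

lemma summand_le_crossing_weight:
  "c m * (\<sigma> i * Z i \<omega>) \<le> (if 0 < Z i \<omega> then c_plus c else - c_minus c) * (\<sigma> i * Z i \<omega>)"
proof (cases "0 < Z i \<omega>")
  case True
  then have "0 \<le> \<sigma> i * Z i \<omega>" using \<sigma>_pos[of i] by simp
  then show ?thesis using True c_le_plus[of m] by (simp add: mult_right_mono)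
next
  case False
  then have "\<sigma> i * Z i \<omega> \<le> 0" using \<sigma>_pos[of i] by (simp add: mult_nonneg_nonpos)
  moreover have "- c_minus c \<le> c m" using c_le_minus[of m] by simp
  ultimately have "c m * (\<sigma> i * Z i \<omega>) \<le> (- c_minus c) * (\<sigma> i * Z i \<omega>)"
    by (intro mult_right_mono_neg)
  then show ?thesis using False by simp
qed

definition below :: "(real \<Rightarrow> real) \<Rightarrow> nat \<Rightarrow> 'a set" where
  "below g n = {\<omega> \<in> space M. \<forall>k\<in>{1..n}. g (real k / real n) * X k \<omega> \<le> a n}"

lemma below_sets [measurable]: "below g n \<in> sets M"
  unfolding below_def by measurable

context
  fixes g :: "real \<Rightarrow> real" and B w \<tau> h \<theta> :: real and l n :: nat
  assumes g0: "\<And>t. t \<in> {0..1} \<Longrightarrow> 0 \<le> g t" and gB: "\<And>t. t \<in> {0..1} \<Longrightarrow> g t \<le> B" and B: "0 < B"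
    and w: "0 < w" and \<tau>: "0 < \<tau>" "3 * \<tau> * B \<le> 1 - 1 / (1 + w)"
    and h: "0 < h" "\<beta>2 * h * (\<Sum>j\<le>l. \<bar>c j\<bar>) \<le> \<tau>" "h * (\<beta>2 * (B * (c_plus c + c_minus c))) < 1"
    and \<theta>: "0 < \<theta>" "\<beta>2 * \<theta> \<le> \<tau>"
    and l: "0 < c_plus c \<Longrightarrow> \<exists>j\<le>l. c j = c_plus c" "0 < c_minus c \<Longrightarrow> \<exists>j\<le>l. - c j = c_minus c"
    and n: "n \<ge> 1"
    and mod: "\<And>i k. i \<in> {1..n} \<Longrightarrow> k \<in> {1..n} \<Longrightarrow> i \<le> k \<Longrightarrow> k \<le> i + l \<Longrightarrow> \<bar>g (real i / real n) - g (real k / real n)\<bar> \<le> w"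
begin

lemma \<tau>2: "2 * \<tau> * B \<le> 1 - 1 / (1 + w)"
  using \<tau>(2) mult_pos_pos[OF \<tau>(1) B] by linarith

lemma time_unit: "i \<in> {1..n} \<Longrightarrow> real i / real n \<in> {0..1}" by auto

text \<open>A crossing by the noise at \<open>i\<close> is passed on to \<open>X (i + m)\<close>,
  where \<open>m\<close> is an index at which the extreme coefficient is attained. The slack
  \<open>w\<close> absorbs the oscillation of \<open>g\<close> over the window and the error
  \<open>2 * \<tau>\<close>, and \<open>h\<close> is so small that noise values up to
  \<open>h * a n\<close> cannot cross.\<close>

lemma below_imp_uncrossed:
  assumes \<omega>: "\<omega> \<in> regular l h \<theta> n" "\<omega> \<in> below g n"
  defines "g0 \<equiv> \<lambda>t. max 0 (g t / (1 + w) - w)"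
  shows "\<omega> \<in> uncrossed (\<lambda>t. g0 t * c_plus c) (\<lambda>t. g0 t * c_minus c) n"
proof (rule ccontr)
  assume "\<not> ?thesis"
  moreover have "\<omega> \<in> space M" using \<omega>(2) by (simp add: below_def)
  ultimately obtain i where i: "i \<in> {1..n}"
    and "\<omega> \<in> crossing (\<lambda>t. g0 t * c_plus c) (\<lambda>t. g0 t * c_minus c) n (real i / real n) (int i)"
    by (auto simp: uncrossed_def)
  define W where "W = (if 0 < Z (int i) \<omega> then c_plus c else - c_minus c)"
  define Y where "Y = \<sigma> (int i) * Z (int i) \<omega>"
  define b where "b = g0 (real i / real n)"
  have an: "0 < a n" using a_pos[OF n] .
  have cross: "a n < b * W * Y"
    using \<open>\<omega> \<in> crossing _ _ _ _ _\<close> crossing_scaled[OF n, of g0 "real i / real n" \<omega> "int i"]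
    by (auto simp: g0_def W_def Y_def b_def)
  have b0: "0 < b"
    using cross an by (cases "b = 0") (auto simp: b_def g0_def less_le)
  then have b_eq: "b = g (real i / real n) / (1 + w) - w" by (auto simp: b_def g0_def)
  have bB: "b \<le> B"
  proof -
    have "g (real i / real n) / (1 + w) \<le> g (real i / real n)"
      using g0[OF time_unit[OF i]] w by (simp add: divide_le_eq mult_le_cancel_left1)
    then show ?thesis using gB[OF time_unit[OF i]] w unfolding b_eq by linarith
  qed
  have "0 < b * (W * Y)" using cross an by (simp add: mult.assoc)
  then have WY: "0 < W * Y" using b0 by (simp add: zero_less_mult_iff)
  obtain m where m: "m \<le> l" "c m = W"
  proof (cases "0 < Z (int i) \<omega>")
    case True
    then have "W \<noteq> 0" using WY by auto
    then have "0 < c_plus c" using c_plus_nonneg True by (simp add: W_def)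
    then show thesis using l(1) True that by (auto simp: W_def)
  next
    case False
    then have "W \<noteq> 0" using WY by auto
    then have "0 < c_minus c" using c_minus_nonneg False by (simp add: W_def)
    then show thesis using l(2) False that by (force simp: W_def)
  qed
  have large: "h * a n < \<bar>Z (int i) \<omega>\<bar>"
  proof (rule ccontr)
    assume "\<not> ?thesis"
    then have z: "\<bar>Z (int i) \<omega>\<bar> \<le> h * a n" by simp
    have "b * W * Y \<le> \<bar>b\<bar> * \<bar>W\<bar> * \<bar>Y\<bar>" by (simp add: abs_mult[symmetric])
    also have "\<dots> \<le> B * (c_plus c + c_minus c) * (\<beta>2 * (h * a n))"
    proof (intro mult_mono)
      show "\<bar>Y\<bar> \<le> \<beta>2 * (h * a n)"
        unfolding Y_def abs_mult using \<sigma>_le[of "int i"] \<sigma>_pos[of "int i"] z \<beta>2_pos by (intro mult_mono) auto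
      show "\<bar>W\<bar> \<le> c_plus c + c_minus c" using c_plus_nonneg c_minus_nonneg by (auto simp: W_def)
    qed (use b0 bB B c_plus_nonneg c_minus_nonneg in auto)
    also have "\<dots> = h * (\<beta>2 * (B * (c_plus c + c_minus c))) * a n" by (simp add: mult_ac)
    also have "\<dots> \<le> 1 * a n" using h(3) an by (intro mult_right_mono) auto
    finally show False using cross by simp
  qed
  \<comment> \<open>Otherwise \<open>i\<close> would lie within distance \<open>l\<close> of the
    end, where regularity excludes large values.\<close>
  have inner: "i + m \<le> n"
  proof (rule ccontr)
    assume "\<not> i + m \<le> n"
    then have "int i \<in> {- int l..0} \<union> {int n - int l..int n}" using m(1) i by auto
    then show False using regular_boundary[OF \<omega>(1)] large by fastforce
  qed
  define k where "k = i + m"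
  have k: "k \<in> {1..n}" "i \<le> k" "k \<le> i + l" using inner i m(1) by (auto simp: k_def)
  have ki: "int k - int m = int i" by (simp add: k_def)
  have "\<bar>X k \<omega> - c m * (\<sigma> (int k - int m) * Z (int k - int m) \<omega>)\<bar> \<le> 2 * \<tau> * a n"
  proof (rule X_single_summand[OF \<omega>(1) n k(1) h(1) \<theta>(1) m(1) _ h(2) \<theta>(2)])
    fix j assume j: "j \<le> l" "j \<noteq> m"
    show "\<bar>Z (int k - int j) \<omega>\<bar> \<le> h * a n"
      using j i k m(1) by (intro regular_isolated[OF \<omega>(1) large]) (auto simp: k_def)
  qed
  then have XY: "W * Y - 2 * \<tau> * a n \<le> X k \<omega>" unfolding ki m(2) Y_def[symmetric] by linarith
  have "b * (2 * \<tau> * a n) \<le> B * (2 * \<tau> * a n)" using bB \<tau>(1) an by (intro mult_right_mono) auto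
  also have "\<dots> = (2 * \<tau> * B) * a n" by simp
  also have "\<dots> \<le> (1 - 1 / (1 + w)) * a n" using \<tau>2 an by (intro mult_right_mono) auto
  finally have "b * (2 * \<tau> * a n) \<le> a n - a n / (1 + w)" by (simp add: algebra_simps)
  moreover have "b * (W * Y - 2 * \<tau> * a n) \<le> b * X k \<omega>" using XY b0 by (intro mult_left_mono) auto
  ultimately have bX: "a n / (1 + w) < b * X k \<omega>" using cross by (simp add: algebra_simps)
  moreover have "0 < a n / (1 + w)" using an w by simp
  ultimately have "0 < b * X k \<omega>" by linarith
  then have X0: "0 < X k \<omega>" using b0 by (simp add: zero_less_mult_iff)
  \<comment> \<open>The subtracted \<open>w\<close> in \<open>b\<close> pays for the change of time
    from \<open>i\<close> to \<open>k\<close>, the factor \<open>1 + w\<close> for the approximation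
    error in \<open>X k\<close>.\<close>
  have "g (real i / real n) \<le> g (real k / real n) + w" using mod[OF i k] by linarith
  then have "g (real i / real n) / (1 + w) \<le> (g (real k / real n) + w) / (1 + w)"
    using w by (intro divide_right_mono) auto
  also have "\<dots> \<le> g (real k / real n) / (1 + w) + w"
    using w by (simp add: add_divide_distrib divide_le_eq)
  finally have "b * (1 + w) \<le> g (real k / real n)" using w unfolding b_eq by (simp add: field_simps)
  then have "b * (1 + w) * X k \<omega> \<le> g (real k / real n) * X k \<omega>" using X0 by (intro mult_right_mono) auto
  moreover have "a n < b * (1 + w) * X k \<omega>" using bX w by (simp add: field_simps)
  moreover have "g (real k / real n) * X k \<omega> \<le> a n" using \<omega>(2) k(1) unfolding below_def by blast
  ultimately show False by linarith
qed

text \<open>A crossing by \<open>X k\<close> needs a large noise value in its window; if all were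
  small, \<open>X k\<close> would be at most \<open>3 * \<tau> * a n\<close>, too little by the
  choice of \<open>\<tau>\<close>. With the extreme coefficient in place of its own, the large value
  crosses all the more.\<close>

lemma uncrossed_imp_below:
  assumes \<omega>: "\<omega> \<in> regular l h \<theta> n"
  defines "g1 \<equiv> \<lambda>t. (g t + w) * (1 + w)"
  assumes unc: "\<omega> \<in> uncrossed (\<lambda>t. g1 t * c_plus c) (\<lambda>t. g1 t * c_minus c) n"
  shows "\<omega> \<in> below g n"
proof (rule ccontr)
  assume "\<not> ?thesis"
  moreover have "\<omega> \<in> space M" using unc by (simp add: uncrossed_def)
  ultimately obtain k where k: "k \<in> {1..n}" and gX: "a n < g (real k / real n) * X k \<omega>"
    by (auto simp: below_def not_le)
  define b where "b = g (real k / real n)"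
  have an: "0 < a n" using a_pos[OF n] .
  have "0 \<le> b" "b \<le> B" using g0 gB time_unit[OF k] by (auto simp: b_def)
  then have b: "0 < b" "b \<le> B" using gX an by (cases "b = 0"; simp add: b_def)+
  have small: "b * (2 * \<tau> * a n) \<le> a n - a n / (1 + w)"
  proof -
    have "b * (2 * \<tau> * a n) \<le> B * (2 * \<tau> * a n)" using b(2) \<tau>(1) an by (intro mult_right_mono) auto
    also have "\<dots> = (2 * \<tau> * B) * a n" by simp
    also have "\<dots> \<le> (1 - 1 / (1 + w)) * a n" using \<tau>2 an by (intro mult_right_mono) auto
    finally show ?thesis by (simp add: algebra_simps)
  qed
  have aw: "0 < a n / (1 + w)" using an w by simp
  have "\<exists>m\<le>l. \<bar>Z (int k - int m) \<omega>\<bar> > h * a n \<and> 1 \<le> int k - int m"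
  proof (rule ccontr)
    assume none: "\<not> ?thesis"
    have all: "\<bar>Z (int k - int j) \<omega>\<bar> \<le> h * a n" if "j \<le> l" for j
    proof (cases "1 \<le> int k - int j")
      case True then show ?thesis using none that by (auto simp: not_less)
    next
      \<comment> \<open>Indices below 1 lie in the initial boundary, where regularity already makes
        the noise small.\<close>
      case False then show ?thesis using that k by (intro regular_boundary[OF \<omega>]) auto
    qed
    \<comment> \<open>The lemma is used with the arbitrary index 0; the term singled out is small as
      well, which gives \<open>3 * \<tau>\<close> in total.\<close>
    have z0: "\<bar>X k \<omega> - c 0 * (\<sigma> (int k - int 0) * Z (int k - int 0) \<omega>)\<bar> \<le> 2 * \<tau> * a n"
      by (rule X_single_summand[OF \<omega> n k h(1) \<theta>(1) _ all h(2) \<theta>(2)]) auto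
    have "\<bar>c 0 * (\<sigma> (int k - int 0) * Z (int k - int 0) \<omega>)\<bar> \<le> \<bar>c 0\<bar> * (\<beta>2 * (h * a n))"
      unfolding abs_mult using all[of 0] \<sigma>_le \<sigma>_pos[of "int k - int 0"] \<beta>2_pos by (intro mult_left_mono mult_mono) auto
    also have "\<dots> = (\<beta>2 * h * \<bar>c 0\<bar>) * a n" by (simp add: mult_ac)
    also have "\<dots> \<le> \<tau> * a n"
    proof (intro mult_right_mono order_trans[OF _ h(2)] mult_left_mono)
      show "\<bar>c 0\<bar> \<le> (\<Sum>j\<le>l. \<bar>c j\<bar>)" by (rule member_le_sum) auto
    qed (use an h(1) \<beta>2_pos in auto)
    finally have "X k \<omega> \<le> 3 * \<tau> * a n" using z0 by linarith
    then have "b * X k \<omega> \<le> b * (3 * \<tau> * a n)" using b(1) by (intro mult_left_mono) auto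
    also have "\<dots> \<le> B * (3 * \<tau> * a n)" using b(2) \<tau>(1) an by (intro mult_right_mono) auto
    also have "\<dots> = (3 * \<tau> * B) * a n" by simp
    also have "\<dots> \<le> (1 - 1 / (1 + w)) * a n" using \<tau>(2) an by (intro mult_right_mono) auto
    also have "\<dots> = a n - a n / (1 + w)" by (simp add: algebra_simps)
    finally show False using gX aw by (simp add: b_def)
  qed
  then obtain m where m: "m \<le> l" "\<bar>Z (int k - int m) \<omega>\<bar> > h * a n" "1 \<le> int k - int m" by blast
  define i where "i = k - m"
  have ik: "int k - int m = int i" "i \<in> {1..n}" "i \<le> k" "k \<le> i + l" using m k by (auto simp: i_def)
  have "\<bar>X k \<omega> - c m * (\<sigma> (int k - int m) * Z (int k - int m) \<omega>)\<bar> \<le> 2 * \<tau> * a n"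
  proof (rule X_single_summand[OF \<omega> n k h(1) \<theta>(1) m(1) _ h(2) \<theta>(2)])
    fix j assume j: "j \<le> l" "j \<noteq> m"
    show "\<bar>Z (int k - int j) \<omega>\<bar> \<le> h * a n"
      using j k m ik by (intro regular_isolated[OF \<omega> m(2)]) auto
  qed
  then have "X k \<omega> \<le> c m * (\<sigma> (int i) * Z (int i) \<omega>) + 2 * \<tau> * a n" unfolding ik by linarith
  also have "c m * (\<sigma> (int i) * Z (int i) \<omega>) \<le> (if 0 < Z (int i) \<omega> then c_plus c else - c_minus c) * (\<sigma> (int i) * Z (int i) \<omega>)"
    by (rule summand_le_crossing_weight)
  finally have XW: "X k \<omega> - 2 * \<tau> * a n \<le> (if 0 < Z (int i) \<omega> then c_plus c else - c_minus c) * (\<sigma> (int i) * Z (int i) \<omega>)" (is "_ \<le> ?W")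
    by simp
  have "b * (X k \<omega> - 2 * \<tau> * a n) \<le> b * ?W" using XW b(1) by (intro mult_left_mono) auto
  then have bW: "a n / (1 + w) < b * ?W" using small gX by (simp add: algebra_simps b_def)
  then have "0 < b * ?W" using aw by linarith
  then have W0: "0 < ?W" using b(1) by (simp add: zero_less_mult_iff)
  have "b \<le> g (real i / real n) + w" using mod[OF ik(2) k ik(3,4)] by (simp add: b_def abs_le_iff)
  then have "b * ?W \<le> (g (real i / real n) + w) * ?W" using W0 by (intro mult_right_mono) auto
  then have "a n / (1 + w) < (g (real i / real n) + w) * ?W" using bW by linarith
  then have "a n < g1 (real i / real n) * ?W" using w by (simp add: g1_def field_simps)
  then have "\<omega> \<in> crossing (\<lambda>t. g1 t * c_plus c) (\<lambda>t. g1 t * c_minus c) n (real i / real n) (int i)"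
    using crossing_scaled[OF n, of g1 "real i / real n" \<omega> "int i"] g0[OF time_unit[OF ik(2)]] w \<open>\<omega> \<in> space M\<close>
    by (simp add: g1_def mult.assoc)
  then show False using unc ik(2) by (auto simp: uncrossed_def)
qed

end

text \<open>The constants are fixed in the order \<open>B\<close>, \<open>\<tau>\<close>,
  \<open>\<theta>\<close>, \<open>l\<close>, \<open>h\<close>: the window must reach the extreme
  coefficients and be long enough for the remainder before \<open>h\<close> can be fitted to the sum
  of its coefficients.\<close>

lemma below_compare:
  assumes g: "continuous_on {0..1} g" and g0: "\<And>t. t \<in> {0..1} \<Longrightarrow> 0 \<le> g t" and w: "0 < w" and \<epsilon>: "0 < \<epsilon>"
  defines "gl \<equiv> \<lambda>t. max 0 (g t / (1 + w) - w)" and "gu \<equiv> \<lambda>t. (g t + w) * (1 + w)"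
  shows "eventually (\<lambda>n. measure M (below g n) \<le> measure M (uncrossed (\<lambda>t. gl t * c_plus c) (\<lambda>t. gl t * c_minus c) n) + \<epsilon>
    \<and> measure M (uncrossed (\<lambda>t. gu t * c_plus c) (\<lambda>t. gu t * c_minus c) n) - \<epsilon> \<le> measure M (below g n)) sequentially"
proof -
  obtain B where B: "0 < B" "\<And>t. t \<in> {0..1} \<Longrightarrow> \<bar>g t\<bar> \<le> B" using continuous_uniform_bound[OF g] by blast
  define \<tau> where "\<tau> = (1 - 1 / (1 + w)) / (3 * B)"
  have \<tau>: "0 < \<tau>" "3 * \<tau> * B \<le> 1 - 1 / (1 + w)" using w B(1) by (auto simp: \<tau>_def)
  define \<theta> where "\<theta> = \<tau> / \<beta>2"
  have \<theta>: "0 < \<theta>" "\<beta>2 * \<theta> \<le> \<tau>" using \<tau>(1) \<beta>2_pos by (auto simp: \<theta>_def)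
  obtain l0 where l0: "\<And>l h. l \<ge> l0 \<Longrightarrow> 0 < h \<Longrightarrow>
    eventually (\<lambda>n. measure M (space M - regular l h \<theta> n) \<le> \<epsilon>) sequentially"
    using regular_prob[OF \<theta>(1) \<epsilon>] by blast
  obtain jp where jp: "0 < c_plus c \<Longrightarrow> c jp = c_plus c" using c_plus_attained by blast
  obtain jm where jm: "0 < c_minus c \<Longrightarrow> - c jm = c_minus c" using c_minus_attained by blast
  define l where "l = max l0 (max jp jm)"
  have l: "l \<ge> l0" "jp \<le> l" "jm \<le> l" by (auto simp: l_def)
  define S where "S = (\<Sum>j\<le>l. \<bar>c j\<bar>)"
  have S: "0 \<le> S" unfolding S_def by (intro sum_nonneg) auto
  define G where "G = B * (c_plus c + c_minus c)"
  have G: "0 \<le> G" using B(1) c_plus_nonneg c_minus_nonneg by (simp add: G_def)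
  \<comment> \<open>The summands 1 keep the denominators positive and the second bound
    strict.\<close>
  define h where "h = min (\<tau> / (\<beta>2 * (S + 1))) (1 / (\<beta>2 * (G + 1)))"
  have h: "0 < h" using \<tau>(1) \<beta>2_pos S G by (simp add: h_def add_nonneg_pos)
  have "\<beta>2 * h * S \<le> \<beta>2 * (\<tau> / (\<beta>2 * (S + 1))) * S"
    using \<beta>2_pos S by (intro mult_right_mono mult_left_mono) (auto simp: h_def)
  also have "\<dots> = \<tau> * (S / (S + 1))" using \<beta>2_pos by simp
  also have "\<dots> \<le> \<tau>" using S \<tau>(1) by (simp add: mult_left_le divide_le_eq)
  finally have hS: "\<beta>2 * h * S \<le> \<tau>" .
  have "h * (\<beta>2 * G) \<le> (1 / (\<beta>2 * (G + 1))) * (\<beta>2 * G)"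
    using \<beta>2_pos G by (intro mult_right_mono) (auto simp: h_def)
  also have "\<dots> = G / (G + 1)" using \<beta>2_pos by simp
  also have "\<dots> < 1" using G by (simp add: divide_less_eq)
  finally have hG: "h * (\<beta>2 * G) < 1" .
  obtain d where d: "0 < d" "\<And>t t'. t \<in> {0..1} \<Longrightarrow> t' \<in> {0..1} \<Longrightarrow> \<bar>t - t'\<bar> < d \<Longrightarrow> \<bar>g t - g t'\<bar> < w"
    using continuous_uniform_modulus[OF g w] by blast
  have "(\<lambda>n. real l / real n) \<longlonglongrightarrow> 0" by real_asymp
  then have "eventually (\<lambda>n. real l / real n < d) sequentially" using d(1) by (rule order_tendstoD)
  with l0[OF l(1) h] show ?thesis
    using eventually_ge_at_top[of 1]
  proof eventually_elim
    case (elim n)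
    have mod: "\<bar>g (real i / real n) - g (real k / real n)\<bar> \<le> w"
      if "i \<in> {1..n}" "k \<in> {1..n}" "i \<le> k" "k \<le> i + l" for i k
    proof -
      have "\<bar>real i - real k\<bar> \<le> real l" using that by simp
      then have "\<bar>real i / real n - real k / real n\<bar> \<le> real l / real n"
        by (simp add: diff_divide_distrib[symmetric] divide_right_mono)
      then show ?thesis using elim(2) that by (intro less_imp_le d(2)) auto
    qed
    have bounds: "\<And>t. t \<in> {0..1} \<Longrightarrow> g t \<le> B" using B(2) by (simp add: abs_le_iff)
    have att: "0 < c_plus c \<Longrightarrow> \<exists>j\<le>l. c j = c_plus c" "0 < c_minus c \<Longrightarrow> \<exists>j\<le>l. - c j = c_minus c"
      using jp jm l(2,3) by blast+
    let ?R = "regular l h \<theta> n"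
    have bad: "measure M (space M - ?R) \<le> \<epsilon>" by (rule elim(1))
    have split: "measure M A \<le> measure M A' + \<epsilon>" if "A \<in> sets M" "A' \<in> sets M" "A \<inter> ?R \<subseteq> A'" for A A'
    proof -
      have "A \<subseteq> A' \<union> (space M - ?R)" using that sets.sets_into_space by blast
      then have "measure M A \<le> measure M (A' \<union> (space M - ?R))" using that by (intro finite_measure_mono) auto
      also have "\<dots> \<le> measure M A' + measure M (space M - ?R)" using that by (intro measure_Un_le) auto
      finally show ?thesis using bad by simp
    qed
    have "measure M (below g n) \<le> measure M (uncrossed (\<lambda>t. gl t * c_plus c) (\<lambda>t. gl t * c_minus c) n) + \<epsilon>"
    proof (intro split below_sets uncrossed_sets subsetI)
      fix \<omega> assume "\<omega> \<in> below g n \<inter> ?R"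
      then have \<omega>: "\<omega> \<in> ?R" "\<omega> \<in> below g n" by auto
      show "\<omega> \<in> uncrossed (\<lambda>t. gl t * c_plus c) (\<lambda>t. gl t * c_minus c) n"
        unfolding gl_def
        by (rule below_imp_uncrossed[OF g0 bounds B(1) w \<tau> h hS[unfolded S_def] hG[unfolded G_def] \<theta> att elim(3) mod \<omega>])
    qed
    moreover have "measure M (uncrossed (\<lambda>t. gu t * c_plus c) (\<lambda>t. gu t * c_minus c) n) \<le> measure M (below g n) + \<epsilon>"
    proof (intro split below_sets uncrossed_sets subsetI)
      fix \<omega> assume "\<omega> \<in> uncrossed (\<lambda>t. gu t * c_plus c) (\<lambda>t. gu t * c_minus c) n \<inter> ?R"
      then have \<omega>: "\<omega> \<in> ?R" "\<omega> \<in> uncrossed (\<lambda>t. gu t * c_plus c) (\<lambda>t. gu t * c_minus c) n" by auto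
      show "\<omega> \<in> below g n"
        by (rule uncrossed_imp_below[OF g0 bounds B(1) w \<tau> h hS[unfolded S_def] hG[unfolded G_def] \<theta> att elim(3) mod \<omega>[unfolded gu_def]])
    qed
    ultimately show ?case by simp
  qed
qed

theorem below_tendsto:
  assumes g: "continuous_on {0..1} g" and g0: "\<And>t. t \<in> {0..1} \<Longrightarrow> 0 \<le> g t"
  shows "(\<lambda>n. measure M (below g n)) \<longlonglongrightarrow> exp (- crossing_rate (\<lambda>t. g t * c_plus c) (\<lambda>t. g t * c_minus c))"
proof -
  define w where "w N = 1 / real (Suc N)" for N
  have w: "0 < w N" "w N \<le> 1" for N by (auto simp: w_def)
  have w_lim: "w \<longlonglongrightarrow> 0" unfolding w_def by real_asymp
  define gl where "gl N = (\<lambda>t. max 0 (g t / (1 + w N) - w N))" for N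
  define gu where "gu N = (\<lambda>t. (g t + w N) * (1 + w N))" for N
  have w1: "1 + w N \<noteq> 0" for N using w(1)[of N] by linarith
  have gl_cont: "continuous_on {0..1} (gl N)" and gu_cont: "continuous_on {0..1} (gu N)" for N
    unfolding gl_def gu_def using w1 by (intro continuous_intros g; simp)+
  obtain B where B: "0 < B" "\<And>t. t \<in> {0..1} \<Longrightarrow> \<bar>g t\<bar> \<le> B" using continuous_uniform_bound[OF g] by blast
  have gl_bound: "0 \<le> gl N t \<and> gl N t \<le> B" if "t \<in> {0..1}" for N t
  proof -
    have "g t / (1 + w N) \<le> g t" using g0[OF that] w[of N] by (simp add: divide_le_eq mult_le_cancel_left1)
    then show ?thesis using B(1) B(2)[OF that] w(1)[of N] by (auto simp: gl_def)
  qed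
  have gu_bound: "0 \<le> gu N t \<and> gu N t \<le> (B + 1) * 2" if "t \<in> {0..1}" for N t
  proof -
    have "(g t + w N) * (1 + w N) \<le> (B + 1) * 2"
      using g0[OF that] B(1) B(2)[OF that] w[of N] by (intro mult_mono) auto
    then show ?thesis using g0[OF that] w(1)[of N] by (simp add: gu_def)
  qed
  have gl_lim: "(\<lambda>N. gl N t) \<longlonglongrightarrow> g t" if "t \<in> {0..1}" for t
  proof -
    have "(\<lambda>N. gl N t) \<longlonglongrightarrow> max 0 (g t / (1 + 0) - 0)" unfolding gl_def by (intro tendsto_intros w_lim) simp
    then show ?thesis using g0[OF that] by simp
  qed
  have gu_lim: "(\<lambda>N. gu N t) \<longlonglongrightarrow> g t" for t
  proof -
    have "(\<lambda>N. gu N t) \<longlonglongrightarrow> (g t + 0) * (1 + 0)" unfolding gu_def by (intro tendsto_intros w_lim)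
    then show ?thesis by simp
  qed
  let ?r = "\<lambda>g. crossing_rate (\<lambda>t. g t * c_plus c) (\<lambda>t. g t * c_minus c)"
  have rate_lim: "(\<lambda>N. ?r (f N)) \<longlonglongrightarrow> ?r g"
    if f: "\<And>N. continuous_on {0..1} (f N)" "\<And>N t. t \<in> {0..1} \<Longrightarrow> 0 \<le> f N t \<and> f N t \<le> K"
      "\<And>t. t \<in> {0..1} \<Longrightarrow> (\<lambda>N. f N t) \<longlonglongrightarrow> g t" for f K
  proof (rule crossing_rate_tendsto[where B = "K * c_plus c + K * c_minus c"])
    fix N and t :: real assume t: "t \<in> {0..1}"
    have "0 \<le> K" using f(2)[OF t, of N] by linarith
    then have "0 \<le> K * c_plus c" "0 \<le> K * c_minus c" using c_plus_nonneg c_minus_nonneg by auto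
    moreover have "f N t * c_plus c \<le> K * c_plus c" "f N t * c_minus c \<le> K * c_minus c"
      using f(2)[OF t, of N] c_plus_nonneg c_minus_nonneg by (auto intro: mult_right_mono)
    moreover have "0 \<le> f N t * c_plus c" "0 \<le> f N t * c_minus c"
      using f(2)[OF t, of N] c_plus_nonneg c_minus_nonneg by auto
    ultimately show "0 \<le> f N t * c_plus c \<and> f N t * c_plus c \<le> K * c_plus c + K * c_minus c"
      "0 \<le> f N t * c_minus c \<and> f N t * c_minus c \<le> K * c_plus c + K * c_minus c"
      by linarith+
  qed (intro continuous_intros tendsto_intros f g; assumption)+
  have unc: "(\<lambda>n. measure M (uncrossed (\<lambda>t. f t * c_plus c) (\<lambda>t. f t * c_minus c) n)) \<longlonglongrightarrow> exp (- ?r f)"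
    if "continuous_on {0..1} f" "\<And>t. t \<in> {0..1} \<Longrightarrow> 0 \<le> f t" for f
    using that c_plus_nonneg c_minus_nonneg by (intro uncrossed_tendsto continuous_intros mult_nonneg_nonneg) auto
  have cmp: "eventually (\<lambda>n. measure M (below g n) \<le> measure M (uncrossed (\<lambda>t. gl N t * c_plus c) (\<lambda>t. gl N t * c_minus c) n) + w N
    \<and> measure M (uncrossed (\<lambda>t. gu N t * c_plus c) (\<lambda>t. gu N t * c_minus c) n) - w N \<le> measure M (below g n)) sequentially" for N
    unfolding gl_def gu_def by (rule below_compare[OF g g0 w(1) w(1)])
  show ?thesis
  proof (rule tendsto_by_bounds)
    show "eventually (\<lambda>n. measure M (below g n) \<le> measure M (uncrossed (\<lambda>t. gl N t * c_plus c) (\<lambda>t. gl N t * c_minus c) n) + w N) sequentially" for N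
      using cmp[of N] by eventually_elim simp
    show "eventually (\<lambda>n. measure M (uncrossed (\<lambda>t. gu N t * c_plus c) (\<lambda>t. gu N t * c_minus c) n) - w N \<le> measure M (below g n)) sequentially" for N
      using cmp[of N] by eventually_elim simp
    show "(\<lambda>n. measure M (uncrossed (\<lambda>t. gl N t * c_plus c) (\<lambda>t. gl N t * c_minus c) n) + w N) \<longlonglongrightarrow> exp (- ?r (gl N)) + w N" for N
      using gl_bound by (intro tendsto_intros unc gl_cont) auto
    show "(\<lambda>n. measure M (uncrossed (\<lambda>t. gu N t * c_plus c) (\<lambda>t. gu N t * c_minus c) n) - w N) \<longlonglongrightarrow> exp (- ?r (gu N)) - w N" for N
      using gu_bound by (intro tendsto_intros unc gu_cont) auto
    have "(\<lambda>N. exp (- ?r (gl N)) + w N) \<longlonglongrightarrow> exp (- ?r g) + 0"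
      by (intro tendsto_intros w_lim rate_lim[OF gl_cont gl_bound gl_lim])
    then show "(\<lambda>N. exp (- ?r (gl N)) + w N) \<longlonglongrightarrow> exp (- ?r g)" by simp
    have "(\<lambda>N. exp (- ?r (gu N)) - w N) \<longlonglongrightarrow> exp (- ?r g) - 0"
      by (intro tendsto_intros w_lim rate_lim[OF gu_cont gu_bound gu_lim])
    then show "(\<lambda>N. exp (- ?r (gu N)) - w N) \<longlonglongrightarrow> exp (- ?r g)" by simp
  qed
qed

end

section \<open>Finite-dimensional distributions of the partial maxima\<close>

text \<open>Including 0 gives the empty family a meaning: no barrier at all.\<close>

definition max0 :: "'i set \<Rightarrow> ('i \<Rightarrow> real) \<Rightarrow> real" where
  "max0 S f = Max (insert 0 (f ` S))"

lemma max0_empty [simp]: "max0 {} f = 0"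
  by (simp add: max0_def)

lemma max0_insert [simp]: "finite S \<Longrightarrow> max0 (insert x S) f = max (f x) (max0 S f)"
  unfolding max0_def image_insert insert_commute[of 0 "f x"] by (rule Max_insert) auto

lemma max0_le_iff: "finite S \<Longrightarrow> max0 S f \<le> y \<longleftrightarrow> 0 \<le> y \<and> (\<forall>v\<in>S. f v \<le> y)"
  by (induction S rule: finite_induct) auto

lemma max0_nonneg: "finite S \<Longrightarrow> 0 \<le> max0 S f"
  by (simp add: max0_def)

lemma max0_mono: "finite S \<Longrightarrow> (\<And>v. v \<in> S \<Longrightarrow> f v \<le> g v) \<Longrightarrow> max0 S f \<le> max0 S g"
proof (induction S rule: finite_induct)
  case (insert x F)
  have "max0 F f \<le> max0 F g" by (rule insert.IH) (simp add: insert.prems)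
  then show ?case using insert.hyps(1) insert.prems[of x] by (simp only: max0_insert) (intro max.mono; simp)
qed simp

lemma max0_continuous:
  "finite S \<Longrightarrow> (\<And>v. v \<in> S \<Longrightarrow> continuous_on A (f v)) \<Longrightarrow> continuous_on A (\<lambda>t. max0 S (\<lambda>v. f v t))"
  by (induction S rule: finite_induct) (auto intro!: continuous_intros)

lemma max0_measurable:
  "finite S \<Longrightarrow> (\<And>v. v \<in> S \<Longrightarrow> f v \<in> borel_measurable M) \<Longrightarrow> (\<lambda>t. max0 S (\<lambda>v. f v t)) \<in> borel_measurable M"
  by (induction S rule: finite_induct) auto

lemma max0_tendsto:
  "finite S \<Longrightarrow> (\<And>v. v \<in> S \<Longrightarrow> ((\<lambda>n. f n v) \<longlongrightarrow> g v) F) \<Longrightarrow> ((\<lambda>n. max0 S (f n)) \<longlongrightarrow> max0 S g) F"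
  by (induction S rule: finite_induct) (auto intro!: tendsto_intros)

text \<open>If \<open>x\<close> is not positive, both sides hold because \<open>A > 0\<close>;
  otherwise one may divide by \<open>x\<close>.\<close>

lemma max0_mult_le_iff:
  assumes S: "finite S" and A: "0 < A" and f: "\<And>v. v \<in> S \<Longrightarrow> 0 \<le> f v"
  shows "max0 S f * x \<le> A \<longleftrightarrow> (\<forall>v\<in>S. f v * x \<le> A)"
proof (cases "0 < x")
  case True
  then show ?thesis using A by (simp add: pos_le_divide_eq[symmetric] max0_le_iff[OF S])
next
  case False
  then have "max0 S f * x \<le> 0" "\<And>v. v \<in> S \<Longrightarrow> f v * x \<le> 0"
    using max0_nonneg[OF S, of f] f by (auto intro!: mult_nonneg_nonpos)
  then show ?thesis using A by (auto intro: order_trans[of _ 0])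
qed

text \<open>\<open>step_barrier m S\<close> is the reciprocal of the lowest of the levels \<open>i / m\<close>, \<open>(j, i) \<in> S\<close>, that are
  in force at time \<open>t\<close>, namely those with \<open>t \<le> j / m\<close>; it is \<open>0\<close> if there is none. The functions
  \<open>ramp_barrier\<close> are continuous approximations.\<close>

definition step_barrier :: "nat \<Rightarrow> (nat \<times> nat) set \<Rightarrow> real \<Rightarrow> real" where
  "step_barrier m S t = max0 S (\<lambda>v. real m / real (snd v) * of_bool (t \<le> real (fst v) / real m))"

definition ramp_barrier :: "real \<Rightarrow> nat \<Rightarrow> (nat \<times> nat) set \<Rightarrow> nat \<Rightarrow> real \<Rightarrow> real" where
  "ramp_barrier b m S N t = max0 S (\<lambda>v. real m / real (snd v) * max 0 (min 1 (b + real N * (real (fst v) / real m - t))))"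

context
  fixes m :: nat and S :: "(nat \<times> nat) set"
  assumes S: "finite S"
begin

lemma ramp_barrier_continuous: "continuous_on A (ramp_barrier b m S N)"
  unfolding ramp_barrier_def by (intro max0_continuous S continuous_intros)

lemma ramp_barrier_bounds: "0 \<le> ramp_barrier b m S N t" "ramp_barrier b m S N t \<le> max0 S (\<lambda>v. real m / real (snd v))"
proof -
  show "0 \<le> ramp_barrier b m S N t" unfolding ramp_barrier_def by (rule max0_nonneg[OF S])
  have le: "x * max 0 (min 1 y) \<le> x" if "0 \<le> x" for x y :: real
    using mult_left_mono[of "max 0 (min 1 y)" 1 x] that by simp
  show "ramp_barrier b m S N t \<le> max0 S (\<lambda>v. real m / real (snd v))"
    unfolding ramp_barrier_def by (intro max0_mono[OF S] le) simp
qed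

lemma step_barrier_nonneg: "0 \<le> step_barrier m S t"
  unfolding step_barrier_def by (rule max0_nonneg[OF S])

lemma step_barrier_measurable: "step_barrier m S \<in> borel_measurable borel"
  unfolding step_barrier_def of_bool_def by (intro max0_measurable S) measurable

lemma step_barrier_bound: "step_barrier m S t \<le> max0 S (\<lambda>v. real m / real (snd v))"
  unfolding step_barrier_def by (intro max0_mono[OF S]) auto

text \<open>The parameter \<open>b\<close> decides the side: ramps with \<open>b = 0\<close>
  approximate the indicator of \<open>t \<le> j / m\<close> from below, those with
  \<open>b = 1\<close> from above.\<close>

lemma ramp_barrier_le: "ramp_barrier 0 m S N t \<le> step_barrier m S t"
  unfolding ramp_barrier_def step_barrier_def
proof (intro max0_mono[OF S] mult_left_mono)
  fix v
  show "max 0 (min 1 (0 + real N * (real (fst v) / real m - t))) \<le> of_bool (t \<le> real (fst v) / real m)"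
  proof (cases "t \<le> real (fst v) / real m")
    case False
    then have "real N * (real (fst v) / real m - t) \<le> 0" by (intro mult_nonneg_nonpos) auto
    then show ?thesis by simp
  qed simp
qed simp

lemma ramp_barrier_ge: "step_barrier m S t \<le> ramp_barrier 1 m S N t"
  unfolding ramp_barrier_def step_barrier_def by (intro max0_mono[OF S] mult_left_mono) auto

text \<open>Away from the jump times each ramp is eventually constant in \<open>N\<close>. At its
  own jump time a ramp does not move with \<open>N\<close>; these finitely many times are excluded
  and form a null set.\<close>

lemma ramp_barrier_tendsto:
  assumes t: "\<And>v. v \<in> S \<Longrightarrow> t \<noteq> real (fst v) / real m"
  shows "(\<lambda>N. ramp_barrier b m S N t) \<longlonglongrightarrow> step_barrier m S t"
  unfolding ramp_barrier_def step_barrier_def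
proof (intro max0_tendsto[OF S] tendsto_mult tendsto_const)
  fix v assume "v \<in> S"
  define x where "x = real (fst v) / real m - t"
  have x: "x \<noteq> 0" using t[OF \<open>v \<in> S\<close>] by (simp add: x_def)
  show "(\<lambda>N. max 0 (min 1 (b + real N * (real (fst v) / real m - t)))) \<longlonglongrightarrow> of_bool (t \<le> real (fst v) / real m)"
  proof (cases "0 < x")
    case True
    then have "eventually (\<lambda>N. 1 \<le> b + real N * x) sequentially" by real_asymp
    then have "eventually (\<lambda>N. max 0 (min 1 (b + real N * x)) = of_bool (t \<le> real (fst v) / real m)) sequentially"
      by eventually_elim (use True in \<open>auto simp: x_def\<close>)
    then show ?thesis unfolding x_def by (rule tendsto_eventually)
  next
    case False
    then have "x < 0" using x by simp
    then have "eventually (\<lambda>N. b + real N * x \<le> 0) sequentially" by real_asymp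
    then have "eventually (\<lambda>N. max 0 (min 1 (b + real N * x)) = of_bool (t \<le> real (fst v) / real m)) sequentially"
      by eventually_elim (use \<open>x < 0\<close> in \<open>auto simp: x_def\<close>)
    then show ?thesis unfolding x_def by (rule tendsto_eventually)
  qed
qed

lemma ramp_barrier_AE_tendsto: "AE t in lborel. t \<in> {0..1} \<longrightarrow> (\<lambda>N. ramp_barrier b m S N t) \<longlonglongrightarrow> step_barrier m S t"
proof -
  have "(\<lambda>v. real (fst v) / real m) ` S \<in> null_sets lborel"
    using S by (intro finite_imp_null_set_lborel) auto
  then have "AE t in lborel. t \<notin> (\<lambda>v. real (fst v) / real m) ` S" by (rule AE_not_in)
  then show ?thesis by eventually_elim (auto intro!: ramp_barrier_tendsto)
qed

end

text \<open>The bridge between grid events and barriers, used for the partial maxima (with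
  \<open>A = a n\<close>) and for the Poisson points (with \<open>A = 1\<close>) alike.\<close>

lemma step_barrier_mult_le_iff:
  assumes S: "finite S" "\<And>v. v \<in> S \<Longrightarrow> 0 < snd v" and m: "0 < m" and A: "0 < A"
  shows "step_barrier m S t * x \<le> A \<longleftrightarrow> (\<forall>v\<in>S. t \<le> real (fst v) / real m \<longrightarrow> x \<le> real (snd v) / real m * A)"
proof -
  have "real m / real (snd v) * of_bool (t \<le> real (fst v) / real m) * x \<le> A \<longleftrightarrow>
      (t \<le> real (fst v) / real m \<longrightarrow> x \<le> real (snd v) / real m * A)" if "v \<in> S" for v
    using S(2)[OF that] m A by (auto simp: field_simps)
  then show ?thesis
    unfolding step_barrier_def by (subst max0_mult_le_iff[OF S(1) A]) auto
qed

lemma (in prob_space) prob_exceed_tendsto_0: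
  fixes X :: "'a \<Rightarrow> real"
  assumes X: "X \<in> borel_measurable M" and b: "filterlim b at_top sequentially"
  shows "(\<lambda>n. measure M {\<omega> \<in> space M. X \<omega> > b n}) \<longlonglongrightarrow> 0"
proof -
  interpret D: real_distribution "distr M borel X" using X by (rule real_distribution_distr)
  have "(\<lambda>n. 1 - cdf (distr M borel X) (b n)) \<longlonglongrightarrow> 1 - 1"
    by (intro tendsto_diff tendsto_const filterlim_compose[OF D.cdf_lim_at_top_prob b])
  moreover have "1 - cdf (distr M borel X) (b n) = measure M {\<omega> \<in> space M. X \<omega> > b n}" for n
  proof -
    have "{\<omega> \<in> space M. X \<omega> > b n} = space M - (X -` {..b n} \<inter> space M)" by auto
    then show ?thesis using X by (simp add: cdf_def measure_distr prob_compl)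
  qed
  ultimately show ?thesis by simp
qed

section \<open>Step barriers and the partial maxima process\<close>

context moving_average_noise
begin

text \<open>The constant of the exponent measure, whose tail is
  \<open>limit_rate * x powr (- \<alpha>)\<close>.\<close>

definition limit_rate :: real where
  "limit_rate = s powr \<alpha> * (p * c_plus c powr \<alpha> + q * c_minus c powr \<alpha>)"

lemma limit_rate_nonneg: "0 \<le> limit_rate"
  using p_nonneg q_nonneg by (simp add: limit_rate_def)

lemma crossing_rate_scaled:
  assumes "\<And>t. t \<in> {0..1} \<Longrightarrow> 0 \<le> g t"
  shows "crossing_rate (\<lambda>t. g t * c_plus c) (\<lambda>t. g t * c_minus c) = limit_rate * (LINT t:{0..1}|lborel. g t powr \<alpha>)"
proof -
  have eq: "(LINT t:{0..1}|lborel. (g t * C) powr \<alpha>) = C powr \<alpha> * (LINT t:{0..1}|lborel. g t powr \<alpha>)" if "0 \<le> C" for C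
  proof -
    have "(LINT t:{0..1}|lborel. (g t * C) powr \<alpha>) = (LINT t:{0..1}|lborel. C powr \<alpha> * g t powr \<alpha>)"
      unfolding set_lebesgue_integral_def using assms that
      by (intro Bochner_Integration.integral_cong) (auto simp: indicator_def powr_mult mult.commute)
    then show ?thesis by simp
  qed
  show ?thesis
    unfolding crossing_rate_def eq[OF c_plus_nonneg] eq[OF c_minus_nonneg] limit_rate_def by (simp add: algebra_simps)
qed

text \<open>Larger reciprocals mean lower barriers; negative \<open>X k\<close> stay below each of
  them since \<open>a n > 0\<close>.\<close>

lemma below_antimono:
  assumes n: "n \<ge> 1" and "\<And>t. 0 \<le> g t" "\<And>t. g t \<le> g' t"
  shows "below g' n \<subseteq> below g n"
proof
  fix \<omega> assume \<omega>: "\<omega> \<in> below g' n"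
  have "g (real k / real n) * X k \<omega> \<le> a n" if k: "k \<in> {1..n}" for k
  proof (cases "0 \<le> X k \<omega>")
    case True
    then have "g (real k / real n) * X k \<omega> \<le> g' (real k / real n) * X k \<omega>" using assms by (intro mult_right_mono)
    moreover have "g' (real k / real n) * X k \<omega> \<le> a n" using \<omega> k unfolding below_def by blast
    ultimately show ?thesis by linarith
  next
    case False
    then have "g (real k / real n) * X k \<omega> \<le> 0" using assms by (intro mult_nonneg_nonpos) auto
    then show ?thesis using a_pos[OF n] by linarith
  qed
  then show "\<omega> \<in> below g n" using \<omega> by (simp add: below_def)
qed

text \<open>A step barrier is squeezed between continuous ramps; the integrals agree in the limit
  because the ramps converge to the step almost everywhere.\<close>

lemma below_step_tendsto:
  assumes S: "finite S"
  shows "(\<lambda>n. measure M (below (step_barrier m S) n))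
    \<longlonglongrightarrow> exp (- (limit_rate * (LINT t:{0..1}|lborel. step_barrier m S t powr \<alpha>)))"
proof -
  let ?I = "\<lambda>g. limit_rate * (LINT t:{0..1}|lborel. g t powr \<alpha>)"
  have ramp: "(\<lambda>n. measure M (below (ramp_barrier b m S N) n)) \<longlonglongrightarrow> exp (- ?I (ramp_barrier b m S N))" for b N
    using below_tendsto[OF ramp_barrier_continuous[OF S], of b m N] ramp_barrier_bounds(1)[OF S]
      crossing_rate_scaled[of "ramp_barrier b m S N"] by simp
  have I: "(\<lambda>N. exp (- ?I (ramp_barrier b m S N))) \<longlonglongrightarrow> exp (- ?I (step_barrier m S))" for b
  proof (intro tendsto_intros powr_integral_tendsto[OF alpha])
    show "(\<lambda>t. indicator {0..1} t * ramp_barrier b m S N t) \<in> borel_measurable borel" for N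
      by (rule continuous_indicator_measurable[OF ramp_barrier_continuous[OF S]])
    show "(\<lambda>t. indicator {0..1} t * step_barrier m S t) \<in> borel_measurable borel"
      using step_barrier_measurable[OF S] by measurable
    show "AE t in lborel. t \<in> {0..1} \<longrightarrow> (\<lambda>N. ramp_barrier b m S N t) \<longlonglongrightarrow> step_barrier m S t"
      by (rule ramp_barrier_AE_tendsto[OF S])
  qed (use ramp_barrier_bounds[OF S] in blast)
  show ?thesis
  proof (rule tendsto_by_bounds[OF _ ramp[of 0] I _ ramp[of 1] I])
    show "eventually (\<lambda>n. measure M (below (step_barrier m S) n) \<le> measure M (below (ramp_barrier 0 m S N) n)) sequentially" for N
      using eventually_ge_at_top[of 1]
      by eventually_elim (intro finite_measure_mono below_antimono below_sets ramp_barrier_bounds ramp_barrier_le S)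
    show "eventually (\<lambda>n. measure M (below (ramp_barrier 1 m S N) n) \<le> measure M (below (step_barrier m S) n)) sequentially" for N
      using eventually_ge_at_top[of 1]
      by eventually_elim (intro finite_measure_mono below_antimono below_sets step_barrier_nonneg ramp_barrier_ge S)
  qed
qed

abbreviation V :: "nat \<Rightarrow> 'a \<Rightarrow> real \<Rightarrow> real" where "V \<equiv> maxima_process X a"

text \<open>\<open>max 1 k\<close> reproduces the convention on \<open>[0, 1/n)\<close>: the index 0
  yields the maximum over the single term \<open>X 1 / a n\<close>.\<close>

lemma V_step_path: "V n \<omega> = step_path n (\<lambda>k. Max ((\<lambda>i. X i \<omega> / a n) ` {1..max 1 k}))"
proof
  fix t
  show "V n \<omega> t = step_path n (\<lambda>k. Max ((\<lambda>i. X i \<omega> / a n) ` {1..max 1 k})) t"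
  proof (cases "t \<in> {0..1}")
    case t: True
    show ?thesis
    proof (cases "real n * t < 1")
      case True
      then have "nat \<lfloor>real n * t\<rfloor> = 0" by linarith
      then show ?thesis using True t by (simp add: maxima_process_def step_path_def)
    next
      case False
      then have "max 1 (nat \<lfloor>real n * t\<rfloor>) = nat \<lfloor>real n * t\<rfloor>" by linarith
      then show ?thesis using False t by (simp add: maxima_process_def step_path_def)
    qed
  next
    case False
    then show ?thesis unfolding maxima_process_def step_path_def restrict_apply by (simp only: if_False)
  qed
qed

lemma running_max_mono: "i \<le> j \<Longrightarrow> Max ((\<lambda>i. X i \<omega> / a n) ` {1..max 1 i}) \<le> Max ((\<lambda>i. X i \<omega> / a n) ` {1..max 1 j})"
  by (intro Max_mono image_mono) auto

lemma running_max_measurable: "(\<lambda>\<omega>. Max ((\<lambda>i. X i \<omega> / a n) ` {1..max 1 k})) \<in> borel_measurable M"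
  by (intro borel_measurable_Max) auto

lemma V_mono_paths: "V n \<omega> \<in> mono_paths"
  unfolding V_step_path by (intro step_path_mono_paths running_max_mono)

lemma V_measurable: "V n \<in> measurable M (borel_of M1_topology)"
proof -
  have "(\<lambda>\<omega>. step_path n (\<lambda>k. Max ((\<lambda>i. X i \<omega> / a n) ` {1..max 1 k}))) \<in> measurable M (borel_of M1_topology)"
    by (intro step_path_measurable running_max_measurable running_max_mono)
  then show ?thesis unfolding V_step_path[symmetric] .
qed

lemma V_coordinate_measurable: "t \<in> {0..1} \<Longrightarrow> (\<lambda>\<omega>. V n \<omega> t) \<in> borel_measurable M"
  unfolding V_step_path step_path_def using running_max_measurable by simp

lemma V_0: "V n \<omega> 0 = X 1 \<omega> / a n"
  by (simp add: maxima_process_def)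

text \<open>\<open>X 1\<close> is one fixed random variable, while \<open>a n\<close> tends to
  infinity.\<close>

lemma V_start_tendsto: "0 < e \<Longrightarrow> (\<lambda>n. measure M {\<omega> \<in> space M. V n \<omega> 0 < - e}) \<longlonglongrightarrow> 0"
  "0 < e \<Longrightarrow> (\<lambda>n. measure M {\<omega> \<in> space M. V n \<omega> 0 > e}) \<longlonglongrightarrow> 0"
proof -
  assume e: "0 < e"
  have A: "(\<lambda>n. measure M {\<omega> \<in> space M. - X 1 \<omega> > e * a n}) \<longlonglongrightarrow> 0"
    by (intro prob_exceed_tendsto_0 scaled_a_top e) measurable
  have B: "(\<lambda>n. measure M {\<omega> \<in> space M. X 1 \<omega> > e * a n}) \<longlonglongrightarrow> 0"
    by (intro prob_exceed_tendsto_0 scaled_a_top e) measurable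
  have "eventually (\<lambda>n. measure M {\<omega> \<in> space M. - X 1 \<omega> > e * a n} = measure M {\<omega> \<in> space M. V n \<omega> 0 < - e}) sequentially"
    using eventually_ge_at_top[of 1]
  proof eventually_elim
    case (elim n)
    have "{\<omega> \<in> space M. - X 1 \<omega> > e * a n} = {\<omega> \<in> space M. V n \<omega> 0 < - e}"
      using a_pos[OF elim] by (auto simp: V_0 pos_divide_less_eq)
    then show ?case by simp
  qed
  then show "(\<lambda>n. measure M {\<omega> \<in> space M. V n \<omega> 0 < - e}) \<longlonglongrightarrow> 0" by (rule Lim_transform_eventually[OF A])
  have "eventually (\<lambda>n. measure M {\<omega> \<in> space M. X 1 \<omega> > e * a n} = measure M {\<omega> \<in> space M. V n \<omega> 0 > e}) sequentially"
    using eventually_ge_at_top[of 1]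
  proof eventually_elim
    case (elim n)
    have "{\<omega> \<in> space M. X 1 \<omega> > e * a n} = {\<omega> \<in> space M. V n \<omega> 0 > e}"
      using a_pos[OF elim] by (auto simp: V_0 pos_less_divide_eq)
    then show ?case by simp
  qed
  then show "(\<lambda>n. measure M {\<omega> \<in> space M. V n \<omega> 0 > e}) \<longlonglongrightarrow> 0" by (rule Lim_transform_eventually[OF B])
qed

text \<open>From \<open>n \<ge> m\<close> and \<open>j \<ge> 1\<close> one gets
  \<open>real n * (j / m) \<ge> 1\<close>, so the convention for small times does not
  interfere.\<close>

lemma V_le_iff:
  assumes n: "n \<ge> m" "m > 0" and j: "1 \<le> j" "j \<le> m"
  shows "V n \<omega> (real j / real m) \<le> y \<longleftrightarrow> (\<forall>k\<in>{1..n}. real k / real n \<le> real j / real m \<longrightarrow> X k \<omega> / a n \<le> y)"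
proof -
  let ?K = "nat \<lfloor>real n * (real j / real m)\<rfloor>"
  have np: "n > 0" using n by simp
  have "real m * 1 \<le> real n * real j" using n j by (intro mult_mono) auto
  then have nt: "1 \<le> real n * (real j / real m)" using n(2) by (simp add: pos_le_divide_eq)
  have t: "real j / real m \<in> {0..1}" using j n(2) by auto
  have k_iff: "k \<le> ?K \<longleftrightarrow> real k / real n \<le> real j / real m" for k
  proof -
    have "k \<le> ?K \<longleftrightarrow> real k \<le> real n * (real j / real m)" using nt by linarith
    then show ?thesis using np by (simp add: pos_divide_le_eq mult.commute)
  qed
  have K: "1 \<le> ?K" "?K \<le> n"
  proof -
    show "1 \<le> ?K" using nt by linarith
    have "real ?K / real n \<le> real j / real m" using k_iff by blast
    also have "\<dots> \<le> 1" using t by simp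
    finally show "?K \<le> n" using np by simp
  qed
  have "V n \<omega> (real j / real m) = Max ((\<lambda>k. X k \<omega> / a n) ` {1..?K})"
    using nt t by (simp add: maxima_process_def)
  then have "V n \<omega> (real j / real m) \<le> y \<longleftrightarrow> (\<forall>k\<in>{1..?K}. X k \<omega> / a n \<le> y)"
    using K by (simp add: Max_le_iff)
  also have "{1..?K} = {k \<in> {1..n}. real k / real n \<le> real j / real m}"
    unfolding k_iff[symmetric] using K(2) by auto
  also have "(\<forall>k\<in>{k \<in> {1..n}. real k / real n \<le> real j / real m}. X k \<omega> / a n \<le> y) \<longleftrightarrow>
      (\<forall>k\<in>{1..n}. real k / real n \<le> real j / real m \<longrightarrow> X k \<omega> / a n \<le> y)" by blast
  finally show ?thesis .
qed

text \<open>Constraints at grid time 0 concern \<open>X 1 / a n\<close> only and are invisible to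
  \<open>below\<close>, which tests the times \<open>k / n > 0\<close>. They hold off an event of
  vanishing probability, because every level is at least \<open>1 / m\<close>.\<close>

theorem V_fidi_tendsto:
  assumes m: "m > 0" and S: "S \<subseteq> {..m} \<times> {1..m\<^sup>2}"
  shows "(\<lambda>n. measure M {\<omega> \<in> space M. \<forall>v\<in>S. V n \<omega> (real (fst v) / real m) \<le> real (snd v) / real m})
    \<longlonglongrightarrow> exp (- (limit_rate * (LINT t:{0..1}|lborel. step_barrier m S t powr \<alpha>)))"
proof -
  have fS: "finite S" using S finite_subset by blast
  let ?E = "\<lambda>n. {\<omega> \<in> space M. \<forall>v\<in>S. V n \<omega> (real (fst v) / real m) \<le> real (snd v) / real m}"
  let ?B = "\<lambda>n. below (step_barrier m S) n"
  let ?D = "\<lambda>n. {\<omega> \<in> space M. V n \<omega> 0 > 1 / real m}"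
  have Dm: "?D n \<in> sets M" for n using V_coordinate_measurable[of 0 n] by measurable
  have Em: "?E n \<in> sets M" for n
  proof -
    have "Measurable.pred M (\<lambda>\<omega>. \<forall>v\<in>S. V n \<omega> (real (fst v) / real m) \<le> real (snd v) / real m)"
    proof (rule pred_intros_finite[OF fS])
      fix v assume "v \<in> S"
      then have "real (fst v) / real m \<in> {0..1}" using S m by auto
      from V_coordinate_measurable[OF this, of n]
      show "Measurable.pred M (\<lambda>\<omega>. V n \<omega> (real (fst v) / real m) \<le> real (snd v) / real m)" by measurable
    qed
    then show ?thesis by simp
  qed
  have sub: "?E n \<subseteq> ?B n" "?B n \<subseteq> ?E n \<union> ?D n" if n: "n \<ge> m" for n
  proof -
    have n1: "n \<ge> 1" using n m by simp
    have an: "0 < a n" using a_pos[OF n1] .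
    have B_iff: "\<omega> \<in> ?B n \<longleftrightarrow> \<omega> \<in> space M \<and> (\<forall>v\<in>S. fst v \<ge> 1 \<longrightarrow> V n \<omega> (real (fst v) / real m) \<le> real (snd v) / real m)" for \<omega>
    proof -
      have "\<omega> \<in> ?B n \<longleftrightarrow> \<omega> \<in> space M \<and> (\<forall>k\<in>{1..n}. \<forall>v\<in>S. real k / real n \<le> real (fst v) / real m \<longrightarrow> X k \<omega> \<le> real (snd v) / real m * a n)"
        unfolding below_def using S by (subst step_barrier_mult_le_iff[OF fS _ m an]) auto
      also have "\<dots> \<longleftrightarrow> \<omega> \<in> space M \<and> (\<forall>v\<in>S. \<forall>k\<in>{1..n}. real k / real n \<le> real (fst v) / real m \<longrightarrow> X k \<omega> / a n \<le> real (snd v) / real m)"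
        using an by (auto simp: pos_divide_le_eq)
      also have "(\<forall>v\<in>S. \<forall>k\<in>{1..n}. real k / real n \<le> real (fst v) / real m \<longrightarrow> X k \<omega> / a n \<le> real (snd v) / real m) \<longleftrightarrow>
          (\<forall>v\<in>S. fst v \<ge> 1 \<longrightarrow> V n \<omega> (real (fst v) / real m) \<le> real (snd v) / real m)"
      proof (rule ball_cong[OF refl])
        fix v assume v: "v \<in> S"
        show "(\<forall>k\<in>{1..n}. real k / real n \<le> real (fst v) / real m \<longrightarrow> X k \<omega> / a n \<le> real (snd v) / real m) \<longleftrightarrow>
          (fst v \<ge> 1 \<longrightarrow> V n \<omega> (real (fst v) / real m) \<le> real (snd v) / real m)"
        proof (cases "fst v \<ge> 1")
          case True
          then show ?thesis using V_le_iff[OF n m, of "fst v"] v S by auto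
        next
          case False
          have "\<not> real k / real n \<le> real (fst v) / real m" if "k \<in> {1..n}" for k
            using False that by (simp add: not_le)
          then show ?thesis using False by blast
        qed
      qed
      finally show ?thesis .
    qed
    show "?E n \<subseteq> ?B n" unfolding B_iff subset_iff by auto
    show "?B n \<subseteq> ?E n \<union> ?D n"
    proof
      fix \<omega> assume "\<omega> \<in> ?B n"
      then have \<omega>: "\<omega> \<in> space M" "\<And>v. v \<in> S \<Longrightarrow> fst v \<ge> 1 \<Longrightarrow> V n \<omega> (real (fst v) / real m) \<le> real (snd v) / real m"
        by (auto simp: B_iff)
      show "\<omega> \<in> ?E n \<union> ?D n"
      proof (cases "V n \<omega> 0 > 1 / real m")
        case False
        have "V n \<omega> (real (fst v) / real m) \<le> real (snd v) / real m" if v: "v \<in> S" for v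
        proof (cases "fst v \<ge> 1")
          case False
          then have "fst v = 0" by simp
          then have "V n \<omega> (real (fst v) / real m) \<le> 1 / real m" using \<open>\<not> V n \<omega> 0 > 1 / real m\<close> by simp
          also have "\<dots> \<le> real (snd v) / real m" using v S by (intro divide_right_mono) auto
          finally show ?thesis .
        qed (use \<omega>(2) v in auto)
        then show ?thesis using \<omega>(1) by simp
      qed (use \<omega>(1) in simp)
    qed
  qed
  have B: "(\<lambda>n. measure M (?B n)) \<longlonglongrightarrow> exp (- (limit_rate * (LINT t:{0..1}|lborel. step_barrier m S t powr \<alpha>)))"
    by (rule below_step_tendsto[OF fS])
  show ?thesis
  proof (rule tendsto_sandwich)
    show "eventually (\<lambda>n. measure M (?B n) - measure M (?D n) \<le> measure M (?E n)) sequentially"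
      using eventually_ge_at_top[of m]
    proof eventually_elim
      case (elim n)
      have "measure M (?B n) \<le> measure M (?E n \<union> ?D n)" using sub(2)[OF elim] Em Dm by (intro finite_measure_mono) auto
      also have "\<dots> \<le> measure M (?E n) + measure M (?D n)" using Em Dm by (intro measure_Un_le) auto
      finally show ?case by simp
    qed
    show "eventually (\<lambda>n. measure M (?E n) \<le> measure M (?B n)) sequentially"
      using eventually_ge_at_top[of m] by eventually_elim (intro finite_measure_mono sub(1) below_sets)
    show "(\<lambda>n. measure M (?B n) - measure M (?D n)) \<longlonglongrightarrow> exp (- (limit_rate * (LINT t:{0..1}|lborel. step_barrier m S t powr \<alpha>)))"
      using tendsto_diff[OF B V_start_tendsto(2)[of "1 / real m"]] m by simp
  qed (rule B)
qed

end

section \<open>The extremal process\<close>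

definition power_measure :: "real \<Rightarrow> real \<Rightarrow> real measure" where
  "power_measure K \<alpha> = density (restrict_space lborel {0<..}) (\<lambda>x. ennreal (K * (\<alpha> * x powr (- \<alpha> - 1))))"

lemma sets_power_measure: "sets (power_measure K \<alpha>) = sets (restrict_space borel {0<..})"
  by (simp add: power_measure_def sets_restrict_space)

lemma space_power_measure: "space (power_measure K \<alpha>) = {0<..}"
  by (simp add: power_measure_def space_restrict_space)

lemma sigma_finite_power_measure: "sigma_finite_measure (power_measure K \<alpha>)"
proof -
  interpret R: sigma_finite_measure "restrict_space lborel {0<..} :: real measure"
    by (rule sigma_finite_measure_restrict_space) (auto simp: lborel.sigma_finite_measure_axioms)
  show ?thesis
    unfolding power_measure_def by (subst R.sigma_finite_iff_density_finite) (auto intro!: measurable_restrict_space1)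
qed

lemma power_measure_tail:
  assumes K: "0 \<le> K" and \<alpha>: "0 < \<alpha>" and u: "0 < u"
  shows "emeasure (power_measure K \<alpha>) {u<..} = ennreal (K * u powr (- \<alpha>))"
proof -
  let ?f = "\<lambda>x. K * (\<alpha> * x powr (- \<alpha> - 1))"
  have "emeasure (power_measure K \<alpha>) {u<..} = (\<integral>\<^sup>+x. ennreal (?f x) * indicator {u<..} x \<partial>restrict_space lborel {0<..})"
    unfolding power_measure_def
    by (rule emeasure_density) (use u in \<open>auto simp: sets_restrict_space intro!: measurable_restrict_space1 image_eqI[of _ _ "{u<..}"]\<close>)
  also have "\<dots> = (\<integral>\<^sup>+x. ennreal (?f x) * indicator {u<..} x * indicator {0<..} x \<partial>lborel)"
    by (subst nn_integral_restrict_space) auto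
  \<comment> \<open>The point \<open>u\<close> is null; the closed half-line is the form in which
    the improper integral is evaluated by an antiderivative.\<close>
  also have "\<dots> = (\<integral>\<^sup>+x. ennreal (?f x) * indicator {u..} x \<partial>lborel)"
  proof (rule nn_integral_cong_AE)
    have "AE x in lborel. x \<noteq> u" by (rule AE_lborel_singleton)
    then show "AE x in lborel. ennreal (?f x) * indicator {u<..} x * indicator {0<..} x = ennreal (?f x) * indicator {u..} x"
      by eventually_elim (use u in \<open>auto simp: indicator_def\<close>)
  qed
  also have "\<dots> = ennreal (0 - (- K * u powr (- \<alpha>)))"
  proof (rule nn_integral_FTC_atLeast)
    show "((\<lambda>x. - K * x powr (- \<alpha>)) \<longlongrightarrow> 0) at_top" using \<alpha> by real_asymp
    fix x assume "u \<le> x"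
    then have x: "0 < x" using u by simp
    show "0 \<le> ?f x" using K \<alpha> by simp
    show "((\<lambda>x. - K * x powr (- \<alpha>)) has_real_derivative ?f x) (at x)"
      using x by (auto intro!: derivative_eq_intros)
  qed measurable
  finally show ?thesis by simp
qed

text \<open>The product form matches \<open>crossing\<close>, so that the Poisson model and the
  noise lead to the same integral.\<close>

definition barrier_region :: "(real \<Rightarrow> real) \<Rightarrow> (real \<times> real) set" where
  "barrier_region g = {v \<in> {0..1} \<times> {0<..}. 1 < g (fst v) * snd v}"

abbreviation time_power_measure :: "real \<Rightarrow> real \<Rightarrow> (real \<times> real) measure" where
  "time_power_measure K \<alpha> \<equiv> restrict_space lborel {0..1} \<Otimes>\<^sub>M power_measure K \<alpha>"

lemma space_time_power_measure: "space (time_power_measure K \<alpha>) = {0..1} \<times> {0<..}"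
  by (simp add: space_pair_measure space_power_measure space_restrict_space)

lemma barrier_region_sets:
  assumes g: "g \<in> borel_measurable borel"
  shows "barrier_region g \<in> sets (time_power_measure K \<alpha>)"
proof -
  have 1: "(\<lambda>v. g (fst v)) \<in> borel_measurable (time_power_measure K \<alpha>)"
    by (rule measurable_compose[OF measurable_fst]) (use g in \<open>auto intro!: measurable_restrict_space1\<close>)
  have "(\<lambda>x. x) \<in> borel_measurable (power_measure K \<alpha>)"
    by (subst measurable_cong_sets[OF sets_power_measure refl]) (auto intro!: measurable_restrict_space1)
  then have 2: "snd \<in> borel_measurable (time_power_measure K \<alpha>)"
    by (rule measurable_compose[OF measurable_snd])
  have "{v \<in> space (time_power_measure K \<alpha>). 1 < g (fst v) * snd v} \<in> sets (time_power_measure K \<alpha>)"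
    using 1 2 by measurable
  then show ?thesis by (simp add: barrier_region_def space_time_power_measure)
qed

text \<open>The section at time \<open>t\<close> is the half-line above \<open>1 / g t\<close>, of
  mass \<open>K * g t powr \<alpha>\<close>; for \<open>g t = 0\<close> it is empty.\<close>

lemma barrier_region_measure:
  assumes g: "g \<in> borel_measurable borel" "\<And>t. 0 \<le> g t" "\<And>t. g t \<le> B" and K: "0 \<le> K" and \<alpha>: "0 < \<alpha>"
  shows "emeasure (time_power_measure K \<alpha>) (barrier_region g) = ennreal (K * (LINT t:{0..1}|lborel. g t powr \<alpha>))"
proof -
  interpret P: sigma_finite_measure "power_measure K \<alpha>" by (rule sigma_finite_power_measure)
  have "emeasure (time_power_measure K \<alpha>) (barrier_region g) =
      (\<integral>\<^sup>+t. emeasure (power_measure K \<alpha>) (Pair t -` barrier_region g) \<partial>restrict_space lborel {0..1})"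
    by (rule P.emeasure_pair_measure_alt[OF barrier_region_sets[OF g(1)]])
  also have "\<dots> = (\<integral>\<^sup>+t. ennreal (K * g t powr \<alpha>) \<partial>restrict_space lborel {0..1})"
  proof (rule nn_integral_cong)
    fix t :: real assume "t \<in> space (restrict_space lborel {0..1})"
    then have t: "t \<in> {0..1}" by (simp add: space_restrict_space)
    show "emeasure (power_measure K \<alpha>) (Pair t -` barrier_region g) = ennreal (K * g t powr \<alpha>)"
    proof (cases "g t = 0")
      case True
      then have "Pair t -` barrier_region g = {}" by (auto simp: barrier_region_def)
      then show ?thesis using True by simp
    next
      case False
      then have gt: "0 < g t" using g(2)[of t] by simp
      have "Pair t -` barrier_region g = {1 / g t<..}"
      proof (intro set_eqI)
        fix x
        have "1 < g t * x \<longleftrightarrow> 1 / g t < x" using gt by (simp add: pos_divide_less_eq mult.commute)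
        moreover have "0 < x" if "1 / g t < x" using that gt by (meson less_trans zero_less_divide_1_iff)
        ultimately show "x \<in> Pair t -` barrier_region g \<longleftrightarrow> x \<in> {1 / g t<..}"
          using t by (auto simp: barrier_region_def)
      qed
      moreover have "(1 / g t) powr (- \<alpha>) = g t powr \<alpha>" using gt by (simp add: powr_divide powr_minus_divide)
      ultimately show ?thesis using power_measure_tail[OF K \<alpha>, of "1 / g t"] gt by simp
    qed
  qed
  also have "\<dots> = (\<integral>\<^sup>+t. ennreal (indicator {0..1} t *\<^sub>R (K * g t powr \<alpha>)) \<partial>lborel)"
    by (subst nn_integral_restrict_space) (auto intro!: nn_integral_cong simp: indicator_def)
  also have "\<dots> = ennreal (LINT t:{0..1}|lborel. K * g t powr \<alpha>)"
    unfolding set_lebesgue_integral_def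
  proof (rule nn_integral_eq_integral)
    show "integrable lborel (\<lambda>t. indicator {0..1} t *\<^sub>R (K * g t powr \<alpha>))"
    proof (rule Bochner_Integration.integrable_bound)
      show "integrable lborel (\<lambda>t. indicator {0..1 :: real} t *\<^sub>R (K * B powr \<alpha>))" by simp
      show "(\<lambda>t. indicator {0..1} t *\<^sub>R (K * g t powr \<alpha>)) \<in> borel_measurable lborel" using g(1) by measurable
      have "K * g t powr \<alpha> \<le> K * B powr \<alpha>" for t using g(2,3)[of t] K \<alpha> by (intro mult_left_mono powr_mono2) auto
      then show "AE t in lborel. norm (indicator {0..1} t *\<^sub>R (K * g t powr \<alpha>)) \<le> norm (indicator {0..1} t *\<^sub>R (K * B powr \<alpha>))"
        using K by (auto simp: indicator_def)
    qed
    show "AE t in lborel. 0 \<le> indicator {0..1} t *\<^sub>R (K * g t powr \<alpha>)" using K by auto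
  qed
  also have "(LINT t:{0..1}|lborel. K * g t powr \<alpha>) = K * (LINT t:{0..1}|lborel. g t powr \<alpha>)" by simp
  finally show ?thesis .
qed

section \<open>Void probabilities and the running supremum\<close>

lemma point_count_eq_0_iff: "point_count z A = 0 \<longleftrightarrow> (\<forall>i v. z i = Some v \<longrightarrow> v \<notin> A)"
proof -
  have "point_count z A = 0 \<longleftrightarrow> (\<forall>i. (case z i of None \<Rightarrow> 0 | Some v \<Rightarrow> (indicator A v :: ennreal)) = 0)"
    unfolding point_count_def by (rule suminf_eq_zero_iff) auto
  also have "\<dots> \<longleftrightarrow> (\<forall>i v. z i = Some v \<longrightarrow> v \<notin> A)"
    by (auto split: option.splits simp: indicator_def)
  finally show ?thesis .
qed

text \<open>The bound \<open>b\<close> matters: \<open>Sup\<close> of an unbounded set of reals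
  carries no information. \<open>AE_bounded\<close> provides such a bound almost surely.\<close>

lemma running_sup_le_iff:
  assumes "\<And>i s x. z i = Some (s, x) \<Longrightarrow> x \<le> b" "t \<in> {0..1}" "0 \<le> y"
  shows "running_sup z t \<le> y \<longleftrightarrow> (\<forall>i s x. z i = Some (s, x) \<longrightarrow> s \<le> t \<longrightarrow> x \<le> y)"
proof -
  have "bdd_above (insert 0 {x. \<exists>i s. z i = Some (s, x) \<and> s \<le> t})"
    using assms(1) by (intro bdd_aboveI[of _ "max 0 b"]) (auto simp: le_max_iff_disj)
  then show ?thesis using assms(2,3) by (simp add: running_sup_def cSup_le_iff) blast
qed

lemma running_sup_mono_bounded:
  assumes "\<And>i s x. z i = Some (s, x) \<Longrightarrow> x \<le> b" "t \<in> {0..1}" "t' \<in> {0..1}" "t \<le> t'"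
  shows "running_sup z t \<le> running_sup z t'" "0 \<le> running_sup z t"
proof -
  have bdd: "bdd_above (insert 0 {x. \<exists>i s. z i = Some (s, x) \<and> s \<le> t})" for t
    using assms(1) by (intro bdd_aboveI[of _ "max 0 b"]) (auto simp: le_max_iff_disj)
  have "Sup (insert 0 {x. \<exists>i s. z i = Some (s, x) \<and> s \<le> t}) \<le> Sup (insert 0 {x. \<exists>i s. z i = Some (s, x) \<and> s \<le> t'})"
    by (rule cSup_subset_mono[OF _ bdd]) (use assms(4) in fastforce)+
  then show "running_sup z t \<le> running_sup z t'" using assms by (simp add: running_sup_def)
  have "0 \<le> Sup (insert 0 {x. \<exists>i s. z i = Some (s, x) \<and> s \<le> t})" by (rule cSup_upper[OF _ bdd]) simp
  then show "0 \<le> running_sup z t" using assms by (simp add: running_sup_def)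
qed

locale power_poisson =
  fixes Q :: "(nat \<Rightarrow> (real \<times> real) option) measure" and K \<alpha> :: real
  assumes poisson: "poisson_process Q (\<lambda>z. z) (time_power_measure K \<alpha>)"
    and K: "0 \<le> K" and \<alpha>: "0 < \<alpha>"
begin

sublocale prob_space Q using poisson by (simp add: poisson_process_def)

lemma point_in_space: "z \<in> space Q \<Longrightarrow> z i = Some (t, x) \<Longrightarrow> t \<in> {0..1} \<and> 0 < x"
  using poisson unfolding poisson_process_def space_time_power_measure by fastforce

lemma point_count_measurable:
  "A \<in> sets (time_power_measure K \<alpha>) \<Longrightarrow> (\<lambda>z. point_count z A) \<in> borel_measurable Q"
  using poisson by (simp add: poisson_process_def)

text \<open>The Poisson probability of the count 0, with the mean taken from
  \<open>barrier_region_measure\<close>.\<close>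

lemma void_prob:
  assumes g: "g \<in> borel_measurable borel" "\<And>t. 0 \<le> g t" "\<And>t. g t \<le> B"
  shows "measure Q {z \<in> space Q. point_count z (barrier_region g) = 0} = exp (- (K * (LINT t:{0..1}|lborel. g t powr \<alpha>)))"
proof -
  let ?A = "barrier_region g"
  have e: "emeasure (time_power_measure K \<alpha>) ?A = ennreal (K * (LINT t:{0..1}|lborel. g t powr \<alpha>))"
    by (rule barrier_region_measure[OF g K \<alpha>])
  have "0 \<le> (LINT t:{0..1}|lborel. g t powr \<alpha>)"
    unfolding set_lebesgue_integral_def by (intro integral_nonneg_AE) auto
  then have m: "measure (time_power_measure K \<alpha>) ?A = K * (LINT t:{0..1}|lborel. g t powr \<alpha>)"
    using e K by (simp add: measure_def)
  have "\<And>k::nat. measure Q {z \<in> space Q. point_count z ?A = of_nat k} =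
      measure (time_power_measure K \<alpha>) ?A ^ k / fact k * exp (- measure (time_power_measure K \<alpha>) ?A)"
    using poisson barrier_region_sets[OF g(1), of K \<alpha>] e unfolding poisson_process_def by auto
  from this[of 0] show ?thesis by (simp add: m)
qed

text \<open>With probability tending to 1 no point lies above the constant barrier of height
  \<open>N + 1\<close>, since the tail mass vanishes; so the union of these void events has
  probability 1.\<close>

lemma AE_bounded: "AE z in Q. \<exists>b. \<forall>i s x. z i = Some (s, x) \<longrightarrow> x \<le> b"
proof -
  let ?g = "\<lambda>N t. 1 / real (Suc N)"
  let ?E = "\<lambda>N. {z \<in> space Q. point_count z (barrier_region (?g N)) = 0}"
  have E: "?E N \<in> sets Q" for N
    using point_count_measurable[OF barrier_region_sets, of "?g N"] by measurable
  have "measure Q (?E N) = exp (- (K * (1 / real (Suc N)) powr \<alpha>))" for N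
    using void_prob[of "?g N" 1] by (simp add: set_lebesgue_integral_def)
  moreover have "(\<lambda>N. exp (- (K * (1 / real (Suc N)) powr \<alpha>))) \<longlonglongrightarrow> exp (- (K * 0))"
    using \<alpha> by (intro tendsto_intros) real_asymp
  ultimately have lim: "(\<lambda>N. measure Q (?E N)) \<longlonglongrightarrow> 1" by simp
  have U: "(\<Union>N. ?E N) \<in> sets Q" using E by auto
  have "measure Q (?E N) \<le> measure Q (\<Union>N. ?E N)" for N using E U by (intro finite_measure_mono) auto
  then have "1 \<le> measure Q (\<Union>N. ?E N)" using lim by (intro LIMSEQ_le_const2[OF lim]) auto
  then have "measure Q (\<Union>N. ?E N) = 1" using prob_le_1 by (intro antisym) auto
  then have "AE z in Q. z \<in> (\<Union>N. ?E N)" using U by (simp add: prob_eq_1)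
  then show ?thesis
  proof eventually_elim
    case (elim z)
    then obtain N where z: "z \<in> space Q" and none: "\<And>i v. z i = Some v \<Longrightarrow> v \<notin> barrier_region (?g N)"
      by (auto simp: point_count_eq_0_iff)
    have "x \<le> real (Suc N)" if "z i = Some (s, x)" for i s x
      using none[OF that] point_in_space[OF z that] by (auto simp: barrier_region_def field_simps)
    then show ?case by blast
  qed
qed

text \<open>For a bounded configuration the constraints hold exactly when no point lies beyond the
  step barrier, which is a void event.\<close>

lemma running_sup_fidi:
  assumes m: "m > 0" and S: "S \<subseteq> {..m} \<times> {1..m\<^sup>2}"
    and meas: "running_sup \<in> measurable Q (PiM {0..1} (\<lambda>_. borel))"
  shows "measure Q {z \<in> space Q. \<forall>v\<in>S. running_sup z (real (fst v) / real m) \<le> real (snd v) / real m} =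
    exp (- (K * (LINT t:{0..1}|lborel. step_barrier m S t powr \<alpha>)))"
proof -
  have fS: "finite S" using S finite_subset by blast
  have t: "real (fst v) / real m \<in> {0..1}" if "v \<in> S" for v using that S m by auto
  have gm: "step_barrier m S \<in> borel_measurable borel" by (rule step_barrier_measurable[OF fS])
  let ?R = "barrier_region (step_barrier m S)"
  have "measure Q {z \<in> space Q. \<forall>v\<in>S. running_sup z (real (fst v) / real m) \<le> real (snd v) / real m} =
    measure Q {z \<in> space Q. point_count z ?R = 0}"
  proof (rule finite_measure_eq_AE)
    show "AE z in Q. z \<in> {z \<in> space Q. \<forall>v\<in>S. running_sup z (real (fst v) / real m) \<le> real (snd v) / real m} \<longleftrightarrow>
        z \<in> {z \<in> space Q. point_count z ?R = 0}"
      using AE_bounded AE_space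
    proof eventually_elim
      case (elim z)
      then obtain b where b: "\<And>i s x. z i = Some (s, x) \<Longrightarrow> x \<le> b" by blast
      have "(\<forall>v\<in>S. running_sup z (real (fst v) / real m) \<le> real (snd v) / real m) \<longleftrightarrow>
        (\<forall>v\<in>S. \<forall>i s x. z i = Some (s, x) \<longrightarrow> s \<le> real (fst v) / real m \<longrightarrow> x \<le> real (snd v) / real m)"
        using running_sup_le_iff[of z b, OF b t] by simp
      also have "\<dots> \<longleftrightarrow> (\<forall>i s x. z i = Some (s, x) \<longrightarrow> (\<forall>v\<in>S. s \<le> real (fst v) / real m \<longrightarrow> x \<le> real (snd v) / real m * 1))"
        unfolding mult_1_right by blast
      also have "\<dots> \<longleftrightarrow> (\<forall>i s x. z i = Some (s, x) \<longrightarrow> step_barrier m S s * x \<le> 1)"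
        using S by (subst step_barrier_mult_le_iff[OF fS _ m zero_less_one]) auto
      also have "\<dots> \<longleftrightarrow> (\<forall>i v. z i = Some v \<longrightarrow> v \<notin> ?R)"
        using point_in_space[OF elim(2)] by (fastforce simp: barrier_region_def not_less)
      finally show ?case using elim(2) by (simp add: point_count_eq_0_iff)
    qed
    have "Measurable.pred Q (\<lambda>z. \<forall>v\<in>S. running_sup z (real (fst v) / real m) \<le> real (snd v) / real m)"
    proof (rule pred_intros_finite[OF fS])
      fix v assume "v \<in> S"
      have "(\<lambda>z. running_sup z (real (fst v) / real m)) \<in> borel_measurable Q"
        by (rule measurable_compose[OF meas measurable_component_singleton[OF t[OF \<open>v \<in> S\<close>]]])
      then show "Measurable.pred Q (\<lambda>z. running_sup z (real (fst v) / real m) \<le> real (snd v) / real m)" by measurable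
    qed
    then show "{z \<in> space Q. \<forall>v\<in>S. running_sup z (real (fst v) / real m) \<le> real (snd v) / real m} \<in> sets Q" by simp
    show "{z \<in> space Q. point_count z ?R = 0} \<in> sets Q"
      using point_count_measurable[OF barrier_region_sets[OF gm]] by measurable
  qed
  also have "\<dots> = exp (- (K * (LINT t:{0..1}|lborel. step_barrier m S t powr \<alpha>)))"
    by (rule void_prob[OF gm step_barrier_nonneg[OF fS] step_barrier_bound[OF fS]])
  finally show ?thesis .
qed

lemma running_sup_AE_mono:
  assumes "t \<in> {0..1}" "t' \<in> {0..1}" "t \<le> t'"
  shows "AE z in Q. running_sup z t \<le> running_sup z t' \<and> 0 \<le> running_sup z t"
  using AE_bounded by eventually_elim (use running_sup_mono_bounded[OF _ assms] in blast)

end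

text \<open>Monotonicity at rational times is a countable family of conditions, hence can be
  transferred in law, and right-continuity extends it. The time 1 has no right neighbourhood in the
  interval but is itself rational.\<close>

lemma cadlag_mono_of_rational:
  assumes x: "x \<in> cadlag_space" and mono: "\<And>t t'. t \<in> \<rat> \<Longrightarrow> t' \<in> \<rat> \<Longrightarrow> 0 \<le> t \<Longrightarrow> t \<le> t' \<Longrightarrow> t' \<le> 1 \<Longrightarrow> x t \<le> x t'"
  shows "x \<in> mono_paths"
proof -
  have right: "\<exists>d>0. \<forall>u. t < u \<and> u < t + d \<longrightarrow> \<bar>x u - x t\<bar> < e" if "0 \<le> t" "t < 1" "0 < e" for t e
  proof -
    have "(x \<longlongrightarrow> x t) (at_right t)" using x that by (simp add: cadlag_space_def)
    then have "eventually (\<lambda>u. \<bar>x u - x t\<bar> < e) (at_right t)"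
      using tendstoD[of x "x t" "at_right t" e] that by (simp add: dist_real_def)
    then obtain b where "b > t" "\<And>u. t < u \<Longrightarrow> u < b \<Longrightarrow> \<bar>x u - x t\<bar> < e"
      unfolding eventually_at_right_field by blast
    then show ?thesis by (intro exI[of _ "b - t"]) auto
  qed
  have "x t \<le> x t'" if t: "0 \<le> t" "t < t'" "t' \<le> 1" for t t'
  proof (rule field_le_epsilon)
    fix e :: real assume e: "0 < e"
    obtain d where d: "d > 0" "\<And>u. t < u \<Longrightarrow> u < t + d \<Longrightarrow> \<bar>x u - x t\<bar> < e / 2"
      using right[of t "e / 2"] t e by auto
    have "t < min (t + d) t'" using d(1) t(2) by simp
    then obtain r where r: "r \<in> \<rat>" "t < r" "r < min (t + d) t'" using Rats_dense_in_real by blast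
    have "\<bar>x r - x t\<bar> < e / 2" using r by (intro d(2)) auto
    then have xr: "x t \<le> x r + e / 2" by linarith
    show "x t \<le> x t' + e"
    proof (cases "t' = 1")
      case True
      then have "x r \<le> x t'" using r t by (intro mono) auto
      then show ?thesis using xr e by simp
    next
      case False
      then obtain d' where d': "d' > 0" "\<And>u. t' < u \<Longrightarrow> u < t' + d' \<Longrightarrow> \<bar>x u - x t'\<bar> < e / 2"
        using right[of t' "e / 2"] t e by auto
      have "t' < min (t' + d') 1" using d'(1) t(3) False by simp
      then obtain r' where r': "r' \<in> \<rat>" "t' < r'" "r' < min (t' + d') 1" using Rats_dense_in_real by blast
      have "x r \<le> x r'" using r r' t by (intro mono) auto
      moreover have "\<bar>x r' - x t'\<bar> < e / 2" using r' by (intro d'(2)) auto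
      then have "x r' \<le> x t' + e / 2" by linarith
      ultimately show ?thesis using xr by simp
    qed
  qed
  then have "mono_on {0..1} x" by (intro mono_onI) (metis atLeastAtMost_iff order_le_less order_refl)
  then show ?thesis using x by (simp add: mono_paths_def)
qed

section \<open>Transfer from the Poisson model to the limit process\<close>

lemma same_law_prob:
  assumes "distr N P X = distr Q P Y" "X \<in> measurable N P" "Y \<in> measurable Q P" "Measurable.pred P \<phi>"
  shows "measure N {\<omega> \<in> space N. \<phi> (X \<omega>)} = measure Q {\<omega> \<in> space Q. \<phi> (Y \<omega>)}"
proof -
  have "measure (distr N P X) {x \<in> space P. \<phi> x} = measure (distr Q P Y) {x \<in> space P. \<phi> x}"
    by (simp only: assms(1))
  moreover have "X -` {x \<in> space P. \<phi> x} \<inter> space N = {\<omega> \<in> space N. \<phi> (X \<omega>)}"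
    "Y -` {x \<in> space P. \<phi> x} \<inter> space Q = {\<omega> \<in> space Q. \<phi> (Y \<omega>)}"
    using measurable_space[OF assms(2)] measurable_space[OF assms(3)] by auto
  ultimately show ?thesis using assms(2-4) by (simp add: measure_distr)
qed

lemma same_law_AE:
  assumes "distr N P X = distr Q P Y" "X \<in> measurable N P" "Y \<in> measurable Q P" "Measurable.pred P \<phi>"
    and "AE \<omega> in Q. \<phi> (Y \<omega>)"
  shows "AE \<omega> in N. \<phi> (X \<omega>)"
proof -
  have s: "{x \<in> space P. \<phi> x} \<in> sets P" using assms(4) by simp
  have "AE x in distr Q P Y. \<phi> x" using assms(5) AE_distr_iff[OF assms(3) s] by simp
  then have "AE x in distr N P X. \<phi> x" by (simp only: assms(1))
  then show ?thesis using AE_distr_iff[OF assms(2) s] by simp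
qed

text \<open>\<open>W\<close> is tied to the Poisson model only through its law on the product space.
  A comparison of two coordinates is measurable there, and countably many of them, at rational
  times, suffice for a cadlag path.\<close>

lemma (in power_poisson) same_law_mono_paths:
  assumes law: "distr N (PiM {0..1} (\<lambda>_. borel)) W = distr Q (PiM {0..1} (\<lambda>_. borel)) running_sup"
    and W: "W \<in> measurable N (PiM {0..1} (\<lambda>_. borel))" and R: "running_sup \<in> measurable Q (PiM {0..1} (\<lambda>_. borel))"
    and cadlag: "\<And>\<omega>. \<omega> \<in> space N \<Longrightarrow> W \<omega> \<in> cadlag_space"
  shows "AE \<omega> in N. W \<omega> \<in> mono_paths \<and> 0 \<le> W \<omega> 0"
proof -
  let ?P = "PiM {0..1 :: real} (\<lambda>_. borel :: real measure)"
  have mono: "AE \<omega> in N. W \<omega> t \<le> W \<omega> t' \<and> 0 \<le> W \<omega> t" if t: "t \<in> {0..1}" "t' \<in> {0..1}" "t \<le> t'" for t t'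
  proof (rule same_law_AE[where \<phi> = "\<lambda>f. f t \<le> f t' \<and> 0 \<le> f t", OF law W R _ running_sup_AE_mono[OF t]])
    show "Measurable.pred ?P (\<lambda>f. f t \<le> f t' \<and> 0 \<le> f t)"
      unfolding pred_def
      by (intro sets.sets_Collect_conj borel_measurable_le measurable_component_singleton t measurable_const) simp
  qed
  have "AE \<omega> in N. \<forall>t\<in>\<rat> \<inter> {0..1}. \<forall>t'\<in>\<rat> \<inter> {t..1}. W \<omega> t \<le> W \<omega> t' \<and> 0 \<le> W \<omega> t"
    by (intro AE_ball_countable[THEN iffD2] ballI mono) (auto intro: countable_rat countable_Int1)
  then show ?thesis
    using AE_space
  proof eventually_elim
    case (elim \<omega>)
    have "W \<omega> \<in> mono_paths"
      using elim by (intro cadlag_mono_of_rational cadlag) auto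
    moreover have "0 \<le> W \<omega> 0" using elim(1) by (metis Int_iff Rats_0 atLeastAtMost_iff order_refl zero_le_one)
    ultimately show ?case by simp
  qed
qed

theorem theorem3p1:
  fixes M :: "'a measure" and Z :: "int \<Rightarrow> 'a \<Rightarrow> real"
    and \<alpha> p q \<beta>1 \<beta>2 s \<delta> :: real and L :: "real \<Rightarrow> real"
    and a :: "nat \<Rightarrow> real" and \<sigma> :: "int \<Rightarrow> real" and c :: "nat \<Rightarrow> real"
    and N :: "'b measure" and W :: "'b \<Rightarrow> real \<Rightarrow> real"
  assumes "prob_space M"
    and "\<alpha> > 0"
    and "strictly_stationary M Z"
    and "slowly_varying L"
    and "\<And>x. x > 0 \<Longrightarrow> measure M {\<omega> \<in> space M. \<bar>Z 1 \<omega>\<bar> > x} = x powr (- \<alpha>) * L x"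
    and "((\<lambda>x. measure M {\<omega> \<in> space M. Z 1 \<omega> > x} /
               measure M {\<omega> \<in> space M. \<bar>Z 1 \<omega>\<bar> > x}) \<longlongrightarrow> p) at_top"
    and "((\<lambda>x. measure M {\<omega> \<in> space M. Z 1 \<omega> < - x} /
               measure M {\<omega> \<in> space M. \<bar>Z 1 \<omega>\<bar> > x}) \<longlongrightarrow> q) at_top"
    and "p \<in> {0..1}" and "p + q = 1"
    and "\<And>n. n \<ge> 1 \<Longrightarrow> a n > 0"
    and "filterlim a at_top sequentially"
    and "(\<lambda>n. real n * measure M {\<omega> \<in> space M. \<bar>Z 1 \<omega>\<bar> > a n}) \<longlonglongrightarrow> 1"
    and "condition_D' M Z a"
    and "0 < \<beta>1" and "\<And>i. \<beta>1 \<le> \<sigma> i" and "\<And>i. \<sigma> i \<le> \<beta>2"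
    and "s > 0"
    and "(\<lambda>n. (\<Sum>i=1..n. \<sigma> (int i) powr \<alpha>) / real n) \<longlonglongrightarrow> s powr \<alpha>"
    and "condition_A' M (\<lambda>i \<omega>. \<sigma> i * Z i \<omega>) a"
    and "0 < \<delta>" and "\<delta> \<le> 1" and "\<delta> < \<alpha>"
    and "summable (\<lambda>j. \<bar>c j\<bar> powr \<delta>)"
    and "p * c_plus c + q * c_minus c > 0"
    and "extremal_process N W
          (density (restrict_space lborel {0<..})
            (\<lambda>x. ennreal (s powr \<alpha> * (p * c_plus c powr \<alpha> + q * c_minus c powr \<alpha>) *
                           (\<alpha> * x powr (- \<alpha> - 1)))))"
  shows "converges_in_distribution M1_topology M
           (maxima_process (moving_average c \<sigma> Z) a) N W"
proof -
  have q: "0 \<le> q" using assms(8,9) by simp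
  interpret moving_average_noise M Z \<alpha> p q L a \<sigma> \<beta>1 \<beta>2 s c \<delta>
    by (intro moving_average_noise.intro mixing_noise.intro scaled_heavy_noise.intro heavy_tailed_noise.intro
        moving_average_noise_axioms.intro mixing_noise_axioms.intro scaled_heavy_noise_axioms.intro
        heavy_tailed_noise_axioms.intro) (use assms q in auto)
  have \<nu>: "density (restrict_space lborel {0<..})
      (\<lambda>x. ennreal (s powr \<alpha> * (p * c_plus c powr \<alpha> + q * c_minus c powr \<alpha>) * (\<alpha> * x powr (- \<alpha> - 1)))) =
      power_measure limit_rate \<alpha>"
    by (simp add: power_measure_def limit_rate_def)
  let ?P = "PiM {0..1 :: real} (\<lambda>_. borel :: real measure)"
  have N: "prob_space N" and W_M1: "W \<in> measurable N (borel_of M1_topology)" and W_P: "W \<in> measurable N ?P"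
    using assms(25) unfolding extremal_process_def by blast+
  obtain Q :: "(nat \<Rightarrow> (real \<times> real) option) measure" where
    poisson: "poisson_process Q (\<lambda>z. z) (time_power_measure limit_rate \<alpha>)"
    and R: "running_sup \<in> measurable Q ?P" and law: "distr N ?P W = distr Q ?P running_sup"
    using assms(25) unfolding extremal_process_def \<nu> by blast
  interpret Q: power_poisson Q limit_rate \<alpha>
    using poisson limit_rate_nonneg alpha by unfold_locales
  interpret N: prob_space N by (rule N)
  have W_cadlag: "W \<omega> \<in> cadlag_space" if "\<omega> \<in> space N" for \<omega>
    using measurable_space[OF W_M1 that] by (simp add: space_borel_of topspace_M1)
  interpret mono_fidi_convergence M N V W
  proof unfold_locales
    show "AE \<omega> in N. W \<omega> \<in> mono_paths \<and> 0 \<le> W \<omega> 0"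
      by (rule Q.same_law_mono_paths[OF law W_P R W_cadlag])
    show "(\<lambda>\<omega>. W \<omega> t) \<in> borel_measurable N" if "t \<in> {0..1}" for t
      by (rule measurable_compose[OF W_P measurable_component_singleton[OF that]])
    fix m :: nat and S :: "(nat \<times> nat) set" assume m: "0 < m" and S: "S \<subseteq> {..m} \<times> {1..m\<^sup>2}"
    have "Measurable.pred ?P (\<lambda>f. \<forall>v\<in>S. f (real (fst v) / real m) \<le> real (snd v) / real m)"
    proof (rule pred_intros_finite)
      show "finite S" using S finite_subset by blast
      fix v assume "v \<in> S"
      then have "real (fst v) / real m \<in> {0..1}" using S m by auto
      then have "(\<lambda>f. f (real (fst v) / real m)) \<in> borel_measurable ?P" by (rule measurable_component_singleton)
      then show "Measurable.pred ?P (\<lambda>f. f (real (fst v) / real m) \<le> real (snd v) / real m)" by measurable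
    qed
    from same_law_prob[OF law W_P R this]
    have "measure N {\<omega> \<in> space N. \<forall>v\<in>S. W \<omega> (real (fst v) / real m) \<le> real (snd v) / real m} =
      exp (- (limit_rate * (LINT t:{0..1}|lborel. step_barrier m S t powr \<alpha>)))"
      using Q.running_sup_fidi[OF m S R] by simp
    \<comment> \<open>The void probability of the Poisson process and the limit for the partial
      maxima are the same exponential.\<close>
    then show "(\<lambda>n. measure M {\<omega> \<in> space M. \<forall>v\<in>S. V n \<omega> (real (fst v) / real m) \<le> real (snd v) / real m})
      \<longlonglongrightarrow> measure N {\<omega> \<in> space N. \<forall>v\<in>S. W \<omega> (real (fst v) / real m) \<le> real (snd v) / real m}"
      using V_fidi_tendsto[OF m S] by simp
  qed (fact V_measurable W_M1 | erule V_coordinate_measurable V_start_tendsto(1) | rule V_mono_paths)+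
  show ?thesis by (rule converges_in_M1)
qed

end
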